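(* Let $r,p,n$ be positive integers with $p$ dividing $r$. If $\gcd(p,n)=1$ but $r/p$ and $p$ are both even, then $\widetilde\rho_{r,p,n}$ is a Gelfand model for $G(r,p,n)$.
   Context: $\mathbb Z_r$ is the cyclic group of integers $[0,r-1]=\{0,\dots,r-1\}$ modulo $r$. $S_n$ acts on $(\mathbb Z_r)^n$ by $\pi(x)=(x_{\pi^{-1}(1)},\dots,x_{\pi^{-1}(n)})$. The group $G(r,1,n)=\mathbb Z_r\wr S_n$ is the set of pairs $(x,\pi)$, $x\in(\mathbb Z_r)^n$, $\pi\in S_n$, with $(x,\pi)(y,\sigma)=(\sigma^{-1}(x)+y,\pi\sigma)$. For $g=(x,\pi)$ set $|g|=\pi$, $z_g(i)=x_i$, $\overline g=(-x,\pi)$, $g^T=\overline{g^{-1}}=(\pi(x),\pi^{-1})$, $\Delta(g)=x_1+\dots+x_n\in\mathbb Z_r$. For $p$ dividing $r$, $G(r,p,n)=\{g\in\mathbb Z_r\wr S_n:\Delta(g)\in p\mathbb Z_r\}$. For $\pi\in S_n$ let $\mathrm{Inv}(\pi)=\{(i,j):1\le i<j\le n,\ \pi(i)>\pi(j)\}$, $\mathrm{Pair}(\pi)=\{(i,j):1\le i<j\le n,\ \pi(i)=j,\ \pi(j)=i\}$, and $\mathrm{Fix}(\pi)=\{i:\pi(i)=i\}$. Assume $p$ and $r/p$ are both even. For $g,\omega\in G(r,p,n)$ define $\widetilde B(g,\omega)\subset[1,n]$ as follows (sums $z_g(i)+k$ are taken in $\mathbb Z_r$, and elements of $\mathbb Z_r$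 are identified with integers in $[0,r-1]$): - if $\Delta(\omega)\in 2p\mathbb Z_r$, then $\widetilde B(g,\omega)$ is the set of $i\in\mathrm{Fix}(|\omega|)$ such that $z_\omega(i)$ is odd and $z_g(i)+k\in[r/2,r-1]$ for the $k\in[0,r/2-1]$ with $2k+1=z_\omega(i)$; - if $\Delta(\omega)\notin 2p\mathbb Z_r$, then $\widetilde B(g,\omega)$ is the set of $i\in\mathrm{Fix}(|\omega|)$ such that $z_\omega(i)$ is even and $z_g(i)+k\in[r/2,r-1]$ for the $k\in[0,r/2-1]$ with $2k=z_\omega(i)$. Put $\widetilde{\mathrm{sign}}_{r,p,n}(g,\omega)=(-1)^{|\widetilde B(g,\omega)|}\cdot(-1)^{|\mathrm{Inv}(|g|)\cap\mathrm{Pair}(|\omega|)|}$. Let $\mathcal V_{r,p,n}$ be the $\mathbb Q$-vector space with basis the symbols $C_\omega$, $\omega\in G(r,p,n)$ with $\omega^T=\omega$. The map $\widetilde\rho_{r,p,n}:G(r,p,n)\to\mathrm{GL}(\mathcal V_{r,p,n})$ is $$\widetilde\rho_{r,p,n}(g)C_\omega=\widetilde{\mathrm{sign}}_{r,p,n}(g,\omega)\cdot C_{g\omega g^T},\qquad g,\omega\in G(r,p,n),\ \omega^T=\omega.$$ A Gelfand model for a finite group $G$ is a representation equivalent to the multiplicity-free sum of all irreducible (complex) representations of $G$, i.e. one whose character is $\sum_{\psi\in\mathrm{Irr}(G)}\psi$. *)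

theory Defs
  imports
    "HOL-Algebra.Bij"
    "HOL-Algebra.Sym_Groups"
    "HOL-Algebra.Elementary_Groups"
    "Jordan_Normal_Form.VS_Connect"
begin

section \<open>Representations on coordinate spaces and Gelfand models\<close>

text \<open>The coordinate space on a set S over a field is the library's space of
  extensional functions on S, so vectors are undefined outside S.\<close>

abbreviation coord_space :: "'s set \<Rightarrow> ('k::field, 's \<Rightarrow> 'k) module" where
  "coord_space S \<equiv> ring.func_space (class_ring :: 'k ring) S"

definition coord_vec :: "'s set \<Rightarrow> 's \<Rightarrow> 's \<Rightarrow> 'k::field" where
  "coord_vec S s = (\<lambda>t\<in>S. if t = s then 1 else 0)"

text \<open>Operators are extensional (undefined outside the space), as in \<^const>\<open>BijGroup\<close>.\<close>

definition GL :: "('k::field, 'v) module \<Rightarrow> ('v \<Rightarrow> 'v) monoid" where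
  "GL V = (BijGroup (carrier V))
     \<lparr>carrier := Bij (carrier V) \<inter> LinearCombinations.module_hom class_ring V V\<rparr>"

definition op_trace :: "'s set \<Rightarrow> (('s \<Rightarrow> 'k::field) \<Rightarrow> ('s \<Rightarrow> 'k)) \<Rightarrow> 'k" where
  "op_trace S T = (\<Sum>s\<in>S. T (coord_vec S s) s)"

definition representation ::
    "('g, 'm) monoid_scheme \<Rightarrow> 's set \<Rightarrow> ('g \<Rightarrow> ('s \<Rightarrow> 'k::field) \<Rightarrow> ('s \<Rightarrow> 'k)) \<Rightarrow> bool" where
  "representation G S \<rho> \<longleftrightarrow> finite S \<and> \<rho> \<in> hom G (GL (coord_space S))"

text \<open>Characters are extensional on the carrier, so that representations agreeing on the
  group have the same character as a function on the whole type.\<close>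

definition rep_character ::
    "('g, 'm) monoid_scheme \<Rightarrow> 's set \<Rightarrow> ('g \<Rightarrow> ('s \<Rightarrow> 'k::field) \<Rightarrow> ('s \<Rightarrow> 'k)) \<Rightarrow> 'g \<Rightarrow> 'k" where
  "rep_character G S \<rho> = (\<lambda>g\<in>carrier G. op_trace S (\<rho> g))"

definition irreducible_rep ::
    "('g, 'm) monoid_scheme \<Rightarrow> 's set \<Rightarrow> ('g \<Rightarrow> ('s \<Rightarrow> 'k::field) \<Rightarrow> ('s \<Rightarrow> 'k)) \<Rightarrow> bool" where
  "irreducible_rep G S \<rho> \<longleftrightarrow> representation G S \<rho> \<and> S \<noteq> {} \<and>
     (\<forall>W. VectorSpace.subspace class_ring W (coord_space S) \<and> (\<forall>g\<in>carrier G. \<rho> g ` W \<subseteq> W) \<longrightarrow>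
        W = {\<zero>\<^bsub>coord_space S\<^esub>} \<or> W = carrier (coord_space S))"

text \<open>Every finite-dimensional complex representation is equivalent to one on some
  coordinate space on \<open>{..<d}\<close>, so these spaces give all irreducible characters.\<close>

definition Irr :: "('g, 'm) monoid_scheme \<Rightarrow> ('g \<Rightarrow> complex) set" where
  "Irr G = {rep_character G {..<d} \<rho> | (d::nat) \<rho>. irreducible_rep G {..<d} \<rho>}"

text \<open>The finiteness clause for \<^const>\<open>Irr\<close> (automatic for a finite group) keeps the sum
  from being 0 by convention. The representation is over the rationals; \<^const>\<open>of_rat\<close> embeds its
  character into the complex numbers (extension of scalars).\<close>

definition gelfand_model ::
    "('g, 'm) monoid_scheme \<Rightarrow> 's set \<Rightarrow> ('g \<Rightarrow> ('s \<Rightarrow> rat) \<Rightarrow> ('s \<Rightarrow> rat)) \<Rightarrow> bool" where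
  "gelfand_model G S \<rho> \<longleftrightarrow> group G \<and> finite (carrier G) \<and> representation G S \<rho> \<and>
     finite (Irr G) \<and>
     (\<forall>g\<in>carrier G. of_rat (rep_character G S \<rho> g) = (\<Sum>\<psi>\<in>Irr G. \<psi> g))"


section \<open>The groups G(r,p,n)\<close>

type_synonym colored_perm = "(nat \<Rightarrow> int) \<times> (nat \<Rightarrow> nat)"

text \<open>Residues modulo r are the integers in \<open>{0..<r}\<close> (r is always positive below);
  tuples are extensional functions on \<open>{1..n}\<close>.\<close>

definition perm_act :: "nat \<Rightarrow> (nat \<Rightarrow> nat) \<Rightarrow> (nat \<Rightarrow> int) \<Rightarrow> (nat \<Rightarrow> int)" where
  "perm_act n \<pi> x = (\<lambda>i\<in>{1..n}. x (inv_into UNIV \<pi> i))"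

definition wreath :: "nat \<Rightarrow> nat \<Rightarrow> colored_perm monoid" where
  "wreath r n =
     \<lparr>carrier = ({1..n} \<rightarrow>\<^sub>E carrier (integer_mod_group r)) \<times> carrier (sym_group n),
      monoid.mult = (\<lambda>(x, \<pi>) (y, \<sigma>).
        (\<lambda>i\<in>{1..n}. perm_act n (inv_into UNIV \<sigma>) x i \<otimes>\<^bsub>integer_mod_group r\<^esub> y i, \<pi> \<circ> \<sigma>)),
      one = (\<lambda>i\<in>{1..n}. \<one>\<^bsub>integer_mod_group r\<^esub>, id)\<rparr>"

definition perm_of :: "colored_perm \<Rightarrow> nat \<Rightarrow> nat" where
  "perm_of g = snd g"

definition color :: "colored_perm \<Rightarrow> nat \<Rightarrow> int" where
  "color g = fst g"

definition bar :: "nat \<Rightarrow> nat \<Rightarrow> colored_perm \<Rightarrow> colored_perm" where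
  "bar r n g = (\<lambda>i\<in>{1..n}. inv\<^bsub>integer_mod_group r\<^esub> (color g i), perm_of g)"

definition transp :: "nat \<Rightarrow> nat \<Rightarrow> colored_perm \<Rightarrow> colored_perm" where
  "transp r n g = bar r n (inv\<^bsub>wreath r n\<^esub> g)"

definition Delta :: "nat \<Rightarrow> nat \<Rightarrow> colored_perm \<Rightarrow> int" where
  "Delta r n g = (\<Sum>i\<in>{1..n}. color g i) mod int r"

definition residue_multiples :: "nat \<Rightarrow> nat \<Rightarrow> int set" where
  "residue_multiples m r = (\<lambda>a. (int m * a) mod int r) ` carrier (integer_mod_group r)"

definition Grpn :: "nat \<Rightarrow> nat \<Rightarrow> nat \<Rightarrow> colored_perm monoid" where
  "Grpn r p n = (wreath r n)
     \<lparr>carrier := {g \<in> carrier (wreath r n). Delta r n g \<in> residue_multiples p r}\<rparr>"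


section \<open>The sign and the representation\<close>

definition Inv :: "nat \<Rightarrow> (nat \<Rightarrow> nat) \<Rightarrow> (nat \<times> nat) set" where
  "Inv n \<pi> = {(i, j). 1 \<le> i \<and> i < j \<and> j \<le> n \<and> \<pi> i > \<pi> j}"

definition Pair2 :: "nat \<Rightarrow> (nat \<Rightarrow> nat) \<Rightarrow> (nat \<times> nat) set" where
  "Pair2 n \<pi> = {(i, j). 1 \<le> i \<and> i < j \<and> j \<le> n \<and> \<pi> i = j \<and> \<pi> j = i}"

definition Fix :: "nat \<Rightarrow> (nat \<Rightarrow> nat) \<Rightarrow> nat set" where
  "Fix n \<pi> = {i \<in> {1..n}. \<pi> i = i}"

definition B_tilde :: "nat \<Rightarrow> nat \<Rightarrow> nat \<Rightarrow> colored_perm \<Rightarrow> colored_perm \<Rightarrow> nat set" where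
  "B_tilde r p n g \<omega> =
     (if Delta r n \<omega> \<in> residue_multiples (2 * p) r
      then {i \<in> Fix n (perm_of \<omega>). odd (color \<omega> i) \<and>
              (\<exists>k \<in> {0..int r div 2 - 1}. 2 * k + 1 = color \<omega> i \<and>
                 (color g i + k) mod int r \<in> {int r div 2..int r - 1})}
      else {i \<in> Fix n (perm_of \<omega>). even (color \<omega> i) \<and>
              (\<exists>k \<in> {0..int r div 2 - 1}. 2 * k = color \<omega> i \<and>
                 (color g i + k) mod int r \<in> {int r div 2..int r - 1})})"

definition sign_tilde :: "nat \<Rightarrow> nat \<Rightarrow> nat \<Rightarrow> colored_perm \<Rightarrow> colored_perm \<Rightarrow> rat" where
  "sign_tilde r p n g \<omega> =
     (-1) ^ card (B_tilde r p n g \<omega>) * (-1) ^ card (Inv n (perm_of g) \<inter> Pair2 n (perm_of \<omega>))"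

definition symmetric_elements :: "nat \<Rightarrow> nat \<Rightarrow> nat \<Rightarrow> colored_perm set" where
  "symmetric_elements r p n = {\<omega> \<in> carrier (Grpn r p n). transp r n \<omega> = \<omega>}"

text \<open>The symbol \<open>C\<^sub>\<omega>\<close> is the coordinate vector at \<open>\<omega>\<close>. The operator below is the linear
  extension of \<open>C\<^sub>\<omega> \<mapsto> sign(g,\<omega>) C\<^bsub>g \<omega> g\<^sup>T\<^esub>\<close>, written coordinatewise.\<close>

definition rho_tilde ::
    "nat \<Rightarrow> nat \<Rightarrow> nat \<Rightarrow> colored_perm \<Rightarrow> (colored_perm \<Rightarrow> rat) \<Rightarrow> (colored_perm \<Rightarrow> rat)" where
  "rho_tilde r p n g =
     (let S = symmetric_elements r p n in
      (\<lambda>v\<in>carrier (coord_space S). (\<lambda>\<tau>\<in>S. \<Sum>\<omega>\<in>S.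
        v \<omega> * (sign_tilde r p n g \<omega> *
          coord_vec S (g \<otimes>\<^bsub>Grpn r p n\<^esub> \<omega> \<otimes>\<^bsub>Grpn r p n\<^esub> transp r n g) \<tau>))))"

lemma rho_tilde_basis:
  assumes "\<omega> \<in> symmetric_elements r p n" "finite (symmetric_elements r p n)"
  shows "rho_tilde r p n g (coord_vec (symmetric_elements r p n) \<omega>) =
    sign_tilde r p n g \<omega> \<odot>\<^bsub>coord_space (symmetric_elements r p n)\<^esub>
      coord_vec (symmetric_elements r p n)
        (g \<otimes>\<^bsub>Grpn r p n\<^esub> \<omega> \<otimes>\<^bsub>Grpn r p n\<^esub> transp r n g)"
proof -
  let ?S = "symmetric_elements r p n"
  have c: "coord_vec ?S \<omega> \<in> carrier (coord_space ?S)"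
    by (auto simp: class_ring.func_space_def coord_vec_def)
  have "(\<Sum>w\<in>?S. coord_vec ?S \<omega> w * f w) = f \<omega>" for f :: "colored_perm \<Rightarrow> rat"
  proof -
    have "(\<Sum>w\<in>?S. coord_vec ?S \<omega> w * f w) = (\<Sum>w\<in>?S. if w = \<omega> then f w else 0)"
      by (rule sum.cong) (auto simp: coord_vec_def)
    then show ?thesis using assms by simp
  qed
  with c show ?thesis
    unfolding rho_tilde_def Let_def
    by (auto simp: class_ring.func_space_def fun_eq_iff)
qed

end

theory Submission
  imports Defs "Jordan_Normal_Form.Char_Poly" "HOL-Computational_Algebra.Fundamental_Theorem_Algebra"
    "HOL-Number_Theory.Cong"
begin

text \<open>The map \<open>g \<mapsto> g\<^sup>T\<close> is an involutive anti-automorphism of \<open>G = G(r,p,n)\<close>, and \<open>g\<^sup>T\<close> is conjugate to \<open>g\<close>.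
  Hence every irreducible representation \<open>R\<close> is equivalent to its twist \<open>g \<mapsto> R(g\<^sup>T)\<^sup>t\<close>, by an intertwiner that
  is symmetric or antisymmetric, so the twisted Frobenius--Schur indicators are \<open>\<plusminus>1\<close>. If a representation has
  character \<open>g \<mapsto> |{h. h = g h\<^sup>T}|\<close>, its multiplicity along \<open>R\<close> is this indicator; being non-negative, it is 1.

  That the character has this form is first shown for the full wreath product, with the odd clause of the sign
  used everywhere. Both the signed count of symmetric elements fixed by \<open>g\<close> and the count of the solutions of
  \<open>h = g h\<^sup>T\<close> multiply over pairs of exchanged cycles and over single cycles of \<open>|g|\<close>. On exchanged cycles the
  signs cancel out and there is a bijection. On a single cycle whose colour sum is 0 the identity contributes
  \<open>r\<close> and the half turn, which exists for even length only, contributes \<open>- r\<close>; this matches the \<open>r\<close> square roots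
  of the cycle, which exist for odd length only. If the colour sum is not 0, all contributions vanish.
  To pass to \<open>G(r,p,n)\<close>, add a constant \<open>c\<close> to all colours: this changes the colour sum by \<open>n c\<close> and exchanges
  the two clauses of the sign when \<open>c\<close> is odd. Since \<open>p\<close> and \<open>n\<close> are coprime and \<open>n\<close> is odd, both counts for the
  wreath product are \<open>p\<close> times those for \<open>G(r,p,n)\<close>.\<close>

section \<open>Matrix representations\<close>

text \<open>The sign repairs two defects of the unsigned count on a cycle with colour sum
  \<open>s\<close>. A colouring \<open>w\<close> that accompanies the identity of the cycle
  satisfies \<open>w (\<pi> i) = w i + 2 * x i\<close>, which closes up as soon as
  \<open>2 * s\<close> vanishes modulo \<open>r\<close>, hence also for \<open>s = r div 2\<close>;
  there odd colours have to cancel even ones. For \<open>s = 0\<close> and even length there is no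
  square root, so the half turn has to cancel the identity. Both cancellations work because the sign
  is a coboundary. For a colour \<open>2 * k + 1\<close> it compares the halves of
  \<open>[0, r - 1]\<close> in which \<open>k\<close> and its image lie; halving modulo
  \<open>r\<close> is ambiguous by \<open>r div 2\<close>, which changes both of these signs
  together. For a pair it compares the orientation before and after applying \<pi>. Such products
  telescope along a cycle, and the same fact yields the cocycle identity. The obstacle is the choice
  of the clause: it depends on the total colour modulo \<open>2 * p\<close>, which is not local to a
  cycle. A sum that factors over cycles must therefore use one clause throughout, and this is
  possible on the whole wreath product.\<close>

definition mat_trace :: "'a::comm_monoid_add mat \<Rightarrow> 'a" where
  "mat_trace A = (\<Sum>i<dim_row A. A $$ (i, i))"

lemma mat_trace_comm:
  fixes A B :: "'a::comm_semiring_0 mat"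
  assumes "A \<in> carrier_mat m n" "B \<in> carrier_mat n m"
  shows "mat_trace (A * B) = mat_trace (B * A)"
proof -
  have "mat_trace (A * B) = (\<Sum>i<m. \<Sum>k<n. A $$ (i, k) * B $$ (k, i))"
    using assms by (auto simp: mat_trace_def scalar_prod_def atLeast0LessThan intro!: sum.cong)
  also have "\<dots> = (\<Sum>k<n. \<Sum>i<m. B $$ (k, i) * A $$ (i, k))"
    by (subst sum.swap) (simp add: mult.commute)
  also have "\<dots> = mat_trace (B * A)"
    using assms by (auto simp: mat_trace_def scalar_prod_def atLeast0LessThan intro!: sum.cong)
  finally show ?thesis .
qed

lemma mat_trace_add:
  assumes "A \<in> carrier_mat n n" "B \<in> carrier_mat n n"
  shows "mat_trace (A + B) = mat_trace A + mat_trace B"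
  using assms by (auto simp: mat_trace_def sum.distrib)

lemma mult_mat_index_sum:
  assumes "A \<in> carrier_mat m n" "B \<in> carrier_mat n k" "i < m" "j < k"
  shows "(A * B) $$ (i, j) = (\<Sum>l<n. A $$ (i, l) * B $$ (l, j))"
  using assms by (auto simp: scalar_prod_def atLeast0LessThan intro!: sum.cong)

lemma mult_mat_unit_vec:
  fixes A :: "'a::semiring_1 mat"
  assumes "A \<in> carrier_mat m n" "j < n"
  shows "A *\<^sub>v unit_vec n j = col A j"
  using assms by (intro eq_vecI) auto

section \<open>Subspaces and complements in terms of rectangular matrices\<close>

definition vec_subspace :: "nat \<Rightarrow> 'a::field vec set \<Rightarrow> bool" where
  "vec_subspace d W \<longleftrightarrow> W \<subseteq> carrier_vec d \<and> 0\<^sub>v d \<in> W \<and>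
     (\<forall>v\<in>W. \<forall>w\<in>W. v + w \<in> W) \<and> (\<forall>c. \<forall>v\<in>W. c \<cdot>\<^sub>v v \<in> W)"

text \<open>Padding with zeros to size \<open>e\<close> makes both matrices square, and then a left
  inverse is also a right inverse. But the padded \<open>A\<close> has a zero row at index
  \<open>d\<close>.\<close>

lemma left_inverse_dim_le:
  fixes A B :: "'a::field mat"
  assumes A: "A \<in> carrier_mat d e" and B: "B \<in> carrier_mat e d" and BA: "B * A = 1\<^sub>m e"
  shows "e \<le> d"
proof (rule ccontr)
  assume "\<not> e \<le> d"
  hence de: "d < e" by simp
  let ?A = "mat e e (\<lambda>(i, j). if i < d then A $$ (i, j) else 0)"
  let ?B = "mat e e (\<lambda>(i, j). if j < d then B $$ (i, j) else 0)"
  have "?B * ?A = B * A"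
  proof (rule eq_matI)
    fix i j assume "i < dim_row (B * A)" "j < dim_col (B * A)"
    hence ij: "i < e" "j < e" using A B by auto
    have "(?B * ?A) $$ (i, j) = (\<Sum>l<e. ?B $$ (i, l) * ?A $$ (l, j))"
      by (rule mult_mat_index_sum) (use ij in auto)
    also have "\<dots> = (\<Sum>l<e. if l < d then B $$ (i, l) * A $$ (l, j) else 0)"
      using ij by (intro sum.cong) auto
    also have "\<dots> = (\<Sum>l<d. B $$ (i, l) * A $$ (l, j))"
      using de by (intro sum.mono_neutral_cong_right) auto
    also have "\<dots> = (B * A) $$ (i, j)"
      by (rule mult_mat_index_sum[symmetric, OF B A]) (use ij in auto)
    finally show "(?B * ?A) $$ (i, j) = (B * A) $$ (i, j)" .
  qed (use A B in auto)
  hence BA': "?B * ?A = 1\<^sub>m e" using BA by simp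
  have "?A * ?B = 1\<^sub>m e"
    by (rule mat_mult_left_right_inverse[OF _ _ BA']) auto
  moreover have "(?A * ?B) $$ (d, d) = (\<Sum>l<e. ?A $$ (d, l) * ?B $$ (l, d))"
    by (rule mult_mat_index_sum) (use de in auto)
  moreover have "\<dots> = 0" using de by (intro sum.neutral) auto
  ultimately show False using de by simp
qed

text \<open>The columns of \<open>A\<close> form a basis of \<open>W\<close> and \<open>B\<close>
  reads off coordinates. The pair is found as a left-invertible \<open>A\<close> with values in
  \<open>W\<close> and as many columns as possible; a vector of \<open>W\<close> that
  \<open>A * B\<close> does not fix would provide a further column.\<close>

lemma subspace_split:
  fixes W :: "'a::field vec set"
  assumes W: "vec_subspace d W"
  obtains e A B where "A \<in> carrier_mat d e" "B \<in> carrier_mat e d" "B * A = 1\<^sub>m e"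
    "\<And>v. v \<in> carrier_vec e \<Longrightarrow> A *\<^sub>v v \<in> W" "\<And>w. w \<in> W \<Longrightarrow> A *\<^sub>v (B *\<^sub>v w) = w"
proof -
  define P where "P e \<longleftrightarrow> (\<exists>A B. A \<in> carrier_mat d e \<and> B \<in> carrier_mat e d \<and> B * A = 1\<^sub>m e \<and>
    (\<forall>v\<in>carrier_vec e. A *\<^sub>v v \<in> W))" for e
  have "P 0" unfolding P_def
  proof (intro exI conjI)
    show "0\<^sub>m d 0 \<in> carrier_mat d 0" "0\<^sub>m 0 d \<in> carrier_mat 0 d" by auto
    show "0\<^sub>m 0 d * 0\<^sub>m d 0 = (1\<^sub>m 0 :: 'a mat)" by auto
    show "\<forall>v\<in>carrier_vec 0. 0\<^sub>m d 0 *\<^sub>v v \<in> W"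
    proof
      fix v :: "'a vec" assume "v \<in> carrier_vec 0"
      hence "0\<^sub>m d 0 *\<^sub>v v = 0\<^sub>v d" by (intro eq_vecI) (auto simp: scalar_prod_def)
      thus "0\<^sub>m d 0 *\<^sub>v v \<in> W" using W by (simp add: vec_subspace_def)
    qed
  qed
  moreover have bnd: "\<forall>e. P e \<longrightarrow> e \<le> d"
    unfolding P_def using left_inverse_dim_le by blast
  ultimately obtain e where Pe: "P e" and maxe: "\<And>k. P k \<Longrightarrow> k \<le> e"
    using Nat.ex_has_greatest_nat[of P 0 d] by auto
  from Pe obtain A B where A: "A \<in> carrier_mat d e" and B: "B \<in> carrier_mat e d"
    and BA: "B * A = 1\<^sub>m e" and AW: "\<And>v. v \<in> carrier_vec e \<Longrightarrow> A *\<^sub>v v \<in> W"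
    unfolding P_def by blast
  have AB: "A * B \<in> carrier_mat d d" using A B by auto
  \<comment> \<open>The projection complementary to \<open>A * B\<close>: it kills the columns of
    \<open>A\<close>, and its values are killed by \<open>B\<close>.\<close>
  define C where "C = 1\<^sub>m d - A * B"
  have C: "C \<in> carrier_mat d d" using AB by (simp add: C_def minus_carrier_mat)
  have "B * (A * B) = B" using A B BA by (metis assoc_mult_mat left_mult_one_mat)
  hence BC: "B * C = 0\<^sub>m e d"
    using A B by (simp add: C_def mult_minus_distrib_mat[OF B one_carrier_mat AB])
  have "(A * B) * A = A" using A B BA by (metis assoc_mult_mat right_mult_one_mat)
  hence CA: "C * A = 0\<^sub>m d e"
    using A B by (simp add: C_def minus_mult_distrib_mat[OF one_carrier_mat AB A])
  have "C * C = C - (A * B) * C"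
    using minus_mult_distrib_mat[OF one_carrier_mat AB C] C by (simp add: C_def[symmetric])
  also have "(A * B) * C = 0\<^sub>m d d" using assoc_mult_mat[OF A B C] BC A by simp
  also have "C - 0\<^sub>m d d = C" using C by (intro eq_matI) auto
  finally have CC: "C * C = C" .
  have "A *\<^sub>v (B *\<^sub>v w) = w" if w: "w \<in> W" for w
  proof (rule ccontr)
    assume neq: "A *\<^sub>v (B *\<^sub>v w) \<noteq> w"
    have wc: "w \<in> carrier_vec d" using w W by (auto simp: vec_subspace_def)
    define u where "u = C *\<^sub>v w"
    have u: "u \<in> carrier_vec d" using C wc by (simp add: u_def)
    have u_alt: "u = w + (- 1) \<cdot>\<^sub>v (A *\<^sub>v (B *\<^sub>v w))"
      using A B wc by (auto simp: u_def C_def minus_mult_distrib_mat_vec[OF one_carrier_mat AB wc]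
          assoc_mult_mat_vec[OF A B wc])
    have uW: "u \<in> W"
      unfolding u_alt using W w AW[of "B *\<^sub>v w"] B wc by (auto simp: vec_subspace_def)
    have "u \<noteq> 0\<^sub>v d"
    proof
      assume u0: "u = 0\<^sub>v d"
      have "A *\<^sub>v (B *\<^sub>v w) = w"
      proof (rule eq_vecI)
        fix i assume "i < dim_vec w"
        hence i: "i < d" using wc by simp
        have "u $ i = w $ i - (A *\<^sub>v (B *\<^sub>v w)) $ i"
          unfolding u_alt using i A B wc by (simp del: index_mult_mat_vec)
        thus "(A *\<^sub>v (B *\<^sub>v w)) $ i = w $ i" using u0 i by simp
      qed (use A wc in auto)
      with neq show False by simp
    qed
    then obtain i0 where i0: "i0 < d" "u $ i0 \<noteq> 0" using u by (metis eq_vecI carrier_vecD index_zero_vec)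
    have Bu: "B *\<^sub>v u = 0\<^sub>v e"
      unfolding u_def using assoc_mult_mat_vec[OF B C wc, symmetric] BC wc by auto
    have Cu: "C *\<^sub>v u = u"
      unfolding u_def using assoc_mult_mat_vec[OF C C wc] CC wc by (auto)
    \<comment> \<open>The new column is \<open>u\<close>. The new row of the left inverse is row
      \<open>i0\<close> of \<open>C\<close> divided by \<open>u $ i0\<close>: it vanishes on
      \<open>A\<close> because \<open>C * A = 0\<close> and takes \<open>u\<close> to 1 because
      \<open>C *\<^sub>v u = u\<close>.\<close>
    define A' where "A' = mat d (Suc e) (\<lambda>(i, j). if j < e then A $$ (i, j) else u $ i)"
    define B' where "B' = mat (Suc e) d (\<lambda>(i, j). if i < e then B $$ (i, j) else C $$ (i0, j) / u $ i0)"
    have A': "A' \<in> carrier_mat d (Suc e)" and B': "B' \<in> carrier_mat (Suc e) d"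
      by (simp_all add: A'_def B'_def)
    have "P (Suc e)" unfolding P_def
    proof (intro exI conjI ballI)
      show "A' \<in> carrier_mat d (Suc e)" "B' \<in> carrier_mat (Suc e) d" by fact+
      show "B' * A' = 1\<^sub>m (Suc e)"
      proof (rule eq_matI)
        fix i j assume "i < dim_row (1\<^sub>m (Suc e) :: 'a mat)" "j < dim_col (1\<^sub>m (Suc e) :: 'a mat)"
        hence ij: "i < Suc e" "j < Suc e" by auto
        have s: "(B' * A') $$ (i, j) = (\<Sum>l<d. B' $$ (i, l) * A' $$ (l, j))"
          by (rule mult_mat_index_sum[OF B' A']) (use ij in auto)
        have su: "(M *\<^sub>v u) $ k = (\<Sum>l<d. M $$ (k, l) * u $ l)" if "M \<in> carrier_mat m d" "k < m" for M m k
          using that u by (auto simp: scalar_prod_def atLeast0LessThan intro!: sum.cong)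
        consider "i < e" "j < e" | "i < e" "j = e" | "i = e" "j < e" | "i = e" "j = e"
          using ij by linarith
        hence "(\<Sum>l<d. B' $$ (i, l) * A' $$ (l, j)) = (if i = j then 1 else 0)"
        proof cases
          case 1
          have "(\<Sum>l<d. B' $$ (i, l) * A' $$ (l, j)) = (B * A) $$ (i, j)"
            unfolding mult_mat_index_sum[OF B A 1] using 1 by (intro sum.cong) (auto simp: A'_def B'_def)
          thus ?thesis using BA 1 by simp
        next
          case 2
          have "(\<Sum>l<d. B' $$ (i, l) * A' $$ (l, j)) = (B *\<^sub>v u) $ i"
            unfolding su[OF B 2(1)] using 2 by (intro sum.cong) (auto simp: A'_def B'_def)
          thus ?thesis using Bu 2 by simp
        next
          case 3
          have "(\<Sum>l<d. B' $$ (i, l) * A' $$ (l, j)) = (C * A) $$ (i0, j) / u $ i0"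
            unfolding mult_mat_index_sum[OF C A i0(1) 3(2)] sum_divide_distrib
            using 3 by (intro sum.cong) (auto simp: A'_def B'_def)
          thus ?thesis using CA 3 i0 by simp
        next
          case 4
          have "(\<Sum>l<d. B' $$ (i, l) * A' $$ (l, j)) = (C *\<^sub>v u) $ i0 / u $ i0"
            unfolding su[OF C i0(1)] sum_divide_distrib
            using 4 by (intro sum.cong) (auto simp: A'_def B'_def)
          thus ?thesis using Cu 4 i0 by simp
        qed
        thus "(B' * A') $$ (i, j) = 1\<^sub>m (Suc e) $$ (i, j)" using s ij by simp
      qed (simp_all add: A'_def B'_def)
    next
      fix v :: "'a vec" assume v: "v \<in> carrier_vec (Suc e)"
      have "A' *\<^sub>v v = A *\<^sub>v vec e (\<lambda>i. v $ i) + v $ e \<cdot>\<^sub>v u"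
        using A u v by (intro eq_vecI) (auto simp: A'_def scalar_prod_def mult.commute)
      moreover have "\<dots> \<in> W" using W AW[of "vec e (\<lambda>i. v $ i)"] uW by (auto simp: vec_subspace_def)
      ultimately show "A' *\<^sub>v v \<in> W" by simp
    qed
    from maxe[OF this] show False by simp
  qed
  thus thesis using that A B BA AW by blast
qed

text \<open>The complement is the kernel of \<open>B\<close>, split by the previous lemma. The
  identity \<open>A * B + P * Q = 1\<close> then serves as a change of basis adapted to
  \<open>W\<close>.\<close>

lemma subspace_split_complement:
  fixes W :: "'a::field vec set"
  assumes W: "vec_subspace d W"
  obtains e A B f P Q where "A \<in> carrier_mat d e" "B \<in> carrier_mat e d" "B * A = 1\<^sub>m e"
    "\<And>v. v \<in> carrier_vec e \<Longrightarrow> A *\<^sub>v v \<in> W" "\<And>w. w \<in> W \<Longrightarrow> A *\<^sub>v (B *\<^sub>v w) = w"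
    "P \<in> carrier_mat d f" "Q \<in> carrier_mat f d" "Q * P = 1\<^sub>m f" "Q * A = 0\<^sub>m f e"
    "A * B + P * Q = 1\<^sub>m d"
proof -
  from subspace_split[OF W] obtain e A B where A: "A \<in> carrier_mat d e" and B: "B \<in> carrier_mat e d"
    and BA: "B * A = 1\<^sub>m e" and AW: "\<And>v. v \<in> carrier_vec e \<Longrightarrow> A *\<^sub>v v \<in> W"
    and ABw: "\<And>w. w \<in> W \<Longrightarrow> A *\<^sub>v (B *\<^sub>v w) = w" by metis
  define K where "K = {v \<in> carrier_vec d. B *\<^sub>v v = 0\<^sub>v e}"
  have "vec_subspace d K"
    using B by (auto simp: vec_subspace_def K_def mult_add_distrib_mat_vec mult_mat_vec)
  from subspace_split[OF this] obtain f P Q0 where P: "P \<in> carrier_mat d f" and Q0: "Q0 \<in> carrier_mat f d"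
    and QP: "Q0 * P = 1\<^sub>m f" and PK: "\<And>v. v \<in> carrier_vec f \<Longrightarrow> P *\<^sub>v v \<in> K"
    and PQk: "\<And>w. w \<in> K \<Longrightarrow> P *\<^sub>v (Q0 *\<^sub>v w) = w" by metis
  have AB: "A * B \<in> carrier_mat d d" using A B by auto
  define C where "C = 1\<^sub>m d - A * B"
  have C: "C \<in> carrier_mat d d" using AB by (simp add: C_def minus_carrier_mat)
  have "B * (A * B) = B" using A B BA by (metis assoc_mult_mat left_mult_one_mat)
  hence BC: "B * C = 0\<^sub>m e d"
    using A B by (simp add: C_def mult_minus_distrib_mat[OF B one_carrier_mat AB])
  have "(A * B) * A = A" using A B BA by (metis assoc_mult_mat right_mult_one_mat)
  hence CA: "C * A = 0\<^sub>m d e"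
    using A B by (simp add: C_def minus_mult_distrib_mat[OF one_carrier_mat AB A])
  have BP: "B * P = 0\<^sub>m e f"
  proof (rule eq_matI)
    fix i j assume ij: "i < dim_row (0\<^sub>m e f :: 'a mat)" "j < dim_col (0\<^sub>m e f :: 'a mat)"
    have "B *\<^sub>v (P *\<^sub>v unit_vec f j) = 0\<^sub>v e" using PK[of "unit_vec f j"] ij by (simp add: K_def)
    moreover have "P *\<^sub>v unit_vec f j = col P j" using P ij by (simp add: mult_mat_unit_vec)
    ultimately have "B *\<^sub>v col P j = 0\<^sub>v e" by simp
    hence "(B *\<^sub>v col P j) $ i = 0" using ij by simp
    thus "(B * P) $$ (i, j) = 0\<^sub>m e f $$ (i, j)" using ij B P by simp
  qed (use B P in auto)
  have PQC: "P * (Q0 * C) = C"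
  proof (rule eq_matI)
    fix i j assume "i < dim_row C" "j < dim_col C"
    hence ij: "i < d" "j < d" using C by auto
    have "B *\<^sub>v col C j = col (B * C) j" using col_mult2[OF B C ij(2)] by simp
    hence "col C j \<in> K" using C ij BC by (auto simp: K_def)
    from PQk[OF this] have "P *\<^sub>v (Q0 *\<^sub>v col C j) = col C j" .
    hence "col (P * (Q0 * C)) j = col C j"
      using col_mult2[OF P mult_carrier_mat[OF Q0 C] ij(2)] col_mult2[OF Q0 C ij(2)] by simp
    hence "col (P * (Q0 * C)) j $ i = col C j $ i" by simp
    thus "(P * (Q0 * C)) $$ (i, j) = C $$ (i, j)"
      using ij C P by (simp add: col_def)
  qed (use C P in auto)
  \<comment> \<open>\<open>Q0\<close> is some left inverse of \<open>P\<close> and need not vanish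
    on \<open>W\<close>. Composing it with the projection \<open>C\<close> enforces
    \<open>Q * A = 0\<close>.\<close>
  define Q where "Q = Q0 * C"
  have Q: "Q \<in> carrier_mat f d" using Q0 C by (simp add: Q_def)
  have "C * P = P - A * (B * P)"
    using P minus_mult_distrib_mat[OF one_carrier_mat AB P] assoc_mult_mat[OF A B P] by (simp add: C_def)
  also have "\<dots> = P" unfolding BP using A P by (intro eq_matI) auto
  finally have "C * P = P" .
  hence "Q * P = 1\<^sub>m f" unfolding Q_def using assoc_mult_mat[OF Q0 C P] QP by simp
  moreover have "Q * A = 0\<^sub>m f e" unfolding Q_def using assoc_mult_mat[OF Q0 C A] CA Q0 by simp
  moreover have "A * B + P * Q = 1\<^sub>m d"
  proof -
    have "P * Q = C" unfolding Q_def by (rule PQC)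
    thus ?thesis unfolding C_def using A B by (intro eq_matI) auto
  qed
  ultimately show thesis using that[OF A B BA AW ABw P Q] by blast
qed

section \<open>Matrix representations and their composition factors\<close>

definition mat_rep :: "('g, 'm) monoid_scheme \<Rightarrow> nat \<Rightarrow> ('g \<Rightarrow> 'a::field mat) \<Rightarrow> bool" where
  "mat_rep G d R \<longleftrightarrow> (\<forall>g\<in>carrier G. R g \<in> carrier_mat d d) \<and> R \<one>\<^bsub>G\<^esub> = 1\<^sub>m d \<and>
     (\<forall>g\<in>carrier G. \<forall>h\<in>carrier G. R (g \<otimes>\<^bsub>G\<^esub> h) = R g * R h)"

definition mat_irr :: "('g, 'm) monoid_scheme \<Rightarrow> nat \<Rightarrow> ('g \<Rightarrow> 'a::field mat) \<Rightarrow> bool" where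
  "mat_irr G d R \<longleftrightarrow> mat_rep G d R \<and> 0 < d \<and>
     (\<forall>W. vec_subspace d W \<and> (\<forall>g\<in>carrier G. \<forall>w\<in>W. R g *\<^sub>v w \<in> W) \<longrightarrow>
        W = {0\<^sub>v d} \<or> W = carrier_vec d)"

lemma mat_rep_carrier: "mat_rep G d R \<Longrightarrow> g \<in> carrier G \<Longrightarrow> R g \<in> carrier_mat d d"
  by (simp add: mat_rep_def)

lemma mat_rep_mult:
  "mat_rep G d R \<Longrightarrow> g \<in> carrier G \<Longrightarrow> h \<in> carrier G \<Longrightarrow> R (g \<otimes>\<^bsub>G\<^esub> h) = R g * R h"
  by (simp add: mat_rep_def)

lemma mat_rep_one: "mat_rep G d R \<Longrightarrow> R \<one>\<^bsub>G\<^esub> = 1\<^sub>m d"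
  by (simp add: mat_rep_def)

lemma mat_irr_rep: "mat_irr G d R \<Longrightarrow> mat_rep G d R"
  by (simp add: mat_irr_def)

lemma mat_irr_subspace:
  assumes "mat_irr G d R" "vec_subspace d W" "\<And>g w. g \<in> carrier G \<Longrightarrow> w \<in> W \<Longrightarrow> R g *\<^sub>v w \<in> W"
  shows "W = {0\<^sub>v d} \<or> W = carrier_vec d"
  using assms unfolding mat_irr_def by blast

lemma mat_eq_by_vec:
  fixes A B :: "'a::semiring_1 mat"
  assumes A: "A \<in> carrier_mat m n" and B: "B \<in> carrier_mat m n"
    and eq: "\<And>v. v \<in> carrier_vec n \<Longrightarrow> A *\<^sub>v v = B *\<^sub>v v"
  shows "A = B"
proof (rule mat_col_eqI)
  fix j assume "j < dim_col B"
  hence j: "j < n" using B by simp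
  show "col A j = col B j"
    using eq[of "unit_vec n j"] mult_mat_unit_vec[OF A j] mult_mat_unit_vec[OF B j] by simp
qed (use A B in auto)

text \<open>In the basis adapted to \<open>W\<close> all matrices are block triangular. The diagonal
  blocks are the representations on \<open>W\<close> and on the quotient, and the trace is the sum
  of their traces.\<close>

lemma mat_rep_split:
  fixes R :: "'g \<Rightarrow> 'a::field mat"
  assumes "group G" and R: "mat_rep G d R" and W: "vec_subspace d W"
    and inv: "\<And>g w. g \<in> carrier G \<Longrightarrow> w \<in> W \<Longrightarrow> R g *\<^sub>v w \<in> W"
    and nz: "W \<noteq> {0\<^sub>v d}" and ntop: "W \<noteq> carrier_vec d"
  obtains e f R1 R2 where "e < d" "f < d" "mat_rep G e R1" "mat_rep G f R2"
    "\<And>g. g \<in> carrier G \<Longrightarrow> mat_trace (R g) = mat_trace (R1 g) + mat_trace (R2 g :: 'a mat)"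
proof -
  interpret group G by fact
  obtain e A B f P Q where A: "A \<in> carrier_mat d e" and B: "B \<in> carrier_mat e d" and BA: "B * A = 1\<^sub>m e"
    and AW: "\<And>v. v \<in> carrier_vec e \<Longrightarrow> A *\<^sub>v v \<in> W" and ABw: "\<And>w. w \<in> W \<Longrightarrow> A *\<^sub>v (B *\<^sub>v w) = w"
    and P: "P \<in> carrier_mat d f" and Q: "Q \<in> carrier_mat f d" and QP: "Q * P = 1\<^sub>m f"
    and QA: "Q * A = 0\<^sub>m f e" and sum1: "A * B + P * Q = 1\<^sub>m d"
    using subspace_split_complement[OF W] by metis
  note Rc = mat_rep_carrier[OF R] and Rm = mat_rep_mult[OF R]
  have Wc: "w \<in> W \<Longrightarrow> w \<in> carrier_vec d" for w using W by (auto simp: vec_subspace_def)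
  have ABRA: "A * (B * (R g * A)) = R g * A" if g: "g \<in> carrier G" for g
  proof (rule mat_eq_by_vec)
    fix v :: "'a vec" assume v: "v \<in> carrier_vec e"
    have "R g *\<^sub>v (A *\<^sub>v v) \<in> W" using inv[OF g AW[OF v]] .
    from ABw[OF this] show "A * (B * (R g * A)) *\<^sub>v v = R g * A *\<^sub>v v"
      using A B Rc[OF g] v
      by (simp add: assoc_mult_mat_vec[of _ d e _ e] assoc_mult_mat_vec[of _ e d _ e] assoc_mult_mat_vec[of _ d d _ e])
  qed (use A B Rc[OF g] in auto)
  \<comment> \<open>Invariance of \<open>W\<close>: the off-diagonal block from \<open>W\<close> to
    the complement is zero.\<close>
  have QRA: "Q * (R g * A) = 0\<^sub>m f e" if g: "g \<in> carrier G" for g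
  proof -
    have "Q * (R g * A) = Q * (A * (B * (R g * A)))" using ABRA[OF g] by simp
    also have "\<dots> = (Q * A) * (B * (R g * A))"
      using A B Q Rc[OF g] by (simp add: assoc_mult_mat[OF Q A, of _ e])
    finally show ?thesis using QA A B Rc[OF g] by simp
  qed
  let ?R1 = "\<lambda>g. B * (R g * A)" and ?R2 = "\<lambda>g. Q * (R g * P)"
  have rep1: "mat_rep G e ?R1"
    unfolding mat_rep_def
  proof (intro conjI ballI)
    fix g h assume g: "g \<in> carrier G" and h: "h \<in> carrier G"
    show "?R1 g \<in> carrier_mat e e" using A B Rc[OF g] by auto
    have "B * (R (g \<otimes>\<^bsub>G\<^esub> h) * A) = B * (R g * (A * (B * (R h * A))))"
      unfolding ABRA[OF h] Rm[OF g h] using Rc g h A by (simp add: assoc_mult_mat[of _ d d _ d])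
    also have "\<dots> = B * (R g * A) * (B * (R h * A))"
    proof -
      have X: "B * (R h * A) \<in> carrier_mat e e" using A B Rc[OF h] by auto
      have RA: "R g * A \<in> carrier_mat d e" using A Rc[OF g] by auto
      show ?thesis
        using assoc_mult_mat[OF Rc[OF g] A X] assoc_mult_mat[OF B RA X] by simp
    qed
    finally show "B * (R (g \<otimes>\<^bsub>G\<^esub> h) * A) = B * (R g * A) * (B * (R h * A))" .
  qed (use A BA mat_rep_one[OF R] in simp)
  have rep2: "mat_rep G f ?R2"
    unfolding mat_rep_def
  proof (intro conjI ballI)
    fix g h assume g: "g \<in> carrier G" and h: "h \<in> carrier G"
    show "?R2 g \<in> carrier_mat f f" using P Q Rc[OF g] by auto
    have RP: "R h * P \<in> carrier_mat d f" using Rc[OF h] P by simp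
    have BRP: "B * (R h * P) \<in> carrier_mat e f" using B RP by simp
    have QRP: "Q * (R h * P) \<in> carrier_mat f f" using Q RP by simp
    \<comment> \<open>The identity is inserted between the two group elements. The summand that
      passes through \<open>A\<close> is killed by \<open>Q * (R g * A) = 0\<close>.\<close>
    have "R h * P = (A * B + P * Q) * (R h * P)"
      unfolding sum1 using left_mult_one_mat[OF RP] by simp
    also have "\<dots> = A * (B * (R h * P)) + P * (Q * (R h * P))"
      using A B P Q RP add_mult_distrib_mat[OF mult_carrier_mat[OF A B] mult_carrier_mat[OF P Q] RP]
      by (simp add: assoc_mult_mat[OF A B RP] assoc_mult_mat[OF P Q RP])
    finally have "R h * P = A * (B * (R h * P)) + P * (Q * (R h * P))" .
    hence "R g * (R h * P) = R g * (A * (B * (R h * P)) + P * (Q * (R h * P)))" by (rule arg_cong[where f = "\<lambda>X. R g * X"])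
    also have "\<dots> = R g * (A * (B * (R h * P))) + R g * (P * (Q * (R h * P)))"
      by (rule mult_add_distrib_mat[OF Rc[OF g] mult_carrier_mat[OF A BRP] mult_carrier_mat[OF P QRP]])
    also have "R g * (A * (B * (R h * P))) = (R g * A) * (B * (R h * P))"
      using assoc_mult_mat[OF Rc[OF g] A BRP] by simp
    also have "R g * (P * (Q * (R h * P))) = (R g * P) * (Q * (R h * P))"
      using assoc_mult_mat[OF Rc[OF g] P QRP] by simp
    finally have e: "R g * (R h * P) = (R g * A) * (B * (R h * P)) + (R g * P) * (Q * (R h * P))" .
    have RgA: "R g * A \<in> carrier_mat d e" and RgP: "R g * P \<in> carrier_mat d f" using Rc[OF g] A P by auto
    have "Q * (R (g \<otimes>\<^bsub>G\<^esub> h) * P) = Q * (R g * (R h * P))"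
      using Rm[OF g h] assoc_mult_mat[OF Rc[OF g] Rc[OF h] P] by simp
    also have "\<dots> = Q * ((R g * A) * (B * (R h * P))) + Q * ((R g * P) * (Q * (R h * P)))"
      unfolding e by (rule mult_add_distrib_mat[OF Q mult_carrier_mat[OF RgA BRP] mult_carrier_mat[OF RgP QRP]])
    also have "Q * ((R g * A) * (B * (R h * P))) = (Q * (R g * A)) * (B * (R h * P))"
      using assoc_mult_mat[OF Q RgA BRP] by simp
    also have "\<dots> = 0\<^sub>m f f" unfolding QRA[OF g] by (rule left_mult_zero_mat[OF BRP])
    also have "Q * ((R g * P) * (Q * (R h * P))) = (Q * (R g * P)) * (Q * (R h * P))"
      using assoc_mult_mat[OF Q RgP QRP] by simp
    finally show "Q * (R (g \<otimes>\<^bsub>G\<^esub> h) * P) = Q * (R g * P) * (Q * (R h * P))"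
      using Q RgP QRP by simp
  qed (use P QP mat_rep_one[OF R] in simp)
  have tr: "mat_trace (R g) = mat_trace (?R1 g) + mat_trace (?R2 g)" if g: "g \<in> carrier G" for g
  proof -
    have "R g = R g * (A * B + P * Q)" using sum1 Rc[OF g] by simp
    also have "\<dots> = R g * (A * B) + R g * (P * Q)"
      by (rule mult_add_distrib_mat[OF Rc[OF g] mult_carrier_mat[OF A B] mult_carrier_mat[OF P Q]])
    also have "\<dots> = R g * A * B + R g * P * Q"
      using assoc_mult_mat[OF Rc[OF g] A B] assoc_mult_mat[OF Rc[OF g] P Q] by simp
    finally have eq: "R g = R g * A * B + R g * P * Q" .
    have "mat_trace (R g) = mat_trace (R g * A * B + R g * P * Q)"
      by (rule arg_cong[where f = mat_trace, OF eq])
    also have "\<dots> = mat_trace (R g * A * B) + mat_trace (R g * P * Q)"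
      by (rule mat_trace_add[of _ d]) (use A B P Q Rc[OF g] in auto)
    finally have "mat_trace (R g) = mat_trace (R g * A * B) + mat_trace (R g * P * Q)" .
    thus ?thesis
      using mat_trace_comm[of "R g * A" d e B] mat_trace_comm[of "R g * P" d f Q] A B P Q Rc[OF g] by auto
  qed
  have "W \<noteq> {}" using W by (auto simp: vec_subspace_def)
  then obtain w where w: "w \<in> W" "w \<noteq> 0\<^sub>v d" using nz by blast
  have "e \<noteq> 0"
  proof
    assume "e = 0"
    hence "A *\<^sub>v (B *\<^sub>v w) = 0\<^sub>v d" using A B by (intro eq_vecI) (auto simp: scalar_prod_def)
    with ABw[OF w(1)] w(2) show False by simp
  qed
  moreover have "f \<noteq> 0"
  proof
    assume f0: "f = 0"
    hence "P * Q = 0\<^sub>m d d" using P Q by (intro eq_matI) (auto simp: scalar_prod_def)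
    hence AB1: "A * B = 1\<^sub>m d" using sum1 A B by simp
    have "v \<in> W" if v: "v \<in> carrier_vec d" for v
      using AW[of "B *\<^sub>v v"] assoc_mult_mat_vec[OF A B v] AB1 B v by simp
    hence "W = carrier_vec d" using Wc by blast
    with ntop show False by simp
  qed
  \<comment> \<open>The columns of \<open>A\<close> and \<open>P\<close> together are left
    invertible, with the rows of \<open>B\<close> and \<open>Q\<close> as left inverse. With
    \<open>e\<close> and \<open>f\<close> non-zero, both degrees are then smaller than
    \<open>d\<close>.\<close>
  moreover have "e + f \<le> d"
  proof -
    let ?L = "mat d (e + f) (\<lambda>(i, j). if j < e then A $$ (i, j) else P $$ (i, j - e))"
    let ?M = "mat (e + f) d (\<lambda>(i, j). if i < e then B $$ (i, j) else Q $$ (i - e, j))"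
    have BP: "B * P = 0\<^sub>m e f"
    proof -
      have "B = B * (A * B + P * Q)" using sum1 B by simp
      also have "\<dots> = B * (A * B) + B * (P * Q)"
        by (rule mult_add_distrib_mat[OF B mult_carrier_mat[OF A B] mult_carrier_mat[OF P Q]])
      also have "B * (A * B) = B" using assoc_mult_mat[OF B A B] BA B by simp
      finally have eq: "B = B + B * (P * Q)" .
      have BPQ: "B * (P * Q) = 0\<^sub>m e d"
      proof (rule eq_matI)
        fix i j assume ij: "i < dim_row (0\<^sub>m e d :: 'a mat)" "j < dim_col (0\<^sub>m e d :: 'a mat)"
        have "B $$ (i, j) = (B + B * (P * Q)) $$ (i, j)" using eq by simp
        also have "\<dots> = B $$ (i, j) + (B * (P * Q)) $$ (i, j)"
          by (rule index_add_mat(1)) (use ij B Q in auto)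
        finally show "(B * (P * Q)) $$ (i, j) = 0\<^sub>m e d $$ (i, j)" using ij by simp
      qed (use B Q in auto)
      have "B * P = B * (P * (Q * P))" using QP P by simp
      also have "\<dots> = B * (P * Q) * P"
        using assoc_mult_mat[OF P Q P] assoc_mult_mat[OF B mult_carrier_mat[OF P Q] P] by simp
      finally show ?thesis using BPQ P by simp
    qed
    have "?M * ?L = 1\<^sub>m (e + f)"
    proof (rule eq_matI)
      fix i j assume "i < dim_row (1\<^sub>m (e + f) :: 'a mat)" "j < dim_col (1\<^sub>m (e + f) :: 'a mat)"
      hence ij: "i < e + f" "j < e + f" by auto
      have s: "(?M * ?L) $$ (i, j) = (\<Sum>l<d. ?M $$ (i, l) * ?L $$ (l, j))"
        by (rule mult_mat_index_sum) (use ij in auto)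
      consider "i < e" "j < e" | "i < e" "\<not> j < e" | "\<not> i < e" "j < e" | "\<not> i < e" "\<not> j < e" by blast
      hence "(\<Sum>l<d. ?M $$ (i, l) * ?L $$ (l, j)) = (if i = j then 1 else 0)"
      proof cases
        case 1
        have "(\<Sum>l<d. ?M $$ (i, l) * ?L $$ (l, j)) = (B * A) $$ (i, j)"
          unfolding mult_mat_index_sum[OF B A 1] using 1 by (intro sum.cong) auto
        thus ?thesis using BA 1 by simp
      next
        case 2
        hence j: "j - e < f" using ij by simp
        have "(\<Sum>l<d. ?M $$ (i, l) * ?L $$ (l, j)) = (B * P) $$ (i, j - e)"
          unfolding mult_mat_index_sum[OF B P 2(1) j] using 2 ij by (intro sum.cong) auto
        thus ?thesis using BP 2 j by simp
      next
        case 3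
        hence i: "i - e < f" using ij by simp
        have "(\<Sum>l<d. ?M $$ (i, l) * ?L $$ (l, j)) = (Q * A) $$ (i - e, j)"
          unfolding mult_mat_index_sum[OF Q A i 3(2)] using 3 ij by (intro sum.cong) auto
        thus ?thesis using QA 3 i by simp
      next
        case 4
        hence i: "i - e < f" and j: "j - e < f" using ij by auto
        have "(\<Sum>l<d. ?M $$ (i, l) * ?L $$ (l, j)) = (Q * P) $$ (i - e, j - e)"
          unfolding mult_mat_index_sum[OF Q P i j] using 4 ij by (intro sum.cong) auto
        thus ?thesis using QP 4 i j by auto
      qed
      thus "(?M * ?L) $$ (i, j) = 1\<^sub>m (e + f) $$ (i, j)" using s ij by simp
    qed auto
    from left_inverse_dim_le[OF _ _ this] show ?thesis by auto
  qed
  ultimately have "e < d" "f < d" by auto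
  thus thesis using that rep1 rep2 tr by blast
qed

text \<open>The list holds the composition factors. Only the traces are kept, as everything
  afterwards is an identity between characters; degree 0 gives the empty list.\<close>

lemma mat_rep_decompose:
  fixes R :: "'g \<Rightarrow> 'a::field mat"
  assumes "group G" "mat_rep G d R"
  shows "\<exists>ps. (\<forall>(e, S)\<in>set ps. mat_irr G e S) \<and>
    (\<forall>g\<in>carrier G. mat_trace (R g) = (\<Sum>(e, S)\<leftarrow>ps. mat_trace (S g)))"
  using assms(2)
proof (induction d arbitrary: R rule: less_induct)
  case (less d)
  show ?case
  proof (cases "mat_irr G d R")
    case True
    thus ?thesis by (intro exI[of _ "[(d, R)]"]) auto
  next
    case irr: False
    show ?thesis
    proof (cases "d = 0")
      case True
      hence "mat_trace (R g) = 0" if "g \<in> carrier G" for g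
        using mat_rep_carrier[OF less.prems that] by (simp add: mat_trace_def)
      thus ?thesis by (intro exI[of _ "[]"]) simp
    next
      case False
      then obtain W where "vec_subspace d W" "\<And>g w. g \<in> carrier G \<Longrightarrow> w \<in> W \<Longrightarrow> R g *\<^sub>v w \<in> W"
        "W \<noteq> {0\<^sub>v d}" "W \<noteq> carrier_vec d"
        using irr less.prems unfolding mat_irr_def by blast
      from mat_rep_split[OF assms(1) less.prems this] obtain e f R1 R2 where ef: "e < d" "f < d"
        and rep: "mat_rep G e R1" "mat_rep G f R2"
        and tr: "\<And>g. g \<in> carrier G \<Longrightarrow> mat_trace (R g) = mat_trace (R1 g) + mat_trace (R2 g :: 'a mat)"
        by metis
      from less.IH[OF ef(1) rep(1)] obtain ps where ps: "\<forall>(e, S)\<in>set ps. mat_irr G e S"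
        "\<forall>g\<in>carrier G. mat_trace (R1 g) = (\<Sum>(e, S)\<leftarrow>ps. mat_trace (S g))" by blast
      from less.IH[OF ef(2) rep(2)] obtain qs where qs: "\<forall>(e, S)\<in>set qs. mat_irr G e S"
        "\<forall>g\<in>carrier G. mat_trace (R2 g) = (\<Sum>(e, S)\<leftarrow>qs. mat_trace (S g))" by blast
      show ?thesis
        by (intro exI[of _ "ps @ qs"]) (use ps qs tr in auto)
    qed
  qed
qed

section \<open>Schur's lemma\<close>

lemma zero_mat_mult_vec:
  fixes v :: "'a::semiring_0 vec"
  shows "v \<in> carrier_vec d \<Longrightarrow> 0\<^sub>m e d *\<^sub>v v = 0\<^sub>v e"
  by (intro eq_vecI) (auto simp: scalar_prod_def)

lemma invertible_if_kernel_zero: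
  fixes M :: "'a::field mat"
  assumes M: "M \<in> carrier_mat d d" and ker: "\<And>v. v \<in> carrier_vec d \<Longrightarrow> M *\<^sub>v v = 0\<^sub>v d \<Longrightarrow> v = 0\<^sub>v d"
  obtains N where "N \<in> carrier_mat d d" "M * N = 1\<^sub>m d" "N * M = 1\<^sub>m d"
proof -
  have "det M \<noteq> 0" using det_0_iff_vec_prod_zero[OF M] ker by blast
  from det_non_zero_imp_unit[OF M this, of "()"] show thesis
    using that by (auto simp: Units_def ring_mat_simps)
qed

text \<open>The kernel is an invariant subspace of the source. Irreducibility is asked of the source
  only, so that the target may be the twisted representation, whose irreducibility is not
  established.\<close>

lemma mat_irr_intertwiner_inj:
  fixes R R' :: "'g \<Rightarrow> 'a::field mat"
  assumes R: "mat_irr G d R" and R': "mat_rep G e R'" and M: "M \<in> carrier_mat e d"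
    and int: "\<And>g. g \<in> carrier G \<Longrightarrow> R' g * M = M * R g" and nz: "M \<noteq> 0\<^sub>m e d"
    and v: "v \<in> carrier_vec d" "M *\<^sub>v v = 0\<^sub>v e"
  shows "v = 0\<^sub>v d"
proof -
  let ?K = "{v \<in> carrier_vec d. M *\<^sub>v v = 0\<^sub>v e}"
  note Rc = mat_rep_carrier[OF mat_irr_rep[OF R]] and Rc' = mat_rep_carrier[OF R']
  have "vec_subspace d ?K"
    using M by (auto simp: vec_subspace_def mult_add_distrib_mat_vec mult_mat_vec)
  moreover have "R g *\<^sub>v w \<in> ?K" if g: "g \<in> carrier G" and w: "w \<in> ?K" for g w
  proof -
    have wc: "w \<in> carrier_vec d" using w by simp
    have "M *\<^sub>v (R g *\<^sub>v w) = (R' g * M) *\<^sub>v w"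
      using assoc_mult_mat_vec[OF M Rc[OF g] wc] int[OF g] by simp
    also have "\<dots> = R' g *\<^sub>v 0\<^sub>v e" using assoc_mult_mat_vec[OF Rc'[OF g] M wc] w by simp
    also have "\<dots> = 0\<^sub>v e" using Rc'[OF g] by auto
    finally show ?thesis using Rc[OF g] wc by simp
  qed
  ultimately have "?K = {0\<^sub>v d} \<or> ?K = carrier_vec d" by (rule mat_irr_subspace[OF R])
  moreover have "?K \<noteq> carrier_vec d"
  proof
    assume eq: "?K = carrier_vec d"
    have "M = 0\<^sub>m e d"
    proof (rule mat_eq_by_vec[OF M])
      fix u :: "'a vec" assume u: "u \<in> carrier_vec d"
      hence "u \<in> ?K" using eq by blast
      thus "M *\<^sub>v u = 0\<^sub>m e d *\<^sub>v u" using zero_mat_mult_vec[OF u] by simp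
    qed simp
    with nz show False by simp
  qed
  ultimately show ?thesis using v by blast
qed

text \<open>The image is invariant as well, so \<open>M\<close> is bijective. Equivalence is
  recorded as equality of traces, obtained from cyclicity of the trace for the rectangular matrices
  \<open>M\<close> and its inverse, which is built from preimages of unit vectors.\<close>

lemma mat_irr_intertwiner_iso:
  fixes R R' :: "'g \<Rightarrow> 'a::field mat"
  assumes R: "mat_irr G d R" and R': "mat_irr G e R'" and M: "M \<in> carrier_mat e d"
    and int: "\<And>g. g \<in> carrier G \<Longrightarrow> R' g * M = M * R g" and nz: "M \<noteq> 0\<^sub>m e d"
    and g: "g \<in> carrier G"
  shows "mat_trace (R' g) = mat_trace (R g)"
proof -
  note Rc = mat_rep_carrier[OF mat_irr_rep[OF R]] and Rc' = mat_rep_carrier[OF mat_irr_rep[OF R']]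
  let ?I = "{M *\<^sub>v v | v. v \<in> carrier_vec d}"
  have "vec_subspace e ?I"
    unfolding vec_subspace_def
  proof (intro conjI ballI allI)
    show "?I \<subseteq> carrier_vec e" using M by auto
    show "0\<^sub>v e \<in> ?I" using M by (auto intro!: exI[of _ "0\<^sub>v d"])
  next
    fix x y assume "x \<in> ?I" "y \<in> ?I"
    then obtain a b where "a \<in> carrier_vec d" "b \<in> carrier_vec d" "x = M *\<^sub>v a" "y = M *\<^sub>v b" by auto
    thus "x + y \<in> ?I"
      using M by (auto intro!: exI[of _ "a + b"] simp: mult_add_distrib_mat_vec)
  next
    fix c x assume "x \<in> ?I"
    then obtain a where "a \<in> carrier_vec d" "x = M *\<^sub>v a" by auto
    thus "c \<cdot>\<^sub>v x \<in> ?I" using M by (auto intro!: exI[of _ "c \<cdot>\<^sub>v a"] simp: mult_mat_vec)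
  qed
  moreover have "R' h *\<^sub>v w \<in> ?I" if h: "h \<in> carrier G" and w: "w \<in> ?I" for h w
  proof -
    from w obtain a where a: "a \<in> carrier_vec d" "w = M *\<^sub>v a" by auto
    have "R' h *\<^sub>v w = M *\<^sub>v (R h *\<^sub>v a)"
      using assoc_mult_mat_vec[OF M Rc[OF h] a(1)] assoc_mult_mat_vec[OF Rc'[OF h] M a(1)] int[OF h] a by simp
    thus ?thesis using Rc[OF h] a by auto
  qed
  ultimately have "?I = {0\<^sub>v e} \<or> ?I = carrier_vec e" by (rule mat_irr_subspace[OF R'])
  moreover have "?I \<noteq> {0\<^sub>v e}"
  proof
    assume eq: "?I = {0\<^sub>v e}"
    have "M = 0\<^sub>m e d"
    proof (rule mat_eq_by_vec[OF M])
      fix u :: "'a vec" assume u: "u \<in> carrier_vec d"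
      hence "M *\<^sub>v u \<in> ?I" by blast
      hence "M *\<^sub>v u = 0\<^sub>v e" using eq by blast
      thus "M *\<^sub>v u = 0\<^sub>m e d *\<^sub>v u" using zero_mat_mult_vec[OF u] by simp
    qed simp
    with nz show False by simp
  qed
  ultimately have onto: "?I = carrier_vec e" by blast
  have "\<exists>v. v \<in> carrier_vec d \<and> M *\<^sub>v v = unit_vec e i" for i
  proof -
    have "unit_vec e i \<in> ?I" unfolding onto by simp
    thus ?thesis by auto
  qed
  then obtain f where f: "f i \<in> carrier_vec d" "M *\<^sub>v f i = unit_vec e i" for i by metis
  let ?N = "mat_of_cols d (map f [0..<e])"
  have N: "?N \<in> carrier_mat d e" by auto
  have MN: "M * ?N = 1\<^sub>m e"
  proof (rule mat_col_eqI)
    fix j assume "j < dim_col (1\<^sub>m e :: 'a mat)"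
    hence j: "j < e" by simp
    have "col ?N j = f j" using j f by (subst col_mat_of_cols) auto
    thus "col (M * ?N) j = col (1\<^sub>m e) j" using col_mult2[OF M N j] f j by simp
  qed (use M in auto)
  have NM: "?N * M = 1\<^sub>m d"
  proof (rule mat_eq_by_vec)
    fix v :: "'a vec" assume v: "v \<in> carrier_vec d"
    let ?w = "?N *\<^sub>v (M *\<^sub>v v) - v"
    have Mv: "M *\<^sub>v v \<in> carrier_vec e" using M v by simp
    have NMv: "?N *\<^sub>v (M *\<^sub>v v) \<in> carrier_vec d" using N Mv by (rule mult_mat_vec_carrier)
    have "M *\<^sub>v ?w = M *\<^sub>v (?N *\<^sub>v (M *\<^sub>v v)) - M *\<^sub>v v"
      by (rule mult_minus_distrib_mat_vec[OF M NMv v])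
    also have "M *\<^sub>v (?N *\<^sub>v (M *\<^sub>v v)) = M *\<^sub>v v"
      using assoc_mult_mat_vec[OF M N Mv] MN Mv by simp
    finally have "M *\<^sub>v ?w = 0\<^sub>v e" using Mv by simp
    from mat_irr_intertwiner_inj[OF R mat_irr_rep[OF R'] M int nz _ this]
    have w0: "?w = 0\<^sub>v d" using NMv v by simp
    have "?N *\<^sub>v (M *\<^sub>v v) = v"
    proof (rule eq_vecI)
      fix i assume i: "i < dim_vec v"
      have "?w $ i = 0" using w0 i v by simp
      thus "(?N *\<^sub>v (M *\<^sub>v v)) $ i = v $ i" using i v NMv by simp
    qed (use NMv v in auto)
    thus "?N * M *\<^sub>v v = 1\<^sub>m d *\<^sub>v v" using assoc_mult_mat_vec[OF N M v] v by simp
  qed (use N M in auto)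
  have "R' g = R' g * M * ?N" using assoc_mult_mat[OF Rc'[OF g] M N] MN Rc'[OF g] by simp
  also have "\<dots> = (M * R g) * ?N" using int[OF g] by simp
  finally have "mat_trace (R' g) = mat_trace (?N * (M * R g))"
    using mat_trace_comm[of "M * R g" e d ?N] M N Rc[OF g] by simp
  also have "?N * (M * R g) = R g" using assoc_mult_mat[OF N M Rc[OF g]] NM Rc[OF g] by simp
  finally show ?thesis .
qed

lemma complex_mat_eigenvector:
  fixes A :: "complex mat"
  assumes A: "A \<in> carrier_mat n n" and n: "0 < n"
  obtains c v where "v \<in> carrier_vec n" "v \<noteq> 0\<^sub>v n" "A *\<^sub>v v = c \<cdot>\<^sub>v v"
proof -
  have "\<not> constant (poly (char_poly A))"
    using degree_monic_char_poly[OF A] n by (simp add: constant_degree)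
  then obtain c where "poly (char_poly A) c = 0" using fundamental_theorem_of_algebra by blast
  hence "eigenvalue A c" using eigenvalue_root_char_poly[OF A] by simp
  thus thesis using that A by (auto simp: eigenvalue_def eigenvector_def)
qed

lemma mat_irr_commutant:
  fixes R :: "'g \<Rightarrow> complex mat"
  assumes R: "mat_irr G d R" and M: "M \<in> carrier_mat d d"
    and comm: "\<And>g. g \<in> carrier G \<Longrightarrow> R g * M = M * R g"
  obtains c where "M = c \<cdot>\<^sub>m 1\<^sub>m d"
proof -
  note Rc = mat_rep_carrier[OF mat_irr_rep[OF R]]
  have "0 < d" using R by (simp add: mat_irr_def)
  from complex_mat_eigenvector[OF M this] obtain c v where
    v: "v \<in> carrier_vec d" "v \<noteq> 0\<^sub>v d" "M *\<^sub>v v = c \<cdot>\<^sub>v v" by metis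
  \<comment> \<open>An eigenvector of \<open>M\<close> lies in the kernel of this intertwiner, and a
    non-zero intertwiner would be injective.\<close>
  let ?N = "M - c \<cdot>\<^sub>m 1\<^sub>m d"
  have N: "?N \<in> carrier_mat d d" using M by (simp add: minus_carrier_mat)
  have cI: "c \<cdot>\<^sub>m 1\<^sub>m d \<in> carrier_mat d d" by simp
  have "?N *\<^sub>v v = M *\<^sub>v v - (c \<cdot>\<^sub>m 1\<^sub>m d) *\<^sub>v v" by (rule minus_mult_distrib_mat_vec[OF M cI v(1)])
  also have "(c \<cdot>\<^sub>m 1\<^sub>m d) *\<^sub>v v = c \<cdot>\<^sub>v v"
    using v(1) by (intro eq_vecI) (simp_all add: row_smult)
  finally have Nv: "?N *\<^sub>v v = 0\<^sub>v d" using v by simp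
  have int: "R g * ?N = ?N * R g" if g: "g \<in> carrier G" for g
    using mult_minus_distrib_mat[OF Rc[OF g] M cI] minus_mult_distrib_mat[OF M cI Rc[OF g]] comm[OF g]
      Rc[OF g] mult_smult_distrib[OF Rc[OF g] one_carrier_mat] mult_smult_assoc_mat[OF one_carrier_mat Rc[OF g]]
    by simp
  have "?N = 0\<^sub>m d d"
    using mat_irr_intertwiner_inj[OF R mat_irr_rep[OF R] N int _ v(1) Nv] v(2) by blast
  have "M = c \<cdot>\<^sub>m 1\<^sub>m d"
  proof (rule eq_matI)
    fix i j assume ij: "i < dim_row (c \<cdot>\<^sub>m 1\<^sub>m d)" "j < dim_col (c \<cdot>\<^sub>m 1\<^sub>m d)"
    have "?N $$ (i, j) = 0" using \<open>?N = 0\<^sub>m d d\<close> ij by simp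
    thus "M $$ (i, j) = (c \<cdot>\<^sub>m 1\<^sub>m d) $$ (i, j)" using ij M by simp
  qed (use M in auto)
  thus thesis by (rule that)
qed

section \<open>Orthogonality of matrix coefficients and characters\<close>

lemma group_average_intertwines:
  fixes R R' :: "'g \<Rightarrow> 'a::field mat"
  assumes "group G" and R: "mat_rep G d R" and R': "mat_rep G e R'" and X: "X \<in> carrier_mat e d"
    and h: "h \<in> carrier G"
  defines "M \<equiv> mat e d (\<lambda>ij. \<Sum>g\<in>carrier G. (R' g * X * R (inv\<^bsub>G\<^esub> g)) $$ ij)"
  shows "R' h * M = M * R h"
proof -
  interpret group G by fact
  let ?Y = "\<lambda>g. R' g * X * R (inv\<^bsub>G\<^esub> g)"
  note Rc = mat_rep_carrier[OF R] and Rc' = mat_rep_carrier[OF R']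
  have Y: "?Y g \<in> carrier_mat e d" if "g \<in> carrier G" for g
    using Rc[of "inv\<^bsub>G\<^esub> g"] Rc'[of g] X that by auto
  have M: "M \<in> carrier_mat e d" by (simp add: M_def)
  have shift: "R' h * ?Y g = ?Y (h \<otimes>\<^bsub>G\<^esub> g) * R h" if g: "g \<in> carrier G" for g
  proof -
    have "?Y (h \<otimes>\<^bsub>G\<^esub> g) * R h = R' h * R' g * X * (R (inv\<^bsub>G\<^esub> (h \<otimes>\<^bsub>G\<^esub> g)) * R h)"
      using mat_rep_mult[OF R' h g] assoc_mult_mat[OF mult_carrier_mat[OF mult_carrier_mat[OF Rc'[OF h] Rc'[OF g]] X]
          Rc[of "inv\<^bsub>G\<^esub> (h \<otimes>\<^bsub>G\<^esub> g)"] Rc[OF h]] g h by simp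
    also have "R (inv\<^bsub>G\<^esub> (h \<otimes>\<^bsub>G\<^esub> g)) * R h = R (inv\<^bsub>G\<^esub> (h \<otimes>\<^bsub>G\<^esub> g) \<otimes>\<^bsub>G\<^esub> h)"
      using g h by (simp add: mat_rep_mult[OF R])
    also have "inv\<^bsub>G\<^esub> (h \<otimes>\<^bsub>G\<^esub> g) \<otimes>\<^bsub>G\<^esub> h = inv\<^bsub>G\<^esub> g" using g h by (simp add: inv_mult_group m_assoc)
    also have "R' h * R' g * X * R (inv\<^bsub>G\<^esub> g) = R' h * ?Y g"
      using assoc_mult_mat[OF Rc'[OF h] Rc'[OF g] X]
        assoc_mult_mat[OF Rc'[OF h] mult_carrier_mat[OF Rc'[OF g] X] Rc[OF inv_closed[OF g]]] by simp
    finally show ?thesis by simp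
  qed
  show ?thesis
  proof (rule eq_matI)
    fix i j assume "i < dim_row (M * R h)" "j < dim_col (M * R h)"
    hence ij: "i < e" "j < d" using M Rc[OF h] by auto
    have "(R' h * M) $$ (i, j) = (\<Sum>k<e. R' h $$ (i, k) * (\<Sum>g\<in>carrier G. ?Y g $$ (k, j)))"
      unfolding mult_mat_index_sum[OF Rc'[OF h] M ij] using ij by (intro sum.cong) (auto simp: M_def)
    also have "\<dots> = (\<Sum>g\<in>carrier G. \<Sum>k<e. R' h $$ (i, k) * ?Y g $$ (k, j))"
      by (subst sum.swap) (simp add: sum_distrib_left)
    also have "\<dots> = (\<Sum>g\<in>carrier G. (?Y (h \<otimes>\<^bsub>G\<^esub> g) * R h) $$ (i, j))"
      by (intro sum.cong refl) (simp add: mult_mat_index_sum[OF Rc'[OF h] Y ij, symmetric] shift)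
    also have "\<dots> = (\<Sum>g\<in>carrier G. (?Y g * R h) $$ (i, j))"
    proof (rule sum.reindex_bij_witness[of _ "\<lambda>g. inv\<^bsub>G\<^esub> h \<otimes>\<^bsub>G\<^esub> g" "\<lambda>g. h \<otimes>\<^bsub>G\<^esub> g"])
    qed (use h in \<open>auto simp: m_assoc[symmetric]\<close>)
    also have "\<dots> = (\<Sum>g\<in>carrier G. \<Sum>k<d. ?Y g $$ (i, k) * R h $$ (k, j))"
      by (intro sum.cong refl) (simp add: mult_mat_index_sum[OF Y Rc[OF h] ij])
    also have "\<dots> = (\<Sum>k<d. (\<Sum>g\<in>carrier G. ?Y g $$ (i, k)) * R h $$ (k, j))"
      by (subst sum.swap) (simp add: sum_distrib_right)
    also have "\<dots> = (M * R h) $$ (i, j)"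
      unfolding mult_mat_index_sum[OF M Rc[OF h] ij] using ij by (intro sum.cong) (auto simp: M_def)
    finally show "(R' h * M) $$ (i, j) = (M * R h) $$ (i, j)" .
  qed (use M Rc[OF h] Rc'[OF h] in auto)
qed

lemma mult_elementary_index:
  fixes A B :: "'a::field mat"
  assumes A: "A \<in> carrier_mat e e" and B: "B \<in> carrier_mat d d" and "a < e" "b < d" "i < e" "j < d"
  shows "(A * mat e d (\<lambda>ij. if ij = (a, b) then 1 else 0) * B) $$ (i, j) = A $$ (i, a) * B $$ (b, j)"
proof -
  let ?E = "mat e d (\<lambda>ij. if ij = (a, b) then 1 else 0)"
  have "(A * ?E) $$ (i, k) = (if k = b then A $$ (i, a) else 0)" if k: "k < d" for k
  proof -
    have "(A * ?E) $$ (i, k) = (\<Sum>l<e. A $$ (i, l) * ?E $$ (l, k))"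
      by (rule mult_mat_index_sum) (use assms k in auto)
    also have "\<dots> = (\<Sum>l<e. if l = a then (if k = b then A $$ (i, a) else 0) else 0)"
      using k by (intro sum.cong) auto
    also have "\<dots> = (if k = b then A $$ (i, a) else 0)" using assms by simp
    finally show ?thesis .
  qed
  note AE = this
  have "(A * ?E * B) $$ (i, j) = (\<Sum>k<d. (A * ?E) $$ (i, k) * B $$ (k, j))"
    by (rule mult_mat_index_sum) (use assms in auto)
  also have "\<dots> = (\<Sum>k<d. if k = b then A $$ (i, a) * B $$ (b, j) else 0)"
    by (intro sum.cong) (auto simp: AE)
  finally show ?thesis using assms by simp
qed

text \<open>Averaging an elementary matrix over the group gives an intertwiner, and its entries are
  these sums. The hypothesis speaks of intertwiners, not of characters, because the lemma is also
  used in contraposition, to produce an intertwiner to the twist.\<close>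

lemma coefficient_sum_zero:
  fixes R R' :: "'g \<Rightarrow> 'a::field mat"
  assumes G: "group G" and R: "mat_rep G d R" and R': "mat_rep G e R'"
    and no: "\<And>M. M \<in> carrier_mat e d \<Longrightarrow> (\<And>g. g \<in> carrier G \<Longrightarrow> R' g * M = M * R g) \<Longrightarrow> M = 0\<^sub>m e d"
    and ind: "a < e" "b < d" "i < e" "j < d"
  shows "(\<Sum>g\<in>carrier G. R' g $$ (i, a) * R (inv\<^bsub>G\<^esub> g) $$ (b, j)) = 0"
proof -
  interpret group G by fact
  let ?E = "mat e d (\<lambda>ij. if ij = (a, b) then 1 else 0) :: 'a mat"
  have E: "?E \<in> carrier_mat e d" by simp
  let ?M = "mat e d (\<lambda>ij. \<Sum>g\<in>carrier G. (R' g * ?E * R (inv\<^bsub>G\<^esub> g)) $$ ij)"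
  have "?M = 0\<^sub>m e d"
    by (rule no) (use group_average_intertwines[OF G R R' E] in auto)
  hence "?M $$ (i, j) = 0" using ind by simp
  moreover have "?M $$ (i, j) = (\<Sum>g\<in>carrier G. R' g $$ (i, a) * R (inv\<^bsub>G\<^esub> g) $$ (b, j))"
    using ind mult_elementary_index[OF mat_rep_carrier[OF R'] mat_rep_carrier[OF R] ind(1,2,3,4)]
    by (simp add: inv_closed)
  ultimately show ?thesis by simp
qed

text \<open>The average of the elementary matrix is now a scalar matrix, and the scalar is found
  from its trace.\<close>

lemma coefficient_sum_same:
  fixes R :: "'g \<Rightarrow> complex mat"
  assumes G: "group G" and fin: "finite (carrier G)" and irr: "mat_irr G d R"
    and ind: "a < d" "b < d" "i < d" "j < d"
  shows "(\<Sum>g\<in>carrier G. R g $$ (i, a) * R (inv\<^bsub>G\<^esub> g) $$ (b, j)) =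
    (if i = j \<and> a = b then of_nat (card (carrier G)) / of_nat d else 0)"
proof -
  interpret group G by fact
  note R = mat_irr_rep[OF irr]
  note Rc = mat_rep_carrier[OF R]
  let ?E = "mat d d (\<lambda>ij. if ij = (a, b) then 1 else 0) :: complex mat"
  have E: "?E \<in> carrier_mat d d" by simp
  let ?M = "mat d d (\<lambda>ij. \<Sum>g\<in>carrier G. (R g * ?E * R (inv\<^bsub>G\<^esub> g)) $$ ij)"
  have Mij: "?M $$ (i, j) = (\<Sum>g\<in>carrier G. R g $$ (i, a) * R (inv\<^bsub>G\<^esub> g) $$ (b, j))"
    if "i < d" "j < d" for i j
    using that mult_elementary_index[OF Rc Rc ind(1,2) that] by (simp add: inv_closed)
  obtain c where c: "?M = c \<cdot>\<^sub>m 1\<^sub>m d"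
    using mat_irr_commutant[OF irr, of ?M] group_average_intertwines[OF G R R E] by auto
  \<comment> \<open>In the trace of the average the factors can be swapped to
    \<open>R (inv g) * R g = 1\<close>, so each group element contributes the entry
    \<open>(b, a)\<close> of the identity.\<close>
  have "of_nat d * c = (\<Sum>i<d. ?M $$ (i, i))" unfolding c by simp
  also have "\<dots> = (\<Sum>i<d. \<Sum>g\<in>carrier G. R g $$ (i, a) * R (inv\<^bsub>G\<^esub> g) $$ (b, i))"
    using Mij by (intro sum.cong) auto
  also have "\<dots> = (\<Sum>g\<in>carrier G. \<Sum>i<d. R (inv\<^bsub>G\<^esub> g) $$ (b, i) * R g $$ (i, a))"
    by (subst sum.swap) (simp add: mult.commute)
  also have "\<dots> = (\<Sum>g\<in>carrier G. (R (inv\<^bsub>G\<^esub> g) * R g) $$ (b, a))"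
    by (intro sum.cong refl) (simp add: mult_mat_index_sum[OF Rc Rc ind(2,1)] inv_closed)
  also have "\<dots> = (\<Sum>g\<in>carrier G. if a = b then 1 else 0)"
    by (intro sum.cong refl) (use ind in \<open>auto simp: mat_rep_mult[OF R, symmetric] mat_rep_one[OF R]\<close>)
  also have "\<dots> = (if a = b then of_nat (card (carrier G)) else 0)" by simp
  finally have "of_nat d * c = (if a = b then of_nat (card (carrier G)) else 0)" .
  hence "c = (if a = b then of_nat (card (carrier G)) / of_nat d else 0)"
    using ind(1) by (auto simp: field_simps split: if_splits)
  moreover have "?M $$ (i, j) = (if i = j then c else 0)" unfolding c using ind by simp
  ultimately show ?thesis using Mij[OF ind(3,4)] by auto
qed

lemma trace_product_sum:
  fixes R R' :: "'g \<Rightarrow> 'a::field mat"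
  assumes "group G" and R: "mat_rep G d R" and R': "mat_rep G e R'"
  shows "(\<Sum>g\<in>carrier G. mat_trace (R' g) * mat_trace (R (inv\<^bsub>G\<^esub> g))) =
    (\<Sum>i<e. \<Sum>j<d. \<Sum>g\<in>carrier G. R' g $$ (i, i) * R (inv\<^bsub>G\<^esub> g) $$ (j, j))"
proof -
  interpret group G by fact
  have "mat_trace (R' g) * mat_trace (R (inv\<^bsub>G\<^esub> g)) =
      (\<Sum>i<e. \<Sum>j<d. R' g $$ (i, i) * R (inv\<^bsub>G\<^esub> g) $$ (j, j))" if "g \<in> carrier G" for g
    using mat_rep_carrier[OF R' that] mat_rep_carrier[OF R inv_closed[OF that]]
    by (auto simp: mat_trace_def sum_product)
  hence "(\<Sum>g\<in>carrier G. mat_trace (R' g) * mat_trace (R (inv\<^bsub>G\<^esub> g))) =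
      (\<Sum>g\<in>carrier G. \<Sum>i<e. \<Sum>j<d. R' g $$ (i, i) * R (inv\<^bsub>G\<^esub> g) $$ (j, j))" by simp
  also have "\<dots> = (\<Sum>i<e. \<Sum>g\<in>carrier G. \<Sum>j<d. R' g $$ (i, i) * R (inv\<^bsub>G\<^esub> g) $$ (j, j))"
    by (rule sum.swap)
  also have "\<dots> = (\<Sum>i<e. \<Sum>j<d. \<Sum>g\<in>carrier G. R' g $$ (i, i) * R (inv\<^bsub>G\<^esub> g) $$ (j, j))"
    by (intro sum.cong refl, rule sum.swap)
  finally show ?thesis .
qed

text \<open>A non-zero intertwiner would force equal traces at every group element, so one element
  with different traces rules all of them out.\<close>

lemma character_orthogonal:
  fixes R R' :: "'g \<Rightarrow> 'a::field mat"
  assumes G: "group G" and R: "mat_irr G d R" and R': "mat_irr G e R'"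
    and ne: "k \<in> carrier G" "mat_trace (R' k) \<noteq> mat_trace (R k)"
  shows "(\<Sum>g\<in>carrier G. mat_trace (R' g) * mat_trace (R (inv\<^bsub>G\<^esub> g))) = 0"
  unfolding trace_product_sum[OF G mat_irr_rep[OF R] mat_irr_rep[OF R']]
  by (intro sum.neutral ballI coefficient_sum_zero[OF G mat_irr_rep[OF R] mat_irr_rep[OF R']])
    (use mat_irr_intertwiner_iso[OF R R' _ _ _ ne(1)] ne(2) in auto)

lemma character_norm:
  fixes R :: "'g \<Rightarrow> complex mat"
  assumes G: "group G" and fin: "finite (carrier G)" and irr: "mat_irr G d R"
  shows "(\<Sum>g\<in>carrier G. mat_trace (R g) * mat_trace (R (inv\<^bsub>G\<^esub> g))) = of_nat (card (carrier G))"
proof -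
  have "(\<Sum>g\<in>carrier G. mat_trace (R g) * mat_trace (R (inv\<^bsub>G\<^esub> g))) =
      (\<Sum>i<d. \<Sum>j<d. if i = j then of_nat (card (carrier G)) / of_nat d else 0)"
    unfolding trace_product_sum[OF G mat_irr_rep[OF irr] mat_irr_rep[OF irr]]
    by (intro sum.cong refl) (auto simp: coefficient_sum_same[OF G fin irr])
  also have "\<dots> = of_nat (card (carrier G))" using irr by (simp add: mat_irr_def)
  finally show ?thesis .
qed

section \<open>Groups with an anti-involution\<close>

text \<open>\<open>T\<close> stands for transposition of coloured permutations. The conjugacy axiom
  is what makes the twist of an irreducible representation have the same character, and so keeps the
  twisted indicator away from 0.\<close>

locale anti_involution = group G for G (structure) +
  fixes T :: "'a \<Rightarrow> 'a"
  assumes finite_carrier: "finite (carrier G)"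
    and T_closed: "g \<in> carrier G \<Longrightarrow> T g \<in> carrier G"
    and T_mult: "g \<in> carrier G \<Longrightarrow> h \<in> carrier G \<Longrightarrow> T (g \<otimes> h) = T h \<otimes> T g"
    and T_T: "g \<in> carrier G \<Longrightarrow> T (T g) = g"
    and T_conj: "g \<in> carrier G \<Longrightarrow> \<exists>k\<in>carrier G. k \<otimes> g = T g \<otimes> k"
begin

lemma T_one: "T \<one> = \<one>"
proof -
  have "T \<one> \<otimes> T \<one> = T \<one>" using T_mult[of \<one> \<one>] by simp
  thus ?thesis using T_closed by simp
qed

text \<open>Both \<open>T\<close> and the transpose of matrices reverse products, so their
  combination preserves them.\<close>

lemma twisted_rep:
  fixes R :: "'a \<Rightarrow> 'k::field mat"
  assumes R: "mat_rep G d R"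
  shows "mat_rep G d (\<lambda>g. transpose_mat (R (T g)))"
  unfolding mat_rep_def
proof (intro conjI ballI)
  fix g h assume g: "g \<in> carrier G" and h: "h \<in> carrier G"
  note Rc = mat_rep_carrier[OF R T_closed]
  show "transpose_mat (R (T g)) \<in> carrier_mat d d" using Rc[OF g] by simp
  show "transpose_mat (R (T (g \<otimes> h))) = transpose_mat (R (T g)) * transpose_mat (R (T h))"
    using T_mult[OF g h] mat_rep_mult[OF R T_closed[OF h] T_closed[OF g]] transpose_mult[OF Rc[OF h] Rc[OF g]]
    by simp
qed (simp add: T_one mat_rep_one[OF R])

lemma trace_T:
  fixes R :: "'a \<Rightarrow> 'k::field mat"
  assumes R: "mat_rep G d R" and g: "g \<in> carrier G"
  shows "mat_trace (R (T g)) = mat_trace (R g)"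
proof -
  obtain k where k: "k \<in> carrier G" "k \<otimes> g = T g \<otimes> k" using T_conj[OF g] by blast
  note Rc = mat_rep_carrier[OF R]
  have ki: "inv k \<in> carrier G" using k by simp
  have "T g = k \<otimes> g \<otimes> inv k" using k g T_closed[OF g] by (simp add: inv_solve_right)
  hence "R (T g) = R (k \<otimes> g \<otimes> inv k)" by (rule arg_cong)
  also have "\<dots> = R k * R g * R (inv k)"
    using mat_rep_mult[OF R m_closed[OF k(1) g] ki] mat_rep_mult[OF R k(1) g] by simp
  finally have "R (T g) = R k * R g * R (inv k)" .
  hence "mat_trace (R (T g)) = mat_trace (R (inv k) * (R k * R g))"
    using mat_trace_comm[OF mult_carrier_mat[OF Rc[OF k(1)] Rc[OF g]] Rc[OF ki]] by simp
  also have "R (inv k) * (R k * R g) = R g"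
    using k(1) g mat_rep_mult[OF R, symmetric] by (simp add: m_assoc[symmetric])
  finally show ?thesis .
qed

text \<open>This is the Frobenius--Schur indicator twisted by the automorphism sending
  \<open>h\<close> to the inverse of \<open>T h\<close>, after substituting \<open>inv h\<close> for
  \<open>h\<close>. An intertwiner \<open>M\<close> to the twist is unique up to a scalar and its
  transpose is another one, so \<open>M\<close> is symmetric or antisymmetric; orthogonality turns
  the sum into exactly that sign.\<close>

lemma twisted_frobenius_schur:
  fixes R :: "'a \<Rightarrow> complex mat"
  assumes irr: "mat_irr G d R"
  obtains c :: complex where "c = 1 \<or> c = -1"
    "(\<Sum>h\<in>carrier G. mat_trace (R (T h \<otimes> inv h))) = c * of_nat (card (carrier G))"
proof -
  note grp = group_axioms and R = mat_irr_rep[OF irr]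
  note Rc = mat_rep_carrier[OF R]
  have d: "0 < d" using irr by (simp add: mat_irr_def)
  let ?R' = "\<lambda>g. transpose_mat (R (T g))"
  note R' = twisted_rep[OF R]
  note Rc' = mat_rep_carrier[OF R']
  have tr': "mat_trace (?R' g) = mat_trace (R g)" if "g \<in> carrier G" for g
  proof -
    have "mat_trace (?R' g) = mat_trace (R (T g))"
      using Rc[OF T_closed[OF that]] by (auto simp: mat_trace_def)
    thus ?thesis using trace_T[OF R that] by simp
  qed
  \<comment> \<open>Without such an \<open>M\<close> all coefficient sums between \<open>R\<close>
    and its twist would vanish, and so would the inner product of their characters. These characters
    are equal, and the norm is not 0.\<close>
  have "\<exists>M. M \<in> carrier_mat d d \<and> (\<forall>g\<in>carrier G. ?R' g * M = M * R g) \<and> M \<noteq> 0\<^sub>m d d"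
  proof (rule ccontr)
    assume "\<not> ?thesis"
    hence no: "M = 0\<^sub>m d d" if "M \<in> carrier_mat d d" "\<And>g. g \<in> carrier G \<Longrightarrow> ?R' g * M = M * R g" for M
      using that by blast
    have "(\<Sum>g\<in>carrier G. mat_trace (R g) * mat_trace (R (inv g))) =
        (\<Sum>g\<in>carrier G. mat_trace (?R' g) * mat_trace (R (inv g)))"
      by (intro sum.cong refl) (simp only: tr')
    also have "\<dots> = 0"
      unfolding trace_product_sum[OF grp R R']
      by (intro sum.neutral ballI coefficient_sum_zero[OF grp R R']) (use no in auto)
    finally have "card (carrier G) = 0" using character_norm[OF grp finite_carrier irr] by simp
    thus False using finite_carrier one_closed by auto
  qed
  then obtain M where M: "M \<in> carrier_mat d d" and int: "\<And>g. g \<in> carrier G \<Longrightarrow> ?R' g * M = M * R g"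
    and nz: "M \<noteq> 0\<^sub>m d d" by blast
  obtain N where N: "N \<in> carrier_mat d d" and MN: "M * N = 1\<^sub>m d" and NM: "N * M = 1\<^sub>m d"
    using invertible_if_kernel_zero[OF M] mat_irr_intertwiner_inj[OF irr R' M int nz] by metis
  let ?M = "transpose_mat M"
  have Mt: "?M \<in> carrier_mat d d" using M by simp
  \<comment> \<open>Transposing the intertwining relation at \<open>T g\<close> gives the relation
    for the transpose of \<open>M\<close> at \<open>g\<close>.\<close>
  have intT: "?R' g * ?M = ?M * R g" if g: "g \<in> carrier G" for g
  proof -
    have "transpose_mat (?R' (T g) * M) = transpose_mat (M * R (T g))" using int[OF T_closed[OF g]] by simp
    thus ?thesis
      using transpose_mult[OF Rc'[OF T_closed[OF g]] M] transpose_mult[OF M Rc[OF T_closed[OF g]]] T_T[OF g]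
      by simp
  qed
  have "R g * (N * ?M) = N * ?M * R g" if g: "g \<in> carrier G" for g
  proof -
    have "R g * N = N * M * (R g * N)" using NM Rc[OF g] N by simp
    also have "\<dots> = N * (M * R g * N)"
      using assoc_mult_mat[OF N M mult_carrier_mat[OF Rc[OF g] N]] assoc_mult_mat[OF M Rc[OF g] N] by simp
    also have "M * R g * N = ?R' g * (M * N)" using int[OF g] assoc_mult_mat[OF Rc'[OF g] M N] by simp
    also have "\<dots> = ?R' g" using MN Rc'[OF g] by simp
    finally have RN: "R g * N = N * ?R' g" .
    have "R g * (N * ?M) = N * ?R' g * ?M" using assoc_mult_mat[OF Rc[OF g] N Mt] RN by simp
    also have "\<dots> = N * (?M * R g)" using assoc_mult_mat[OF N Rc'[OF g] Mt] intT[OF g] by simp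
    also have "\<dots> = N * ?M * R g" using assoc_mult_mat[OF N Mt Rc[OF g]] by simp
    finally show ?thesis .
  qed
  then obtain c where c: "N * ?M = c \<cdot>\<^sub>m 1\<^sub>m d"
    using mat_irr_commutant[OF irr mult_carrier_mat[OF N Mt]] by metis
  have "?M = M * (N * ?M)" using assoc_mult_mat[OF M N Mt] MN Mt by simp
  also have "\<dots> = c \<cdot>\<^sub>m M" unfolding c using mult_smult_distrib[OF M one_carrier_mat] M by simp
  finally have Mc: "?M = c \<cdot>\<^sub>m M" .
  have sym: "M $$ (j, i) = c * M $$ (i, j)" if "i < d" "j < d" for i j
  proof -
    have "?M $$ (i, j) = (c \<cdot>\<^sub>m M) $$ (i, j)" using Mc by simp
    thus ?thesis using that M by simp
  qed
  obtain i0 j0 where ij0: "i0 < d" "j0 < d" "M $$ (i0, j0) \<noteq> 0"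
    using nz M by (metis eq_matI carrier_matD index_zero_mat)
  have "M $$ (i0, j0) = c * (c * M $$ (i0, j0))"
    using sym[OF ij0(2,1)] sym[OF ij0(1,2)] by simp
  hence "c * c = 1" using ij0(3) by (simp add: mult.assoc[symmetric])
  hence c1: "c = 1 \<or> c = -1" by (simp add: square_eq_1_iff)
  let ?S = "\<lambda>k l j i. \<Sum>h\<in>carrier G. R h $$ (k, l) * R (inv h) $$ (j, i)"
  \<comment> \<open>As \<open>N\<close> inverts \<open>M\<close>, the twist equals
    \<open>M * R h * N\<close>. This rewrites an entry of \<open>R (T h)\<close> through entries of
    \<open>R h\<close>, to which orthogonality applies.\<close>
  have R'e: "R (T h) $$ (i, j) = (\<Sum>l<d. (\<Sum>k<d. M $$ (j, k) * R h $$ (k, l)) * N $$ (l, i))"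
    if h: "h \<in> carrier G" and ij: "i < d" "j < d" for h i j
  proof -
    have "?R' h = ?R' h * (M * N)" using MN Rc'[OF h] by simp
    also have "\<dots> = M * R h * N" using int[OF h] assoc_mult_mat[OF Rc'[OF h] M N] by simp
    finally have "?R' h $$ (j, i) = (M * R h * N) $$ (j, i)" by (rule arg_cong)
    moreover have "?R' h $$ (j, i) = R (T h) $$ (i, j)" using ij Rc[OF T_closed[OF h]] by simp
    ultimately show ?thesis
      by (simp add: mult_mat_index_sum[OF mult_carrier_mat[OF M Rc[OF h]] N ij(2,1)]
          mult_mat_index_sum[OF M Rc[OF h] ij(2)])
  qed
  have "(\<Sum>h\<in>carrier G. mat_trace (R (T h \<otimes> inv h))) =
      (\<Sum>h\<in>carrier G. \<Sum>i<d. \<Sum>j<d. R (T h) $$ (i, j) * R (inv h) $$ (j, i))"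
  proof (intro sum.cong refl)
    fix h assume h: "h \<in> carrier G"
    have "R (T h \<otimes> inv h) = R (T h) * R (inv h)" using mat_rep_mult[OF R T_closed[OF h] inv_closed[OF h]] .
    thus "mat_trace (R (T h \<otimes> inv h)) = (\<Sum>i<d. \<Sum>j<d. R (T h) $$ (i, j) * R (inv h) $$ (j, i))"
      using Rc[OF T_closed[OF h]]
      by (simp add: mat_trace_def mult_mat_index_sum[OF Rc[OF T_closed[OF h]] Rc[OF inv_closed[OF h]]])
  qed
  also have "\<dots> = (\<Sum>h\<in>carrier G. \<Sum>i<d. \<Sum>j<d. \<Sum>l<d. \<Sum>k<d.
      M $$ (j, k) * N $$ (l, i) * (R h $$ (k, l) * R (inv h) $$ (j, i)))"
    by (intro sum.cong refl) (simp add: R'e sum_distrib_right sum_distrib_left mult_ac)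
  also have "\<dots> = (\<Sum>i<d. \<Sum>j<d. \<Sum>l<d. \<Sum>k<d. \<Sum>h\<in>carrier G.
      M $$ (j, k) * N $$ (l, i) * (R h $$ (k, l) * R (inv h) $$ (j, i)))"
    by (rule trans[OF sum.swap], intro sum.cong refl, rule trans[OF sum.swap], intro sum.cong refl,
        rule trans[OF sum.swap], intro sum.cong refl, rule sum.swap)
  also have "\<dots> = (\<Sum>i<d. \<Sum>j<d. \<Sum>l<d. \<Sum>k<d. M $$ (j, k) * N $$ (l, i) * ?S k l j i)"
    by (simp only: sum_distrib_left)
  also have "\<dots> = (\<Sum>i<d. \<Sum>j<d. \<Sum>l<d. \<Sum>k<d. if k = i then (if l = j then
      M $$ (j, i) * N $$ (j, i) * (of_nat (card (carrier G)) / of_nat d) else 0) else 0)"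
    by (intro sum.cong refl) (auto simp: coefficient_sum_same[OF grp finite_carrier irr])
  also have "\<dots> = (\<Sum>i<d. \<Sum>j<d. M $$ (j, i) * N $$ (j, i) * (of_nat (card (carrier G)) / of_nat d))"
    by (intro sum.cong refl) simp
  \<comment> \<open>Orthogonality leaves the entries of \<open>M\<close> and \<open>N\<close> at the
    same position. The symmetry \<open>M $$ (j, i) = c * M $$ (i, j)\<close> turns their sum into
    \<open>c\<close> times the trace of \<open>M * N\<close>.\<close>
  also have "\<dots> = (\<Sum>i<d. \<Sum>j<d. M $$ (i, j) * N $$ (j, i) * (c * (of_nat (card (carrier G)) / of_nat d)))"
  proof (intro sum.cong refl)
    fix i j assume "i \<in> {..<d}" "j \<in> {..<d}"
    hence "M $$ (j, i) = c * M $$ (i, j)" using sym by blast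
    thus "M $$ (j, i) * N $$ (j, i) * (of_nat (card (carrier G)) / of_nat d) =
        M $$ (i, j) * N $$ (j, i) * (c * (of_nat (card (carrier G)) / of_nat d))"
      by (simp only: mult_ac)
  qed
  also have "\<dots> = (\<Sum>i<d. (M * N) $$ (i, i) * (c * (of_nat (card (carrier G)) / of_nat d)))"
    by (intro sum.cong refl) (simp add: mult_mat_index_sum[OF M N] sum_distrib_right sum_divide_distrib)
  also have "\<dots> = c * of_nat (card (carrier G))" unfolding MN using d by simp
  finally show thesis using that c1 by blast
qed

text \<open>Pairing the counting function with a character and exchanging the two sums gives the
  twisted indicator, because every \<open>h\<close> solves the equation for exactly one
  \<open>g\<close>. The comparison is made along the list of composition factors, where
  multiplicities are list counts.\<close>

theorem model_character:
  fixes X :: "'a \<Rightarrow> complex mat"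
  assumes X: "mat_rep G D X"
    and tr: "\<And>g. g \<in> carrier G \<Longrightarrow> mat_trace (X g) = of_nat (card {h \<in> carrier G. h = g \<otimes> T h})"
  defines "I \<equiv> {\<lambda>g\<in>carrier G. mat_trace (R g) | d (R :: 'a \<Rightarrow> complex mat). mat_irr G d R}"
  shows "finite I" and "g \<in> carrier G \<Longrightarrow> mat_trace (X g) = (\<Sum>\<psi>\<in>I. \<psi> g)"
proof -
  note grp = group_axioms
  obtain ps where ps: "\<And>e S. (e, S) \<in> set ps \<Longrightarrow> mat_irr G e (S :: 'a \<Rightarrow> complex mat)"
    and dec: "\<And>g. g \<in> carrier G \<Longrightarrow> mat_trace (X g) = (\<Sum>(e, S)\<leftarrow>ps. mat_trace (S g))"
    using mat_rep_decompose[OF grp X] by fast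
  define cs where "cs = map (\<lambda>(e, S). \<lambda>g\<in>carrier G. mat_trace (S g)) ps"
  have dec': "mat_trace (X g) = (\<Sum>\<psi>\<leftarrow>cs. \<psi> g)" if "g \<in> carrier G" for g
    unfolding dec[OF that] cs_def using that by (induction ps) auto
  have csI: "set cs \<subseteq> I" using ps by (force simp: cs_def I_def)
  have card0: "card (carrier G) \<noteq> 0" using finite_carrier one_closed by auto
  have ip: "(\<Sum>g\<in>carrier G. \<phi> g * \<psi> (inv g)) = (if \<phi> = \<psi> then of_nat (card (carrier G)) else 0)"
    if "\<phi> \<in> I" "\<psi> \<in> I" for \<phi> \<psi>
  proof -
    from that(1) obtain d R where R: "mat_irr G d R" "\<phi> = (\<lambda>g\<in>carrier G. mat_trace (R g))"
      by (auto simp: I_def)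
    from that(2) obtain e S where S: "mat_irr G e S" "\<psi> = (\<lambda>g\<in>carrier G. mat_trace (S g))"
      by (auto simp: I_def)
    have eq: "(\<Sum>g\<in>carrier G. \<phi> g * \<psi> (inv g)) = (\<Sum>g\<in>carrier G. mat_trace (R g) * mat_trace (S (inv g)))"
      by (intro sum.cong) (auto simp: R S)
    show ?thesis
    proof (cases "\<phi> = \<psi>")
      case True
      hence "mat_trace (R g) = mat_trace (S g)" if "g \<in> carrier G" for g
        using that R(2) S(2) by (metis restrict_apply')
      hence "(\<Sum>g\<in>carrier G. mat_trace (R g) * mat_trace (S (inv g))) =
          (\<Sum>g\<in>carrier G. mat_trace (R g) * mat_trace (R (inv g)))" by simp
      thus ?thesis using True eq character_norm[OF grp finite_carrier R(1)] by simp
    next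
      case False
      then obtain k where "k \<in> carrier G" "mat_trace (R k) \<noteq> mat_trace (S k)"
        unfolding R S by (metis restrict_ext)
      from character_orthogonal[OF grp S(1) R(1) this] show ?thesis using False eq by simp
    qed
  qed
  have mult1: "count_list cs \<psi> = 1" if \<psi>: "\<psi> \<in> I" for \<psi>
  proof -
    obtain d R where R: "mat_irr G d R" "\<psi> = (\<lambda>g\<in>carrier G. mat_trace (R g))"
      using \<psi> unfolding I_def by blast
    obtain c :: complex where c: "c = 1 \<or> c = -1"
      "(\<Sum>h\<in>carrier G. mat_trace (R (T h \<otimes> inv h))) = c * of_nat (card (carrier G))"
      using twisted_frobenius_schur[OF R(1)] by metis
    have "(\<Sum>g\<in>carrier G. mat_trace (X g) * \<psi> (inv g)) =
        (\<Sum>g\<in>carrier G. \<Sum>h | h \<in> carrier G \<and> h = g \<otimes> T h. \<psi> (inv g))"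
      by (intro sum.cong refl) (simp add: tr)
    also have "\<dots> = (\<Sum>g\<in>carrier G. \<Sum>h\<in>carrier G. if h = g \<otimes> T h then \<psi> (inv g) else 0)"
      by (rule sum.cong[OF refl], rule sum.inter_filter[OF finite_carrier])
    also have "\<dots> = (\<Sum>h\<in>carrier G. \<Sum>g\<in>carrier G. if h = g \<otimes> T h then \<psi> (inv g) else 0)"
      by (rule sum.swap)
    \<comment> \<open>For fixed \<open>h\<close> the only \<open>g\<close> is
      \<open>h \<otimes> inv (T h)\<close>, with inverse \<open>T h \<otimes> inv h\<close>.\<close>
    also have "\<dots> = (\<Sum>h\<in>carrier G. mat_trace (R (T h \<otimes> inv h)))"
    proof (intro sum.cong refl)
      fix h assume h: "h \<in> carrier G"
      have "(\<Sum>g\<in>carrier G. if h = g \<otimes> T h then \<psi> (inv g) else 0) =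
          (\<Sum>g\<in>carrier G. if g = h \<otimes> inv (T h) then \<psi> (inv g) else 0)"
      proof (intro sum.cong refl)
        fix g assume g: "g \<in> carrier G"
        have "h = g \<otimes> T h \<longleftrightarrow> g = h \<otimes> inv (T h)"
          using inv_solve_right[OF g h T_closed[OF h]] by blast
        thus "(if h = g \<otimes> T h then \<psi> (inv g) else 0) = (if g = h \<otimes> inv (T h) then \<psi> (inv g) else 0)"
          by simp
      qed
      also have "\<dots> = \<psi> (inv (h \<otimes> inv (T h)))" using finite_carrier h T_closed by simp
      also have "inv (h \<otimes> inv (T h)) = T h \<otimes> inv h" using h T_closed by (simp add: inv_mult_group)
      finally show "(\<Sum>g\<in>carrier G. if h = g \<otimes> T h then \<psi> (inv g) else 0) = mat_trace (R (T h \<otimes> inv h))"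
        using h T_closed R by simp
    qed
    finally have 1: "(\<Sum>g\<in>carrier G. mat_trace (X g) * \<psi> (inv g)) = c * of_nat (card (carrier G))"
      using c by simp
    have "(\<Sum>g\<in>carrier G. (\<Sum>\<phi>\<leftarrow>xs. \<phi> g) * \<psi> (inv g)) = of_nat (count_list xs \<psi>) * of_nat (card (carrier G))"
      if "set xs \<subseteq> I" for xs
      using that
    proof (induction xs)
      case (Cons \<phi> xs)
      thus ?case using ip[OF _ \<psi>, of \<phi>] by (simp add: distrib_right sum.distrib)
    qed simp
    from this[OF csI] have "(\<Sum>g\<in>carrier G. mat_trace (X g) * \<psi> (inv g)) =
        of_nat (count_list cs \<psi>) * of_nat (card (carrier G))"
      using dec' by simp
    with 1 card0 have cc: "c = of_nat (count_list cs \<psi>)" by simp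
    from c(1) show ?thesis
    proof
      assume "c = -1"
      with cc have "(of_nat (count_list cs \<psi>) :: complex) = - 1" by simp
      hence "Re (of_nat (count_list cs \<psi>)) = Re (-1)" by (rule arg_cong)
      thus ?thesis by simp
    qed (use cc in \<open>metis of_nat_eq_1_iff\<close>)
  qed
  \<comment> \<open>Multiplicity 1 shows that each irreducible character occurs in the finite list;
    finiteness of the set of all of them follows from this.\<close>
  have setI: "set cs = I"
  proof (intro equalityI csI subsetI)
    fix \<psi> assume "\<psi> \<in> I"
    from mult1[OF this] show "\<psi> \<in> set cs" by (metis count_notin zero_neq_one)
  qed
  thus "finite I" by (metis List.finite_set)
  have "count_list xs x = count (mset xs) x" for xs and x :: "'a \<Rightarrow> complex" by (induction xs) auto
  hence "distinct cs" using mult1 setI by (auto simp: distinct_count_atmost_1 count_eq_zero_iff)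
  thus "mat_trace (X g) = (\<Sum>\<psi>\<in>I. \<psi> g)" if "g \<in> carrier G"
    using dec'[OF that] setI by (simp add: sum_list_distinct_conv_sum_set)
qed

end

section \<open>Operators on coordinate spaces and matrices\<close>

lemma coord_space_simps:
  "carrier (coord_space S :: ('k::field, 's \<Rightarrow> 'k) module) = S \<rightarrow>\<^sub>E UNIV"
  "u \<oplus>\<^bsub>coord_space S\<^esub> v = (\<lambda>s\<in>S. u s + v s :: 'k)"
  "c \<odot>\<^bsub>coord_space S\<^esub> v = (\<lambda>s\<in>S. c * v s :: 'k)"
  "\<zero>\<^bsub>coord_space S\<^esub> = (\<lambda>s\<in>S. 0 :: 'k)"
  by (simp_all add: class_ring.func_space_def)

lemma subspace_coord_space_iff:
  "VectorSpace.subspace class_ring W (coord_space S :: ('k::field, 's \<Rightarrow> 'k) module) \<longleftrightarrow>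
     W \<subseteq> S \<rightarrow>\<^sub>E UNIV \<and> (\<lambda>s\<in>S. 0) \<in> W \<and> (\<forall>u\<in>W. \<forall>v\<in>W. (\<lambda>s\<in>S. u s + v s) \<in> W) \<and>
     (\<forall>c. \<forall>v\<in>W. (\<lambda>s\<in>S. c * v s) \<in> W)"
proof -
  have "Module.module class_ring (coord_space S :: ('k, 's \<Rightarrow> 'k) module)"
    by (rule class_cring.func_space_is_module)
  moreover from this have "vectorspace class_ring (coord_space S :: ('k, 's \<Rightarrow> 'k) module)"
    using class_field by (simp add: vectorspace_def)
  ultimately show ?thesis
    unfolding VectorSpace.subspace_def submodule_def coord_space_simps by auto
qed

lemma GL_carrier: "carrier (GL V) = Bij (carrier V) \<inter> LinearCombinations.module_hom class_ring V V"
  by (simp add: GL_def)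

lemma GL_mult:
  "f \<in> Bij (carrier V) \<Longrightarrow> g \<in> Bij (carrier V) \<Longrightarrow> f \<otimes>\<^bsub>GL V\<^esub> g = compose (carrier V) f g"
  by (simp add: GL_def BijGroup_def)

text \<open>The operator has the shape of \<open>rho_tilde\<close>, with an arbitrary index set and
  field. So the lemma serves the rational model as well as the complex matrix representations on
  \<open>{..<d}\<close>.\<close>

lemma matrix_representation:
  fixes M :: "'g \<Rightarrow> 's \<Rightarrow> 's \<Rightarrow> 'k::field"
  assumes "group G" and fin: "finite S"
    and one: "\<And>s t. s \<in> S \<Longrightarrow> t \<in> S \<Longrightarrow> M \<one>\<^bsub>G\<^esub> s t = (if s = t then 1 else 0)"
    and mult: "\<And>g h s t. g \<in> carrier G \<Longrightarrow> h \<in> carrier G \<Longrightarrow> s \<in> S \<Longrightarrow> t \<in> S \<Longrightarrow>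
      M (g \<otimes>\<^bsub>G\<^esub> h) s t = (\<Sum>u\<in>S. M g s u * M h u t)"
  shows "representation G S (\<lambda>g. \<lambda>v\<in>carrier (coord_space S). \<lambda>s\<in>S. \<Sum>t\<in>S. v t * M g s t)"
proof -
  interpret group G by fact
  let ?V = "S \<rightarrow>\<^sub>E (UNIV :: 'k set)"
  let ?r = "\<lambda>g. \<lambda>v\<in>?V. \<lambda>s\<in>S. \<Sum>t\<in>S. v t * M g s t"
  have comp: "?r (g \<otimes>\<^bsub>G\<^esub> h) = compose ?V (?r g) (?r h)" if g: "g \<in> carrier G" and h: "h \<in> carrier G" for g h
  proof
    fix v
    show "?r (g \<otimes>\<^bsub>G\<^esub> h) v = compose ?V (?r g) (?r h) v"
    proof (cases "v \<in> ?V")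
      case True
      have rv: "?r h v \<in> ?V" using True by auto
      have "(\<Sum>t\<in>S. v t * M (g \<otimes>\<^bsub>G\<^esub> h) s t) = (\<Sum>u\<in>S. (\<Sum>t\<in>S. v t * M h u t) * M g s u)" if s: "s \<in> S" for s
      proof -
        have "(\<Sum>t\<in>S. v t * M (g \<otimes>\<^bsub>G\<^esub> h) s t) = (\<Sum>t\<in>S. \<Sum>u\<in>S. v t * M h u t * M g s u)"
          by (intro sum.cong refl) (simp add: mult[OF g h s] sum_distrib_left mult_ac)
        also have "\<dots> = (\<Sum>u\<in>S. \<Sum>t\<in>S. v t * M h u t * M g s u)" by (rule sum.swap)
        finally show ?thesis by (simp add: sum_distrib_right)
      qed
      thus ?thesis using True rv by (simp add: compose_def cong: restrict_cong)
    qed (simp add: compose_def)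
  qed
  have id: "?r \<one>\<^bsub>G\<^esub> v = v" if v: "v \<in> ?V" for v
  proof -
    have "(\<Sum>t\<in>S. v t * M \<one>\<^bsub>G\<^esub> s t) = v s" if s: "s \<in> S" for s
    proof -
      have "(\<Sum>t\<in>S. v t * M \<one>\<^bsub>G\<^esub> s t) = (\<Sum>t\<in>S. if t = s then v t else 0)"
        by (intro sum.cong refl) (simp add: one s)
      thus ?thesis using fin s by simp
    qed
    thus ?thesis using v by (auto simp: fun_eq_iff)
  qed
  have bij: "?r g \<in> Bij ?V" if g: "g \<in> carrier G" for g
  proof -
    have inv: "?r g (?r h v) = v" if gh: "g \<in> carrier G" "h \<in> carrier G" "g \<otimes>\<^bsub>G\<^esub> h = \<one>\<^bsub>G\<^esub>" and v: "v \<in> ?V" for g h v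
    proof -
      have "?r g (?r h v) = compose ?V (?r g) (?r h) v" by (rule compose_eq[OF v, symmetric])
      also have "\<dots> = ?r \<one>\<^bsub>G\<^esub> v" using comp[OF gh(1,2)] gh(3) by simp
      finally show ?thesis using id[OF v] by simp
    qed
    have closed: "?r h ` ?V \<subseteq> ?V" for h by auto
    have "bij_betw (?r g) ?V ?V"
    proof (rule bij_betw_byWitness[where f' = "?r (inv\<^bsub>G\<^esub> g)"])
      show "\<forall>v\<in>?V. ?r (inv\<^bsub>G\<^esub> g) (?r g v) = v"
        by (intro ballI inv[OF inv_closed[OF g] g l_inv[OF g]])
      show "\<forall>v\<in>?V. ?r g (?r (inv\<^bsub>G\<^esub> g) v) = v"
        by (intro ballI inv[OF g inv_closed[OF g] r_inv[OF g]])
    qed (rule closed)+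
    thus ?thesis by (simp add: Bij_def)
  qed
  have lin: "?r g \<in> LinearCombinations.module_hom class_ring (coord_space S) (coord_space S)" for g
    unfolding LinearCombinations.module_hom_def coord_space_simps class_ring_simps
  proof (intro CollectI conjI allI impI)
    show "?r g \<in> ?V \<rightarrow> ?V" by auto
  next
    fix u v :: "'s \<Rightarrow> 'k" assume uv: "u \<in> ?V \<and> v \<in> ?V"
    have "(\<lambda>s\<in>S. u s + v s) \<in> ?V" by simp
    thus "?r g (\<lambda>s\<in>S. u s + v s) = (\<lambda>s\<in>S. ?r g u s + ?r g v s)"
      using uv by (simp add: distrib_right sum.distrib cong: restrict_cong)
  next
    fix c :: 'k and v :: "'s \<Rightarrow> 'k" assume cv: "c \<in> UNIV \<and> v \<in> ?V"
    have "(\<lambda>s\<in>S. c * v s) \<in> ?V" by simp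
    thus "?r g (\<lambda>s\<in>S. c * v s) = (\<lambda>s\<in>S. c * ?r g v s)"
      using cv by (simp add: sum_distrib_left mult.assoc cong: restrict_cong)
  qed
  have "?r \<in> hom G (GL (coord_space S))"
  proof (rule homI)
    fix g h assume g: "g \<in> carrier G" and h: "h \<in> carrier G"
    show "?r g \<in> carrier (GL (coord_space S))"
      unfolding GL_carrier using bij[OF g] lin[of g] by (simp only: coord_space_simps IntI)
    have "?r g \<otimes>\<^bsub>GL (coord_space S)\<^esub> ?r h = compose (carrier (coord_space S)) (?r g) (?r h)"
      by (rule GL_mult; unfold coord_space_simps; rule bij[OF g] bij[OF h])
    thus "?r (g \<otimes>\<^bsub>G\<^esub> h) = ?r g \<otimes>\<^bsub>GL (coord_space S)\<^esub> ?r h"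
      unfolding comp[OF g h] coord_space_simps by (rule sym)
  qed
  thus ?thesis unfolding representation_def coord_space_simps using fin by blast
qed

section \<open>Coordinate functions and vectors\<close>

definition vec_of_coords :: "nat \<Rightarrow> (nat \<Rightarrow> 'k) \<Rightarrow> 'k vec" where
  "vec_of_coords d f = vec d f"

definition coords_of_vec :: "nat \<Rightarrow> 'k vec \<Rightarrow> nat \<Rightarrow> 'k" where
  "coords_of_vec d v = (\<lambda>i\<in>{..<d}. v $ i)"

lemma vec_of_coords_carrier: "vec_of_coords d f \<in> carrier_vec d"
  by (simp add: vec_of_coords_def)

lemma coords_of_vec_carrier: "coords_of_vec d v \<in> {..<d} \<rightarrow>\<^sub>E UNIV"
  by (simp add: coords_of_vec_def)

lemma coords_of_vec_inverse: "v \<in> carrier_vec d \<Longrightarrow> vec_of_coords d (coords_of_vec d v) = v"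
  by (intro eq_vecI) (simp_all add: vec_of_coords_def coords_of_vec_def)

lemma vec_of_coords_inverse:
  assumes "f \<in> {..<d} \<rightarrow>\<^sub>E UNIV"
  shows "coords_of_vec d (vec_of_coords d f) = f"
  by (rule PiE_ext[OF coords_of_vec_carrier assms]) (simp add: vec_of_coords_def coords_of_vec_def)

lemma inj_on_coords_of_vec: "inj_on (coords_of_vec d) (carrier_vec d)"
  by (rule inj_on_inverseI[where g = "vec_of_coords d"]) (rule coords_of_vec_inverse)

lemma vec_subspace_coords_iff:
  fixes W :: "'k::field vec set"
  assumes "W \<subseteq> carrier_vec d"
  shows "VectorSpace.subspace class_ring (coords_of_vec d ` W) (coord_space {..<d}) \<longleftrightarrow> vec_subspace d W"
proof -
  have mem: "coords_of_vec d v \<in> coords_of_vec d ` W \<longleftrightarrow> v \<in> W" if "v \<in> carrier_vec d" for v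
    using assms that by (simp add: inj_on_image_mem_iff[OF inj_on_coords_of_vec])
  have 0: "(\<lambda>s\<in>{..<d}. 0) = coords_of_vec d (0\<^sub>v d :: 'k vec)"
    by (auto simp: coords_of_vec_def)
  have add: "(\<lambda>s\<in>{..<d}. coords_of_vec d u s + coords_of_vec d v s) = coords_of_vec d (u + v)"
    if "u \<in> carrier_vec d" "v \<in> carrier_vec d" for u v :: "'k vec"
    using that by (auto simp: coords_of_vec_def)
  have smult: "(\<lambda>s\<in>{..<d}. c * coords_of_vec d u s) = coords_of_vec d (c \<cdot>\<^sub>v u)"
    if "u \<in> carrier_vec d" for c and u :: "'k vec"
    using that by (auto simp: coords_of_vec_def)
  have "coords_of_vec d ` W \<subseteq> {..<d} \<rightarrow>\<^sub>E UNIV" by (rule image_subsetI) (rule coords_of_vec_carrier)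
  moreover have "(\<lambda>s\<in>{..<d}. 0) \<in> coords_of_vec d ` W \<longleftrightarrow> 0\<^sub>v d \<in> W"
    unfolding 0 by (rule mem) simp
  moreover have "(\<forall>u\<in>coords_of_vec d ` W. \<forall>v\<in>coords_of_vec d ` W. (\<lambda>s\<in>{..<d}. u s + v s) \<in> coords_of_vec d ` W) \<longleftrightarrow>
      (\<forall>v\<in>W. \<forall>w\<in>W. v + w \<in> W)"
    unfolding ball_simps
    by (intro ball_cong refl) (use assms in \<open>simp add: add mem subset_iff\<close>)
  moreover have "(\<forall>c. \<forall>v\<in>coords_of_vec d ` W. (\<lambda>s\<in>{..<d}. c * v s) \<in> coords_of_vec d ` W) \<longleftrightarrow>
      (\<forall>c. \<forall>v\<in>W. c \<cdot>\<^sub>v v \<in> W)"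
    unfolding ball_simps
    by (intro all_cong1 ball_cong refl) (use assms in \<open>simp add: smult mem subset_iff\<close>)
  ultimately show ?thesis
    unfolding subspace_coord_space_iff vec_subspace_def using assms by blast
qed

text \<open>The relation \<open>act\<close> is all that ties \<rho> to \<open>R\<close>, so the
  equivalence can be used in both directions: for the matrix of a given operator and for the
  operator of a given matrix.\<close>

lemma irreducible_rep_iff_mat_irr:
  fixes R :: "'g \<Rightarrow> complex mat"
  assumes R: "mat_rep G d R" and \<rho>: "representation G {..<d} \<rho>"
    and act: "\<And>g v. g \<in> carrier G \<Longrightarrow> v \<in> carrier_vec d \<Longrightarrow>
      \<rho> g (coords_of_vec d v) = coords_of_vec d (R g *\<^sub>v v)"
  shows "irreducible_rep G {..<d} \<rho> \<longleftrightarrow> mat_irr G d R"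
proof -
  note Rc = mat_rep_carrier[OF R]
  have inv: "(\<forall>g\<in>carrier G. \<rho> g ` (coords_of_vec d ` W) \<subseteq> coords_of_vec d ` W) \<longleftrightarrow>
      (\<forall>g\<in>carrier G. \<forall>w\<in>W. R g *\<^sub>v w \<in> W)" if W: "W \<subseteq> carrier_vec d" for W
  proof -
    have "coords_of_vec d (R g *\<^sub>v w) \<in> coords_of_vec d ` W \<longleftrightarrow> R g *\<^sub>v w \<in> W"
      if "g \<in> carrier G" "w \<in> W" for g w
      using W that Rc[of g] by (intro inj_on_image_mem_iff[OF inj_on_coords_of_vec]) auto
    moreover have "\<rho> g (coords_of_vec d w) = coords_of_vec d (R g *\<^sub>v w)" if "g \<in> carrier G" "w \<in> W" for g w
      using act W that by blast
    ultimately show ?thesis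
      unfolding image_subset_iff ball_simps by (intro ball_cong refl) simp
  qed
  have zero: "coords_of_vec d ` W = {\<zero>\<^bsub>coord_space {..<d}\<^esub>} \<longleftrightarrow> W = {0\<^sub>v d}"
    if W: "W \<subseteq> carrier_vec d" for W :: "complex vec set"
  proof -
    have "{\<zero>\<^bsub>coord_space {..<d}\<^esub>} = coords_of_vec d ` {0\<^sub>v d :: complex vec}"
      by (auto simp: coord_space_simps coords_of_vec_def)
    thus ?thesis using inj_on_image_eq_iff[OF inj_on_coords_of_vec W, of "{0\<^sub>v d}"] by simp
  qed
  have car: "carrier (coord_space {..<d}) = coords_of_vec d ` (carrier_vec d :: complex vec set)"
    unfolding coord_space_simps
  proof (intro equalityI subsetI)
    fix f :: "nat \<Rightarrow> complex" assume "f \<in> {..<d} \<rightarrow>\<^sub>E UNIV"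
    from vec_of_coords_inverse[OF this, symmetric] show "f \<in> coords_of_vec d ` carrier_vec d"
      by (rule image_eqI) (rule vec_of_coords_carrier)
  next
    fix f :: "nat \<Rightarrow> complex" assume "f \<in> coords_of_vec d ` carrier_vec d"
    thus "f \<in> {..<d} \<rightarrow>\<^sub>E UNIV" using coords_of_vec_carrier by (elim imageE) simp
  qed
  have full: "coords_of_vec d ` W = carrier (coord_space {..<d}) \<longleftrightarrow> W = carrier_vec d"
    if W: "W \<subseteq> carrier_vec d" for W :: "complex vec set"
    unfolding car using inj_on_image_eq_iff[OF inj_on_coords_of_vec W] by simp
  have "(\<forall>W. VectorSpace.subspace class_ring W (coord_space {..<d}) \<and> (\<forall>g\<in>carrier G. \<rho> g ` W \<subseteq> W) \<longrightarrow>
        W = {\<zero>\<^bsub>coord_space {..<d}\<^esub>} \<or> W = carrier (coord_space {..<d})) \<longleftrightarrow>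
      (\<forall>W\<subseteq>carrier_vec d. VectorSpace.subspace class_ring (coords_of_vec d ` W) (coord_space {..<d}) \<and>
        (\<forall>g\<in>carrier G. \<rho> g ` (coords_of_vec d ` W) \<subseteq> coords_of_vec d ` W) \<longrightarrow>
        coords_of_vec d ` W = {\<zero>\<^bsub>coord_space {..<d}\<^esub>} \<or> coords_of_vec d ` W = carrier (coord_space {..<d}))"
    (is "(\<forall>W. ?P W) \<longleftrightarrow> ?Q")
  proof
    assume ?Q
    show "\<forall>W. ?P W"
    proof
      fix W
      show "?P W"
      proof (cases "W \<subseteq> carrier (coord_space {..<d})")
        case True
        then obtain W' where "W' \<subseteq> carrier_vec d" "W = coords_of_vec d ` W'"
          unfolding car by (rule subset_imageE)
        thus ?thesis using \<open>?Q\<close> by blast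
      next
        case False
        thus ?thesis unfolding subspace_coord_space_iff coord_space_simps by blast
      qed
    qed
  qed blast
  also have "\<dots> \<longleftrightarrow> (\<forall>W\<subseteq>carrier_vec d. vec_subspace d W \<and> (\<forall>g\<in>carrier G. \<forall>w\<in>W. R g *\<^sub>v w \<in> W) \<longrightarrow>
        W = {0\<^sub>v d} \<or> W = carrier_vec d)"
  proof -
    have "(VectorSpace.subspace class_ring (coords_of_vec d ` W) (coord_space {..<d}) \<and>
        (\<forall>g\<in>carrier G. \<rho> g ` (coords_of_vec d ` W) \<subseteq> coords_of_vec d ` W) \<longrightarrow>
        coords_of_vec d ` W = {\<zero>\<^bsub>coord_space {..<d}\<^esub>} \<or> coords_of_vec d ` W = carrier (coord_space {..<d})) \<longleftrightarrow>
      (vec_subspace d W \<and> (\<forall>g\<in>carrier G. \<forall>w\<in>W. R g *\<^sub>v w \<in> W) \<longrightarrow>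
        W = {0\<^sub>v d} \<or> W = carrier_vec d)" if W: "W \<subseteq> carrier_vec d" for W
      unfolding inv[OF W] zero[OF W] full[OF W] vec_subspace_coords_iff[OF W] by (rule refl)
    thus ?thesis by - (rule all_cong1, rule imp_cong[OF refl])
  qed
  also have "\<dots> \<longleftrightarrow> (\<forall>W. vec_subspace d W \<and> (\<forall>g\<in>carrier G. \<forall>w\<in>W. R g *\<^sub>v w \<in> W) \<longrightarrow>
        W = {0\<^sub>v d} \<or> W = carrier_vec d)"
    by (auto simp: vec_subspace_def)
  finally show ?thesis
    unfolding irreducible_rep_def mat_irr_def using R \<rho> by (simp add: lessThan_empty_iff)
qed

lemma representation_matrix_exists:
  assumes G: "group G" and \<rho>: "representation G {..<d} (\<rho> :: 'g \<Rightarrow> (nat \<Rightarrow> complex) \<Rightarrow> nat \<Rightarrow> complex)"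
  obtains R where "mat_rep G d R"
    "\<And>g v. g \<in> carrier G \<Longrightarrow> v \<in> carrier_vec d \<Longrightarrow> \<rho> g (coords_of_vec d v) = coords_of_vec d (R g *\<^sub>v v)"
    "\<And>g. g \<in> carrier G \<Longrightarrow> op_trace {..<d} (\<rho> g) = mat_trace (R g)"
proof -
  interpret group G by fact
  let ?V = "{..<d} \<rightarrow>\<^sub>E (UNIV :: complex set)"
  define R where "R g = mat d d (\<lambda>(i, j). \<rho> g (coord_vec {..<d} j) i)" for g
  have hom: "\<rho> \<in> hom G (GL (coord_space {..<d}))" using \<rho> by (simp add: representation_def)
  have bij: "\<rho> g \<in> Bij ?V" and modh: "\<rho> g \<in> LinearCombinations.module_hom class_ring (coord_space {..<d}) (coord_space {..<d})"
    if "g \<in> carrier G" for g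
    using hom that by (auto simp: hom_def Pi_iff GL_def coord_space_simps)
  have closed: "\<rho> g f \<in> ?V" if "g \<in> carrier G" "f \<in> ?V" for g f
    using bij[OF that(1)] that(2) Bij_imp_funcset by blast
  have add: "\<rho> g (\<lambda>s\<in>{..<d}. u s + v s) = (\<lambda>s\<in>{..<d}. \<rho> g u s + \<rho> g v s)"
    if "g \<in> carrier G" "u \<in> ?V" "v \<in> ?V" for g u v
    using modh[OF that(1)] that unfolding LinearCombinations.module_hom_def coord_space_simps by simp
  have smult: "\<rho> g (\<lambda>s\<in>{..<d}. c * v s) = (\<lambda>s\<in>{..<d}. c * \<rho> g v s)"
    if "g \<in> carrier G" "v \<in> ?V" for g c v
    using modh[OF that(1)] that unfolding LinearCombinations.module_hom_def coord_space_simps by simp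
  have comp: "\<rho> (g \<otimes>\<^bsub>G\<^esub> h) f = \<rho> g (\<rho> h f)" if "g \<in> carrier G" "h \<in> carrier G" "f \<in> ?V" for g h f
    using hom_mult[OF hom that(1,2)] bij[OF that(1)] bij[OF that(2)] that(3)
    by (simp add: GL_def BijGroup_def coord_space_simps compose_eq)
  have restr: "(\<lambda>s\<in>{..<d}. f s) \<in> ?V" for f by simp
  have unitV: "coord_vec {..<d} j \<in> ?V" for j :: nat by (simp add: coord_vec_def)
  have expand: "\<rho> g f i = (\<Sum>j<d. f j * \<rho> g (coord_vec {..<d} j) i)"
    if g: "g \<in> carrier G" and f: "f \<in> ?V" and i: "i < d" for g f i
  proof -
    have zero: "\<rho> g (\<lambda>s\<in>{..<d}. 0) = (\<lambda>s\<in>{..<d}. 0)"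
      using smult[OF g f, of 0] by (simp cong: restrict_cong)
    \<comment> \<open>Truncation of \<open>f\<close> to its first \<open>m\<close> coordinates. Each
      step of the induction adds one multiple of a coordinate vector, so binary additivity
      suffices.\<close>
    define F where "F m = (\<lambda>s\<in>{..<d}. if s < m then f s else 0)" for m
    have FV: "F m \<in> ?V" for m unfolding F_def by (rule restr)
    have key: "\<rho> g (F m) i = (\<Sum>j<m. f j * \<rho> g (coord_vec {..<d} j) i)" for m
    proof (induction m)
      case 0
      have F0: "F 0 = (\<lambda>s\<in>{..<d}. 0)" by (simp add: F_def)
      show ?case unfolding F0 zero using i by simp
    next
      case (Suc m)
      show ?case
      proof (cases "m < d")
        case True
        have eq: "F (Suc m) = (\<lambda>s\<in>{..<d}. F m s + (\<lambda>s\<in>{..<d}. f m * coord_vec {..<d} m s) s)"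
          using True by (auto simp: fun_eq_iff coord_vec_def less_Suc_eq F_def)
        have "\<rho> g (F (Suc m)) = (\<lambda>s\<in>{..<d}. \<rho> g (F m) s + \<rho> g (\<lambda>s\<in>{..<d}. f m * coord_vec {..<d} m s) s)"
          unfolding eq by (rule add[OF g FV restr])
        hence "\<rho> g (F (Suc m)) i = \<rho> g (F m) i + f m * \<rho> g (coord_vec {..<d} m) i"
          unfolding smult[OF g unitV] using i by simp
        thus ?thesis using Suc.IH by simp
      next
        \<comment> \<open>Beyond the dimension the truncation no longer changes and the coordinate
          vector is zero, so the formula persists for every \<open>m\<close>.\<close>
        case False
        hence F: "F (Suc m) = F m" by (auto simp: F_def fun_eq_iff)
        have c: "coord_vec {..<d} m = (\<lambda>s\<in>{..<d}. 0 :: complex)"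
          using False by (auto simp: coord_vec_def fun_eq_iff)
        have "\<rho> g (coord_vec {..<d} m) i = (\<lambda>s\<in>{..<d}. 0) i"
          by (rule arg_cong[where f = "\<lambda>h. h i"]) (rule trans[OF arg_cong[where f = "\<rho> g", OF c] zero])
        hence 0: "\<rho> g (coord_vec {..<d} m) i = 0" using i by simp
        show ?thesis by (simp only: F sum.lessThan_Suc Suc.IH 0 mult_zero_right add_0_right)
      qed
    qed
    have Fd: "F d = f" by (rule PiE_ext[OF FV f]) (simp add: F_def)
    show ?thesis using key[of d] unfolding Fd .
  qed
  have act: "\<rho> g (coords_of_vec d v) = coords_of_vec d (R g *\<^sub>v v)"
    if g: "g \<in> carrier G" and v: "v \<in> carrier_vec d" for g v
  proof (rule PiE_ext[OF closed[OF g coords_of_vec_carrier] coords_of_vec_carrier])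
    fix i assume "i \<in> {..<d}"
    thus "\<rho> g (coords_of_vec d v) i = coords_of_vec d (R g *\<^sub>v v) i"
      using expand[OF g coords_of_vec_carrier, of i v] v
      by (simp add: R_def coords_of_vec_def scalar_prod_def atLeast0LessThan mult.commute)
  qed
  \<comment> \<open>Membership in \<open>hom\<close> only provides multiplicativity. The image of
    the unit is idempotent and injective, hence the identity.\<close>
  have one: "\<rho> \<one>\<^bsub>G\<^esub> f = f" if f: "f \<in> ?V" for f
  proof -
    have "\<rho> \<one>\<^bsub>G\<^esub> (\<rho> \<one>\<^bsub>G\<^esub> f) = \<rho> \<one>\<^bsub>G\<^esub> f" using comp[OF one_closed one_closed f] by simp
    moreover have "inj_on (\<rho> \<one>\<^bsub>G\<^esub>) ?V" using bij[OF one_closed] by (auto simp: Bij_def bij_betw_def)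
    ultimately show ?thesis using f closed[OF one_closed f] by (meson inj_onD)
  qed
  have Rc: "R g \<in> carrier_mat d d" for g by (simp add: R_def)
  have "mat_rep G d R"
    unfolding mat_rep_def
  proof (intro conjI ballI)
    show "R g \<in> carrier_mat d d" for g by (rule Rc)
    show "R \<one>\<^bsub>G\<^esub> = 1\<^sub>m d"
    proof (rule eq_matI)
      fix i j assume "i < dim_row (1\<^sub>m d :: complex mat)" "j < dim_col (1\<^sub>m d :: complex mat)"
      thus "R \<one>\<^bsub>G\<^esub> $$ (i, j) = 1\<^sub>m d $$ (i, j)" using one[OF unitV] by (simp add: R_def coord_vec_def)
    qed (simp_all add: R_def)
    fix g h assume g: "g \<in> carrier G" and h: "h \<in> carrier G"
    show "R (g \<otimes>\<^bsub>G\<^esub> h) = R g * R h"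
    proof (rule eq_matI)
      fix i j assume "i < dim_row (R g * R h)" "j < dim_col (R g * R h)"
      hence ij: "i < d" "j < d" using Rc[of g] Rc[of h] by auto
      have "R (g \<otimes>\<^bsub>G\<^esub> h) $$ (i, j) = \<rho> g (\<rho> h (coord_vec {..<d} j)) i"
        using ij comp[OF g h unitV] by (simp add: R_def)
      also have "\<dots> = (\<Sum>k<d. \<rho> h (coord_vec {..<d} j) k * \<rho> g (coord_vec {..<d} k) i)"
        by (rule expand[OF g closed[OF h unitV] ij(1)])
      also have "\<dots> = (R g * R h) $$ (i, j)"
        unfolding mult_mat_index_sum[OF Rc Rc ij] using ij by (intro sum.cong) (auto simp: R_def)
      finally show "R (g \<otimes>\<^bsub>G\<^esub> h) $$ (i, j) = (R g * R h) $$ (i, j)" .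
    qed (use Rc[of g] Rc[of h] Rc[of "g \<otimes>\<^bsub>G\<^esub> h"] in auto)
  qed
  moreover have "op_trace {..<d} (\<rho> g) = mat_trace (R g)" for g
    by (simp add: op_trace_def mat_trace_def R_def)
  ultimately show thesis using that act by blast
qed

lemma matrix_operator_exists:
  fixes R :: "'g \<Rightarrow> complex mat"
  assumes G: "group G" and R: "mat_rep G d R"
  obtains \<rho> where "representation G {..<d} (\<rho> :: 'g \<Rightarrow> (nat \<Rightarrow> complex) \<Rightarrow> nat \<Rightarrow> complex)"
    "\<And>g v. g \<in> carrier G \<Longrightarrow> v \<in> carrier_vec d \<Longrightarrow> \<rho> g (coords_of_vec d v) = coords_of_vec d (R g *\<^sub>v v)"
    "\<And>g. g \<in> carrier G \<Longrightarrow> op_trace {..<d} (\<rho> g) = mat_trace (R g)"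
proof -
  interpret group G by fact
  note Rc = mat_rep_carrier[OF R]
  define \<rho> where "\<rho> = (\<lambda>g. \<lambda>v\<in>carrier (coord_space {..<d}). \<lambda>s\<in>{..<d}. \<Sum>t<d. v t * R g $$ (s, t))"
  have "representation G {..<d} \<rho>"
    unfolding \<rho>_def
  proof (rule matrix_representation[OF G finite_lessThan])
    show "R \<one>\<^bsub>G\<^esub> $$ (s, t) = (if s = t then 1 else 0)" if "s \<in> {..<d}" "t \<in> {..<d}" for s t
      using that mat_rep_one[OF R] by simp
    show "R (g \<otimes>\<^bsub>G\<^esub> h) $$ (s, t) = (\<Sum>u<d. R g $$ (s, u) * R h $$ (u, t))"
      if "g \<in> carrier G" "h \<in> carrier G" "s \<in> {..<d}" "t \<in> {..<d}" for g h s t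
      using that mat_rep_mult[OF R that(1,2)] mult_mat_index_sum[OF Rc Rc] by simp
  qed
  moreover have "\<rho> g (coords_of_vec d v) = coords_of_vec d (R g *\<^sub>v v)"
    if "g \<in> carrier G" "v \<in> carrier_vec d" for g v
  proof -
    have "\<rho> g (coords_of_vec d v) = (\<lambda>s\<in>{..<d}. \<Sum>t<d. coords_of_vec d v t * R g $$ (s, t))"
      unfolding \<rho>_def coord_space_simps by (rule restrict_apply', rule coords_of_vec_carrier)
    also have "\<dots> = coords_of_vec d (R g *\<^sub>v v)"
      unfolding coords_of_vec_def[of d "R g *\<^sub>v v"]
    proof (rule restrict_ext)
      fix s assume "s \<in> {..<d}"
      thus "(\<Sum>t<d. coords_of_vec d v t * R g $$ (s, t)) = (R g *\<^sub>v v) $ s"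
        using that Rc[OF that(1)]
        by (auto simp: coords_of_vec_def scalar_prod_def atLeast0LessThan mult.commute intro!: sum.cong)
    qed
    finally show ?thesis .
  qed
  moreover have "op_trace {..<d} (\<rho> g) = mat_trace (R g)" if g: "g \<in> carrier G" for g
  proof -
    have "\<rho> g (coord_vec {..<d} s) s = R g $$ (s, s)" if s: "s < d" for s
    proof -
      have "\<rho> g (coord_vec {..<d} s) s = (\<Sum>t<d. coord_vec {..<d} s t * R g $$ (s, t))"
        using s by (simp add: \<rho>_def coord_space_simps coord_vec_def)
      also have "\<dots> = (\<Sum>t<d. if t = s then R g $$ (s, t) else 0)"
        by (intro sum.cong refl) (auto simp: coord_vec_def)
      finally show ?thesis using s by simp
    qed
    thus ?thesis using Rc[OF g] by (auto simp: op_trace_def mat_trace_def)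
  qed
  ultimately show thesis by (rule that)
qed

lemma Irr_eq_matrix_characters:
  assumes G: "group G"
  shows "Irr G = {\<lambda>g\<in>carrier G. mat_trace (R g) | d (R :: 'g \<Rightarrow> complex mat). mat_irr G d R}"
    (is "_ = ?I")
proof (intro equalityI subsetI)
  fix \<psi> assume "\<psi> \<in> Irr G"
  then obtain d and \<rho> :: "'g \<Rightarrow> (nat \<Rightarrow> complex) \<Rightarrow> nat \<Rightarrow> complex" where
    \<psi>: "\<psi> = rep_character G {..<d} \<rho>" and irr: "irreducible_rep G {..<d} \<rho>"
    unfolding Irr_def by blast
  have \<rho>: "representation G {..<d} \<rho>" using irr by (simp add: irreducible_rep_def)
  obtain R where R: "mat_rep G d R"
    and act: "\<And>g v. g \<in> carrier G \<Longrightarrow> v \<in> carrier_vec d \<Longrightarrow> \<rho> g (coords_of_vec d v) = coords_of_vec d (R g *\<^sub>v v)"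
    and tr: "\<And>g. g \<in> carrier G \<Longrightarrow> op_trace {..<d} (\<rho> g) = mat_trace (R g)"
    using representation_matrix_exists[OF G \<rho>] by metis
  have "mat_irr G d R" using irreducible_rep_iff_mat_irr[OF R \<rho> act] irr by blast
  moreover have "\<psi> = (\<lambda>g\<in>carrier G. mat_trace (R g))"
    unfolding \<psi> rep_character_def by (rule restrict_ext) (rule tr)
  ultimately show "\<psi> \<in> ?I" by blast
next
  fix \<psi> assume "\<psi> \<in> ?I"
  then obtain d and R :: "'g \<Rightarrow> complex mat" where
    \<psi>: "\<psi> = (\<lambda>g\<in>carrier G. mat_trace (R g))" and irr: "mat_irr G d R" by blast
  note R = mat_irr_rep[OF irr]
  obtain \<rho> :: "'g \<Rightarrow> (nat \<Rightarrow> complex) \<Rightarrow> nat \<Rightarrow> complex" where \<rho>: "representation G {..<d} \<rho>"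
    and act: "\<And>g v. g \<in> carrier G \<Longrightarrow> v \<in> carrier_vec d \<Longrightarrow> \<rho> g (coords_of_vec d v) = coords_of_vec d (R g *\<^sub>v v)"
    and tr: "\<And>g. g \<in> carrier G \<Longrightarrow> op_trace {..<d} (\<rho> g) = mat_trace (R g)"
    using matrix_operator_exists[OF G R] by metis
  have "irreducible_rep G {..<d} \<rho>" using irreducible_rep_iff_mat_irr[OF R \<rho> act] irr by blast
  moreover have "\<psi> = rep_character G {..<d} \<rho>"
    unfolding \<psi> rep_character_def by (rule restrict_ext) (simp add: tr)
  ultimately show "\<psi> \<in> Irr G" unfolding Irr_def by blast
qed

section \<open>Cycles\<close>

text \<open>Injectivity below \<open>m\<close> makes \<open>m\<close> the exact length. Iterates of
  a base point are used because colours and signs are followed step by step along the cycle.\<close>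

definition cyc :: "('a \<Rightarrow> 'a) \<Rightarrow> 'a \<Rightarrow> nat \<Rightarrow> bool" where
  "cyc f a m \<longleftrightarrow> 0 < m \<and> (f ^^ m) a = a \<and> inj_on (\<lambda>k. (f ^^ k) a) {..<m}"

definition orb :: "('a \<Rightarrow> 'a) \<Rightarrow> 'a \<Rightarrow> 'a set" where
  "orb f a = range (\<lambda>k. (f ^^ k) a)"

lemma funpow_in_orb: "(f ^^ k) a \<in> orb f a"
  by (simp add: orb_def)

lemma self_in_orb: "a \<in> orb f a"
  using funpow_in_orb[where k = 0] by simp

lemma orb_closed:
  assumes "i \<in> orb f a"
  shows "f i \<in> orb f a"
proof -
  obtain k where "i = (f ^^ k) a" using assms by (auto simp: orb_def)
  hence "f i = (f ^^ Suc k) a" by simp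
  thus ?thesis using funpow_in_orb by metis
qed

lemma orb_subset:
  assumes "f ` A \<subseteq> A" "a \<in> A"
  shows "orb f a \<subseteq> A"
proof -
  have "(f ^^ k) a \<in> A" for k using assms by (induction k) auto
  thus ?thesis by (auto simp: orb_def)
qed

lemma cyc_funpow_eq_iff:
  assumes "cyc f a m"
  shows "(f ^^ j) a = (f ^^ k) a \<longleftrightarrow> j mod m = k mod m"
proof -
  have m: "0 < m" "(f ^^ m) a = a" "inj_on (\<lambda>k. (f ^^ k) a) {..<m}" using assms by (auto simp: cyc_def)
  have "(f ^^ j) a = (f ^^ k) a \<longleftrightarrow> (f ^^ (j mod m)) a = (f ^^ (k mod m)) a"
    using funpow_mod_eq[OF m(2)] by simp
  also have "\<dots> \<longleftrightarrow> j mod m = k mod m"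
    using m inj_on_eq_iff[OF m(3), of "j mod m" "k mod m"] by simp
  finally show ?thesis .
qed

lemma cyc_orb:
  assumes "cyc f a m"
  shows "orb f a = (\<lambda>k. (f ^^ k) a) ` {..<m}"
proof -
  have m: "0 < m" "(f ^^ m) a = a" using assms by (auto simp: cyc_def)
  have "(f ^^ k) a \<in> (\<lambda>k. (f ^^ k) a) ` {..<m}" for k
    using funpow_mod_eq[OF m(2), of k] m(1) by (intro image_eqI[of _ _ "k mod m"]) auto
  thus ?thesis by (auto simp: orb_def)
qed

lemma cyc_exists:
  assumes "inj f" "finite A" "f ` A \<subseteq> A" "a \<in> A"
  obtains m where "cyc f a m"
proof -
  have fin: "finite (orb f a)" using orb_subset[OF assms(3,4)] assms(2) finite_subset by blast
  have "\<not> inj (\<lambda>k. (f ^^ k) a)"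
    using fin unfolding orb_def by (metis finite_imageD infinite_UNIV_nat)
  then obtain i j where ij: "i < j" "(f ^^ i) a = (f ^^ j) a"
    unfolding inj_def by (metis linorder_neqE_nat)
  have "(f ^^ i) ((f ^^ (j - i)) a) = (f ^^ i) a"
    using ij by (metis comp_apply funpow_add le_add_diff_inverse less_imp_le)
  hence per: "(f ^^ (j - i)) a = a" using inj_fn[OF assms(1)] by (simp add: inj_eq)
  define m where "m = (LEAST m. 0 < m \<and> (f ^^ m) a = a)"
  have m: "0 < m \<and> (f ^^ m) a = a"
    unfolding m_def by (rule LeastI[of _ "j - i"]) (use ij per in auto)
  have least: "m \<le> k" if "0 < k" "(f ^^ k) a = a" for k
    unfolding m_def by (rule Least_le) (use that in auto)
  have "inj_on (\<lambda>k. (f ^^ k) a) {..<m}"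
  proof (rule linorder_inj_onI')
    fix k l assume kl: "k \<in> {..<m}" "l \<in> {..<m}" "k < l"
    show "(f ^^ k) a \<noteq> (f ^^ l) a"
    proof
      assume eq: "(f ^^ k) a = (f ^^ l) a"
      have "(f ^^ k) ((f ^^ (l - k)) a) = (f ^^ k) a"
        using kl eq by (metis comp_apply funpow_add le_add_diff_inverse less_imp_le)
      hence "(f ^^ (l - k)) a = a" using inj_fn[OF assms(1)] by (simp add: inj_eq)
      from least[OF _ this] kl show False by auto
    qed
  qed
  with m have "cyc f a m" by (simp add: cyc_def)
  thus thesis by (rule that)
qed

lemma image_orb:
  assumes "cyc f a m"
  shows "f ` orb f a = orb f a"
proof
  show "f ` orb f a \<subseteq> orb f a" using orb_closed by fast
  show "orb f a \<subseteq> f ` orb f a"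
  proof
    fix i assume "i \<in> orb f a"
    then obtain k where k: "i = (f ^^ k) a" by (auto simp: orb_def)
    obtain m' where m': "m = Suc m'" using assms by (cases m) (auto simp: cyc_def)
    have "(f ^^ (k + m)) a = (f ^^ k) a" using cyc_funpow_eq_iff[OF assms] by simp
    hence "i = f ((f ^^ (k + m')) a)" using k m' by simp
    thus "i \<in> f ` orb f a" using funpow_in_orb by fast
  qed
qed

lemma cyc_in_orb:
  assumes "cyc f a m" "inj f" "b \<in> orb f a"
  shows "cyc f b m" "orb f b = orb f a"
proof -
  obtain l where l: "b = (f ^^ l) a" using assms(3) by (auto simp: orb_def)
  have pw: "(f ^^ k) b = (f ^^ l) ((f ^^ k) a)" for k
    unfolding l by (metis add.commute comp_apply funpow_add)
  have inj: "(f ^^ l) i = (f ^^ l) j \<longleftrightarrow> i = j" for i j using inj_fn[OF assms(2)] by (simp add: inj_eq)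
  show cyc: "cyc f b m"
    using assms(1) unfolding cyc_def pw inj_on_def inj by (simp add: l)
  have "orb f b \<subseteq> orb f a"
  proof
    fix i assume "i \<in> orb f b"
    then obtain k where "i = (f ^^ k) b" by (auto simp: orb_def)
    hence "i = (f ^^ (l + k)) a" using pw[of k] by (simp add: funpow_add)
    thus "i \<in> orb f a" using funpow_in_orb by metis
  qed
  moreover have "card (orb f b) = card (orb f a)"
    unfolding cyc_orb[OF cyc] cyc_orb[OF assms(1)]
    using cyc assms(1) by (simp add: cyc_def card_image)
  moreover have "finite (orb f a)" unfolding cyc_orb[OF assms(1)] by simp
  ultimately show "orb f b = orb f a" by (simp add: card_subset_eq)
qed

lemma orb_sum:
  assumes "cyc f a m"
  shows "(\<Sum>i\<in>orb f a. c i) = (\<Sum>k<m. c ((f ^^ k) a))"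
  unfolding cyc_orb[OF assms] using assms by (simp add: sum.reindex cyc_def)

lemma orb_prod:
  assumes "cyc f a m"
  shows "(\<Prod>i\<in>orb f a. c i) = (\<Prod>k<m. c ((f ^^ k) a))"
  unfolding cyc_orb[OF assms] using assms by (simp add: prod.reindex cyc_def)

text \<open>Every interior factor appears twice and is its own inverse. This evaluates every product
  of signs along a cycle.\<close>

lemma prod_telescope:
  fixes q :: "nat \<Rightarrow> int"
  assumes "\<And>j. q j * q j = 1"
  shows "(\<Prod>j<n. q j * q (Suc j)) = q 0 * q n"
proof (induction n)
  case (Suc n)
  have "(\<Prod>j<Suc n. q j * q (Suc j)) = q 0 * (q n * q n) * q (Suc n)" using Suc by (simp add: mult_ac)
  thus ?case using assms by simp
qed (use assms in simp)

section \<open>Difference equations modulo \<open>r\<close> around a cycle\<close>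

definition cyc_sols :: "int \<Rightarrow> ('a \<Rightarrow> 'a) \<Rightarrow> 'a \<Rightarrow> ('a \<Rightarrow> int) \<Rightarrow> ('a \<Rightarrow> int) set" where
  "cyc_sols r f a c = {w \<in> orb f a \<rightarrow>\<^sub>E {0..<r}. \<forall>i\<in>orb f a. r dvd w (f i) - w i - c i}"

lemma cyc_sols_path:
  assumes "\<And>i. i \<in> orb f a \<Longrightarrow> r dvd w (f i) - w i - c i"
  shows "(r::int) dvd w ((f ^^ k) a) - w a - (\<Sum>j<k. c ((f ^^ j) a))"
proof (induction k)
  case (Suc k)
  have "r dvd w (f ((f ^^ k) a)) - w ((f ^^ k) a) - c ((f ^^ k) a)" by (rule assms) (rule funpow_in_orb)
  from dvd_add[OF this Suc] show ?case by (simp add: algebra_simps)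
qed simp

lemma cyc_sols_sum:
  assumes "cyc f a m" "w \<in> cyc_sols r f a c"
  shows "r dvd (\<Sum>i\<in>orb f a. c i)"
  using cyc_sols_path[of f a r w c m] assms unfolding orb_sum[OF assms(1)]
  by (auto simp: cyc_sols_def cyc_def)

lemma eq_if_dvd_diff:
  fixes s t :: int
  assumes "r dvd s - t" "s \<in> {0..<r}" "t \<in> {0..<r}"
  shows "s = t"
  using assms by (metis atLeastLessThan_iff mod_eq_dvd_iff mod_pos_pos_trivial)

text \<open>A solution is its starting value plus the partial sums of \<open>c\<close>. Going once
  round returns to the starting value exactly when the total of \<open>c\<close> vanishes modulo
  \<open>r\<close>.\<close>

lemma cyc_sols_bij:
  assumes C: "cyc f a m" and "0 < r" and sum: "r dvd (\<Sum>i\<in>orb f a. c i)"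
  shows "bij_betw (\<lambda>w. w a) (cyc_sols r f a c) {0..<r}"
  unfolding bij_betw_def
proof
  show "inj_on (\<lambda>w. w a) (cyc_sols r f a c)"
  proof (rule inj_onI)
    fix v w assume v: "v \<in> cyc_sols r f a c" and w: "w \<in> cyc_sols r f a c" and eq: "v a = w a"
    have "v i = w i" if i: "i \<in> orb f a" for i
    proof -
      obtain k where k: "i = (f ^^ k) a" using i by (auto simp: orb_def)
      have "r dvd (v i - v a - (\<Sum>j<k. c ((f ^^ j) a))) - (w i - w a - (\<Sum>j<k. c ((f ^^ j) a)))"
        unfolding k using v w
        by (intro dvd_diff[OF cyc_sols_path[of f a r v c k] cyc_sols_path[of f a r w c k]]) (auto simp: cyc_sols_def)
      hence "r dvd v i - w i" using eq by simp
      thus ?thesis by (rule eq_if_dvd_diff) (use v w i in \<open>auto simp: cyc_sols_def\<close>)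
    qed
    thus "v = w" using v w by (intro PiE_ext[of v "orb f a" _ w]) (auto simp: cyc_sols_def)
  qed
  show "(\<lambda>w. w a) ` cyc_sols r f a c = {0..<r}"
  proof (intro equalityI subsetI)
    fix t assume "t \<in> (\<lambda>w. w a) ` cyc_sols r f a c"
    thus "t \<in> {0..<r}" using self_in_orb by (fastforce simp: cyc_sols_def)
  next
    fix t assume t: "t \<in> {0..<r}"
    have m: "0 < m" and inj: "inj_on (\<lambda>k. (f ^^ k) a) {..<m}" using C by (auto simp: cyc_def)
    \<comment> \<open>The position of a point on the cycle, counted from \<open>a\<close>; it fixes
      the number of terms in the partial sum.\<close>
    define idx where "idx = the_inv_into {..<m} (\<lambda>k. (f ^^ k) a)"
    have idx: "idx ((f ^^ k) a) = k" if "k < m" for k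
      unfolding idx_def by (rule the_inv_into_f_f[OF inj]) (use that in simp)
    define w where "w = (\<lambda>i\<in>orb f a. (t + (\<Sum>j<idx i. c ((f ^^ j) a))) mod r)"
    have wk: "w ((f ^^ k) a) = (t + (\<Sum>j<k. c ((f ^^ j) a))) mod r" if "k < m" for k
      using that funpow_in_orb[where k = k and f = f and a = a] by (simp add: w_def idx)
    have "r dvd w (f i) - w i - c i" if i: "i \<in> orb f a" for i
    proof -
      obtain k where k: "k < m" "i = (f ^^ k) a" using i unfolding cyc_orb[OF C] by auto
      have 1: "r dvd w i - (t + (\<Sum>j<k. c ((f ^^ j) a)))"
        using wk[OF k(1)] k(2) by (simp add: mod_eq_dvd_iff[symmetric])
      have 2: "r dvd w (f i) - (t + (\<Sum>j<Suc k. c ((f ^^ j) a)))"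
      proof (cases "Suc k < m")
        case True
        thus ?thesis using wk[OF True] k(2) by (simp add: mod_eq_dvd_iff[symmetric])
      next
        \<comment> \<open>The last point of the cycle: its successor is \<open>a\<close>, whose
          value is \<open>t\<close> without the full sum, and the hypothesis \<open>sum\<close>
          closes this gap.\<close>
        case False
        hence km: "Suc k = m" using k by simp
        have "f i = (f ^^ 0) a" using C k km by (auto simp: cyc_def)
        hence "w (f i) = t" using wk[of 0] m t by simp
        thus ?thesis using sum unfolding km orb_sum[OF C] by simp
      qed
      from dvd_diff[OF 2 1] show ?thesis using k(2) by (simp add: algebra_simps)
    qed
    moreover have "w \<in> orb f a \<rightarrow>\<^sub>E {0..<r}" using \<open>0 < r\<close> by (auto simp: w_def)
    ultimately have "w \<in> cyc_sols r f a c" by (auto simp: cyc_sols_def)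
    moreover have "w a = t" using wk[of 0] m t by simp
    ultimately show "t \<in> (\<lambda>w. w a) ` cyc_sols r f a c" by blast
  qed
qed

lemma card_cyc_sols:
  assumes "cyc f a m" "0 < r"
  shows "card (cyc_sols r f a c) = (if r dvd (\<Sum>i\<in>orb f a. c i) then nat r else 0)"
proof (cases "r dvd (\<Sum>i\<in>orb f a. c i)")
  case True
  thus ?thesis using bij_betw_same_card[OF cyc_sols_bij[OF assms True]] by simp
next
  case False
  hence "cyc_sols r f a c = {}" using cyc_sols_sum[OF assms(1)] by blast
  thus ?thesis using False by simp
qed

section \<open>Signed involutions and square roots\<close>

text \<open>A coloured permutation \<open>(x, \<pi>)\<close> is encoded by the extensional map \<open>i \<mapsto> (\<pi> i, x i)\<close>, which can be
  restricted to and glued from \<open>\<pi>\<close>-invariant sets.\<close>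

definition Adm :: "int \<Rightarrow> ((nat \<Rightarrow> nat \<times> int) \<Rightarrow> nat \<Rightarrow> bool) \<Rightarrow> nat set \<Rightarrow> (nat \<Rightarrow> nat \<times> int) set" where
  "Adm r P A = {h \<in> A \<rightarrow>\<^sub>E A \<times> {0..<r}. \<forall>i\<in>A. P h i}"

text \<open>The condition at \<open>i\<close> may look at \<open>h\<close> only at \<open>i\<close>,
  at its image under \<pi> and at its image under \<open>h\<close> itself. Hence it survives
  restriction to, and gluing along, sets closed under both maps.\<close>

definition local_cond :: "(nat \<Rightarrow> nat) \<Rightarrow> ((nat \<Rightarrow> nat \<times> int) \<Rightarrow> nat \<Rightarrow> bool) \<Rightarrow> bool" where
  "local_cond \<pi> P \<longleftrightarrow> (\<forall>h h' i. h i = h' i \<longrightarrow> h (\<pi> i) = h' (\<pi> i) \<longrightarrow>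
     h (fst (h i)) = h' (fst (h i)) \<longrightarrow> P h i = P h' i)"

definition adm_sum :: "int \<Rightarrow> ((nat \<Rightarrow> nat \<times> int) \<Rightarrow> nat \<Rightarrow> bool) \<Rightarrow> (nat \<Rightarrow> nat \<times> int \<Rightarrow> int) \<Rightarrow> nat set \<Rightarrow> int" where
  "adm_sum r P s A = (\<Sum>h\<in>Adm r P A. \<Prod>i\<in>A. s i (h i))"

text \<open>Prescribing the image of one base point decides which cycle the cycle of
  \<open>a\<close> is sent to, and this is what allows the sum to factor.\<close>

definition adm_sum_at ::
    "int \<Rightarrow> ((nat \<Rightarrow> nat \<times> int) \<Rightarrow> nat \<Rightarrow> bool) \<Rightarrow> (nat \<Rightarrow> nat \<times> int \<Rightarrow> int) \<Rightarrow> nat set \<Rightarrow> nat \<Rightarrow> nat \<Rightarrow> int" where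
  "adm_sum_at r P s A a b = (\<Sum>h | h \<in> Adm r P A \<and> fst (h a) = b. \<Prod>i\<in>A. s i (h i))"

lemma finite_Adm: "finite A \<Longrightarrow> finite (Adm r P A)"
  unfolding Adm_def by (rule finite_subset[of _ "A \<rightarrow>\<^sub>E A \<times> {0..<r}"]) (auto intro: finite_PiE)

lemma Adm_PiE: "h \<in> Adm r P A \<Longrightarrow> h \<in> A \<rightarrow>\<^sub>E A \<times> {0..<r}"
  by (simp add: Adm_def)

lemma Adm_fst: "h \<in> Adm r P A \<Longrightarrow> i \<in> A \<Longrightarrow> fst (h i) \<in> A"
  using PiE_mem[OF Adm_PiE] by (metis mem_Times_iff)

lemma Adm_snd: "h \<in> Adm r P A \<Longrightarrow> i \<in> A \<Longrightarrow> snd (h i) \<in> {0..<r}"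
  using PiE_mem[OF Adm_PiE] by (metis mem_Times_iff)

lemma Adm_cond: "h \<in> Adm r P A \<Longrightarrow> i \<in> A \<Longrightarrow> P h i"
  by (simp add: Adm_def)

lemma AdmI:
  assumes "\<And>i. i \<in> A \<Longrightarrow> fst (h i) \<in> A" "\<And>i. i \<in> A \<Longrightarrow> snd (h i) \<in> {0..<r}"
    "\<And>i. i \<notin> A \<Longrightarrow> h i = undefined" "\<And>i. i \<in> A \<Longrightarrow> P h i"
  shows "h \<in> Adm r P A"
  unfolding Adm_def using assms by (auto simp: mem_Times_iff)

lemma local_condD:
  "local_cond \<pi> P \<Longrightarrow> h i = h' i \<Longrightarrow> h (\<pi> i) = h' (\<pi> i) \<Longrightarrow> h (fst (h i)) = h' (fst (h i)) \<Longrightarrow> P h i = P h' i"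
  unfolding local_cond_def by blast

lemma Adm_restrict:
  assumes P: "local_cond \<pi> P" and D: "D \<subseteq> A" and \<pi>D: "\<pi> ` D \<subseteq> D"
    and h: "h \<in> Adm r P A" and hD: "\<And>i. i \<in> D \<Longrightarrow> fst (h i) \<in> D"
  shows "restrict h D \<in> Adm r P D"
proof (rule AdmI)
  fix i assume i: "i \<in> D"
  hence iA: "i \<in> A" using D by blast
  have "P (restrict h D) i = P h i"
    by (rule local_condD[OF P]) (use i \<pi>D hD in auto)
  thus "P (restrict h D) i" using Adm_cond[OF h iA] by simp
  show "fst (restrict h D i) \<in> D" "snd (restrict h D i) \<in> {0..<r}" using i hD Adm_snd[OF h iA] by auto
qed auto

lemma Adm_glue:
  assumes P: "local_cond \<pi> P" and D: "D \<subseteq> A" and \<pi>D: "\<pi> ` D \<subseteq> D" and \<pi>D': "\<pi> ` (A - D) \<subseteq> A - D"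
    and h1: "h1 \<in> Adm r P D" and h2: "h2 \<in> Adm r P (A - D)"
  shows "(\<lambda>i\<in>A. if i \<in> D then h1 i else h2 i) \<in> Adm r P A" (is "?h \<in> _")
proof (rule AdmI)
  fix i assume i: "i \<in> A"
  show "fst (?h i) \<in> A" "snd (?h i) \<in> {0..<r}"
    using i D Adm_fst[OF h1, of i] Adm_fst[OF h2, of i] Adm_snd[OF h1, of i] Adm_snd[OF h2, of i] by auto
  show "P ?h i"
  proof (cases "i \<in> D")
    case True
    hence m: "\<pi> i \<in> D" "fst (h1 i) \<in> D" using \<pi>D Adm_fst[OF h1] by auto
    have "P ?h i = P h1 i"
      by (rule local_condD[OF P]) (use True m D in auto)
    thus ?thesis using Adm_cond[OF h1 True] by simp
  next
    case False
    hence iD: "i \<in> A - D" using i by simp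
    hence m: "\<pi> i \<in> A - D" "fst (h2 i) \<in> A - D" using \<pi>D' Adm_fst[OF h2] by auto
    have "P ?h i = P h2 i"
      by (rule local_condD[OF P]) (use iD m D in auto)
    thus ?thesis using Adm_cond[OF h2 iD] by simp
  qed
qed auto

text \<open>Once the image of \<open>a\<close> is fixed, every admissible map preserves
  \<open>D\<close> and its complement, so it amounts to an independent pair of restrictions. The
  summand is a product of local signs and splits accordingly.\<close>

lemma adm_sum_at_split:
  assumes P: "local_cond \<pi> P" and A: "finite A" and D: "D \<subseteq> A" and \<pi>D: "\<pi> ` D \<subseteq> D"
    and \<pi>D': "\<pi> ` (A - D) \<subseteq> A - D" and a: "a \<in> D"
    and pres: "\<And>h i. h \<in> Adm r P A \<Longrightarrow> fst (h a) = b \<Longrightarrow> i \<in> A \<Longrightarrow> fst (h i) \<in> D \<longleftrightarrow> i \<in> D"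
  shows "adm_sum_at r P s A a b = adm_sum_at r P s D a b * adm_sum r P s (A - D)"
proof -
  let ?T = "{h \<in> Adm r P D. fst (h a) = b} \<times> Adm r P (A - D)"
  let ?g = "\<lambda>(h1, h2). \<lambda>i\<in>A. if i \<in> D then h1 i else h2 i"
  have "adm_sum_at r P s A a b = (\<Sum>(h1, h2)\<in>?T. (\<Prod>i\<in>D. s i (h1 i)) * (\<Prod>i\<in>A - D. s i (h2 i)))"
    unfolding adm_sum_at_def
  proof (rule sum.reindex_bij_witness[where i = ?g and j = "\<lambda>h. (restrict h D, restrict h (A - D))"])
    fix h assume h: "h \<in> {h. h \<in> Adm r P A \<and> fst (h a) = b}"
    hence hA: "h \<in> Adm r P A" by simp
    have pr: "i \<in> A \<Longrightarrow> fst (h i) \<in> D \<longleftrightarrow> i \<in> D" for i using pres h by blast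
    show "?g (restrict h D, restrict h (A - D)) = h"
    proof
      show "?g (restrict h D, restrict h (A - D)) i = h i" for i
        using PiE_arb[OF Adm_PiE[OF hA], of i] by auto
    qed
    have "restrict h D \<in> Adm r P D" by (rule Adm_restrict[OF P D \<pi>D hA]) (use pr D in blast)
    moreover have "restrict h (A - D) \<in> Adm r P (A - D)"
      by (rule Adm_restrict[OF P _ \<pi>D' hA]) (use pr Adm_fst[OF hA] in blast)+
    ultimately show "(restrict h D, restrict h (A - D)) \<in> ?T" using a h by simp
    have "(\<Prod>i\<in>A. s i (h i)) = (\<Prod>i\<in>A - D. s i (h i)) * (\<Prod>i\<in>D. s i (h i))"
      by (rule prod.subset_diff[OF D A])
    thus "(case (restrict h D, restrict h (A - D)) of (h1, h2) \<Rightarrow>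
        (\<Prod>i\<in>D. s i (h1 i)) * (\<Prod>i\<in>A - D. s i (h2 i))) = (\<Prod>i\<in>A. s i (h i))"
      by (simp add: mult.commute)
  next
    fix p assume "p \<in> ?T"
    then obtain h1 h2 where p: "p = (h1, h2)" and h1: "h1 \<in> Adm r P D" "fst (h1 a) = b"
      and h2: "h2 \<in> Adm r P (A - D)" by auto
    have g: "?g p \<in> Adm r P A" unfolding p using Adm_glue[OF P D \<pi>D \<pi>D' h1(1) h2] by simp
    show "?g p \<in> {h. h \<in> Adm r P A \<and> fst (h a) = b}" using g a D h1 by (auto simp: p)
    have "restrict (?g p) D i = h1 i" for i
      using PiE_arb[OF Adm_PiE[OF h1(1)], of i] D by (cases "i \<in> D") (auto simp: p)
    moreover have "restrict (?g p) (A - D) i = h2 i" for i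
      using PiE_arb[OF Adm_PiE[OF h2], of i] by (cases "i \<in> A - D") (auto simp: p)
    ultimately show "(restrict (?g p) D, restrict (?g p) (A - D)) = p"
      unfolding p prod.inject by (intro conjI ext)
  qed
  also have "\<dots> = adm_sum_at r P s D a b * adm_sum r P s (A - D)"
    unfolding adm_sum_at_def adm_sum_def sum_product sum.cartesian_product by simp
  finally show ?thesis .
qed

lemma adm_sum_fibres:
  assumes "finite A" "a \<in> A"
  shows "adm_sum r P s A = (\<Sum>b\<in>A. adm_sum_at r P s A a b)"
proof -
  have "adm_sum r P s A = (\<Sum>b\<in>A. \<Sum>h\<in>{h \<in> Adm r P A. fst (h a) = b}. \<Prod>i\<in>A. s i (h i))"
    unfolding adm_sum_def
    by (rule sum.group[symmetric]) (use assms finite_Adm Adm_fst in auto)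
  thus ?thesis by (simp add: adm_sum_at_def)
qed

section \<open>Signs of fixed points and of inversions\<close>

definition half_sign :: "int \<Rightarrow> int \<Rightarrow> int" where
  "half_sign r k = (if r div 2 \<le> k mod r then -1 else 1)"

lemma half_sign_square: "half_sign r k * half_sign r k = 1"
  by (simp add: half_sign_def)

lemma half_sign_cong: "r dvd k - l \<Longrightarrow> half_sign r k = half_sign r l"
  by (simp add: half_sign_def mod_eq_dvd_iff[symmetric])

text \<open>This antisymmetry controls the choice of a half modulo an even \<open>r\<close>: two
  halves of the same residue differ by a multiple of \<open>r div 2\<close>.\<close>

lemma half_sign_half:
  assumes "even r" "0 < r"
  shows "half_sign r (k + r div 2) = - half_sign r k"
proof -
  obtain q where q: "r = 2 * q" "0 < q" using assms by auto
  define t where "t = k mod r"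
  have t: "0 \<le> t" "t < r" using assms by (simp_all add: t_def)
  have e: "(k + q) mod r = (t + q) mod r" by (simp add: t_def mod_add_left_eq)
  have "(t + q) mod r = (if t < q then t + q else t - q)"
  proof (cases "t < q")
    case True
    thus ?thesis using t q by simp
  next
    case False
    have "(t + q) mod r = (t - q + r) mod r" using q by (simp add: algebra_simps)
    also have "\<dots> = (t - q) mod r" by (rule mod_add_self2)
    also have "\<dots> = t - q" by (rule mod_pos_pos_trivial) (use False t q in auto)
    finally show ?thesis using False by simp
  qed
  hence e': "(k + q) mod r = (if t < q then t + q else t - q)" using e by simp
  have r2: "r div 2 = q" using q by simp
  have "t < 2 * q" using t q by simp
  thus ?thesis unfolding half_sign_def r2 e' t_def[symmetric] using t(1) by auto
qed

lemma half_sign_small: "0 \<le> k \<Longrightarrow> k < r div 2 \<Longrightarrow> half_sign r k = 1"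
  by (simp add: half_sign_def)

lemma half_sign_multiple:
  assumes "even r" "0 < r"
  shows "half_sign r (k + (r div 2) * e) = (if even e then half_sign r k else - half_sign r k)"
proof -
  have ev: "half_sign r (l + (r div 2) * (2 * f)) = half_sign r l" for l f
  proof (rule half_sign_cong)
    have "(r div 2) * (2 * f) = r * f" using assms(1) by auto
    hence "l + r div 2 * (2 * f) - l = r * f" by simp
    thus "r dvd l + r div 2 * (2 * f) - l" by (metis dvd_triv_left)
  qed
  show ?thesis
  proof (cases "even e")
    case True
    then obtain f where "e = 2 * f" by auto
    thus ?thesis using ev by simp
  next
    case False
    then obtain f where f: "e = 2 * f + 1" by (rule oddE)
    have e: "k + (r div 2) * e = (k + r div 2) + (r div 2) * (2 * f)" by (simp add: f algebra_simps)
    show ?thesis unfolding e using ev[of "k + r div 2" f] half_sign_half[OF assms, of k] False by simp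
  qed
qed

definition col_sign :: "int \<Rightarrow> int \<Rightarrow> int \<Rightarrow> int \<Rightarrow> int" where
  "col_sign r par c t = (if t mod 2 = par \<and> r div 2 \<le> (c + t div 2) mod r then -1 else 1)"

text \<open>The sign of a fixed point is the coboundary of \<^const>\<open>half_sign\<close>, whichever lift \<open>k\<close> of the half of
  its colour is chosen.\<close>

lemma col_sign_lift:
  assumes r: "even r" "0 < r" and w: "w \<in> {0..<r}" "w mod 2 = par" and k: "r dvd w - 2 * k - par"
  shows "col_sign r par c w = half_sign r k * half_sign r (k + c)"
proof -
  let ?q = "w div 2"
  have w2: "w = 2 * ?q + par" using w(2) by (metis mult_div_mod_eq)
  obtain d where d: "w - 2 * k - par = r * d" using k by (auto simp: dvd_def)
  \<comment> \<open>The canonical half \<open>?q\<close> lies below \<open>r div 2\<close> and so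
    has half sign 1. Passing to the lift \<open>k\<close> multiplies both half signs by the same
    power of -1, which drops out of their product.\<close>
  have "2 * ?q - 2 * k = 2 * ((r div 2) * d)" using d w2 r(1) by auto
  hence q: "?q = k + (r div 2) * d" by simp
  have q1: "half_sign r ?q = 1" by (rule half_sign_small) (use w r in auto)
  have "col_sign r par c w = half_sign r (c + ?q)"
    using w(2) by (simp add: col_sign_def half_sign_def)
  also have "c + ?q = (k + c) + (r div 2) * d" using q by simp
  finally have cs: "col_sign r par c w = half_sign r ((k + c) + (r div 2) * d)" .
  show ?thesis
    using cs q1[unfolded q] unfolding half_sign_multiple[OF r] by (auto split: if_splits)
qed

lemma col_sign_parity: "t mod 2 \<noteq> par \<Longrightarrow> col_sign r par c t = 1"
  by (simp add: col_sign_def)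

text \<open>Only the smaller end of an inverted pair carries the -1, so that a product over all
  points counts the pair once.\<close>

definition inv_sign :: "(nat \<Rightarrow> nat) \<Rightarrow> nat \<Rightarrow> nat \<Rightarrow> int" where
  "inv_sign \<pi> i j = (if i < j \<and> \<pi> j < \<pi> i then -1 else 1)"

text \<open>The argument \<open>par\<close> is 1 for the first clause of \<^const>\<open>B_tilde\<close> (odd colours) and 0 for the second
  (even colours).\<close>

definition loc_sign :: "int \<Rightarrow> (nat \<Rightarrow> nat) \<Rightarrow> (nat \<Rightarrow> int) \<Rightarrow> int \<Rightarrow> nat \<Rightarrow> nat \<times> int \<Rightarrow> int" where
  "loc_sign r \<pi> x par i p = (if fst p = i then col_sign r par (x i) (snd p) else inv_sign \<pi> i (fst p))"

text \<open>Taken over both ends, the sign compares the orientation of a pair with that of its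
  image, which is a coboundary along the iterates of \<pi>.\<close>

lemma inv_sign_pair:
  assumes "inj \<pi>" "i \<noteq> j"
  shows "inv_sign \<pi> i j * inv_sign \<pi> j i = sgn (int j - int i) * sgn (int (\<pi> j) - int (\<pi> i))"
proof -
  have "\<pi> i \<noteq> \<pi> j" using assms by (simp add: inj_eq)
  thus ?thesis using assms(2) by (auto simp: inv_sign_def sgn_if)
qed

text \<open>With \<open>g = (x, \<pi>)\<close>, \<open>invol_cond\<close> says that the encoded \<open>\<omega>\<close> satisfies \<open>\<omega>\<^sup>T = \<omega>\<close> and \<open>g \<omega> g\<^sup>T = \<omega>\<close>, and
  \<open>sqrt_cond\<close> says that the encoded \<open>h\<close> satisfies \<open>h = g h\<^sup>T\<close>.\<close>

definition invol_cond :: "int \<Rightarrow> (nat \<Rightarrow> nat) \<Rightarrow> (nat \<Rightarrow> int) \<Rightarrow> (nat \<Rightarrow> nat \<times> int) \<Rightarrow> nat \<Rightarrow> bool" where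
  "invol_cond r \<pi> x h i \<longleftrightarrow> fst (h (fst (h i))) = i \<and> fst (h (\<pi> i)) = \<pi> (fst (h i)) \<and>
     snd (h (fst (h i))) = snd (h i) \<and> r dvd snd (h (\<pi> i)) - snd (h i) - (x i + x (fst (h i)))"

definition sqrt_cond :: "int \<Rightarrow> (nat \<Rightarrow> nat) \<Rightarrow> (nat \<Rightarrow> int) \<Rightarrow> (nat \<Rightarrow> nat \<times> int) \<Rightarrow> nat \<Rightarrow> bool" where
  "sqrt_cond r \<pi> x h i \<longleftrightarrow> fst (h (fst (h i))) = \<pi> i \<and> r dvd snd (h (fst (h i))) - snd (h i) - x i"

lemma local_invol_cond: "local_cond \<pi> (invol_cond r \<pi> x)"
  by (simp add: local_cond_def invol_cond_def)

lemma local_sqrt_cond: "local_cond \<pi> (sqrt_cond r \<pi> x)"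
  by (simp add: local_cond_def sqrt_cond_def)

lemma invol_commute: "h \<in> Adm r (invol_cond r \<pi> x) A \<Longrightarrow> i \<in> A \<Longrightarrow> fst (h (\<pi> i)) = \<pi> (fst (h i))"
  using Adm_cond by (fastforce simp: invol_cond_def)

lemma sqrt_commute:
  assumes "h \<in> Adm r (sqrt_cond r \<pi> x) A" "i \<in> A"
  shows "fst (h (\<pi> i)) = \<pi> (fst (h i))"
proof -
  have "fst (h (fst (h i))) = \<pi> i" if "i \<in> A" for i
    using Adm_cond[OF assms(1) that] by (simp add: sqrt_cond_def)
  from this[OF assms(2)] this[OF Adm_fst[OF assms]] show ?thesis by simp
qed

section \<open>Contributions of a single cycle\<close>

lemma commute_funpow:
  assumes "\<And>i. i \<in> A \<Longrightarrow> fst (h (\<pi> i)) = \<pi> (fst (h i))" "\<pi> ` A \<subseteq> A" "i \<in> A"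
  shows "fst (h ((\<pi> ^^ k) i)) = (\<pi> ^^ k) (fst (h i))"
proof (induction k)
  case (Suc k)
  have "(\<pi> ^^ k) i \<in> A" using orb_subset[OF assms(2,3)] funpow_in_orb by fast
  thus ?case using assms(1) Suc by simp
qed simp

text \<open>The signs telescope to the half signs of \<open>k\<close> and of \<open>k\<close> plus
  the colour sum, where \<open>2 * k + 1\<close> is the starting colour. Since the solution closes
  up, twice the colour sum is 0 modulo \<open>r\<close>, so the colour sum is 0 or
  \<open>r div 2\<close>, and only the latter gives -1.\<close>

lemma half_path_sign:
  assumes r: "even r" "0 < r" and C: "cyc \<pi> a m"
    and w: "w \<in> cyc_sols r \<pi> a (\<lambda>i. 2 * x i)"
  shows "(\<Prod>i\<in>orb \<pi> a. col_sign r 1 (x i) (w i)) =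
    (if even (w a) \<or> r dvd (\<Sum>i\<in>orb \<pi> a. x i) then 1 else -1)"
proof -
  let ?S = "\<lambda>j. \<Sum>l<j. x ((\<pi> ^^ l) a)"
  let ?w = "\<lambda>j. w ((\<pi> ^^ j) a)"
  have path: "r dvd ?w j - w a - 2 * ?S j" for j
    using cyc_sols_path[of \<pi> a r w "\<lambda>i. 2 * x i" j] w
    by (auto simp: cyc_sols_def sum_distrib_left)
  have wr: "?w j \<in> {0..<r}" for j
    using w funpow_in_orb[where k = j and f = \<pi> and a = a] by (auto simp: cyc_sols_def)
  \<comment> \<open>For even \<open>r\<close> the colour keeps its parity along the cycle, so either
    all points of the cycle can carry a colour sign or none can.\<close>
  have par: "?w j mod 2 = w a mod 2" for j
  proof -
    have "2 dvd ?w j - w a - 2 * ?S j" using path r(1) dvd_trans by blast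
    hence "2 dvd ?w j - w a" by presburger
    thus ?thesis by presburger
  qed
  show ?thesis
  proof (cases "even (w a)")
    case True
    hence "?w j mod 2 \<noteq> 1" for j using par[of j] by simp
    thus ?thesis unfolding orb_prod[OF C] using True by (simp add: col_sign_parity)
  next
    case False
    define k where "k = w a div 2"
    have k: "w a = 2 * k + 1" "0 \<le> k" "k < r div 2"
      using False wr[of 0] r by (auto simp: k_def)
    \<comment> \<open>\<open>k + ?S j\<close> is a half of the colour at step \<open>j\<close>, up
      to a multiple of \<open>r div 2\<close>; it is not reduced to the canonical half.\<close>
    define q where "q j = half_sign r (k + ?S j)" for j
    have "col_sign r 1 (x ((\<pi> ^^ j) a)) (?w j) = q j * q (Suc j)" for j
    proof -
      have "col_sign r 1 (x ((\<pi> ^^ j) a)) (?w j) =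
          half_sign r (k + ?S j) * half_sign r (k + ?S j + x ((\<pi> ^^ j) a))"
      proof (rule col_sign_lift[OF r wr])
        show "?w j mod 2 = 1" using par[of j] False by (simp add: odd_iff_mod_2_eq_one)
        show "r dvd ?w j - 2 * (k + ?S j) - 1" using path[of j] k(1) by (simp add: algebra_simps)
      qed
      thus ?thesis by (simp add: q_def add.assoc)
    qed
    hence "(\<Prod>i\<in>orb \<pi> a. col_sign r 1 (x i) (w i)) = (\<Prod>j<m. q j * q (Suc j))"
      unfolding orb_prod[OF C] by simp
    also have "\<dots> = q 0 * q m" by (rule prod_telescope) (simp add: q_def half_sign_square)
    also have "q 0 = 1" using k(2,3) by (simp add: q_def half_sign_small)
    also have "q m = half_sign r (k + (\<Sum>i\<in>orb \<pi> a. x i))" by (simp add: q_def orb_sum[OF C])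
    finally have P: "(\<Prod>i\<in>orb \<pi> a. col_sign r 1 (x i) (w i)) = half_sign r (k + (\<Sum>i\<in>orb \<pi> a. x i))"
      by simp
    \<comment> \<open>After \<open>m\<close> steps the path is back at its start, so the increments
      \<open>2 * x\<close> sum to 0 modulo \<open>r\<close>.\<close>
    have "r dvd 2 * ?S m" using path[of m] C by (auto simp: cyc_def)
    then obtain e where e: "2 * ?S m = r * e" by (auto simp: dvd_def)
    have s: "(\<Sum>i\<in>orb \<pi> a. x i) = (r div 2) * e" using e r(1) unfolding orb_sum[OF C] by auto
    have "r dvd (r div 2) * e \<longleftrightarrow> even e"
    proof -
      have "r dvd (r div 2) * e \<longleftrightarrow> (r div 2) * 2 dvd (r div 2) * e" using r(1) by simp
      also have "\<dots> \<longleftrightarrow> even e" using r by (subst dvd_times_left_cancel_iff) auto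
      finally show ?thesis .
    qed
    thus ?thesis unfolding P s half_sign_multiple[OF r] using False half_sign_small[OF k(2,3)] by simp
  qed
qed

lemma sum_parity_signs:
  fixes r :: int
  assumes "even r" "0 < r"
  shows "(\<Sum>t\<in>{0..<r}. if even t then 1 else - 1 :: int) = 0"
proof -
  obtain q where q: "r = 2 * q" using assms by auto
  hence n: "r = 2 * int (nat q)" using assms by simp
  have "(\<Sum>t\<in>{0..<2 * int n}. if even t then 1 else - 1 :: int) = 0" for n
  proof (induction n)
    case (Suc n)
    have "{0..<2 * int (Suc n)} = insert (2 * int n) (insert (2 * int n + 1) {0..<2 * int n})" by auto
    thus ?case using Suc by simp
  qed simp
  thus ?thesis unfolding n .
qed

text \<open>A map commuting with the cycle is determined by the image of \<open>a\<close>, hence a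
  rotation. What remains is a colouring that solves a difference equation and is invariant under the
  rotation. Only rotations of order at most 2 are considered, namely the identity and the half
  turn.\<close>

lemma invol_sum_rotation:
  assumes C: "cyc \<pi> a m" and l: "(\<pi> ^^ (2 * l)) a = a"
  shows "adm_sum_at r (invol_cond r \<pi> x) s (orb \<pi> a) a ((\<pi> ^^ l) a) =
    (\<Sum>w | w \<in> cyc_sols r \<pi> a (\<lambda>i. x i + x ((\<pi> ^^ l) i)) \<and> (\<forall>i\<in>orb \<pi> a. w ((\<pi> ^^ l) i) = w i).
      \<Prod>i\<in>orb \<pi> a. s i ((\<pi> ^^ l) i, w i))"
proof -
  let ?C = "orb \<pi> a" and ?c = "\<lambda>i. x i + x ((\<pi> ^^ l) i)"
  have rot: "(\<pi> ^^ l) i \<in> ?C" "(\<pi> ^^ l) ((\<pi> ^^ l) i) = i" if i: "i \<in> ?C" for i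
  proof -
    obtain k where k: "i = (\<pi> ^^ k) a" using i by (auto simp: orb_def)
    have "(\<pi> ^^ l) i = (\<pi> ^^ (l + k)) a" by (simp add: k funpow_add)
    thus "(\<pi> ^^ l) i \<in> ?C" using funpow_in_orb by metis
    have "(\<pi> ^^ l) ((\<pi> ^^ l) i) = (\<pi> ^^ (k + 2 * l)) a"
      unfolding k by (simp add: mult_2 add_ac flip: funpow_add[THEN fun_cong, unfolded comp_def])
    also have "\<dots> = (\<pi> ^^ k) ((\<pi> ^^ (2 * l)) a)" by (simp only: funpow_add comp_apply)
    finally show "(\<pi> ^^ l) ((\<pi> ^^ l) i) = i" using l k by simp
  qed
  show ?thesis
    unfolding adm_sum_at_def
  proof (rule sum.reindex_bij_witness[where i = "\<lambda>w. \<lambda>i\<in>?C. ((\<pi> ^^ l) i, w i)" and j = "\<lambda>h. \<lambda>i\<in>?C. snd (h i)"])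
    fix h assume "h \<in> {h \<in> Adm r (invol_cond r \<pi> x) ?C. fst (h a) = (\<pi> ^^ l) a}"
    hence h: "h \<in> Adm r (invol_cond r \<pi> x) ?C" and ha: "fst (h a) = (\<pi> ^^ l) a" by auto
    have fsth: "fst (h i) = (\<pi> ^^ l) i" if "i \<in> ?C" for i
    proof -
      obtain k where k: "i = (\<pi> ^^ k) a" using \<open>i \<in> ?C\<close> by (auto simp: orb_def)
      have "\<pi> ` ?C \<subseteq> ?C" using orb_closed by fast
      from commute_funpow[where h = h and \<pi> = \<pi> and A = ?C, OF invol_commute[OF h] this self_in_orb]
      have "fst (h i) = (\<pi> ^^ k) ((\<pi> ^^ l) a)" unfolding k ha[symmetric] .
      also have "\<dots> = (\<pi> ^^ l) i" unfolding k by (metis add.commute comp_apply funpow_add)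
      finally show ?thesis .
    qed
    show "(\<lambda>i\<in>?C. ((\<pi> ^^ l) i, (\<lambda>i\<in>?C. snd (h i)) i)) = h"
    proof
      show "(\<lambda>i\<in>?C. ((\<pi> ^^ l) i, (\<lambda>i\<in>?C. snd (h i)) i)) i = h i" for i
        using PiE_arb[OF Adm_PiE[OF h], of i] fsth[of i] by (cases "i \<in> ?C") (auto simp: prod_eq_iff)
    qed
    have "(\<lambda>i\<in>?C. snd (h i)) \<in> cyc_sols r \<pi> a ?c"
      unfolding cyc_sols_def
    proof (intro CollectI conjI ballI)
      show "(\<lambda>i\<in>?C. snd (h i)) \<in> ?C \<rightarrow>\<^sub>E {0..<r}" using Adm_snd[OF h] by simp
      fix i assume i: "i \<in> ?C"
      show "r dvd (\<lambda>i\<in>?C. snd (h i)) (\<pi> i) - (\<lambda>i\<in>?C. snd (h i)) i - ?c i"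
        using Adm_cond[OF h i] fsth[OF i] i orb_closed[OF i] by (simp add: invol_cond_def)
    qed
    moreover have "snd (h ((\<pi> ^^ l) i)) = snd (h i)" if "i \<in> ?C" for i
      using Adm_cond[OF h that] fsth[OF that] by (simp add: invol_cond_def)
    ultimately show "(\<lambda>i\<in>?C. snd (h i)) \<in> {w \<in> cyc_sols r \<pi> a ?c. \<forall>i\<in>?C. w ((\<pi> ^^ l) i) = w i}"
      using rot by simp
    show "(\<Prod>i\<in>?C. s i ((\<pi> ^^ l) i, (\<lambda>i\<in>?C. snd (h i)) i)) = (\<Prod>i\<in>?C. s i (h i))"
      by (rule prod.cong) (auto simp: fsth[symmetric])
  next
    fix w assume "w \<in> {w \<in> cyc_sols r \<pi> a ?c. \<forall>i\<in>?C. w ((\<pi> ^^ l) i) = w i}"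
    hence w: "w \<in> cyc_sols r \<pi> a ?c" and winv: "\<And>i. i \<in> ?C \<Longrightarrow> w ((\<pi> ^^ l) i) = w i" by auto
    from w have wP: "w \<in> ?C \<rightarrow>\<^sub>E {0..<r}" by (simp add: cyc_sols_def)
    show "(\<lambda>i\<in>?C. snd ((\<lambda>i\<in>?C. ((\<pi> ^^ l) i, w i)) i)) = w"
    proof
      show "(\<lambda>i\<in>?C. snd ((\<lambda>i\<in>?C. ((\<pi> ^^ l) i, w i)) i)) i = w i" for i
        using PiE_arb[OF wP, of i] by (cases "i \<in> ?C") auto
    qed
    have "(\<lambda>i\<in>?C. ((\<pi> ^^ l) i, w i)) \<in> Adm r (invol_cond r \<pi> x) ?C" (is "?h \<in> _")
    proof (rule AdmI)
      fix i assume i: "i \<in> ?C"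
      show "fst (?h i) \<in> ?C" "snd (?h i) \<in> {0..<r}" using i rot PiE_mem[OF wP i] by simp_all
      have "r dvd w (\<pi> i) - w i - ?c i" using w i by (simp add: cyc_sols_def)
      thus "invol_cond r \<pi> x ?h i"
        using i rot[OF i] winv[OF i] orb_closed[OF i] by (simp add: invol_cond_def funpow_swap1)
    qed simp
    thus "?h \<in> {h \<in> Adm r (invol_cond r \<pi> x) ?C. fst (h a) = (\<pi> ^^ l) a}"
      using self_in_orb[of a \<pi>] by simp
  qed
qed

text \<open>If the doubled colour sum vanishes, every starting colour occurs once. For colour sum 0
  all of them count 1; for colour sum \<open>r div 2\<close> the even colours cancel the odd
  ones.\<close>

lemma invol_sum_identity:
  assumes r: "even r" "0 < r" and C: "cyc \<pi> a m"
  shows "adm_sum_at r (invol_cond r \<pi> x) (loc_sign r \<pi> x 1) (orb \<pi> a) a a =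
    (if r dvd (\<Sum>i\<in>orb \<pi> a. x i) then r else 0)"
proof -
  let ?C = "orb \<pi> a" and ?sols = "cyc_sols r \<pi> a (\<lambda>i. 2 * x i)"
  let ?G = "\<lambda>t::int. if even t \<or> r dvd (\<Sum>i\<in>?C. x i) then 1 else -1 :: int"
  have "adm_sum_at r (invol_cond r \<pi> x) (loc_sign r \<pi> x 1) ?C a a =
      (\<Sum>w\<in>?sols. \<Prod>i\<in>?C. col_sign r 1 (x i) (w i))"
  proof -
    have "(\<pi> ^^ (2 * 0)) a = a" by simp
    from invol_sum_rotation[OF C this, of r x "loc_sign r \<pi> x 1"]
    have "adm_sum_at r (invol_cond r \<pi> x) (loc_sign r \<pi> x 1) ?C a a =
        (\<Sum>w | w \<in> cyc_sols r \<pi> a (\<lambda>i. x i + x i) \<and> (\<forall>i\<in>?C. w i = w i).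
          \<Prod>i\<in>?C. loc_sign r \<pi> x 1 i (i, w i))"
      unfolding funpow_0 .
    also have "(\<lambda>i. x i + x i) = (\<lambda>i. 2 * x i)" by (simp only: mult_2)
    finally have eq: "adm_sum_at r (invol_cond r \<pi> x) (loc_sign r \<pi> x 1) ?C a a =
        (\<Sum>w | w \<in> ?sols \<and> (\<forall>i\<in>?C. w i = w i). \<Prod>i\<in>?C. loc_sign r \<pi> x 1 i (i, w i))" .
    have "loc_sign r \<pi> x 1 i (i, t) = col_sign r 1 (x i) t" for i t by (simp add: loc_sign_def)
    thus ?thesis unfolding eq by (simp only: refl simp_thms ball_triv Collect_mem_eq)
  qed
  also have "\<dots> = (\<Sum>w\<in>?sols. ?G (w a))"
    by (rule sum.cong[OF refl]) (rule half_path_sign[OF r C])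
  also have "\<dots> = (if r dvd (\<Sum>i\<in>?C. x i) then r else 0)"
  proof (cases "r dvd (\<Sum>i\<in>?C. 2 * x i)")
    case True
    have "(\<Sum>w\<in>?sols. ?G (w a)) = (\<Sum>t\<in>{0..<r}. ?G t)"
      by (rule sum.reindex_bij_betw[OF cyc_sols_bij[OF C r(2) True]])
    thus ?thesis using r sum_parity_signs[OF r] by simp
  next
    case False
    hence "\<not> r dvd (\<Sum>i\<in>?C. x i)" by (metis dvd_mult sum_distrib_left)
    moreover have "?sols = {}" using cyc_sols_sum[OF C] False by blast
    ultimately show ?thesis by simp
  qed
  finally show ?thesis .
qed

lemma prod_lessThan_add:
  fixes f :: "nat \<Rightarrow> 'a::comm_monoid_mult"
  shows "(\<Prod>j<l + k. f j) = (\<Prod>j<l. f j) * (\<Prod>j<k. f (l + j))"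
  by (induction k) (simp_all add: mult.assoc)

lemma sum_lessThan_add:
  fixes f :: "nat \<Rightarrow> 'a::comm_monoid_add"
  shows "(\<Sum>j<l + k. f j) = (\<Sum>j<l. f j) + (\<Sum>j<k. f (l + j))"
  by (induction k) (simp_all add: add.assoc)

text \<open>The pairs are a point and its opposite. Their orientations telescope over half of the
  cycle, and half a turn maps the first pair to itself with its ends exchanged.\<close>

lemma half_turn_sign:
  assumes C: "cyc \<pi> a (2 * l)" and inj: "inj \<pi>" and l: "0 < l"
  shows "(\<Prod>i\<in>orb \<pi> a. inv_sign \<pi> i ((\<pi> ^^ l) i)) = -1"
proof -
  let ?p = "\<lambda>j. (\<pi> ^^ j) a"
  define q where "q j = sgn (int (?p (l + j)) - int (?p j))" for j
  have ne: "?p (l + j) \<noteq> ?p j" for j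
  proof
    assume "?p (l + j) = ?p j"
    hence "(l + j) mod (2 * l) = j mod (2 * l)" using cyc_funpow_eq_iff[OF C] by blast
    hence "2 * l dvd (l + j) - j" using mod_eq_dvd_iff_nat[of j "l + j" "2 * l"] by simp
    thus False using l by (simp add: dvd_imp_le nat_dvd_not_less)
  qed
  have per: "?p (2 * l + j) = ?p j" for j using cyc_funpow_eq_iff[OF C] by simp
  have pl: "(\<pi> ^^ l) (?p j) = ?p (l + j)" for j by (simp add: funpow_add)
  have qq: "q j * q j = 1" for j using ne[of j] by (simp add: q_def sgn_if)
  have "(\<Prod>i\<in>orb \<pi> a. inv_sign \<pi> i ((\<pi> ^^ l) i)) = (\<Prod>j<l + l. inv_sign \<pi> (?p j) (?p (l + j)))"
    unfolding orb_prod[OF C] pl by (simp add: mult_2)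
  \<comment> \<open>The two ends of an opposite pair lie in different halves of the cycle, so
    cutting the product at \<open>l\<close> lets them be multiplied pairwise.\<close>
  also have "\<dots> = (\<Prod>j<l. inv_sign \<pi> (?p j) (?p (l + j))) * (\<Prod>j<l. inv_sign \<pi> (?p (l + j)) (?p (l + (l + j))))"
    by (rule prod_lessThan_add)
  also have "\<dots> = (\<Prod>j<l. q j * q (Suc j))"
    unfolding prod.distrib[symmetric]
  proof (rule prod.cong[OF refl])
    fix j
    have e: "l + (l + j) = 2 * l + j" by simp
    have "inv_sign \<pi> (?p j) (?p (l + j)) * inv_sign \<pi> (?p (l + j)) (?p j) = q j * q (Suc j)"
      using inv_sign_pair[OF inj ne[of j, symmetric]] by (simp add: q_def)
    thus "inv_sign \<pi> (?p j) (?p (l + j)) * inv_sign \<pi> (?p (l + j)) (?p (l + (l + j))) = q j * q (Suc j)"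
      unfolding e per .
  qed
  also have "\<dots> = q 0 * q l" by (rule prod_telescope) (rule qq)
  also have "q l = - q 0"
  proof -
    have "l + l = 2 * l + 0" by simp
    hence "?p (l + l) = ?p 0" using per[of 0] by metis
    thus ?thesis by (simp add: q_def sgn_if)
  qed
  finally show ?thesis using qq[of 0] by simp
qed

text \<open>The increments \<open>x i + x ((\<pi> ^^ l) i)\<close> over half of the cycle add up to
  the full colour sum. So invariance under the half turn holds for all solutions if the colour sum
  is 0, and for none otherwise; colour sum \<open>r div 2\<close> contributes nothing here.\<close>

lemma invol_sum_half_turn:
  assumes r: "0 < r" and C: "cyc \<pi> a (2 * l)" and inj: "inj \<pi>" and l: "0 < l"
  shows "adm_sum_at r (invol_cond r \<pi> x) (loc_sign r \<pi> x 1) (orb \<pi> a) a ((\<pi> ^^ l) a) =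
    - (if r dvd (\<Sum>i\<in>orb \<pi> a. x i) then r else 0)"
proof -
  let ?C = "orb \<pi> a" and ?c = "\<lambda>i. x i + x ((\<pi> ^^ l) i)"
  let ?W = "{w \<in> cyc_sols r \<pi> a ?c. \<forall>i\<in>?C. w ((\<pi> ^^ l) i) = w i}"
  have per: "(\<pi> ^^ (2 * l)) a = a" using C by (simp add: cyc_def)
  have ne: "(\<pi> ^^ l) i \<noteq> i" if i: "i \<in> ?C" for i
  proof
    assume eq: "(\<pi> ^^ l) i = i"
    have "(\<pi> ^^ l) i = (\<pi> ^^ 0) i \<longleftrightarrow> l mod (2 * l) = 0 mod (2 * l)"
      by (rule cyc_funpow_eq_iff[OF cyc_in_orb(1)[OF C inj i]])
    thus False using eq l by simp
  qed
  have "adm_sum_at r (invol_cond r \<pi> x) (loc_sign r \<pi> x 1) ?C a ((\<pi> ^^ l) a) =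
      (\<Sum>w\<in>?W. \<Prod>i\<in>?C. loc_sign r \<pi> x 1 i ((\<pi> ^^ l) i, w i))"
    by (rule invol_sum_rotation[OF C per])
  also have "\<dots> = (\<Sum>w\<in>?W. - 1)"
  proof (rule sum.cong[OF refl])
    fix w
    have "(\<Prod>i\<in>?C. loc_sign r \<pi> x 1 i ((\<pi> ^^ l) i, w i)) = (\<Prod>i\<in>?C. inv_sign \<pi> i ((\<pi> ^^ l) i))"
      by (rule prod.cong[OF refl]) (simp add: loc_sign_def ne)
    thus "(\<Prod>i\<in>?C. loc_sign r \<pi> x 1 i ((\<pi> ^^ l) i, w i)) = - 1" using half_turn_sign[OF C inj l] by simp
  qed
  also have "\<dots> = - int (card ?W)" by simp
  also have "int (card ?W) = (if r dvd (\<Sum>i\<in>?C. x i) then r else 0)"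
  proof -
    have step: "r dvd w ((\<pi> ^^ l) i) - w i - (\<Sum>i\<in>?C. x i)" if w: "w \<in> cyc_sols r \<pi> a ?c" and i: "i \<in> ?C" for w i
    proof -
      note Ci = cyc_in_orb[OF C inj i]
      have "r dvd w ((\<pi> ^^ l) i) - w i - (\<Sum>j<l. ?c ((\<pi> ^^ j) i))"
        by (rule cyc_sols_path[where c = ?c]) (use w Ci(2) in \<open>simp add: cyc_sols_def\<close>)
      moreover have "(\<Sum>j<l. ?c ((\<pi> ^^ j) i)) = (\<Sum>j<l + l. x ((\<pi> ^^ j) i))"
        unfolding sum_lessThan_add sum.distrib by (simp add: funpow_add)
      moreover have "(\<Sum>j<l + l. x ((\<pi> ^^ j) i)) = (\<Sum>i\<in>?C. x i)"
        using orb_sum[OF Ci(1), of x] Ci(2) by (simp add: mult_2)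
      ultimately show ?thesis by simp
    qed
    have sum2: "(\<Sum>i\<in>?C. ?c i) = 2 * (\<Sum>i\<in>?C. x i)"
    proof -
      have "(\<Sum>i\<in>?C. x ((\<pi> ^^ l) i)) = (\<Sum>i\<in>?C. x i)"
      proof (rule sum.reindex_bij_witness[where i = "\<pi> ^^ l" and j = "\<pi> ^^ l"])
        fix i assume i: "i \<in> ?C"
        have "(\<pi> ^^ (l + l)) i = i" using cyc_in_orb(1)[OF C inj i] by (simp add: cyc_def mult_2)
        thus "(\<pi> ^^ l) ((\<pi> ^^ l) i) = i" by (simp add: funpow_add)
        thus "(\<pi> ^^ l) ((\<pi> ^^ l) i) = i" .
        have "(\<pi> ^^ l) i \<in> orb \<pi> i" by (rule funpow_in_orb)
        thus "(\<pi> ^^ l) i \<in> ?C" using cyc_in_orb(2)[OF C inj i] by simp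
        thus "(\<pi> ^^ l) i \<in> ?C" .
      qed simp
      thus ?thesis by (simp add: sum.distrib)
    qed
    show ?thesis
    proof (cases "r dvd (\<Sum>i\<in>?C. x i)")
      case True
      have "w ((\<pi> ^^ l) i) = w i" if w: "w \<in> cyc_sols r \<pi> a ?c" and i: "i \<in> ?C" for w i
      proof (rule eq_if_dvd_diff)
        show "r dvd w ((\<pi> ^^ l) i) - w i" using dvd_add[OF step[OF w i] True] by simp
        have "(\<pi> ^^ l) i \<in> orb \<pi> i" by (rule funpow_in_orb)
        thus "w ((\<pi> ^^ l) i) \<in> {0..<r}" "w i \<in> {0..<r}"
          using w i cyc_in_orb(2)[OF C inj i] by (auto simp: cyc_sols_def)
      qed
      hence "?W = cyc_sols r \<pi> a ?c" by blast
      moreover have "r dvd (\<Sum>i\<in>?C. ?c i)" unfolding sum2 using True by simp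
      ultimately show ?thesis using True r by (simp add: card_cyc_sols[OF C r])
    next
      case False
      have W0: "?W = {}"
      proof (rule ccontr)
        assume "?W \<noteq> {}"
        then obtain w where w: "w \<in> cyc_sols r \<pi> a ?c" "w ((\<pi> ^^ l) a) = w a" using self_in_orb[of a \<pi>] by blast
        from step[OF w(1) self_in_orb] w(2) False show False by simp
      qed
      show ?thesis unfolding W0 using False by simp
    qed
  qed
  finally show ?thesis .
qed

text \<open>A root on one cycle commutes with \<pi>, so it is the power \<open>k\<close> of \<pi>
  with \<open>2 * k\<close> congruent to 1 modulo \<open>m\<close>. Its colours solve the difference
  equation with increments \<open>x\<close> along the root, which runs through the same points in
  another order.\<close>

lemma sqrt_sum_cycle:
  assumes r: "0 < r" and C: "cyc \<pi> a m"
  shows "adm_sum r (sqrt_cond r \<pi> x) (\<lambda>_ _. 1) (orb \<pi> a) =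
    (if odd m \<and> r dvd (\<Sum>i\<in>orb \<pi> a. x i) then r else 0)"
proof -
  let ?C = "orb \<pi> a" and ?A = "Adm r (sqrt_cond r \<pi> x) (orb \<pi> a)"
  have m: "0 < m" using C by (simp add: cyc_def)
  have inv: "\<pi> ` ?C \<subseteq> ?C" using orb_closed by fast
  have root: "\<exists>k. (2 * k) mod m = 1 mod m \<and> (\<forall>i\<in>?C. fst (h i) = (\<pi> ^^ k) i)" if h: "h \<in> ?A" for h
  proof -
    obtain k where k: "fst (h a) = (\<pi> ^^ k) a" using Adm_fst[OF h self_in_orb] by (auto simp: orb_def)
    have cf: "fst (h ((\<pi> ^^ k) i)) = (\<pi> ^^ k) (fst (h i))" if i: "i \<in> ?C" for i k
      by (rule commute_funpow[where A = ?C and h = h and \<pi> = \<pi>]) (use sqrt_commute[OF h] inv i in blast)+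
    have "fst (h i) = (\<pi> ^^ k) i" if i: "i \<in> ?C" for i
    proof -
      obtain j where j: "i = (\<pi> ^^ j) a" using i by (auto simp: orb_def)
      show ?thesis unfolding j cf[OF self_in_orb] k by (metis add.commute comp_apply funpow_add)
    qed
    moreover have "(\<pi> ^^ (2 * k)) a = (\<pi> ^^ 1) a"
    proof -
      have "fst (h (fst (h a))) = \<pi> a" using Adm_cond[OF h self_in_orb] by (simp add: sqrt_cond_def)
      moreover have "fst (h (fst (h a))) = (\<pi> ^^ (k + k)) a"
        unfolding k cf[OF self_in_orb] by (simp add: funpow_add)
      ultimately show ?thesis by (simp add: mult_2)
    qed
    ultimately show ?thesis using cyc_funpow_eq_iff[OF C] by blast
  qed
  show ?thesis
  proof (cases "odd m")
    case False
    have "?A = {}"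
    proof (rule ccontr)
      assume "?A \<noteq> {}"
      then obtain k where k: "(2 * k) mod m = 1 mod m" using root by blast
      \<comment> \<open>For \<open>m \<ge> 2\<close> the residue of 1 is odd, while an even number
        stays even modulo the even \<open>m\<close>.\<close>
      have "2 \<le> m" using False m by (cases "m = 1") auto
      hence "odd ((2 * k) mod m)" using k by simp
      thus False using False by (simp add: dvd_mod_iff)
    qed
    thus ?thesis using False by (simp add: adm_sum_def)
  next
    case True
    \<comment> \<open>The inverse of 2 modulo the odd length \<open>m\<close>.\<close>
    define l where "l = Suc m div 2"
    have l: "2 * l = m + 1" using True by (simp add: l_def)
    let ?\<rho> = "\<pi> ^^ l"
    have rp: "(?\<rho> ^^ j) a = (\<pi> ^^ (l * j)) a" for j by (simp add: funpow_mult)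
    have dbl: "(j * (m + 1)) mod m = j mod m" for j by (simp add: algebra_simps)
    have lj: "(2 * (l * j)) mod m = j mod m" for j
      using dbl[of j] l by (metis mult.assoc mult.commute)
    have C': "cyc ?\<rho> a m"
      unfolding cyc_def
    proof (intro conjI m inj_onI)
      have "(\<pi> ^^ (l * m)) a = (\<pi> ^^ 0) a" unfolding cyc_funpow_eq_iff[OF C] by simp
      thus "(?\<rho> ^^ m) a = a" using rp[of m] by simp
      fix j k assume jk: "j \<in> {..<m}" "k \<in> {..<m}" "(?\<rho> ^^ j) a = (?\<rho> ^^ k) a"
      hence "(l * j) mod m = (l * k) mod m" unfolding rp cyc_funpow_eq_iff[OF C] by simp
      hence "(2 * (l * j)) mod m = (2 * (l * k)) mod m" by (metis mod_mult_right_eq)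
      thus "j = k" using jk lj by simp
    qed
    \<comment> \<open>Root and cycle have the same points, hence the same colour sum decides whether
      the colours exist.\<close>
    have orb: "orb ?\<rho> a = ?C"
    proof (rule card_subset_eq)
      show "finite ?C" unfolding cyc_orb[OF C] by simp
      show "orb ?\<rho> a \<subseteq> ?C" by (auto simp: orb_def rp)
      show "card (orb ?\<rho> a) = card ?C"
        unfolding cyc_orb[OF C] cyc_orb[OF C'] using C C' by (simp add: cyc_def card_image)
    qed
    have fsth: "fst (h i) = ?\<rho> i" if h: "h \<in> ?A" and i: "i \<in> ?C" for h i
    proof -
      obtain k where k: "(2 * k) mod m = 1 mod m" "fst (h i) = (\<pi> ^^ k) i" using root[OF h] i by blast
      obtain j where j: "i = (\<pi> ^^ j) a" using i by (auto simp: orb_def)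
      have "k mod m = (2 * (l * k)) mod m" using lj by simp
      also have "\<dots> = (l * ((2 * k) mod m)) mod m" by (simp add: mod_mult_right_eq mult_ac)
      also have "\<dots> = l mod m" unfolding k(1) by (simp add: mod_mult_right_eq)
      finally have kl: "k mod m = l mod m" .
      have "(\<pi> ^^ (k + j)) a = (\<pi> ^^ (l + j)) a"
        unfolding cyc_funpow_eq_iff[OF C] using kl by (metis mod_add_left_eq)
      hence "(\<pi> ^^ k) i = ?\<rho> i" unfolding j by (simp add: funpow_add)
      thus ?thesis using k(2) by simp
    qed
    have sq: "?\<rho> (?\<rho> i) = \<pi> i" if i: "i \<in> ?C" for i
    proof -
      obtain j where j: "i = (\<pi> ^^ j) a" using i by (auto simp: orb_def)
      have e: "l + l + j = (1 + j) + m" using l by simp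
      have "(\<pi> ^^ (l + l + j)) a = (\<pi> ^^ (1 + j)) a"
        unfolding cyc_funpow_eq_iff[OF C] e by (rule mod_add_self2)
      thus ?thesis unfolding j by (simp add: funpow_add)
    qed
    have "bij_betw (\<lambda>h. \<lambda>i\<in>?C. snd (h i)) ?A (cyc_sols r ?\<rho> a x)"
    proof (rule bij_betw_byWitness[where f' = "\<lambda>w. \<lambda>i\<in>?C. (?\<rho> i, w i)"])
      show "\<forall>h\<in>?A. (\<lambda>i\<in>?C. (?\<rho> i, (\<lambda>i\<in>?C. snd (h i)) i)) = h"
      proof (intro ballI ext)
        fix h i assume h: "h \<in> ?A"
        show "(\<lambda>i\<in>?C. (?\<rho> i, (\<lambda>i\<in>?C. snd (h i)) i)) i = h i"
          using PiE_arb[OF Adm_PiE[OF h], of i] fsth[OF h, of i] by (cases "i \<in> ?C") (auto simp: prod_eq_iff)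
      qed
      show "\<forall>w\<in>cyc_sols r ?\<rho> a x. (\<lambda>i\<in>?C. snd ((\<lambda>i\<in>?C. (?\<rho> i, w i)) i)) = w"
      proof (intro ballI ext)
        fix w i assume "w \<in> cyc_sols r ?\<rho> a x"
        hence wP: "w \<in> ?C \<rightarrow>\<^sub>E {0..<r}" by (simp add: cyc_sols_def orb)
        show "(\<lambda>i\<in>?C. snd ((\<lambda>i\<in>?C. (?\<rho> i, w i)) i)) i = w i"
          using PiE_arb[OF wP, of i] by (cases "i \<in> ?C") auto
      qed
      show "(\<lambda>h. \<lambda>i\<in>?C. snd (h i)) ` ?A \<subseteq> cyc_sols r ?\<rho> a x"
      proof (rule image_subsetI)
        fix h assume h: "h \<in> ?A"
        show "(\<lambda>i\<in>?C. snd (h i)) \<in> cyc_sols r ?\<rho> a x"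
          unfolding cyc_sols_def orb
        proof (intro CollectI conjI ballI)
          show "(\<lambda>i\<in>?C. snd (h i)) \<in> ?C \<rightarrow>\<^sub>E {0..<r}" using Adm_snd[OF h] by simp
          fix i assume i: "i \<in> ?C"
          have "?\<rho> i \<in> ?C" using Adm_fst[OF h i] fsth[OF h i] by simp
          thus "r dvd (\<lambda>i\<in>?C. snd (h i)) (?\<rho> i) - (\<lambda>i\<in>?C. snd (h i)) i - x i"
            using Adm_cond[OF h i] fsth[OF h i] i by (simp add: sqrt_cond_def)
        qed
      qed
      show "(\<lambda>w. \<lambda>i\<in>?C. (?\<rho> i, w i)) ` cyc_sols r ?\<rho> a x \<subseteq> ?A"
      proof (rule image_subsetI)
        fix w assume w: "w \<in> cyc_sols r ?\<rho> a x"
        hence wP: "w \<in> ?C \<rightarrow>\<^sub>E {0..<r}" by (simp add: cyc_sols_def orb)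
        show "(\<lambda>i\<in>?C. (?\<rho> i, w i)) \<in> ?A" (is "?h \<in> _")
        proof (rule AdmI)
          fix i assume i: "i \<in> ?C"
          have ri: "?\<rho> i \<in> ?C" using orb_closed[of i ?\<rho> a] i unfolding orb .
          show "fst (?h i) \<in> ?C" "snd (?h i) \<in> {0..<r}" using i ri PiE_mem[OF wP i] by simp_all
          have "r dvd w (?\<rho> i) - w i - x i" using w i by (simp add: cyc_sols_def orb)
          thus "sqrt_cond r \<pi> x ?h i" using i ri sq[OF i] by (simp add: sqrt_cond_def)
        qed simp
      qed
    qed
    from bij_betw_same_card[OF this] have "card ?A = (if r dvd (\<Sum>i\<in>?C. x i) then nat r else 0)"
      unfolding card_cyc_sols[OF C' r] orb .
    thus ?thesis using True r by (simp add: adm_sum_def)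
  qed
qed

lemma cycle_sums_agree:
  assumes r: "even r" "0 < r" and C: "cyc \<pi> a m" and inj: "inj \<pi>"
  shows "adm_sum r (invol_cond r \<pi> x) (loc_sign r \<pi> x 1) (orb \<pi> a) =
    adm_sum r (sqrt_cond r \<pi> x) (\<lambda>_ _. 1) (orb \<pi> a)"
proof -
  let ?C = "orb \<pi> a" and ?at = "adm_sum_at r (invol_cond r \<pi> x) (loc_sign r \<pi> x 1) (orb \<pi> a) a"
  have m: "0 < m" using C by (simp add: cyc_def)
  have finC: "finite ?C" unfolding cyc_orb[OF C] by simp
  \<comment> \<open>A rotation by \<open>k\<close> is an involution only if \<open>m\<close> divides
    \<open>2 * k\<close>; for other \<open>k\<close> the fibre is empty.\<close>
  have zero: "?at ((\<pi> ^^ k) a) = 0" if "(2 * k) mod m \<noteq> 0" for k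
  proof -
    have "{h \<in> Adm r (invol_cond r \<pi> x) ?C. fst (h a) = (\<pi> ^^ k) a} = {}"
    proof (rule ccontr)
      assume "\<not> ?thesis"
      then obtain h where h: "h \<in> Adm r (invol_cond r \<pi> x) ?C" and ha: "fst (h a) = (\<pi> ^^ k) a" by blast
      have inv: "\<pi> ` ?C \<subseteq> ?C" using orb_closed by fast
      have cf: "fst (h ((\<pi> ^^ k) i)) = (\<pi> ^^ k) (fst (h i))" if i: "i \<in> ?C" for i k
        by (rule commute_funpow[where A = ?C and h = h and \<pi> = \<pi>]) (use invol_commute[OF h] inv i in blast)+
      have "fst (h (fst (h a))) = a" using Adm_cond[OF h self_in_orb] by (simp add: invol_cond_def)
      moreover have "fst (h (fst (h a))) = (\<pi> ^^ (k + k)) a"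
        unfolding ha cf[OF self_in_orb] by (simp add: funpow_add)
      ultimately have "(\<pi> ^^ (2 * k)) a = (\<pi> ^^ 0) a" by (simp add: mult_2)
      hence "(2 * k) mod m = 0 mod m" using cyc_funpow_eq_iff[OF C] by blast
      thus False using that by simp
    qed
    thus ?thesis unfolding adm_sum_at_def by (simp only: sum.empty)
  qed
  have tot: "adm_sum r (invol_cond r \<pi> x) (loc_sign r \<pi> x 1) ?C = (\<Sum>k<m. ?at ((\<pi> ^^ k) a))"
    unfolding adm_sum_fibres[OF finC self_in_orb] by (rule orb_sum[OF C])
  show ?thesis
  proof (cases "odd m")
    case True
    have "(\<Sum>k<m. ?at ((\<pi> ^^ k) a)) = (\<Sum>k\<in>{0}. ?at ((\<pi> ^^ k) a))"
    proof (rule sum.mono_neutral_right)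
      show "\<forall>k\<in>{..<m} - {0}. ?at ((\<pi> ^^ k) a) = 0"
      proof
        fix k assume k: "k \<in> {..<m} - {0}"
        have "\<not> m dvd 2 * k"
        proof
          assume "m dvd 2 * k"
          moreover have "coprime m 2" using True by simp
          ultimately have "m dvd k" by (simp add: coprime_dvd_mult_right_iff)
          thus False using k by (auto dest: dvd_imp_le)
        qed
        thus "?at ((\<pi> ^^ k) a) = 0" by (intro zero) (simp add: mod_eq_0_iff_dvd)
      qed
    qed (use m in auto)
    thus ?thesis
      unfolding tot sqrt_sum_cycle[OF r(2) C] using True by (simp add: invol_sum_identity[OF r C])
  next
    case False
    then obtain l where l: "m = 2 * l" by auto
    hence l0: "0 < l" using m by simp
    have "(\<Sum>k<m. ?at ((\<pi> ^^ k) a)) = (\<Sum>k\<in>{0, l}. ?at ((\<pi> ^^ k) a))"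
    proof (rule sum.mono_neutral_right)
      show "\<forall>k\<in>{..<m} - {0, l}. ?at ((\<pi> ^^ k) a) = 0"
      proof
        fix k assume k: "k \<in> {..<m} - {0, l}"
        have "\<not> l dvd k"
        proof
          assume "l dvd k"
          then obtain e where e: "k = l * e" by (auto simp: dvd_def)
          hence "e < 2" using k l l0 by simp
          thus False using k e by (auto simp: less_Suc_eq numeral_2_eq_2)
        qed
        thus "?at ((\<pi> ^^ k) a) = 0" by (intro zero) (simp add: l mod_eq_0_iff_dvd)
      qed
    qed (use m l l0 in auto)
    thus ?thesis
      unfolding tot sqrt_sum_cycle[OF r(2) C]
      using False l0 invol_sum_identity[OF r C, of x] invol_sum_half_turn[OF r(2) C[unfolded l] inj l0, of x] by simp
  qed
qed

section \<open>Two cycles exchanged with each other\<close>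

lemma orb_cases:
  assumes "i \<in> orb \<pi> a"
  obtains k where "i = (\<pi> ^^ k) a"
  using assms by (auto simp: orb_def)

lemma invol_orb:
  assumes h: "h \<in> Adm r (invol_cond r \<pi> x) A" and inv: "\<pi> ` A \<subseteq> A" and a: "a \<in> A"
  shows "fst (h ((\<pi> ^^ k) a)) = (\<pi> ^^ k) (fst (h a))" "fst (h ((\<pi> ^^ k) (fst (h a)))) = (\<pi> ^^ k) a"
proof -
  have cf: "fst (h ((\<pi> ^^ k) i)) = (\<pi> ^^ k) (fst (h i))" if i: "i \<in> A" for i k
    by (rule commute_funpow[where A = A and h = h and \<pi> = \<pi>]) (use invol_commute[OF h] inv i in blast)+
  show "fst (h ((\<pi> ^^ k) a)) = (\<pi> ^^ k) (fst (h a))" by (rule cf[OF a])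
  have "fst (h (fst (h a))) = a" using Adm_cond[OF h a] by (simp add: invol_cond_def)
  thus "fst (h ((\<pi> ^^ k) (fst (h a)))) = (\<pi> ^^ k) a" using cf[OF Adm_fst[OF h a]] by simp
qed

lemma sqrt_orb:
  assumes h: "h \<in> Adm r (sqrt_cond r \<pi> x) A" and inv: "\<pi> ` A \<subseteq> A" and a: "a \<in> A"
  shows "fst (h ((\<pi> ^^ k) a)) = (\<pi> ^^ k) (fst (h a))" "fst (h ((\<pi> ^^ k) (fst (h a)))) = \<pi> ((\<pi> ^^ k) a)"
proof -
  have cf: "fst (h ((\<pi> ^^ k) i)) = (\<pi> ^^ k) (fst (h i))" if i: "i \<in> A" for i k
    by (rule commute_funpow[where A = A and h = h and \<pi> = \<pi>]) (use sqrt_commute[OF h] inv i in blast)+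
  show "fst (h ((\<pi> ^^ k) a)) = (\<pi> ^^ k) (fst (h a))" by (rule cf[OF a])
  have "fst (h (fst (h a))) = \<pi> a" using Adm_cond[OF h a] by (simp add: sqrt_cond_def)
  thus "fst (h ((\<pi> ^^ k) (fst (h a)))) = \<pi> ((\<pi> ^^ k) a)"
    using cf[OF Adm_fst[OF h a]] by (simp add: funpow_swap1)
qed

lemma invol_preserves:
  assumes h: "h \<in> Adm r (invol_cond r \<pi> x) A" and inv: "\<pi> ` A \<subseteq> A" and a: "a \<in> A" and i: "i \<in> A"
  defines "D \<equiv> orb \<pi> a \<union> orb \<pi> (fst (h a))"
  shows "fst (h i) \<in> D \<longleftrightarrow> i \<in> D"
proof -
  have fwd: "fst (h i) \<in> D" if "i \<in> D" for i
    using that unfolding D_def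
    by (elim UnE; elim orb_cases) (simp_all add: invol_orb[OF h inv a] funpow_in_orb)
  moreover have "fst (h (fst (h i))) = i" using Adm_cond[OF h i] by (simp add: invol_cond_def)
  ultimately show ?thesis by metis
qed

text \<open>Here \<open>h\<close> composed with itself is \<pi> and not the identity, so the
  converse direction rests on the invariance of \<open>D\<close> under \<pi>.\<close>

lemma sqrt_preserves:
  assumes h: "h \<in> Adm r (sqrt_cond r \<pi> x) A" and inv: "\<pi> ` A \<subseteq> A" and a: "a \<in> A" and i: "i \<in> A"
    and inj: "inj \<pi>" and D: "D = orb \<pi> a \<union> orb \<pi> (fst (h a))" and \<pi>D: "\<pi> ` D = D"
  shows "fst (h i) \<in> D \<longleftrightarrow> i \<in> D"
proof -
  have fwd: "fst (h i) \<in> D" if "i \<in> D" for i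
    using that unfolding D
    by (elim UnE; elim orb_cases) (simp_all add: sqrt_orb[OF h inv a] funpow_in_orb orb_closed)
  moreover have "fst (h (fst (h i))) = \<pi> i" using Adm_cond[OF h i] by (simp add: sqrt_cond_def)
  moreover have "\<pi> i \<in> D \<longleftrightarrow> i \<in> D" using \<pi>D inj by (metis inj_image_mem_iff)
  ultimately show ?thesis by metis
qed

text \<open>Two cycles \<open>C\<close>, \<open>C'\<close> exchanged by an involution \<open>\<iota>\<close> correspond to the square root equal to \<open>\<iota>\<close> on
  \<open>C\<close> and to \<open>\<pi> \<circ> \<iota>\<close> on \<open>C'\<close>.\<close>

lemma exchanged_cycles_agree:
  assumes r: "0 < r" and inj: "inj \<pi>" and C: "cyc \<pi> a m" and C': "cyc \<pi> b m'" and b: "b \<notin> orb \<pi> a"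
  shows "adm_sum_at r (invol_cond r \<pi> x) (loc_sign r \<pi> x 1) (orb \<pi> a \<union> orb \<pi> b) a b =
    adm_sum_at r (sqrt_cond r \<pi> x) (\<lambda>_ _. 1) (orb \<pi> a \<union> orb \<pi> b) a b"
proof -
  let ?C = "orb \<pi> a" and ?C' = "orb \<pi> b"
  let ?D = "?C \<union> ?C'"
  have disj: "?C \<inter> ?C' = {}"
  proof (rule ccontr)
    assume "?C \<inter> ?C' \<noteq> {}"
    then obtain i where i: "i \<in> ?C" "i \<in> ?C'" by blast
    have "?C = ?C'" using cyc_in_orb(2)[OF C inj i(1)] cyc_in_orb(2)[OF C' inj i(2)] by simp
    thus False using b self_in_orb[of b \<pi>] by simp
  qed
  have inv: "\<pi> ` ?D \<subseteq> ?D" using orb_closed by fast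
  have aD: "a \<in> ?D" using self_in_orb by fast
  have finC: "finite ?C" "finite ?C'" unfolding cyc_orb[OF C] cyc_orb[OF C'] by simp_all
  have inv_\<pi>: "inv_into UNIV \<pi> (\<pi> i) = i" for i using inj by simp
  let ?E = "{h \<in> Adm r (invol_cond r \<pi> x) ?D. fst (h a) = b}"
  let ?F = "{h \<in> Adm r (sqrt_cond r \<pi> x) ?D. fst (h a) = b}"
  \<comment> \<open>On \<open>?C\<close> the colours are kept. On \<open>?C'\<close> the colour is
    forced by \<open>sqrt_cond\<close> at the partner \<open>z\<close> in \<open>?C\<close>: it has
    to be \<open>snd (h z) + x z\<close> modulo \<open>r\<close>.\<close>
  let ?\<Phi> = "\<lambda>h. \<lambda>i\<in>?D. if i \<in> ?C then h i else (\<pi> (fst (h i)), (snd (h i) + x (fst (h i))) mod r)"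
  let ?\<Psi> = "\<lambda>h. \<lambda>i\<in>?D. if i \<in> ?C then h i else (inv_into UNIV \<pi> (fst (h i)), (snd (h i) - x (inv_into UNIV \<pi> (fst (h i)))) mod r)"
  have E1: "fst (h i) \<in> ?C'" "fst (h (fst (h i))) = i" if h: "h \<in> ?E" and i: "i \<in> ?C" for h i
  proof -
    from i obtain k where k: "i = (\<pi> ^^ k) a" by (rule orb_cases)
    have hb: "fst (h a) = b" and hA: "h \<in> Adm r (invol_cond r \<pi> x) ?D" using h by auto
    show "fst (h i) \<in> ?C'" unfolding k invol_orb(1)[OF hA inv aD] hb by (rule funpow_in_orb)
    show "fst (h (fst (h i))) = i" unfolding k invol_orb[OF hA inv aD] ..
  qed
  have E2: "\<exists>i\<in>?C. j = fst (h i) \<and> fst (h j) = i" if h: "h \<in> ?E" and j: "j \<in> ?C'" for h j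
  proof -
    from j obtain k where k: "j = (\<pi> ^^ k) b" by (rule orb_cases)
    have hb: "fst (h a) = b" and hA: "h \<in> Adm r (invol_cond r \<pi> x) ?D" using h by auto
    have "j = fst (h ((\<pi> ^^ k) a))" "fst (h j) = (\<pi> ^^ k) a"
      using invol_orb[OF hA inv aD, of k] unfolding hb k by simp_all
    thus ?thesis using funpow_in_orb by metis
  qed
  have F1: "fst (h i) \<in> ?C'" "fst (h (fst (h i))) = \<pi> i" if h: "h \<in> ?F" and i: "i \<in> ?C" for h i
  proof -
    from i obtain k where k: "i = (\<pi> ^^ k) a" by (rule orb_cases)
    have hb: "fst (h a) = b" and hA: "h \<in> Adm r (sqrt_cond r \<pi> x) ?D" using h by auto
    show "fst (h i) \<in> ?C'" unfolding k sqrt_orb(1)[OF hA inv aD] hb by (rule funpow_in_orb)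
    show "fst (h (fst (h i))) = \<pi> i" unfolding k sqrt_orb[OF hA inv aD] ..
  qed
  have F2: "\<exists>i\<in>?C. j = fst (h i)" if h: "h \<in> ?F" and j: "j \<in> ?C'" for h j
  proof -
    from j obtain k where k: "j = (\<pi> ^^ k) b" by (rule orb_cases)
    have hb: "fst (h a) = b" and hA: "h \<in> Adm r (sqrt_cond r \<pi> x) ?D" using h by auto
    have "j = fst (h ((\<pi> ^^ k) a))" using sqrt_orb(1)[OF hA inv aD, of k] unfolding hb k by simp
    thus ?thesis using funpow_in_orb by metis
  qed
  have notC: "j \<notin> ?C" if "j \<in> ?C'" for j using disj that by blast
  have \<Phi>C: "?\<Phi> h i = h i" if "i \<in> ?C" for h i using that by simp
  have \<Psi>C: "?\<Psi> h i = h i" if "i \<in> ?C" for h i using that by simp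
  have sndE: "snd (h (fst (h i))) = snd (h i)" if h: "h \<in> ?E" and i: "i \<in> ?D" for h i
  proof -
    have "invol_cond r \<pi> x h i" by (rule Adm_cond[OF _ i]) (use h in blast)
    thus ?thesis by (simp add: invol_cond_def)
  qed
  have \<Phi>C': "?\<Phi> h (fst (h i)) = (\<pi> i, (snd (h i) + x i) mod r)" if h: "h \<in> ?E" and i: "i \<in> ?C" for h i
    using E1[OF h i] notC[OF E1(1)[OF h i]] sndE[OF h, of i] i by simp
  have rgF: "snd (h i) \<in> {0..<r}" if "h \<in> ?F" "i \<in> ?D" for h i using that Adm_snd by blast
  have rgE: "snd (h i) \<in> {0..<r}" if "h \<in> ?E" "i \<in> ?D" for h i using that Adm_snd by blast
  have dvdF: "r dvd snd (h (fst (h i))) - snd (h i) - x i" if h: "h \<in> ?F" and i: "i \<in> ?D" for h i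
  proof -
    have "sqrt_cond r \<pi> x h i" by (rule Adm_cond[OF _ i]) (use h in blast)
    thus ?thesis by (simp add: sqrt_cond_def)
  qed
  have \<Psi>C': "?\<Psi> h (fst (h i)) = (i, snd (h i))" if h: "h \<in> ?F" and i: "i \<in> ?C" for h i
  proof -
    have "(snd (h (fst (h i))) - x i) mod r = snd (h i)"
    proof (rule eq_if_dvd_diff)
      have "r dvd (snd (h (fst (h i))) - x i) mod r - (snd (h (fst (h i))) - x i)"
        by (simp add: mod_eq_dvd_iff[symmetric])
      from dvd_add[OF this dvdF[OF h, of i]] i
      show "r dvd (snd (h (fst (h i))) - x i) mod r - snd (h i)" by (simp add: algebra_simps)
    qed (use r rgF[OF h] i in auto)
    thus ?thesis using F1[OF h i] notC[OF F1(1)[OF h i]] by (simp add: inv_\<pi>)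
  qed
  have \<Phi>adm: "?\<Phi> h \<in> ?F" if h: "h \<in> ?E" for h
  proof -
    have hb: "fst (h a) = b" and hA: "h \<in> Adm r (invol_cond r \<pi> x) ?D" using h by auto
    have "?\<Phi> h \<in> Adm r (sqrt_cond r \<pi> x) ?D"
    proof (rule AdmI)
      fix i assume i: "i \<in> ?D"
      have "(fst (?\<Phi> h i) \<in> ?D \<and> snd (?\<Phi> h i) \<in> {0..<r}) \<and> sqrt_cond r \<pi> x (?\<Phi> h) i"
      proof (cases "i \<in> ?C")
        case True
        have "r dvd (snd (h i) + x i) mod r - (snd (h i) + x i)" by (simp add: mod_eq_dvd_iff[symmetric])
        hence "sqrt_cond r \<pi> x (?\<Phi> h) i"
          unfolding sqrt_cond_def \<Phi>C[OF True] \<Phi>C'[OF h True] by (simp add: algebra_simps)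
        thus ?thesis unfolding \<Phi>C[OF True] using Adm_fst[OF hA i] Adm_snd[OF hA i] by blast
      next
        case False
        hence "i \<in> ?C'" using i by blast
        then obtain z where z: "z \<in> ?C" "i = fst (h z)" "fst (h i) = z" using E2[OF h] by blast
        have \<pi>z: "\<pi> z \<in> ?C" using orb_closed[OF z(1)] .
        have eq: "?\<Phi> h i = (\<pi> z, (snd (h z) + x z) mod r)" unfolding z(2) by (rule \<Phi>C'[OF h z(1)])
        have d1: "r dvd (snd (h z) + x z) - (snd (h z) + x z) mod r" by (simp add: mod_eq_dvd_iff[symmetric])
        have c: "invol_cond r \<pi> x h z" by (rule Adm_cond[OF hA]) (use z(1) in blast)
        have d2: "r dvd snd (h (\<pi> z)) - snd (h z) - (x z + x i)" and f: "fst (h (\<pi> z)) = \<pi> i"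
          using c unfolding z(2) invol_cond_def by blast+
        have "snd (h (\<pi> z)) - (snd (h z) + x z) mod r - x i =
            (snd (h (\<pi> z)) - snd (h z) - (x z + x i)) + ((snd (h z) + x z) - (snd (h z) + x z) mod r)" by simp
        hence "r dvd snd (h (\<pi> z)) - (snd (h z) + x z) mod r - x i" using dvd_add[OF d2 d1] by metis
        with f have "fst (h (\<pi> z)) = \<pi> i \<and> r dvd snd (h (\<pi> z)) - (snd (h z) + x z) mod r - x i" by blast
        hence "sqrt_cond r \<pi> x (?\<Phi> h) i"
          unfolding sqrt_cond_def eq fst_conv snd_conv \<Phi>C[OF \<pi>z] by blast
        thus ?thesis unfolding eq using \<pi>z r by simp
      qed
      thus "fst (?\<Phi> h i) \<in> ?D" "snd (?\<Phi> h i) \<in> {0..<r}" "sqrt_cond r \<pi> x (?\<Phi> h) i" by blast+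
    qed simp
    thus ?thesis using \<Phi>C[OF self_in_orb, of h] hb by simp
  qed
  have \<Psi>adm: "?\<Psi> h \<in> ?E" if h: "h \<in> ?F" for h
  proof -
    have hb: "fst (h a) = b" and hA: "h \<in> Adm r (sqrt_cond r \<pi> x) ?D" using h by auto
    have "?\<Psi> h \<in> Adm r (invol_cond r \<pi> x) ?D"
    proof (rule AdmI)
      fix i assume i: "i \<in> ?D"
      have step: "r dvd snd (h (\<pi> z)) - snd (h z) - (x z + x (fst (h z)))"
        if z: "z \<in> ?C" for z
      proof -
        have zD: "z \<in> ?D" "fst (h z) \<in> ?D" using z F1(1)[OF h z] by auto
        have "r dvd snd (h (\<pi> z)) - snd (h (fst (h z))) - x (fst (h z))"
          using dvdF[OF h zD(2)] F1(2)[OF h z] by simp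
        from dvd_add[OF this dvdF[OF h zD(1)]] show ?thesis by (simp add: algebra_simps)
      qed
      have com: "fst (h (\<pi> z)) = \<pi> (fst (h z))" if z: "z \<in> ?C" for z
        using sqrt_commute[OF hA, of z] z by blast
      have "(fst (?\<Psi> h i) \<in> ?D \<and> snd (?\<Psi> h i) \<in> {0..<r}) \<and> invol_cond r \<pi> x (?\<Psi> h) i"
      proof (cases "i \<in> ?C")
        case True
        have "invol_cond r \<pi> x (?\<Psi> h) i"
          unfolding invol_cond_def \<Psi>C[OF True] \<Psi>C'[OF h True] \<Psi>C[OF orb_closed[OF True]] fst_conv snd_conv
          using com[OF True] step[OF True] by blast
        thus ?thesis unfolding \<Psi>C[OF True] using Adm_fst[OF hA i] Adm_snd[OF hA i] by blast
      next
        case False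
        hence "i \<in> ?C'" using i by blast
        then obtain z where z: "z \<in> ?C" "i = fst (h z)" using F2[OF h] by blast
        have eq: "?\<Psi> h i = (z, snd (h z))" unfolding z(2) by (rule \<Psi>C'[OF h z(1)])
        have \<pi>i: "\<pi> i = fst (h (\<pi> z))" unfolding z(2) by (rule com[OF z(1), symmetric])
        have eq2: "?\<Psi> h (\<pi> i) = (\<pi> z, snd (h (\<pi> z)))"
          unfolding \<pi>i by (rule \<Psi>C'[OF h orb_closed[OF z(1)]])
        have "invol_cond r \<pi> x (?\<Psi> h) i"
          unfolding invol_cond_def eq eq2 fst_conv snd_conv \<Psi>C[OF z(1)]
          using step[OF z(1)] z(2) by (simp add: add.commute)
        thus ?thesis unfolding eq using z(1) rgF[OF h, of z] by simp
      qed
      thus "fst (?\<Psi> h i) \<in> ?D" "snd (?\<Psi> h i) \<in> {0..<r}" "invol_cond r \<pi> x (?\<Psi> h) i" by blast+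
    qed simp
    thus ?thesis using \<Psi>C[OF self_in_orb, of h] hb by simp
  qed
  have \<Psi>\<Phi>: "?\<Psi> (?\<Phi> h) = h" if h: "h \<in> ?E" for h
  proof
    fix i
    consider "i \<notin> ?D" | "i \<in> ?C" | z where "z \<in> ?C" "i = fst (h z)" using E2[OF h] by blast
    thus "?\<Psi> (?\<Phi> h) i = h i"
    proof cases
      case 1
      have hA: "h \<in> Adm r (invol_cond r \<pi> x) ?D" using h by blast
      show ?thesis using PiE_arb[OF Adm_PiE[OF hA] 1] 1 by simp
    next
      case 2
      show ?thesis unfolding \<Psi>C[OF 2] \<Phi>C[OF 2] ..
    next
      case 3
      have "?\<Psi> (?\<Phi> h) (fst (?\<Phi> h z)) = (z, snd (?\<Phi> h z))" by (rule \<Psi>C'[OF \<Phi>adm[OF h] 3(1)])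
      hence "?\<Psi> (?\<Phi> h) i = (z, snd (h z))" unfolding \<Phi>C[OF 3(1)] 3(2) .
      moreover have "h i = (z, snd (h z))"
        using E1(2)[OF h 3(1)] sndE[OF h, of z] 3 by (simp add: prod_eq_iff)
      ultimately show ?thesis by simp
    qed
  qed
  have \<Phi>\<Psi>: "?\<Phi> (?\<Psi> h) = h" if h: "h \<in> ?F" for h
  proof
    fix i
    consider "i \<notin> ?D" | "i \<in> ?C" | z where "z \<in> ?C" "i = fst (h z)" using F2[OF h] by blast
    thus "?\<Phi> (?\<Psi> h) i = h i"
    proof cases
      case 1
      have hA: "h \<in> Adm r (sqrt_cond r \<pi> x) ?D" using h by blast
      show ?thesis using PiE_arb[OF Adm_PiE[OF hA] 1] 1 by simp
    next
      case 2
      show ?thesis unfolding \<Phi>C[OF 2] \<Psi>C[OF 2] ..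
    next
      case 3
      have zD: "z \<in> ?D" "fst (h z) \<in> ?D" using 3(1) F1(1)[OF h 3(1)] by auto
      have "?\<Phi> (?\<Psi> h) (fst (?\<Psi> h z)) = (\<pi> z, (snd (?\<Psi> h z) + x z) mod r)"
        by (rule \<Phi>C'[OF \<Psi>adm[OF h] 3(1)])
      hence "?\<Phi> (?\<Psi> h) i = (\<pi> z, (snd (h z) + x z) mod r)" unfolding \<Psi>C[OF 3(1)] 3(2) .
      moreover have "(snd (h z) + x z) mod r = snd (h i)"
      proof (rule eq_if_dvd_diff)
        have "r dvd (snd (h z) + x z) mod r - (snd (h z) + x z)" by (simp add: mod_eq_dvd_iff[symmetric])
        from dvd_diff[OF this dvdF[OF h zD(1)]] show "r dvd (snd (h z) + x z) mod r - snd (h i)"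
          unfolding 3(2) by (simp add: algebra_simps)
        show "snd (h i) \<in> {0..<r}" unfolding 3(2) by (rule rgF[OF h zD(2)])
      qed (use r in simp)
      ultimately show ?thesis using F1(2)[OF h 3(1)] 3(2) by (simp add: prod_eq_iff)
    qed
  qed
  \<comment> \<open>The orientations of the exchanged pairs telescope along the whole cycle of
    \<open>a\<close>. In contrast to the half turn, the starting pair comes back with its ends in
    the same order, so the product is 1.\<close>
  have sign: "(\<Prod>i\<in>?D. loc_sign r \<pi> x 1 i (h i)) = 1" if h: "h \<in> ?E" for h
  proof -
    have hb: "fst (h a) = b" and hA: "h \<in> Adm r (invol_cond r \<pi> x) ?D" using h by auto
    let ?e = "\<lambda>i. fst (h i)"
    have ne: "?e i \<noteq> i" if "i \<in> ?C" for i using E1(1)[OF h that] notC that by metis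
    have bij: "bij_betw ?e ?C ?C'"
      by (rule bij_betw_byWitness[where f' = ?e]) (use E1[OF h] E2[OF h] in fastforce)+
    have "(\<Prod>i\<in>?D. loc_sign r \<pi> x 1 i (h i)) =
        (\<Prod>i\<in>?C. loc_sign r \<pi> x 1 i (h i)) * (\<Prod>i\<in>?C'. loc_sign r \<pi> x 1 i (h i))"
      by (rule prod.union_disjoint[OF finC disj])
    also have "(\<Prod>i\<in>?C'. loc_sign r \<pi> x 1 i (h i)) = (\<Prod>i\<in>?C. loc_sign r \<pi> x 1 (?e i) (h (?e i)))"
      by (rule prod.reindex_bij_betw[OF bij, symmetric])
    also have "(\<Prod>i\<in>?C. loc_sign r \<pi> x 1 i (h i)) * \<dots> =
        (\<Prod>i\<in>?C. sgn (int (?e i) - int i) * sgn (int (\<pi> (?e i)) - int (\<pi> i)))"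
      unfolding prod.distrib[symmetric]
    proof (rule prod.cong[OF refl])
      fix i assume i: "i \<in> ?C"
      have "loc_sign r \<pi> x 1 i (h i) * loc_sign r \<pi> x 1 (?e i) (h (?e i)) = inv_sign \<pi> i (?e i) * inv_sign \<pi> (?e i) i"
        using ne[OF i] E1(2)[OF h i] by (simp add: loc_sign_def)
      thus "loc_sign r \<pi> x 1 i (h i) * loc_sign r \<pi> x 1 (?e i) (h (?e i)) =
          sgn (int (?e i) - int i) * sgn (int (\<pi> (?e i)) - int (\<pi> i))"
        using inv_sign_pair[OF inj ne[OF i, symmetric]] by simp
    qed
    also have "\<dots> = (\<Prod>k<m. sgn (int ((\<pi> ^^ k) b) - int ((\<pi> ^^ k) a)) *
        sgn (int ((\<pi> ^^ Suc k) b) - int ((\<pi> ^^ Suc k) a)))"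
      unfolding orb_prod[OF C] invol_orb(1)[OF hA inv aD] hb by simp
    also have "\<dots> = sgn (int ((\<pi> ^^ 0) b) - int ((\<pi> ^^ 0) a)) * sgn (int ((\<pi> ^^ m) b) - int ((\<pi> ^^ m) a))"
    proof (rule prod_telescope)
      fix k
      have "(\<pi> ^^ k) b \<noteq> (\<pi> ^^ k) a"
        using notC[OF funpow_in_orb, of k] funpow_in_orb[of k \<pi> a] by metis
      thus "sgn (int ((\<pi> ^^ k) b) - int ((\<pi> ^^ k) a)) * sgn (int ((\<pi> ^^ k) b) - int ((\<pi> ^^ k) a)) = 1"
        by (simp add: sgn_if)
    qed
    \<comment> \<open>The length of the second cycle is only known as \<open>m'\<close>, but
      \<open>h\<close> commutes with \<pi>, so \<open>m\<close> is a period of \<open>b\<close>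
      too.\<close>
    also have "(\<pi> ^^ m) b = b"
    proof -
      have "(\<pi> ^^ m) a = a" using C by (simp add: cyc_def)
      thus ?thesis using invol_orb(1)[OF hA inv aD, of m] hb by simp
    qed
    also have "(\<pi> ^^ m) a = a" using C by (simp add: cyc_def)
    also have "sgn (int ((\<pi> ^^ 0) b) - int ((\<pi> ^^ 0) a)) * sgn (int b - int a) = 1"
      using b self_in_orb[of a \<pi>] by (auto simp: sgn_if)
    finally show ?thesis .
  qed
  show ?thesis
    unfolding adm_sum_at_def
  proof (rule sum.reindex_bij_witness[where i = ?\<Psi> and j = ?\<Phi>])
    fix h assume h: "h \<in> ?E"
    show "?\<Psi> (?\<Phi> h) = h" by (rule \<Psi>\<Phi>[OF h])
    show "?\<Phi> h \<in> ?F" by (rule \<Phi>adm[OF h])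
    show "(\<Prod>i\<in>?D. 1) = (\<Prod>i\<in>?D. loc_sign r \<pi> x 1 i (h i))" using sign[OF h] by simp
  next
    fix h assume h: "h \<in> ?F"
    show "?\<Phi> (?\<Psi> h) = h" by (rule \<Phi>\<Psi>[OF h])
    show "?\<Psi> h \<in> ?E" by (rule \<Psi>adm[OF h])
  qed
qed

section \<open>Assembling the cycles\<close>

lemma invariant_union:
  assumes inj: "inj \<pi>" and D: "D \<subseteq> A" "\<pi> ` D = D" and A: "\<pi> ` A \<subseteq> A"
  shows "\<pi> ` (A - D) \<subseteq> A - D"
proof
  fix j assume "j \<in> \<pi> ` (A - D)"
  then obtain i where i: "j = \<pi> i" "i \<in> A" "i \<notin> D" by blast
  have "\<pi> i \<notin> D" using i(3) D(2) inj by (metis inj_image_mem_iff)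
  thus "j \<in> A - D" using i A by blast
qed

text \<open>Both sums are sorted by the image \<open>b\<close> of a base point \<open>a\<close>.
  Removing the cycles of \<open>a\<close> and \<open>b\<close> leaves a smaller invariant set, on
  which the sums agree by induction.\<close>

theorem invol_sum_eq_sqrt_sum:
  assumes "finite A" "\<pi> ` A \<subseteq> A" and r: "even r" "0 < r" and inj: "inj \<pi>"
  shows "adm_sum r (invol_cond r \<pi> x) (loc_sign r \<pi> x 1) A = adm_sum r (sqrt_cond r \<pi> x) (\<lambda>_ _. 1) A"
  using assms(1,2)
proof (induction A rule: finite_psubset_induct)
  case (psubset A)
  let ?E = "adm_sum r (invol_cond r \<pi> x) (loc_sign r \<pi> x 1)" and ?F = "adm_sum r (sqrt_cond r \<pi> x) (\<lambda>_ _. 1)"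
  let ?Eat = "adm_sum_at r (invol_cond r \<pi> x) (loc_sign r \<pi> x 1)"
  let ?Fat = "adm_sum_at r (sqrt_cond r \<pi> x) (\<lambda>_ _. 1)"
  note fin = psubset.hyps and inv = psubset.prems
  show ?case
  proof (cases "A = {}")
    case True
    thus ?thesis by (simp add: adm_sum_def Adm_def)
  next
    case False
    then obtain a where a: "a \<in> A" by blast
    obtain m where C: "cyc \<pi> a m" using cyc_exists[OF inj fin inv a] .
    let ?C = "orb \<pi> a"
    have CA: "?C \<subseteq> A" by (rule orb_subset[OF inv a])
    have \<pi>C: "\<pi> ` ?C = ?C" by (rule image_orb[OF C])
    have split: "?Eat A a b = ?Eat (?C \<union> orb \<pi> b) a b * ?E (A - (?C \<union> orb \<pi> b))"
      "?Fat A a b = ?Fat (?C \<union> orb \<pi> b) a b * ?F (A - (?C \<union> orb \<pi> b))"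
      "?E (A - (?C \<union> orb \<pi> b)) = ?F (A - (?C \<union> orb \<pi> b))" if b: "b \<in> A" for b
    proof -
      let ?D = "?C \<union> orb \<pi> b"
      obtain m' where C': "cyc \<pi> b m'" using cyc_exists[OF inj fin inv b] .
      have DA: "?D \<subseteq> A" using CA orb_subset[OF inv b] by blast
      have \<pi>D: "\<pi> ` ?D = ?D" using \<pi>C image_orb[OF C'] by (simp add: image_Un)
      have \<pi>D': "\<pi> ` (A - ?D) \<subseteq> A - ?D" by (rule invariant_union[OF inj DA \<pi>D inv])
      have aD: "a \<in> ?D" using self_in_orb by fast
      show "?Eat A a b = ?Eat ?D a b * ?E (A - ?D)"
        by (rule adm_sum_at_split[OF local_invol_cond fin DA equalityD1[OF \<pi>D] \<pi>D' aD])
          (use invol_preserves[OF _ inv a] in blast)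
      show "?Fat A a b = ?Fat ?D a b * ?F (A - ?D)"
      proof (rule adm_sum_at_split[OF local_sqrt_cond fin DA equalityD1[OF \<pi>D] \<pi>D' aD])
        fix h i assume h: "h \<in> Adm r (sqrt_cond r \<pi> x) A" "fst (h a) = b" "i \<in> A"
        show "fst (h i) \<in> ?D \<longleftrightarrow> i \<in> ?D"
          by (rule sqrt_preserves[OF h(1) inv a h(3) inj _ \<pi>D]) (simp add: h(2))
      qed
      show "?E (A - ?D) = ?F (A - ?D)"
        by (rule psubset.IH[OF _ \<pi>D']) (use aD a in blast)
    qed
    \<comment> \<open>Inside the cycle of \<open>a\<close> the fibres agree only in total: for even
      length the identity and the half turn cancel each other, and for odd length identity and root
      sit over different \<open>b\<close>.\<close>
    have inC: "(\<Sum>b\<in>?C. ?Eat A a b) = (\<Sum>b\<in>?C. ?Fat A a b)"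
    proof -
      have D: "?C \<union> orb \<pi> b = ?C" if "b \<in> ?C" for b using cyc_in_orb(2)[OF C inj that] by simp
      have E: "?Eat A a b = ?Eat ?C a b * ?F (A - ?C)" and F: "?Fat A a b = ?Fat ?C a b * ?F (A - ?C)"
        if b: "b \<in> ?C" for b
      proof -
        have bA: "b \<in> A" using b CA by blast
        show "?Eat A a b = ?Eat ?C a b * ?F (A - ?C)" "?Fat A a b = ?Fat ?C a b * ?F (A - ?C)"
          using split[OF bA] unfolding D[OF b] by (simp_all only:)
      qed
      have fC: "finite ?C" using CA fin finite_subset by blast
      have "(\<Sum>b\<in>?C. ?Eat A a b) = (\<Sum>b\<in>?C. ?Eat ?C a b * ?F (A - ?C))"
        by (rule sum.cong[OF refl]) (rule E)
      also have "\<dots> = ?E ?C * ?F (A - ?C)"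
        unfolding adm_sum_fibres[OF fC self_in_orb] sum_distrib_right ..
      also have "\<dots> = ?F ?C * ?F (A - ?C)" unfolding cycle_sums_agree[OF r C inj] ..
      also have "\<dots> = (\<Sum>b\<in>?C. ?Fat ?C a b * ?F (A - ?C))"
        unfolding adm_sum_fibres[OF fC self_in_orb] sum_distrib_right ..
      also have "\<dots> = (\<Sum>b\<in>?C. ?Fat A a b)"
        by (rule sum.cong[OF refl]) (rule F[symmetric])
      finally show ?thesis .
    qed
    \<comment> \<open>Outside the cycle of \<open>a\<close> the fibres agree one by one.\<close>
    have outC: "(\<Sum>b\<in>A - ?C. ?Eat A a b) = (\<Sum>b\<in>A - ?C. ?Fat A a b)"
    proof (rule sum.cong[OF refl])
      fix b assume b: "b \<in> A - ?C"
      hence bA: "b \<in> A" and bC: "b \<notin> ?C" by auto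
      obtain m' where C': "cyc \<pi> b m'" using cyc_exists[OF inj fin inv bA] .
      show "?Eat A a b = ?Fat A a b"
        unfolding split(1,2)[OF bA] split(3)[OF bA] exchanged_cycles_agree[OF r(2) inj C C' bC] ..
    qed
    have "?E A = (\<Sum>b\<in>A - ?C. ?Eat A a b) + (\<Sum>b\<in>?C. ?Eat A a b)"
      unfolding adm_sum_fibres[OF fin a] by (rule sum.subset_diff[OF CA fin])
    also have "\<dots> = (\<Sum>b\<in>A - ?C. ?Fat A a b) + (\<Sum>b\<in>?C. ?Fat A a b)" using inC outC by simp
    also have "\<dots> = ?F A"
      unfolding adm_sum_fibres[OF fin a] by (rule sum.subset_diff[OF CA fin, symmetric])
    finally show ?thesis .
  qed
qed

text \<open>The encoded \<open>k\<close> satisfies \<open>k g = g\<^sup>T k\<close>.\<close>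

definition reverse_cond :: "int \<Rightarrow> (nat \<Rightarrow> nat) \<Rightarrow> (nat \<Rightarrow> int) \<Rightarrow> (nat \<Rightarrow> nat \<times> int) \<Rightarrow> nat \<Rightarrow> bool" where
  "reverse_cond r \<pi> x h i \<longleftrightarrow> fst (h (fst (h i))) = i \<and> \<pi> (fst (h (\<pi> i))) = fst (h i) \<and>
     r dvd snd (h (\<pi> i)) - snd (h i) - (x (fst (h (\<pi> i))) - x i)"

lemma local_reverse_cond: "local_cond \<pi> (reverse_cond r \<pi> x)"
  by (simp add: local_cond_def reverse_cond_def)

text \<open>The reflection \<theta> sends the iterate \<open>k\<close> of \<open>a\<close> to the
  iterate \<open>-k\<close> and so conjugates \<pi> to its inverse. Its colours solve a difference
  equation whose increments sum to 0.\<close>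

lemma reverse_cond_cycle:
  assumes C: "cyc \<pi> a m" and r: "0 < r"
  shows "Adm r (reverse_cond r \<pi> x) (orb \<pi> a) \<noteq> {}"
proof -
  let ?C = "orb \<pi> a"
  have m: "0 < m" and inj: "inj_on (\<lambda>k. (\<pi> ^^ k) a) {..<m}" using C by (auto simp: cyc_def)
  \<comment> \<open>The exponent is the negative of the position of \<open>i\<close>, kept natural
    by adding \<open>m\<close>.\<close>
  define \<theta> where "\<theta> i = (\<pi> ^^ (m - the_inv_into {..<m} (\<lambda>k. (\<pi> ^^ k) a) i)) a" for i
  have \<theta>: "\<theta> ((\<pi> ^^ k) a) = (\<pi> ^^ e) a" if "m dvd e + k" for e k
  proof -
    let ?k = "k mod m"
    have "(\<pi> ^^ k) a = (\<pi> ^^ ?k) a" unfolding cyc_funpow_eq_iff[OF C] by simp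
    moreover have "the_inv_into {..<m} (\<lambda>k. (\<pi> ^^ k) a) ((\<pi> ^^ ?k) a) = ?k"
      by (rule the_inv_into_f_f[OF inj]) (use m in simp)
    ultimately have 1: "\<theta> ((\<pi> ^^ k) a) = (\<pi> ^^ (m - ?k)) a" by (simp add: \<theta>_def)
    have "[e + ?k = 0] (mod m)" using that by (simp add: cong_def mod_add_right_eq mod_eq_0_iff_dvd)
    moreover have "[(m - ?k) + ?k = 0] (mod m)" using m by (simp add: cong_def mod_less_divisor less_imp_le)
    ultimately have "[(m - ?k) + ?k = e + ?k] (mod m)" by (metis cong_sym cong_trans)
    hence "(m - ?k) mod m = e mod m" by (simp only: cong_add_rcancel_nat) (simp add: cong_def)
    thus ?thesis unfolding 1 cyc_funpow_eq_iff[OF C] .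
  qed
  have neg: "\<exists>e. m dvd e + k" for k
    by (rule exI[of _ "k * m - k"]) (use m in simp)
  have \<theta>C: "\<theta> i \<in> ?C" if i: "i \<in> ?C" for i
  proof -
    from i obtain k where k: "i = (\<pi> ^^ k) a" by (rule orb_cases)
    obtain e where "m dvd e + k" using neg by blast
    from \<theta>[OF this] show ?thesis unfolding k using funpow_in_orb by metis
  qed
  have \<theta>\<theta>: "\<theta> (\<theta> i) = i" if i: "i \<in> ?C" for i
  proof -
    from i obtain k where k: "i = (\<pi> ^^ k) a" by (rule orb_cases)
    obtain e where e: "m dvd e + k" using neg by blast
    have e': "m dvd k + e" using e by (simp add: add.commute)
    show ?thesis unfolding k \<theta>[OF e] \<theta>[OF e'] ..
  qed
  have \<pi>\<theta>: "\<pi> (\<theta> (\<pi> i)) = \<theta> i" if i: "i \<in> ?C" for i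
  proof -
    from i obtain k where k: "i = (\<pi> ^^ k) a" by (rule orb_cases)
    obtain e where e: "m dvd e + Suc k" using neg by blast
    have e': "m dvd Suc e + k" using e by simp
    have "\<pi> i = (\<pi> ^^ Suc k) a" by (simp add: k)
    hence "\<theta> (\<pi> i) = (\<pi> ^^ e) a" using \<theta>[OF e] by simp
    moreover have "\<theta> i = (\<pi> ^^ Suc e) a" unfolding k by (rule \<theta>[OF e'])
    ultimately show ?thesis by simp
  qed
  let ?c = "\<lambda>i. x (\<theta> (\<pi> i)) - x i"
  \<comment> \<open>The composition of \<theta> with \<pi> is again a reflection, so it permutes the
    points of the cycle and the increments cancel in the sum.\<close>
  have "(\<Sum>i\<in>?C. x (\<theta> (\<pi> i))) = (\<Sum>i\<in>?C. x i)"
  proof (rule sum.reindex_bij_witness[where i = "\<lambda>i. \<theta> (\<pi> i)" and j = "\<lambda>i. \<theta> (\<pi> i)"])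
    fix i assume i: "i \<in> ?C"
    have \<pi>i: "\<pi> i \<in> ?C" by (rule orb_closed[OF i])
    have t: "\<theta> (\<pi> (\<theta> (\<pi> i))) = i" using \<pi>\<theta>[OF i] \<theta>\<theta>[OF i] by simp
    show "\<theta> (\<pi> (\<theta> (\<pi> i))) = i" "\<theta> (\<pi> (\<theta> (\<pi> i))) = i" by (fact t)+
    show "\<theta> (\<pi> i) \<in> ?C" "\<theta> (\<pi> i) \<in> ?C" by (fact \<theta>C[OF \<pi>i])+
  qed simp
  hence "r dvd (\<Sum>i\<in>?C. ?c i)" by (simp add: sum_subtractf)
  from bij_betw_imp_surj_on[OF cyc_sols_bij[OF C r this]] r
  obtain y where y: "y \<in> cyc_sols r \<pi> a ?c" by (metis atLeastLessThan_iff empty_iff ex_in_conv image_is_empty order_refl)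
  hence yP: "y \<in> ?C \<rightarrow>\<^sub>E {0..<r}" by (simp add: cyc_sols_def)
  have "(\<lambda>i\<in>?C. (\<theta> i, y i)) \<in> Adm r (reverse_cond r \<pi> x) ?C" (is "?h \<in> _")
  proof (rule AdmI)
    fix i assume i: "i \<in> ?C"
    show "fst (?h i) \<in> ?C" "snd (?h i) \<in> {0..<r}" using i \<theta>C[OF i] PiE_mem[OF yP i] by simp_all
    have "r dvd y (\<pi> i) - y i - ?c i" using y i by (simp add: cyc_sols_def)
    thus "reverse_cond r \<pi> x ?h i"
      using i \<theta>C[OF i] \<theta>\<theta>[OF i] \<pi>\<theta>[OF i] orb_closed[OF i] by (simp add: reverse_cond_def)
  qed simp
  thus ?thesis by blast
qed

lemma reverse_cond_exists:
  assumes "finite A" "\<pi> ` A \<subseteq> A" and r: "0 < r" and inj: "inj \<pi>"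
  shows "Adm r (reverse_cond r \<pi> x) A \<noteq> {}"
  using assms(1,2)
proof (induction A rule: finite_psubset_induct)
  case (psubset A)
  note fin = psubset.hyps and inv = psubset.prems
  show ?case
  proof (cases "A = {}")
    case True
    thus ?thesis by (simp add: Adm_def)
  next
    case False
    then obtain a where a: "a \<in> A" by blast
    obtain m where C: "cyc \<pi> a m" using cyc_exists[OF inj fin inv a] .
    have CA: "orb \<pi> a \<subseteq> A" by (rule orb_subset[OF inv a])
    have inv': "\<pi> ` (A - orb \<pi> a) \<subseteq> A - orb \<pi> a" by (rule invariant_union[OF inj CA image_orb[OF C] inv])
    have "Adm r (reverse_cond r \<pi> x) (A - orb \<pi> a) \<noteq> {}"
      by (rule psubset.IH[OF _ inv']) (use self_in_orb[of a \<pi>] a in blast)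
    then obtain h1 h2 where "h1 \<in> Adm r (reverse_cond r \<pi> x) (orb \<pi> a)" "h2 \<in> Adm r (reverse_cond r \<pi> x) (A - orb \<pi> a)"
      using reverse_cond_cycle[OF C r] by blast
    from Adm_glue[OF local_reverse_cond CA equalityD1[OF image_orb[OF C]] inv' this] show ?thesis by blast
  qed
qed

section \<open>The groups G(r,p,n)\<close>

lemma wreath_carrier_iff:
  assumes "0 < r"
  shows "(x, \<pi>) \<in> carrier (wreath r n) \<longleftrightarrow> x \<in> {1..n} \<rightarrow>\<^sub>E {0..<int r} \<and> \<pi> permutes {1..n}"
  using assms by (simp add: wreath_def carrier_integer_mod_group sym_group_carrier)

lemma wreath_mult:
  assumes "\<sigma> permutes {1..n}"
  shows "(x, \<pi>) \<otimes>\<^bsub>wreath r n\<^esub> (y, \<sigma>) = (\<lambda>i\<in>{1..n}. (x (\<sigma> i) + y i) mod int r, \<pi> \<circ> \<sigma>)"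
  using assms
  by (auto simp: wreath_def perm_act_def inv_inv_eq[OF permutes_bij[OF assms]] intro!: restrict_ext)

lemma wreath_one: "\<one>\<^bsub>wreath r n\<^esub> = (\<lambda>i\<in>{1..n}. 0, id)"
  by (simp add: wreath_def)

context
  fixes r n :: nat
  assumes r_pos: "0 < r"
begin

lemma wreath_inverse_pair:
  assumes "\<pi> permutes {1..n}"
  shows "(\<lambda>i\<in>{1..n}. (- x (inv_into UNIV \<pi> i)) mod int r, inv_into UNIV \<pi>) \<otimes>\<^bsub>wreath r n\<^esub> (x, \<pi>) = \<one>\<^bsub>wreath r n\<^esub>"
proof -
  have "(\<lambda>i\<in>{1..n}. ((\<lambda>i\<in>{1..n}. (- x (inv_into UNIV \<pi> i)) mod int r) (\<pi> i) + x i) mod int r) =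
      (\<lambda>i\<in>{1..n}. 0)"
  proof (rule restrict_ext)
    fix i assume i: "i \<in> {1..n}"
    have "\<pi> i \<in> {1..n}" using i permutes_in_image[OF assms] by blast
    thus "((\<lambda>i\<in>{1..n}. (- x (inv_into UNIV \<pi> i)) mod int r) (\<pi> i) + x i) mod int r = 0"
      by (simp add: permutes_inverses(2)[OF assms] mod_simps)
  qed
  thus ?thesis unfolding wreath_mult[OF assms] wreath_one by (simp add: permutes_inv_o(2)[OF assms])
qed

lemma wreath_inverse_closed:
  assumes "\<pi> permutes {1..n}"
  shows "(\<lambda>i\<in>{1..n}. (- x (inv_into UNIV \<pi> i)) mod int r, inv_into UNIV \<pi>) \<in> carrier (wreath r n)"
  unfolding wreath_carrier_iff[OF r_pos] using r_pos permutes_inv[OF assms] by simp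

lemma group_wreath: "group (wreath r n)"
proof (rule groupI)
  fix g h assume g: "g \<in> carrier (wreath r n)" and h: "h \<in> carrier (wreath r n)"
  obtain x \<pi> y \<sigma> where e: "g = (x, \<pi>)" "h = (y, \<sigma>)" by (cases g, cases h)
  show "g \<otimes>\<^bsub>wreath r n\<^esub> h \<in> carrier (wreath r n)"
    using g h r_pos unfolding e wreath_carrier_iff[OF r_pos]
    by (simp add: wreath_mult wreath_carrier_iff permutes_compose)
  fix k assume k: "k \<in> carrier (wreath r n)"
  obtain z \<tau> where k': "k = (z, \<tau>)" by (cases k)
  have p: "\<pi> permutes {1..n}" "\<sigma> permutes {1..n}" "\<tau> permutes {1..n}"
    using g h k unfolding e k' wreath_carrier_iff[OF r_pos] by auto
  have "(\<lambda>i\<in>{1..n}. ((\<lambda>i\<in>{1..n}. (x (\<sigma> i) + y i) mod int r) (\<tau> i) + z i) mod int r) =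
      (\<lambda>i\<in>{1..n}. (x ((\<sigma> \<circ> \<tau>) i) + (\<lambda>i\<in>{1..n}. (y (\<tau> i) + z i) mod int r) i) mod int r)"
  proof (rule restrict_ext)
    fix i assume i: "i \<in> {1..n}"
    have "\<tau> i \<in> {1..n}" using i permutes_in_image[OF p(3)] by blast
    thus "((\<lambda>i\<in>{1..n}. (x (\<sigma> i) + y i) mod int r) (\<tau> i) + z i) mod int r =
        (x ((\<sigma> \<circ> \<tau>) i) + (\<lambda>i\<in>{1..n}. (y (\<tau> i) + z i) mod int r) i) mod int r"
      using i by (simp add: mod_simps add.assoc)
  qed
  thus "g \<otimes>\<^bsub>wreath r n\<^esub> h \<otimes>\<^bsub>wreath r n\<^esub> k = g \<otimes>\<^bsub>wreath r n\<^esub> (h \<otimes>\<^bsub>wreath r n\<^esub> k)"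
    unfolding e k' wreath_mult[OF p(2)] wreath_mult[OF p(3)] wreath_mult[OF permutes_compose[OF p(3) p(2)]]
    by (simp add: comp_assoc)
next
  show "\<one>\<^bsub>wreath r n\<^esub> \<in> carrier (wreath r n)"
    unfolding wreath_one wreath_carrier_iff[OF r_pos] using r_pos by (simp add: permutes_id)
next
  fix g assume g: "g \<in> carrier (wreath r n)"
  obtain x \<pi> where e: "g = (x, \<pi>)" by (cases g)
  have x: "x \<in> {1..n} \<rightarrow>\<^sub>E {0..<int r}" and \<pi>: "\<pi> permutes {1..n}"
    using g unfolding e wreath_carrier_iff[OF r_pos] by auto
  have "(\<lambda>i\<in>{1..n}. ((\<lambda>i\<in>{1..n}. 0) (\<pi> i) + x i) mod int r) = x"
  proof (rule PiE_ext[OF _ x])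
    fix i assume i: "i \<in> {1..n}"
    have "\<pi> i \<in> {1..n}" using i permutes_in_image[OF \<pi>] by blast
    thus "(\<lambda>i\<in>{1..n}. ((\<lambda>i\<in>{1..n}. 0) (\<pi> i) + x i) mod int r) i = x i"
      using i PiE_mem[OF x i] by simp
  qed (use r_pos in simp)
  thus "\<one>\<^bsub>wreath r n\<^esub> \<otimes>\<^bsub>wreath r n\<^esub> g = g" unfolding e wreath_one wreath_mult[OF \<pi>] by simp
  show "\<exists>h\<in>carrier (wreath r n). h \<otimes>\<^bsub>wreath r n\<^esub> g = \<one>\<^bsub>wreath r n\<^esub>"
    unfolding e using wreath_inverse_pair[OF \<pi>] wreath_inverse_closed[OF \<pi>] by blast
qed

lemma wreath_inv:
  assumes "(x, \<pi>) \<in> carrier (wreath r n)"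
  shows "inv\<^bsub>wreath r n\<^esub> (x, \<pi>) = (\<lambda>i\<in>{1..n}. (- x (inv_into UNIV \<pi> i)) mod int r, inv_into UNIV \<pi>)"
proof -
  have "\<pi> permutes {1..n}" using assms unfolding wreath_carrier_iff[OF r_pos] by simp
  from group.inv_equality[OF group_wreath wreath_inverse_pair[OF this] assms wreath_inverse_closed[OF this]]
  show ?thesis .
qed

lemma transp_pair:
  assumes "(x, \<pi>) \<in> carrier (wreath r n)"
  shows "transp r n (x, \<pi>) = (\<lambda>i\<in>{1..n}. x (inv_into UNIV \<pi> i), inv_into UNIV \<pi>)"
proof -
  have x: "x \<in> {1..n} \<rightarrow>\<^sub>E {0..<int r}" and \<pi>: "\<pi> permutes {1..n}"
    using assms unfolding wreath_carrier_iff[OF r_pos] by auto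
  have "(\<lambda>i\<in>{1..n}. inv\<^bsub>integer_mod_group r\<^esub> ((\<lambda>i\<in>{1..n}. (- x (inv_into UNIV \<pi> i)) mod int r) i)) =
      (\<lambda>i\<in>{1..n}. x (inv_into UNIV \<pi> i))"
  proof (rule restrict_ext)
    fix i assume i: "i \<in> {1..n}"
    have "inv_into UNIV \<pi> i \<in> {1..n}" using i permutes_in_image[OF permutes_inv[OF \<pi>]] by blast
    hence "x (inv_into UNIV \<pi> i) \<in> {0..<int r}" by (rule PiE_mem[OF x])
    moreover have "(- x (inv_into UNIV \<pi> i)) mod int r \<in> carrier (integer_mod_group r)"
      using r_pos by (simp add: carrier_integer_mod_group)
    ultimately show "inv\<^bsub>integer_mod_group r\<^esub> ((\<lambda>i\<in>{1..n}. (- x (inv_into UNIV \<pi> i)) mod int r) i) =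
        x (inv_into UNIV \<pi> i)"
      using i by (simp add: mod_minus_eq)
  qed
  thus ?thesis unfolding transp_def bar_def wreath_inv[OF assms] color_def perm_of_def by simp
qed

lemma transp_closed:
  assumes "g \<in> carrier (wreath r n)"
  shows "transp r n g \<in> carrier (wreath r n)"
proof -
  obtain x \<pi> where e: "g = (x, \<pi>)" by (cases g)
  have x: "x \<in> {1..n} \<rightarrow>\<^sub>E {0..<int r}" and \<pi>: "\<pi> permutes {1..n}"
    using assms unfolding e wreath_carrier_iff[OF r_pos] by auto
  have "x (inv_into UNIV \<pi> i) \<in> {0..<int r}" if "i \<in> {1..n}" for i
    using that permutes_in_image[OF permutes_inv[OF \<pi>]] by (intro PiE_mem[OF x]) blast
  thus ?thesis
    unfolding e transp_pair[OF assms[unfolded e]] wreath_carrier_iff[OF r_pos] using permutes_inv[OF \<pi>] by simp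
qed

lemma transp_transp:
  assumes "g \<in> carrier (wreath r n)"
  shows "transp r n (transp r n g) = g"
proof -
  obtain x \<pi> where e: "g = (x, \<pi>)" by (cases g)
  have x: "x \<in> {1..n} \<rightarrow>\<^sub>E {0..<int r}" and \<pi>: "\<pi> permutes {1..n}"
    using assms unfolding e wreath_carrier_iff[OF r_pos] by auto
  have ii: "inv_into UNIV (inv_into UNIV \<pi>) = \<pi>" by (rule inv_inv_eq[OF permutes_bij[OF \<pi>]])
  note t = transp_closed[OF assms, unfolded e transp_pair[OF assms[unfolded e]]]
  have "(\<lambda>i\<in>{1..n}. (\<lambda>i\<in>{1..n}. x (inv_into UNIV \<pi> i)) (\<pi> i)) = x"
  proof
    fix i
    show "(\<lambda>i\<in>{1..n}. (\<lambda>i\<in>{1..n}. x (inv_into UNIV \<pi> i)) (\<pi> i)) i = x i"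
      using PiE_arb[OF x, of i] permutes_in_image[OF \<pi>, of i]
      by (cases "i \<in> {1..n}") (simp_all add: permutes_inverses(2)[OF \<pi>])
  qed
  thus ?thesis unfolding e transp_pair[OF assms[unfolded e]] transp_pair[OF t] ii by simp
qed

lemma transp_mult:
  assumes "g \<in> carrier (wreath r n)" "h \<in> carrier (wreath r n)"
  shows "transp r n (g \<otimes>\<^bsub>wreath r n\<^esub> h) = transp r n h \<otimes>\<^bsub>wreath r n\<^esub> transp r n g"
proof -
  obtain x \<pi> y \<sigma> where e: "g = (x, \<pi>)" "h = (y, \<sigma>)" by (cases g, cases h)
  have x: "x \<in> {1..n} \<rightarrow>\<^sub>E {0..<int r}" and \<pi>: "\<pi> permutes {1..n}"
    and y: "y \<in> {1..n} \<rightarrow>\<^sub>E {0..<int r}" and \<sigma>: "\<sigma> permutes {1..n}"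
    using assms unfolding e wreath_carrier_iff[OF r_pos] by auto
  have gh: "g \<otimes>\<^bsub>wreath r n\<^esub> h \<in> carrier (wreath r n)"
    using group.is_monoid[OF group_wreath] assms by (simp add: monoid.m_closed)
  have ic: "inv_into UNIV (\<pi> \<circ> \<sigma>) = inv_into UNIV \<sigma> \<circ> inv_into UNIV \<pi>"
    by (rule o_inv_distrib[OF permutes_bij[OF \<pi>] permutes_bij[OF \<sigma>]])
  have "(\<lambda>i\<in>{1..n}. (\<lambda>i\<in>{1..n}. (x (\<sigma> i) + y i) mod int r) (inv_into UNIV (\<pi> \<circ> \<sigma>) i)) =
      (\<lambda>i\<in>{1..n}. ((\<lambda>i\<in>{1..n}. y (inv_into UNIV \<sigma> i)) (inv_into UNIV \<pi> i) +
        (\<lambda>i\<in>{1..n}. x (inv_into UNIV \<pi> i)) i) mod int r)"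
  proof (rule restrict_ext)
    fix i assume i: "i \<in> {1..n}"
    have 1: "inv_into UNIV \<pi> i \<in> {1..n}" using i permutes_in_image[OF permutes_inv[OF \<pi>]] by blast
    have 2: "inv_into UNIV \<sigma> (inv_into UNIV \<pi> i) \<in> {1..n}" using 1 permutes_in_image[OF permutes_inv[OF \<sigma>]] by blast
    show "(\<lambda>i\<in>{1..n}. (x (\<sigma> i) + y i) mod int r) (inv_into UNIV (\<pi> \<circ> \<sigma>) i) =
        ((\<lambda>i\<in>{1..n}. y (inv_into UNIV \<sigma> i)) (inv_into UNIV \<pi> i) +
          (\<lambda>i\<in>{1..n}. x (inv_into UNIV \<pi> i)) i) mod int r"
      unfolding ic using i 1 2 by (simp add: permutes_inverses(1)[OF \<sigma>] add.commute)
  qed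
  thus ?thesis
    using gh[unfolded e wreath_mult[OF \<sigma>]]
    unfolding e wreath_mult[OF \<sigma>] transp_pair[OF assms(1)[unfolded e]] transp_pair[OF assms(2)[unfolded e]]
      wreath_mult[OF permutes_inv[OF \<pi>]]
    by (simp add: transp_pair ic)
qed

lemma finite_wreath: "finite (carrier (wreath r n))"
proof -
  have "carrier (wreath r n) = ({1..n} \<rightarrow>\<^sub>E {0..<int r}) \<times> {\<pi>. \<pi> permutes {1..n}}"
    using wreath_carrier_iff[OF r_pos] by auto
  thus ?thesis by (simp add: finite_PiE finite_permutations)
qed

end

section \<open>Colour sums modulo divisors of \<open>r\<close>\<close>

definition col_sum :: "nat \<Rightarrow> (nat \<Rightarrow> int) \<Rightarrow> int" where
  "col_sum n x = (\<Sum>i\<in>{1..n}. x i)"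

text \<open>Since \<open>m\<close> divides \<open>r\<close>, divisibility by \<open>m\<close> does
  not depend on the representative modulo \<open>r\<close>. From here on conditions on
  \<open>Delta\<close> are divisibility statements about unreduced integer sums.\<close>

lemma residue_multiples_iff:
  assumes "0 < r" "m dvd r"
  shows "s mod int r \<in> residue_multiples m r \<longleftrightarrow> int m dvd s"
proof
  assume "s mod int r \<in> residue_multiples m r"
  then obtain a where "s mod int r = (int m * a) mod int r" by (auto simp: residue_multiples_def)
  hence "int r dvd s - int m * a" by (simp add: mod_eq_dvd_iff)
  hence "int m dvd s - int m * a" using assms(2) by (meson dvd_trans int_dvd_int_iff)
  thus "int m dvd s" by (simp add: dvd_diff_right_iff dvd_diff_left_iff)
next
  assume "int m dvd s"
  then obtain a where a: "s = int m * a" by (auto simp: dvd_def)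
  have "s mod int r = (int m * (a mod int r)) mod int r" by (simp add: a mod_mult_right_eq)
  moreover have "a mod int r \<in> carrier (integer_mod_group r)" using assms(1) by (simp add: carrier_integer_mod_group)
  ultimately show "s mod int r \<in> residue_multiples m r" unfolding residue_multiples_def by (rule image_eqI)
qed

lemma Delta_pair: "Delta r n (x, \<pi>) = col_sum n x mod int r"
  by (simp add: Delta_def color_def col_sum_def)

lemma col_sum_mod:
  assumes "int m dvd int r" "\<And>i. i \<in> {1..n} \<Longrightarrow> int r dvd x i - y i"
  shows "int m dvd col_sum n x \<longleftrightarrow> int m dvd col_sum n y"
proof -
  have "int m dvd col_sum n x - col_sum n y"
    unfolding col_sum_def sum_subtractf[symmetric] using assms by (intro dvd_sum) (blast intro: dvd_trans)
  thus ?thesis by (metis dvd_diff_commute dvd_diffD dvd_diff_right_iff dvd_diff_left_iff diff_add_cancel dvd_add)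
qed

lemma col_sum_permute: "\<sigma> permutes {1..n} \<Longrightarrow> col_sum n (\<lambda>i. x (\<sigma> i)) = col_sum n x"
  unfolding col_sum_def by (rule sum.permute[symmetric, unfolded comp_def])

lemma mod_dvd_diff: "(k::int) dvd a mod k - a"
  by (simp add: mod_eq_dvd_iff[symmetric])

lemma Grpn_carrier_iff:
  assumes "0 < r" "p dvd r"
  shows "g \<in> carrier (Grpn r p n) \<longleftrightarrow> g \<in> carrier (wreath r n) \<and> int p dvd col_sum n (fst g)"
  using residue_multiples_iff[OF assms] by (cases g) (simp add: Grpn_def Delta_pair)

lemma Grpn_mult: "g \<otimes>\<^bsub>Grpn r p n\<^esub> h = g \<otimes>\<^bsub>wreath r n\<^esub> h"
  by (simp add: Grpn_def)

lemma Grpn_one: "\<one>\<^bsub>Grpn r p n\<^esub> = \<one>\<^bsub>wreath r n\<^esub>"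
  by (simp add: Grpn_def)

lemma col_sum_mult:
  assumes "\<sigma> permutes {1..n}" "m dvd r"
  shows "int m dvd col_sum n (fst ((x, \<pi>) \<otimes>\<^bsub>wreath r n\<^esub> (y, \<sigma>))) \<longleftrightarrow> int m dvd col_sum n x + col_sum n y"
proof -
  have "int m dvd col_sum n (fst ((x, \<pi>) \<otimes>\<^bsub>wreath r n\<^esub> (y, \<sigma>))) \<longleftrightarrow> int m dvd col_sum n (\<lambda>i. x (\<sigma> i) + y i)"
    unfolding wreath_mult[OF assms(1)] fst_conv
    by (rule col_sum_mod[where r = r]) (use assms(2) in \<open>simp_all only: restrict_apply' mod_dvd_diff int_dvd_int_iff\<close>)
  also have "col_sum n (\<lambda>i. x (\<sigma> i) + y i) = col_sum n x + col_sum n y"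
    using col_sum_permute[OF assms(1), of x] by (simp add: col_sum_def sum.distrib)
  finally show ?thesis .
qed

context
  fixes r p n :: nat
  assumes r_pos: "0 < r" and p_dvd: "p dvd r"
begin

lemma subgroup_Grpn: "subgroup (carrier (Grpn r p n)) (wreath r n)"
proof (rule group.subgroupI[OF group_wreath[OF r_pos]])
  show "carrier (Grpn r p n) \<subseteq> carrier (wreath r n)" by (auto simp: Grpn_carrier_iff[OF r_pos p_dvd])
  have "\<one>\<^bsub>wreath r n\<^esub> \<in> carrier (wreath r n)" using group_wreath[OF r_pos] group.is_monoid monoid.one_closed by blast
  hence "\<one>\<^bsub>wreath r n\<^esub> \<in> carrier (Grpn r p n)"
    by (simp add: Grpn_carrier_iff[OF r_pos p_dvd] wreath_one col_sum_def)
  thus "carrier (Grpn r p n) \<noteq> {}" by blast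
next
  fix g assume g: "g \<in> carrier (Grpn r p n)"
  obtain x \<pi> where e: "g = (x, \<pi>)" by (cases g)
  have gW: "(x, \<pi>) \<in> carrier (wreath r n)" and s: "int p dvd col_sum n x"
    using g unfolding e Grpn_carrier_iff[OF r_pos p_dvd] by auto
  have \<pi>: "\<pi> permutes {1..n}" using gW unfolding wreath_carrier_iff[OF r_pos] by simp
  have "int p dvd col_sum n (\<lambda>i\<in>{1..n}. (- x (inv_into UNIV \<pi> i)) mod int r) \<longleftrightarrow>
      int p dvd col_sum n (\<lambda>i. - x (inv_into UNIV \<pi> i))"
    by (rule col_sum_mod[where r = r]) (use p_dvd in \<open>simp_all only: restrict_apply' mod_dvd_diff int_dvd_int_iff\<close>)
  also have "col_sum n (\<lambda>i. - x (inv_into UNIV \<pi> i)) = - col_sum n x"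
    using col_sum_permute[OF permutes_inv[OF \<pi>], of x] by (simp add: col_sum_def sum_negf)
  finally show "inv\<^bsub>wreath r n\<^esub> g \<in> carrier (Grpn r p n)"
    unfolding e wreath_inv[OF r_pos gW] Grpn_carrier_iff[OF r_pos p_dvd] fst_conv
    using s wreath_inverse_closed[OF r_pos \<pi>, of x] by (simp only: dvd_minus_iff simp_thms)
next
  fix g h assume g: "g \<in> carrier (Grpn r p n)" and h: "h \<in> carrier (Grpn r p n)"
  obtain x \<pi> y \<sigma> where e: "g = (x, \<pi>)" "h = (y, \<sigma>)" by (cases g, cases h)
  have gW: "g \<in> carrier (wreath r n)" "h \<in> carrier (wreath r n)" and s: "int p dvd col_sum n x" "int p dvd col_sum n y"
    using g h unfolding e Grpn_carrier_iff[OF r_pos p_dvd] by auto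
  have \<sigma>: "\<sigma> permutes {1..n}" using gW(2) unfolding e wreath_carrier_iff[OF r_pos] by simp
  have "g \<otimes>\<^bsub>wreath r n\<^esub> h \<in> carrier (wreath r n)"
    using group.is_monoid[OF group_wreath[OF r_pos]] gW by (simp add: monoid.m_closed)
  moreover have "int p dvd col_sum n (fst (g \<otimes>\<^bsub>wreath r n\<^esub> h))"
    unfolding e col_sum_mult[OF \<sigma> p_dvd] using s by (rule dvd_add)
  ultimately show "g \<otimes>\<^bsub>wreath r n\<^esub> h \<in> carrier (Grpn r p n)" by (simp add: Grpn_carrier_iff[OF r_pos p_dvd])
qed

lemma group_Grpn: "group (Grpn r p n)"
proof -
  have "Grpn r p n = (wreath r n)\<lparr>carrier := carrier (Grpn r p n)\<rparr>" by (simp add: Grpn_def)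
  thus ?thesis using group.subgroup_imp_group[OF group_wreath[OF r_pos] subgroup_Grpn] by metis
qed

lemma transp_Grpn:
  assumes "g \<in> carrier (Grpn r p n)"
  shows "transp r n g \<in> carrier (Grpn r p n)"
proof -
  obtain x \<pi> where e: "g = (x, \<pi>)" by (cases g)
  have gW: "(x, \<pi>) \<in> carrier (wreath r n)" and s: "int p dvd col_sum n x"
    using assms unfolding e Grpn_carrier_iff[OF r_pos p_dvd] by auto
  have \<pi>: "\<pi> permutes {1..n}" using gW unfolding wreath_carrier_iff[OF r_pos] by simp
  have "col_sum n (\<lambda>i\<in>{1..n}. x (inv_into UNIV \<pi> i)) = col_sum n (\<lambda>i. x (inv_into UNIV \<pi> i))"
    by (simp add: col_sum_def)
  also have "\<dots> = col_sum n x" by (rule col_sum_permute[OF permutes_inv[OF \<pi>]])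
  finally show ?thesis
    using transp_closed[OF r_pos gW] s
    unfolding e transp_pair[OF r_pos gW] Grpn_carrier_iff[OF r_pos p_dvd] fst_conv by (simp only: simp_thms)
qed

end

section \<open>Coloured permutations and their encodings\<close>

definition enc :: "nat \<Rightarrow> colored_perm \<Rightarrow> nat \<Rightarrow> nat \<times> int" where
  "enc n g = (\<lambda>i\<in>{1..n}. (snd g i, fst g i))"

text \<open>The encoded map is undefined off \<open>{1..n}\<close>, whereas a permutation of
  \<open>{1..n}\<close> has to be the identity there.\<close>

definition dec :: "nat \<Rightarrow> (nat \<Rightarrow> nat \<times> int) \<Rightarrow> colored_perm" where
  "dec n h = (\<lambda>i\<in>{1..n}. snd (h i), \<lambda>i. if i \<in> {1..n} then fst (h i) else i)"

lemma enc_apply: "i \<in> {1..n} \<Longrightarrow> enc n (x, \<pi>) i = (\<pi> i, x i)"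
  by (simp add: enc_def)

lemma enc_dec: "h \<in> {1..n} \<rightarrow>\<^sub>E B \<Longrightarrow> enc n (dec n h) = h"
proof
  fix i assume h: "h \<in> {1..n} \<rightarrow>\<^sub>E B"
  show "enc n (dec n h) i = h i" using PiE_arb[OF h, of i] by (cases "i \<in> {1..n}") (simp_all add: enc_def dec_def)
qed

context
  fixes r n :: nat
  assumes r_pos: "0 < r"
begin

lemma dec_enc:
  assumes "g \<in> carrier (wreath r n)"
  shows "dec n (enc n g) = g"
proof -
  obtain x \<pi> where e: "g = (x, \<pi>)" by (cases g)
  have x: "x \<in> {1..n} \<rightarrow>\<^sub>E {0..<int r}" and \<pi>: "\<pi> permutes {1..n}"
    using assms unfolding e wreath_carrier_iff[OF r_pos] by auto
  have "(\<lambda>i\<in>{1..n}. snd (enc n (x, \<pi>) i)) = x"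
  proof
    fix i show "(\<lambda>i\<in>{1..n}. snd (enc n (x, \<pi>) i)) i = x i"
      using PiE_arb[OF x, of i] by (cases "i \<in> {1..n}") (simp_all add: enc_apply)
  qed
  moreover have "(\<lambda>i. if i \<in> {1..n} then fst (enc n (x, \<pi>) i) else i) = \<pi>"
  proof
    fix i show "(if i \<in> {1..n} then fst (enc n (x, \<pi>) i) else i) = \<pi> i"
      using permutes_not_in[OF \<pi>, of i] by (cases "i \<in> {1..n}") (simp_all add: enc_apply)
  qed
  ultimately show ?thesis unfolding e dec_def by simp
qed

lemma dec_closed:
  assumes h: "h \<in> {1..n} \<rightarrow>\<^sub>E {1..n} \<times> {0..<int r}" and inj: "inj_on (\<lambda>i. fst (h i)) {1..n}"
  shows "dec n h \<in> carrier (wreath r n)"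
proof -
  have hm: "fst (h i) \<in> {1..n}" "snd (h i) \<in> {0..<int r}" if "i \<in> {1..n}" for i
    using PiE_mem[OF h that] unfolding mem_Times_iff by blast+
  let ?f = "\<lambda>i. if i \<in> {1..n} then fst (h i) else i"
  have a: "inj_on ?f {1..n}" using inj by (rule inj_on_cong[THEN iffD1, rotated]) simp
  have b: "?f ` {1..n} \<subseteq> {1..n}" using hm(1) by (intro image_subsetI) simp
  have "bij_betw ?f {1..n} {1..n}" unfolding bij_betw_def using a endo_inj_surj[OF _ b a] by blast
  hence "?f permutes {1..n}" by (rule bij_imp_permutes) (rule if_not_P)
  thus ?thesis unfolding dec_def wreath_carrier_iff[OF r_pos] restrict_PiE_iff using hm(2) by blast
qed

lemma dec_closed_invol:
  assumes h: "h \<in> Adm (int r) (invol_cond (int r) \<pi> x) {1..n}"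
  shows "dec n h \<in> carrier (wreath r n)"
proof (rule dec_closed[OF Adm_PiE[OF h]])
  show "inj_on (\<lambda>i. fst (h i)) {1..n}"
    by (rule inj_on_inverseI[where g = "\<lambda>i. fst (h i)"]) (use Adm_cond[OF h] in \<open>simp add: invol_cond_def\<close>)
qed

lemma dec_closed_reverse:
  assumes h: "h \<in> Adm (int r) (reverse_cond (int r) \<pi> x) {1..n}"
  shows "dec n h \<in> carrier (wreath r n)"
proof (rule dec_closed[OF Adm_PiE[OF h]])
  show "inj_on (\<lambda>i. fst (h i)) {1..n}"
    by (rule inj_on_inverseI[where g = "\<lambda>i. fst (h i)"]) (use Adm_cond[OF h] in \<open>simp add: reverse_cond_def\<close>)
qed

text \<open>A map whose square is injective is injective, so bijectivity is no separate condition on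
  encoded square roots.\<close>

lemma dec_closed_sqrt:
  assumes h: "h \<in> Adm (int r) (sqrt_cond (int r) \<pi> x) {1..n}" and \<pi>: "inj \<pi>"
  shows "dec n h \<in> carrier (wreath r n)"
proof (rule dec_closed[OF Adm_PiE[OF h]])
  have sq: "fst (h (fst (h i))) = \<pi> i" if "i \<in> {1..n}" for i
    using Adm_cond[OF h that] by (simp add: sqrt_cond_def)
  show "inj_on (\<lambda>i. fst (h i)) {1..n}"
  proof (rule inj_onI)
    fix i j assume ij: "i \<in> {1..n}" "j \<in> {1..n}" and eq: "fst (h i) = fst (h j)"
    have "\<pi> i = \<pi> j" unfolding sq[OF ij(1), symmetric] sq[OF ij(2), symmetric] eq ..
    thus "i = j" by (rule injD[OF \<pi>])
  qed
qed

lemma enc_Adm_iff: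
  assumes g: "(w, \<iota>) \<in> carrier (wreath r n)"
  shows "enc n (w, \<iota>) \<in> Adm (int r) P {1..n} \<longleftrightarrow> (\<forall>i\<in>{1..n}. P (enc n (w, \<iota>)) i)"
proof -
  have w: "w \<in> {1..n} \<rightarrow>\<^sub>E {0..<int r}" and \<iota>: "\<iota> permutes {1..n}"
    using g unfolding wreath_carrier_iff[OF r_pos] by auto
  have "enc n (w, \<iota>) \<in> {1..n} \<rightarrow>\<^sub>E {1..n} \<times> {0..<int r}"
    unfolding enc_def using PiE_mem[OF w] permutes_in_image[OF \<iota>] by simp
  thus ?thesis by (simp add: Adm_def)
qed

lemma transp_fixed_iff:
  assumes g: "(w, \<iota>) \<in> carrier (wreath r n)"
  shows "transp r n (w, \<iota>) = (w, \<iota>) \<longleftrightarrow> (\<forall>i\<in>{1..n}. \<iota> (\<iota> i) = i \<and> w (\<iota> i) = w i)"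
proof -
  have w: "w \<in> {1..n} \<rightarrow>\<^sub>E {0..<int r}" and \<iota>: "\<iota> permutes {1..n}"
    using g unfolding wreath_carrier_iff[OF r_pos] by auto
  show ?thesis
  proof
    assume "transp r n (w, \<iota>) = (w, \<iota>)"
    hence inv: "inv_into UNIV \<iota> = \<iota>" and wi: "(\<lambda>i\<in>{1..n}. w (inv_into UNIV \<iota> i)) = w"
      unfolding transp_pair[OF r_pos g] by auto
    have "\<iota> (\<iota> i) = i" for i using permutes_inverses(1)[OF \<iota>, of i] unfolding inv .
    moreover have "w (\<iota> i) = w i" if "i \<in> {1..n}" for i
      using fun_cong[OF wi, of i] that unfolding inv by simp
    ultimately show "\<forall>i\<in>{1..n}. \<iota> (\<iota> i) = i \<and> w (\<iota> i) = w i" by blast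
  next
    assume R: "\<forall>i\<in>{1..n}. \<iota> (\<iota> i) = i \<and> w (\<iota> i) = w i"
    have "\<iota> (\<iota> i) = i" for i
      using R permutes_not_in[OF \<iota>, of i] by (cases "i \<in> {1..n}") auto
    hence "\<iota> \<circ> \<iota> = id" by (simp add: fun_eq_iff)
    hence inv: "inv_into UNIV \<iota> = \<iota>" by (simp add: inv_unique_comp)
    have "(\<lambda>i\<in>{1..n}. w (\<iota> i)) = w"
    proof
      fix i show "(\<lambda>i\<in>{1..n}. w (\<iota> i)) i = w i"
        using R PiE_arb[OF w, of i] by (cases "i \<in> {1..n}") auto
    qed
    thus "transp r n (w, \<iota>) = (w, \<iota>)" unfolding transp_pair[OF r_pos g] inv by simp
  qed
qed

lemma act_pair:
  assumes g: "(x, \<pi>) \<in> carrier (wreath r n)" and \<omega>: "(w, \<iota>) \<in> carrier (wreath r n)"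
  shows "(x, \<pi>) \<otimes>\<^bsub>wreath r n\<^esub> (w, \<iota>) \<otimes>\<^bsub>wreath r n\<^esub> transp r n (x, \<pi>) =
    (\<lambda>i\<in>{1..n}. (x (\<iota> (inv_into UNIV \<pi> i)) + w (inv_into UNIV \<pi> i) + x (inv_into UNIV \<pi> i)) mod int r,
     \<pi> \<circ> \<iota> \<circ> inv_into UNIV \<pi>)"
proof -
  have \<pi>: "\<pi> permutes {1..n}" and \<iota>: "\<iota> permutes {1..n}"
    using g \<omega> unfolding wreath_carrier_iff[OF r_pos] by auto
  have "(\<lambda>i\<in>{1..n}. ((\<lambda>i\<in>{1..n}. (x (\<iota> i) + w i) mod int r) (inv_into UNIV \<pi> i) +
      (\<lambda>i\<in>{1..n}. x (inv_into UNIV \<pi> i)) i) mod int r) =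
    (\<lambda>i\<in>{1..n}. (x (\<iota> (inv_into UNIV \<pi> i)) + w (inv_into UNIV \<pi> i) + x (inv_into UNIV \<pi> i)) mod int r)"
  proof (rule restrict_ext)
    fix i assume i: "i \<in> {1..n}"
    have "inv_into UNIV \<pi> i \<in> {1..n}" using i permutes_in_image[OF permutes_inv[OF \<pi>]] by blast
    thus "((\<lambda>i\<in>{1..n}. (x (\<iota> i) + w i) mod int r) (inv_into UNIV \<pi> i) +
        (\<lambda>i\<in>{1..n}. x (inv_into UNIV \<pi> i)) i) mod int r =
      (x (\<iota> (inv_into UNIV \<pi> i)) + w (inv_into UNIV \<pi> i) + x (inv_into UNIV \<pi> i)) mod int r"
      using i by (simp add: mod_simps)
  qed
  thus ?thesis
    unfolding transp_pair[OF r_pos g] wreath_mult[OF \<iota>] wreath_mult[OF permutes_inv[OF \<pi>]] by simp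
qed

lemma act_fixed_iff:
  assumes g: "(x, \<pi>) \<in> carrier (wreath r n)" and \<omega>: "(w, \<iota>) \<in> carrier (wreath r n)"
  shows "(x, \<pi>) \<otimes>\<^bsub>wreath r n\<^esub> (w, \<iota>) \<otimes>\<^bsub>wreath r n\<^esub> transp r n (x, \<pi>) = (w, \<iota>) \<longleftrightarrow>
    (\<forall>i\<in>{1..n}. \<iota> (\<pi> i) = \<pi> (\<iota> i) \<and> int r dvd w (\<pi> i) - w i - (x i + x (\<iota> i)))"
proof -
  have \<pi>: "\<pi> permutes {1..n}" and \<iota>: "\<iota> permutes {1..n}" and w: "w \<in> {1..n} \<rightarrow>\<^sub>E {0..<int r}"
    using g \<omega> unfolding wreath_carrier_iff[OF r_pos] by auto
  let ?w = "\<lambda>i\<in>{1..n}. (x (\<iota> (inv_into UNIV \<pi> i)) + w (inv_into UNIV \<pi> i) + x (inv_into UNIV \<pi> i)) mod int r"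
  have perm: "\<pi> \<circ> \<iota> \<circ> inv_into UNIV \<pi> = \<iota> \<longleftrightarrow> (\<forall>i\<in>{1..n}. \<iota> (\<pi> i) = \<pi> (\<iota> i))"
  proof
    assume eq: "\<pi> \<circ> \<iota> \<circ> inv_into UNIV \<pi> = \<iota>"
    have "\<iota> (\<pi> i) = \<pi> (\<iota> i)" for i
      using fun_cong[OF eq, of "\<pi> i"] by (simp add: permutes_inverses(2)[OF \<pi>])
    thus "\<forall>i\<in>{1..n}. \<iota> (\<pi> i) = \<pi> (\<iota> i)" by blast
  next
    assume R: "\<forall>i\<in>{1..n}. \<iota> (\<pi> i) = \<pi> (\<iota> i)"
    have "\<iota> (\<pi> i) = \<pi> (\<iota> i)" for i
      using R permutes_not_in[OF \<pi>, of i] permutes_not_in[OF \<iota>, of i] by (cases "i \<in> {1..n}") auto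
    hence "(\<pi> \<circ> \<iota> \<circ> inv_into UNIV \<pi>) i = \<iota> i" for i
      using permutes_inverses(1)[OF \<pi>, of i] by (metis comp_apply)
    thus "\<pi> \<circ> \<iota> \<circ> inv_into UNIV \<pi> = \<iota>" by (rule ext)
  qed
  have col: "?w = w \<longleftrightarrow> (\<forall>i\<in>{1..n}. int r dvd w (\<pi> i) - w i - (x i + x (\<iota> i)))"
  proof
    assume eq: "?w = w"
    show "\<forall>i\<in>{1..n}. int r dvd w (\<pi> i) - w i - (x i + x (\<iota> i))"
    proof
      fix i assume "i \<in> {1..n}"
      hence "\<pi> i \<in> {1..n}" using permutes_in_image[OF \<pi>] by blast
      hence "w (\<pi> i) = (x (\<iota> i) + w i + x i) mod int r"
        using fun_cong[OF eq, of "\<pi> i"] by (simp add: permutes_inverses(2)[OF \<pi>])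
      hence "int r dvd w (\<pi> i) - (x (\<iota> i) + w i + x i)" by (simp add: mod_eq_dvd_iff[symmetric])
      thus "int r dvd w (\<pi> i) - w i - (x i + x (\<iota> i))" by (simp add: algebra_simps)
    qed
  next
    assume R: "\<forall>i\<in>{1..n}. int r dvd w (\<pi> i) - w i - (x i + x (\<iota> i))"
    show "?w = w"
    proof (rule PiE_ext[OF _ w])
      show "?w \<in> {1..n} \<rightarrow>\<^sub>E {0..<int r}" using r_pos by simp
      fix j assume j: "j \<in> {1..n}"
      define i where "i = inv_into UNIV \<pi> j"
      have i: "i \<in> {1..n}" unfolding i_def using j permutes_in_image[OF permutes_inv[OF \<pi>]] by blast
      have ji: "j = \<pi> i" by (simp add: i_def permutes_inverses(1)[OF \<pi>])
      have "int r dvd w j - (x (\<iota> i) + w i + x i)" using R i ji by (simp add: algebra_simps)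
      hence "w j mod int r = (x (\<iota> i) + w i + x i) mod int r" by (simp add: mod_eq_dvd_iff)
      moreover have "w j mod int r = w j" using PiE_mem[OF w j] by simp
      ultimately show "?w j = w j" using j by (simp add: i_def[symmetric])
    qed
  qed
  show ?thesis unfolding act_pair[OF g \<omega>] prod.inject perm col by blast
qed

lemma sqrt_iff:
  assumes g: "(x, \<pi>) \<in> carrier (wreath r n)" and h: "(y, \<sigma>) \<in> carrier (wreath r n)"
  shows "(y, \<sigma>) = (x, \<pi>) \<otimes>\<^bsub>wreath r n\<^esub> transp r n (y, \<sigma>) \<longleftrightarrow>
    (\<forall>i\<in>{1..n}. \<sigma> (\<sigma> i) = \<pi> i \<and> int r dvd y (\<sigma> i) - y i - x i)"
proof -
  have \<pi>: "\<pi> permutes {1..n}" and \<sigma>: "\<sigma> permutes {1..n}" and y: "y \<in> {1..n} \<rightarrow>\<^sub>E {0..<int r}"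
    using g h unfolding wreath_carrier_iff[OF r_pos] by auto
  let ?y = "\<lambda>i\<in>{1..n}. (x (inv_into UNIV \<sigma> i) + (\<lambda>i\<in>{1..n}. y (inv_into UNIV \<sigma> i)) i) mod int r"
  have perm: "\<sigma> = \<pi> \<circ> inv_into UNIV \<sigma> \<longleftrightarrow> (\<forall>i\<in>{1..n}. \<sigma> (\<sigma> i) = \<pi> i)"
  proof
    assume eq: "\<sigma> = \<pi> \<circ> inv_into UNIV \<sigma>"
    have "\<sigma> (\<sigma> i) = \<pi> i" for i
      using fun_cong[OF eq, of "\<sigma> i"] by (simp add: permutes_inverses(2)[OF \<sigma>])
    thus "\<forall>i\<in>{1..n}. \<sigma> (\<sigma> i) = \<pi> i" by blast
  next
    assume R: "\<forall>i\<in>{1..n}. \<sigma> (\<sigma> i) = \<pi> i"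
    have "\<sigma> (\<sigma> i) = \<pi> i" for i
      using R permutes_not_in[OF \<pi>, of i] permutes_not_in[OF \<sigma>, of i] by (cases "i \<in> {1..n}") auto
    hence "\<sigma> i = (\<pi> \<circ> inv_into UNIV \<sigma>) i" for i
      using permutes_inverses(1)[OF \<sigma>, of i] by (metis comp_apply)
    thus "\<sigma> = \<pi> \<circ> inv_into UNIV \<sigma>" by (rule ext)
  qed
  have col: "y = ?y \<longleftrightarrow> (\<forall>i\<in>{1..n}. int r dvd y (\<sigma> i) - y i - x i)"
  proof
    assume eq: "y = ?y"
    show "\<forall>i\<in>{1..n}. int r dvd y (\<sigma> i) - y i - x i"
    proof
      fix i assume "i \<in> {1..n}"
      hence "\<sigma> i \<in> {1..n}" using permutes_in_image[OF \<sigma>] by blast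
      hence "y (\<sigma> i) = (x i + y i) mod int r"
        using fun_cong[OF eq, of "\<sigma> i"] by (simp add: permutes_inverses(2)[OF \<sigma>])
      hence "int r dvd y (\<sigma> i) - (x i + y i)" by (simp add: mod_eq_dvd_iff[symmetric])
      thus "int r dvd y (\<sigma> i) - y i - x i" by (simp add: algebra_simps)
    qed
  next
    assume R: "\<forall>i\<in>{1..n}. int r dvd y (\<sigma> i) - y i - x i"
    show "y = ?y"
    proof (rule PiE_ext[OF y])
      show "?y \<in> {1..n} \<rightarrow>\<^sub>E {0..<int r}" using r_pos by simp
      fix j assume j: "j \<in> {1..n}"
      define i where "i = inv_into UNIV \<sigma> j"
      have i: "i \<in> {1..n}" unfolding i_def using j permutes_in_image[OF permutes_inv[OF \<sigma>]] by blast
      have ji: "j = \<sigma> i" by (simp add: i_def permutes_inverses(1)[OF \<sigma>])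
      have "int r dvd y j - (x i + y i)" using R i ji by (simp add: algebra_simps)
      hence "y j mod int r = (x i + y i) mod int r" by (simp add: mod_eq_dvd_iff)
      moreover have "y j mod int r = y j" using PiE_mem[OF y j] by simp
      ultimately show "y j = ?y j" using j by (simp add: i_def[symmetric])
    qed
  qed
  show ?thesis
    unfolding transp_pair[OF r_pos h] wreath_mult[OF permutes_inv[OF \<sigma>]] prod.inject perm col by blast
qed

lemma enc_invol_iff:
  assumes g: "(x, \<pi>) \<in> carrier (wreath r n)" and \<omega>: "\<omega> \<in> carrier (wreath r n)"
  shows "enc n \<omega> \<in> Adm (int r) (invol_cond (int r) \<pi> x) {1..n} \<longleftrightarrow>
    transp r n \<omega> = \<omega> \<and> (x, \<pi>) \<otimes>\<^bsub>wreath r n\<^esub> \<omega> \<otimes>\<^bsub>wreath r n\<^esub> transp r n (x, \<pi>) = \<omega>"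
proof -
  obtain w \<iota> where e: "\<omega> = (w, \<iota>)" by (cases \<omega>)
  have \<pi>: "\<pi> permutes {1..n}" and \<iota>: "\<iota> permutes {1..n}"
    using g \<omega> unfolding e wreath_carrier_iff[OF r_pos] by auto
  have "invol_cond (int r) \<pi> x (enc n (w, \<iota>)) i \<longleftrightarrow> (\<iota> (\<iota> i) = i \<and> w (\<iota> i) = w i) \<and>
      (\<iota> (\<pi> i) = \<pi> (\<iota> i) \<and> int r dvd w (\<pi> i) - w i - (x i + x (\<iota> i)))" if i: "i \<in> {1..n}" for i
  proof -
    have "\<iota> i \<in> {1..n}" "\<pi> i \<in> {1..n}" using i permutes_in_image[OF \<iota>] permutes_in_image[OF \<pi>] by blast+
    thus ?thesis using i by (auto simp: invol_cond_def enc_apply)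
  qed
  thus ?thesis
    unfolding e enc_Adm_iff[OF \<omega>[unfolded e]] transp_fixed_iff[OF \<omega>[unfolded e]] act_fixed_iff[OF g \<omega>[unfolded e]]
    by blast
qed

lemma enc_sqrt_iff:
  assumes g: "(x, \<pi>) \<in> carrier (wreath r n)" and h: "h \<in> carrier (wreath r n)"
  shows "enc n h \<in> Adm (int r) (sqrt_cond (int r) \<pi> x) {1..n} \<longleftrightarrow>
    h = (x, \<pi>) \<otimes>\<^bsub>wreath r n\<^esub> transp r n h"
proof -
  obtain y \<sigma> where e: "h = (y, \<sigma>)" by (cases h)
  have \<pi>: "\<pi> permutes {1..n}" and \<sigma>: "\<sigma> permutes {1..n}"
    using g h unfolding e wreath_carrier_iff[OF r_pos] by auto
  have "sqrt_cond (int r) \<pi> x (enc n (y, \<sigma>)) i \<longleftrightarrow> \<sigma> (\<sigma> i) = \<pi> i \<and> int r dvd y (\<sigma> i) - y i - x i"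
    if i: "i \<in> {1..n}" for i
  proof -
    have "\<sigma> i \<in> {1..n}" using i permutes_in_image[OF \<sigma>] by blast
    thus ?thesis using i by (simp add: sqrt_cond_def enc_apply)
  qed
  thus ?thesis unfolding e enc_Adm_iff[OF h[unfolded e]] sqrt_iff[OF g h[unfolded e]] by blast
qed

end

text \<open>The conjugating element must lie in the subgroup. Adding a constant \<open>c\<close> to
  its colours does not disturb the relation, as one colour of \<open>k\<close> occurs on either
  side, and since \<open>n\<close> is invertible modulo \<open>p\<close> some \<open>c\<close> makes
  the total colour divisible by \<open>p\<close>.\<close>

lemma transp_conjugate:
  assumes r_pos: "0 < r" and p_dvd: "p dvd r" and cop: "coprime p n"
    and g: "g \<in> carrier (wreath r n)"
  shows "\<exists>k\<in>carrier (Grpn r p n). k \<otimes>\<^bsub>wreath r n\<^esub> g = transp r n g \<otimes>\<^bsub>wreath r n\<^esub> k"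
proof -
  obtain x \<pi> where e: "g = (x, \<pi>)" by (cases g)
  note g' = g[unfolded e]
  have \<pi>: "\<pi> permutes {1..n}" using g' unfolding wreath_carrier_iff[OF r_pos] by simp
  have "\<pi> ` {1..n} \<subseteq> {1..n}" using permutes_image[OF \<pi>] by simp
  then obtain h where h: "h \<in> Adm (int r) (reverse_cond (int r) \<pi> x) {1..n}"
    using reverse_cond_exists[of "{1..n}" \<pi> "int r" x] permutes_inj[OF \<pi>] r_pos by auto
  obtain y \<theta> where d: "dec n h = (y, \<theta>)" by (cases "dec n h")
  have dW: "(y, \<theta>) \<in> carrier (wreath r n)" using dec_closed_reverse[OF r_pos h] unfolding d .
  have y: "y \<in> {1..n} \<rightarrow>\<^sub>E {0..<int r}" and \<theta>: "\<theta> permutes {1..n}"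
    using dW unfolding wreath_carrier_iff[OF r_pos] by auto
  have hi: "h i = (\<theta> i, y i)" if "i \<in> {1..n}" for i
    using that d enc_apply[OF that, of y \<theta>] enc_dec[OF Adm_PiE[OF h]] by simp
  have rev: "\<pi> (\<theta> (\<pi> i)) = \<theta> i" "int r dvd y (\<pi> i) - y i - (x (\<theta> (\<pi> i)) - x i)" if i: "i \<in> {1..n}" for i
  proof -
    have "\<pi> i \<in> {1..n}" using i permutes_in_image[OF \<pi>] by blast
    thus "\<pi> (\<theta> (\<pi> i)) = \<theta> i" "int r dvd y (\<pi> i) - y i - (x (\<theta> (\<pi> i)) - x i)"
      using Adm_cond[OF h i] i by (simp_all add: reverse_cond_def hi)
  qed
  \<comment> \<open>The constant is minus the colour sum of \<open>y\<close> times an inverse of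
    \<open>n\<close> modulo \<open>p\<close>.\<close>
  obtain c where c: "int p dvd col_sum n y + int n * c"
  proof -
    have "coprime (int n) (int p)" using cop by (simp add: coprime_commute)
    then obtain u where "[int n * u = 1] (mod int p)" using cong_solve_coprime_int by blast
    hence "int p dvd int n * u - 1" by (simp add: cong_iff_dvd_diff)
    hence "int p dvd (int n * u - 1) * (- col_sum n y)" by (rule dvd_mult2)
    hence "int p dvd col_sum n y + int n * (u * (- col_sum n y))" by (simp add: algebra_simps)
    thus thesis by (rule that)
  qed
  let ?k = "(\<lambda>i\<in>{1..n}. (y i + c) mod int r, \<theta>)"
  have kW: "?k \<in> carrier (wreath r n)" unfolding wreath_carrier_iff[OF r_pos] using r_pos \<theta> by simp
  have "int p dvd col_sum n (\<lambda>i\<in>{1..n}. (y i + c) mod int r) \<longleftrightarrow> int p dvd col_sum n (\<lambda>i. y i + c)"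
    by (rule col_sum_mod[where r = r]) (use p_dvd in \<open>simp_all only: restrict_apply' mod_dvd_diff int_dvd_int_iff\<close>)
  also have "col_sum n (\<lambda>i. y i + c) = col_sum n y + int n * c" by (simp add: col_sum_def sum.distrib)
  finally have kG: "?k \<in> carrier (Grpn r p n)" 
    using c kW unfolding Grpn_carrier_iff[OF r_pos p_dvd] fst_conv by blast
  have "?k \<otimes>\<^bsub>wreath r n\<^esub> g = transp r n g \<otimes>\<^bsub>wreath r n\<^esub> ?k"
    unfolding e transp_pair[OF r_pos g'] wreath_mult[OF \<pi>] wreath_mult[OF \<theta>] prod.inject
  proof (intro conjI restrict_ext)
    show "\<theta> \<circ> \<pi> = inv_into UNIV \<pi> \<circ> \<theta>"
    proof
      fix i
      have "\<pi> (\<theta> (\<pi> i)) = \<theta> i"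
        using rev(1)[of i] permutes_not_in[OF \<pi>, of i] permutes_not_in[OF \<theta>, of i] by (cases "i \<in> {1..n}") auto
      hence "inv_into UNIV \<pi> (\<theta> i) = \<theta> (\<pi> i)" using permutes_inverses(2)[OF \<pi>] by metis
      thus "(\<theta> \<circ> \<pi>) i = (inv_into UNIV \<pi> \<circ> \<theta>) i" by simp
    qed
    fix i assume i: "i \<in> {1..n}"
    have \<pi>i: "\<pi> i \<in> {1..n}" and \<theta>i: "\<theta> i \<in> {1..n}"
      using i permutes_in_image[OF \<pi>] permutes_in_image[OF \<theta>] by blast+
    have inv: "inv_into UNIV \<pi> (\<theta> i) = \<theta> (\<pi> i)" using rev(1)[OF i] permutes_inverses(2)[OF \<pi>] by metis
    have "int r dvd (y (\<pi> i) + c + x i) - (x (\<theta> (\<pi> i)) + (y i + c))"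
      using rev(2)[OF i] by (simp add: algebra_simps)
    hence "(y (\<pi> i) + c + x i) mod int r = (x (\<theta> (\<pi> i)) + (y i + c)) mod int r" by (simp add: mod_eq_dvd_iff)
    thus "((\<lambda>i\<in>{1..n}. (y i + c) mod int r) (\<pi> i) + x i) mod int r =
        ((\<lambda>i\<in>{1..n}. x (inv_into UNIV \<pi> i)) (\<theta> i) + (\<lambda>i\<in>{1..n}. (y i + c) mod int r) i) mod int r"
      using i \<pi>i \<theta>i inv by (simp add: mod_simps)
  qed
  thus ?thesis using kG by blast
qed

section \<open>The sign as a cocycle\<close>

definition tot_sign :: "nat \<Rightarrow> nat \<Rightarrow> int \<Rightarrow> colored_perm \<Rightarrow> (nat \<Rightarrow> nat \<times> int) \<Rightarrow> int" where
  "tot_sign r n par g h = (\<Prod>i\<in>{1..n}. loc_sign (int r) (snd g) (fst g) par i (h i))"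

text \<open>The orientation change of an unordered pair. For injective \<pi> it is symmetric in its
  ends, and it is multiplicative in \<pi>, which \<open>inv_sign\<close> is not.\<close>

definition pair_sign :: "(nat \<Rightarrow> nat) \<Rightarrow> nat \<Rightarrow> nat \<Rightarrow> int" where
  "pair_sign \<pi> i j = (if (i < j) = (\<pi> i < \<pi> j) then 1 else -1)"

definition lower_ends :: "nat \<Rightarrow> (nat \<Rightarrow> nat) \<Rightarrow> nat set" where
  "lower_ends n \<iota> = {i \<in> {1..n}. i < \<iota> i}"

lemma pair_sign_sym: "inj \<pi> \<Longrightarrow> i \<noteq> j \<Longrightarrow> pair_sign \<pi> i j = pair_sign \<pi> j i"
  unfolding pair_sign_def by (metis inj_eq linorder_less_linear order_less_asym)

lemma pair_sign_comp: "pair_sign (\<pi> \<circ> \<sigma>) i j = pair_sign \<pi> (\<sigma> i) (\<sigma> j) * pair_sign \<sigma> i j"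
  by (auto simp: pair_sign_def)

lemma prod_minus_one:
  "finite A \<Longrightarrow> (\<Prod>i\<in>A. if Q i then -1 else 1 :: int) = (-1) ^ card {i \<in> A. Q i}"
  by (simp add: prod.inter_filter[symmetric])

text \<open>With \<open>k\<close> a half of \<open>w i\<close>, the number \<open>k + y i\<close> is
  a half of the transformed colour. So the two signs on the right share the half sign of
  \<open>k + y i\<close>, which cancels.\<close>

lemma fix_sign_prod:
  assumes "even R" "0 < R" and \<sigma>: "\<sigma> permutes {1..n}"
    and conj: "\<And>i. i \<in> {1..n} \<Longrightarrow> \<iota>' (\<sigma> i) = \<sigma> (\<iota> i)"
    and w': "\<And>i. i \<in> Fix n \<iota> \<Longrightarrow> w' (\<sigma> i) = (w i + 2 * y i) mod R"
    and w: "\<And>i. i \<in> {1..n} \<Longrightarrow> w i \<in> {0..<R}"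
  shows "(\<Prod>i\<in>Fix n \<iota>. col_sign R par ((x (\<sigma> i) + y i) mod R) (w i)) =
    (\<Prod>j\<in>Fix n \<iota>'. col_sign R par (x j) (w' j)) * (\<Prod>i\<in>Fix n \<iota>. col_sign R par (y i) (w i))"
proof -
  have \<sigma>i: "\<sigma> i \<in> {1..n} \<longleftrightarrow> i \<in> {1..n}" for i by (rule permutes_in_image[OF \<sigma>])
  have inj: "\<sigma> i = \<sigma> j \<longleftrightarrow> i = j" for i j using permutes_inj[OF \<sigma>] by (simp add: inj_eq)
  have bij: "bij_betw \<sigma> (Fix n \<iota>) (Fix n \<iota>')"
  proof (rule bij_betw_byWitness[where f' = "inv_into UNIV \<sigma>"])
    show "\<forall>i\<in>Fix n \<iota>. inv_into UNIV \<sigma> (\<sigma> i) = i" by (simp add: permutes_inverses(2)[OF \<sigma>])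
    show "\<forall>j\<in>Fix n \<iota>'. \<sigma> (inv_into UNIV \<sigma> j) = j" by (simp add: permutes_inverses(1)[OF \<sigma>])
    show "\<sigma> ` Fix n \<iota> \<subseteq> Fix n \<iota>'"
      by (rule image_subsetI) (use conj \<sigma>i in \<open>simp add: Fix_def\<close>)
    show "inv_into UNIV \<sigma> ` Fix n \<iota>' \<subseteq> Fix n \<iota>"
    proof (rule image_subsetI)
      fix j assume j: "j \<in> Fix n \<iota>'"
      define i where "i = inv_into UNIV \<sigma> j"
      have ji: "j = \<sigma> i" by (simp add: i_def permutes_inverses(1)[OF \<sigma>])
      have "i \<in> {1..n}" using j \<sigma>i[of i] unfolding ji Fix_def by blast
      moreover have "\<sigma> (\<iota> i) = \<sigma> i" using j conj[OF \<open>i \<in> {1..n}\<close>] unfolding ji Fix_def by auto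
      ultimately show "inv_into UNIV \<sigma> j \<in> Fix n \<iota>" unfolding i_def[symmetric] Fix_def inj by blast
    qed
  qed
  have "col_sign R par ((x (\<sigma> i) + y i) mod R) (w i) = col_sign R par (x (\<sigma> i)) (w' (\<sigma> i)) * col_sign R par (y i) (w i)"
    if i: "i \<in> Fix n \<iota>" for i
  proof -
    have iA: "i \<in> {1..n}" using i by (simp add: Fix_def)
    have d: "R dvd w' (\<sigma> i) - (w i + 2 * y i)" unfolding w'[OF i] by (rule mod_dvd_diff)
    hence "2 dvd w' (\<sigma> i) - (w i + 2 * y i)" using assms(1) dvd_trans by blast
    hence par: "w' (\<sigma> i) mod 2 = w i mod 2" by presburger
    show ?thesis
    proof (cases "w i mod 2 = par")
      case True
      define k where "k = w i div 2"
      have wk: "w i = 2 * k + par" using True by (metis k_def mult_div_mod_eq)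
      have 0: "R dvd w i - 2 * k - par" by (simp add: wk)
      have 1: "R dvd w' (\<sigma> i) - 2 * (k + y i) - par" using d unfolding wk by (simp add: algebra_simps)
      have w'r: "w' (\<sigma> i) \<in> {0..<R}" unfolding w'[OF i] using assms(2) by simp
      have e: "half_sign R (k + (x (\<sigma> i) + y i) mod R) = half_sign R (k + y i + x (\<sigma> i))"
      proof (rule half_sign_cong)
        have "k + (x (\<sigma> i) + y i) mod R - (k + y i + x (\<sigma> i)) = (x (\<sigma> i) + y i) mod R - (x (\<sigma> i) + y i)" by simp
        thus "R dvd k + (x (\<sigma> i) + y i) mod R - (k + y i + x (\<sigma> i))" using mod_dvd_diff by metis
      qed
      have "col_sign R par ((x (\<sigma> i) + y i) mod R) (w i) = half_sign R k * half_sign R (k + y i + x (\<sigma> i))"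
        using col_sign_lift[OF assms(1,2) w[OF iA] True 0] e by simp
      \<comment> \<open>The square of the intermediate half sign is inserted.\<close>
      also have "\<dots> = (half_sign R (k + y i) * half_sign R (k + y i + x (\<sigma> i))) * (half_sign R k * half_sign R (k + y i))"
        using half_sign_square[of R "k + y i"] by (simp add: mult_ac)
      also have "\<dots> = col_sign R par (x (\<sigma> i)) (w' (\<sigma> i)) * col_sign R par (y i) (w i)"
        using col_sign_lift[OF assms(1,2) w[OF iA] True 0, of "y i"]
          col_sign_lift[OF assms(1,2) w'r _ 1, of "x (\<sigma> i)"] par True by simp
      finally show ?thesis .
    qed (simp add: col_sign_parity par)
  qed
  hence "(\<Prod>i\<in>Fix n \<iota>. col_sign R par ((x (\<sigma> i) + y i) mod R) (w i)) =
      (\<Prod>i\<in>Fix n \<iota>. col_sign R par (x (\<sigma> i)) (w' (\<sigma> i)) * col_sign R par (y i) (w i))"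
    by (rule prod.cong[OF refl])
  also have "\<dots> = (\<Prod>i\<in>Fix n \<iota>. col_sign R par (x (\<sigma> i)) (w' (\<sigma> i))) * (\<Prod>i\<in>Fix n \<iota>. col_sign R par (y i) (w i))"
    by (rule prod.distrib)
  also have "(\<Prod>i\<in>Fix n \<iota>. col_sign R par (x (\<sigma> i)) (w' (\<sigma> i))) = (\<Prod>j\<in>Fix n \<iota>'. col_sign R par (x j) (w' j))"
    by (rule prod.reindex_bij_betw[OF bij])
  finally show ?thesis .
qed

text \<open>\<sigma> carries the pairs of one involution to those of the other but may exchange
  lower and upper ends. The bijection picks the lower end of the image, and symmetry of
  \<open>pair_sign\<close> makes the choice harmless.\<close>

lemma pair_sign_prod:
  assumes \<pi>: "inj \<pi>" and \<sigma>: "\<sigma> permutes {1..n}"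
    and conj: "\<And>i. i \<in> {1..n} \<Longrightarrow> \<iota>' (\<sigma> i) = \<sigma> (\<iota> i)"
    and \<iota>: "\<And>i. i \<in> {1..n} \<Longrightarrow> \<iota> i \<in> {1..n} \<and> \<iota> (\<iota> i) = i"
  shows "(\<Prod>i\<in>lower_ends n \<iota>. pair_sign (\<pi> \<circ> \<sigma>) i (\<iota> i)) =
    (\<Prod>j\<in>lower_ends n \<iota>'. pair_sign \<pi> j (\<iota>' j)) * (\<Prod>i\<in>lower_ends n \<iota>. pair_sign \<sigma> i (\<iota> i))"
proof -
  have \<sigma>i: "\<sigma> i \<in> {1..n} \<longleftrightarrow> i \<in> {1..n}" for i by (rule permutes_in_image[OF \<sigma>])
  have inj: "\<sigma> i = \<sigma> j \<longleftrightarrow> i = j" for i j using permutes_inj[OF \<sigma>] by (simp add: inj_eq)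
  have inv: "inv_into UNIV \<sigma> (\<sigma> i) = i" for i by (rule permutes_inverses(2)[OF \<sigma>])
  let ?f = "\<lambda>i. if \<sigma> i < \<sigma> (\<iota> i) then \<sigma> i else \<sigma> (\<iota> i)"
  let ?b = "\<lambda>j. if inv_into UNIV \<sigma> j < inv_into UNIV \<sigma> (\<iota>' j) then inv_into UNIV \<sigma> j else inv_into UNIV \<sigma> (\<iota>' j)"
  have "(\<Prod>i\<in>lower_ends n \<iota>. pair_sign \<pi> (\<sigma> i) (\<sigma> (\<iota> i))) = (\<Prod>j\<in>lower_ends n \<iota>'. pair_sign \<pi> j (\<iota>' j))"
  proof (rule prod.reindex_bij_witness[where i = ?b and j = ?f])
    fix i assume "i \<in> lower_ends n \<iota>"
    hence i: "i \<in> {1..n}" "i < \<iota> i" by (simp_all add: lower_ends_def)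
    have \<iota>i: "\<iota> i \<in> {1..n}" "\<iota> (\<iota> i) = i" using \<iota>[OF i(1)] by blast+
    have c1: "\<iota>' (\<sigma> i) = \<sigma> (\<iota> i)" by (rule conj[OF i(1)])
    have c2: "\<iota>' (\<sigma> (\<iota> i)) = \<sigma> i" using conj[OF \<iota>i(1)] \<iota>i(2) by simp
    have ne: "\<sigma> i \<noteq> \<sigma> (\<iota> i)" using i(2) inj by simp
    show "?b (?f i) = i" using i(2) by (simp add: c1 c2 inv)
    show "?f i \<in> lower_ends n \<iota>'"
      using i(1) \<iota>i(1) \<sigma>i ne c1 c2 unfolding lower_ends_def by (simp del: atLeastAtMost_iff)
    show "pair_sign \<pi> (?f i) (\<iota>' (?f i)) = pair_sign \<pi> (\<sigma> i) (\<sigma> (\<iota> i))"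
      using pair_sign_sym[OF \<pi> ne] by (simp add: c1 c2)
  next
    fix j assume "j \<in> lower_ends n \<iota>'"
    hence j: "j \<in> {1..n}" "j < \<iota>' j" by (simp_all add: lower_ends_def)
    define i where "i = inv_into UNIV \<sigma> j"
    have ji: "j = \<sigma> i" by (simp add: i_def permutes_inverses(1)[OF \<sigma>])
    have i: "i \<in> {1..n}" using j(1) \<sigma>i unfolding ji by blast
    have \<iota>i: "\<iota> i \<in> {1..n}" "\<iota> (\<iota> i) = i" using \<iota>[OF i] by blast+
    have c1: "\<iota>' (\<sigma> i) = \<sigma> (\<iota> i)" by (rule conj[OF i])
    have lt: "\<sigma> i < \<sigma> (\<iota> i)" using j(2) unfolding ji c1 .
    hence ne: "i \<noteq> \<iota> i" by auto
    show "?f (?b j) = j" using lt \<iota>i(2) unfolding ji c1 inv by simp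
    show "?b j \<in> lower_ends n \<iota>"
      using i \<iota>i ne unfolding ji c1 inv lower_ends_def by (simp del: atLeastAtMost_iff)
  qed
  thus ?thesis unfolding pair_sign_comp prod.distrib by simp
qed

section \<open>Cocycle identity and comparison with the given sign\<close>

context
  fixes r n :: nat
  assumes r_pos: "0 < r" and r_even: "even r"
begin

text \<open>Upper ends of pairs contribute 1, and at a lower end \<open>inv_sign\<close> agrees with
  \<open>pair_sign\<close>. In this form the two kinds of sign can be treated separately.\<close>

lemma tot_sign_split:
  assumes g: "(x, \<pi>) \<in> carrier (wreath r n)" and \<omega>: "(w, \<iota>) \<in> carrier (wreath r n)"
  shows "tot_sign r n par (x, \<pi>) (enc n (w, \<iota>)) =
    (\<Prod>i\<in>Fix n \<iota>. col_sign (int r) par (x i) (w i)) * (\<Prod>i\<in>lower_ends n \<iota>. pair_sign \<pi> i (\<iota> i))"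
proof -
  have \<pi>: "\<pi> permutes {1..n}" using g unfolding wreath_carrier_iff[OF r_pos] by simp
  have F: "Fix n \<iota> \<subseteq> {1..n}" by (auto simp: Fix_def)
  have "tot_sign r n par (x, \<pi>) (enc n (w, \<iota>)) = (\<Prod>i\<in>{1..n}. loc_sign (int r) \<pi> x par i (\<iota> i, w i))"
    unfolding tot_sign_def fst_conv snd_conv by (rule prod.cong[OF refl]) (simp only: enc_apply)
  also have "\<dots> = (\<Prod>i\<in>{1..n} - Fix n \<iota>. loc_sign (int r) \<pi> x par i (\<iota> i, w i)) *
      (\<Prod>i\<in>Fix n \<iota>. loc_sign (int r) \<pi> x par i (\<iota> i, w i))"
    by (rule prod.subset_diff[OF F]) simp
  also have "(\<Prod>i\<in>Fix n \<iota>. loc_sign (int r) \<pi> x par i (\<iota> i, w i)) = (\<Prod>i\<in>Fix n \<iota>. col_sign (int r) par (x i) (w i))"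
    by (rule prod.cong[OF refl]) (simp add: loc_sign_def Fix_def)
  also have "(\<Prod>i\<in>{1..n} - Fix n \<iota>. loc_sign (int r) \<pi> x par i (\<iota> i, w i)) =
      (\<Prod>i\<in>lower_ends n \<iota>. pair_sign \<pi> i (\<iota> i))"
  proof (rule prod.mono_neutral_cong_right)
    show "lower_ends n \<iota> \<subseteq> {1..n} - Fix n \<iota>" by (auto simp: lower_ends_def Fix_def)
    show "\<forall>i\<in>{1..n} - Fix n \<iota> - lower_ends n \<iota>. loc_sign (int r) \<pi> x par i (\<iota> i, w i) = 1"
      by (auto simp: lower_ends_def Fix_def loc_sign_def inv_sign_def)
    fix i assume "i \<in> lower_ends n \<iota>"
    hence lt: "i < \<iota> i" by (simp add: lower_ends_def)
    have "\<pi> i \<noteq> \<pi> (\<iota> i)" using lt permutes_inj[OF \<pi>] by (metis inj_eq less_irrefl)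
    thus "loc_sign (int r) \<pi> x par i (\<iota> i, w i) = pair_sign \<pi> i (\<iota> i)"
      using lt by (auto simp: loc_sign_def inv_sign_def pair_sign_def)
  qed simp
  finally show ?thesis by (simp only: mult.commute)
qed

text \<open>The part on fixed points and the part on pairs each satisfy the identity, and they do so
  for either value of \<open>par\<close>. The dependence of the clause on the total colour is dealt
  with apart from this.\<close>

lemma tot_sign_cocycle:
  assumes g: "g \<in> carrier (wreath r n)" and h: "h \<in> carrier (wreath r n)"
    and \<omega>: "\<omega> \<in> carrier (wreath r n)" and sym: "transp r n \<omega> = \<omega>"
  shows "tot_sign r n par (g \<otimes>\<^bsub>wreath r n\<^esub> h) (enc n \<omega>) =
    tot_sign r n par g (enc n (h \<otimes>\<^bsub>wreath r n\<^esub> \<omega> \<otimes>\<^bsub>wreath r n\<^esub> transp r n h)) * tot_sign r n par h (enc n \<omega>)"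
proof -
  obtain x \<pi> y \<sigma> w \<iota> where e: "g = (x, \<pi>)" "h = (y, \<sigma>)" "\<omega> = (w, \<iota>)" by (cases g, cases h, cases \<omega>)
  note g' = g[unfolded e] and h' = h[unfolded e] and \<omega>' = \<omega>[unfolded e]
  have \<pi>: "\<pi> permutes {1..n}" and \<sigma>: "\<sigma> permutes {1..n}" and \<iota>: "\<iota> permutes {1..n}"
    and w: "w \<in> {1..n} \<rightarrow>\<^sub>E {0..<int r}"
    using g' h' \<omega>' unfolding wreath_carrier_iff[OF r_pos] by auto
  let ?w' = "\<lambda>i\<in>{1..n}. (y (\<iota> (inv_into UNIV \<sigma> i)) + w (inv_into UNIV \<sigma> i) + y (inv_into UNIV \<sigma> i)) mod int r"
  let ?\<iota>' = "\<sigma> \<circ> \<iota> \<circ> inv_into UNIV \<sigma>"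
  have act: "h \<otimes>\<^bsub>wreath r n\<^esub> \<omega> \<otimes>\<^bsub>wreath r n\<^esub> transp r n h = (?w', ?\<iota>')"
    unfolding e by (rule act_pair[OF r_pos h' \<omega>'])
  have mon: "Group.monoid (wreath r n)" by (rule group.is_monoid[OF group_wreath[OF r_pos]])
  have actW: "(?w', ?\<iota>') \<in> carrier (wreath r n)"
    unfolding act[symmetric] by (intro monoid.m_closed[OF mon] h \<omega> transp_closed[OF r_pos])
  have gh: "g \<otimes>\<^bsub>wreath r n\<^esub> h \<in> carrier (wreath r n)" by (intro monoid.m_closed[OF mon] g h)
  have inv: "inv_into UNIV \<sigma> (\<sigma> i) = i" for i by (rule permutes_inverses(2)[OF \<sigma>])
  have iota: "\<iota> i \<in> {1..n} \<and> \<iota> (\<iota> i) = i" if "i \<in> {1..n}" for i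
    using that sym permutes_in_image[OF \<iota>, of i] unfolding e transp_fixed_iff[OF r_pos \<omega>'] by blast
  have conj: "?\<iota>' (\<sigma> i) = \<sigma> (\<iota> i)" for i by (simp add: inv)
  have fixpart: "(\<Prod>i\<in>Fix n \<iota>. col_sign (int r) par ((x (\<sigma> i) + y i) mod int r) (w i)) =
      (\<Prod>j\<in>Fix n ?\<iota>'. col_sign (int r) par (x j) (?w' j)) * (\<Prod>i\<in>Fix n \<iota>. col_sign (int r) par (y i) (w i))"
  proof (rule fix_sign_prod[where \<sigma> = \<sigma> and \<iota> = \<iota> and \<iota>' = ?\<iota>' and w' = ?w' and R = "int r"])
    show "\<sigma> permutes {1..n}" by (rule \<sigma>)
    show "?\<iota>' (\<sigma> i) = \<sigma> (\<iota> i)" for i by (rule conj)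
    show "even (int r)" "0 < int r" using r_pos r_even by simp_all
    show "w i \<in> {0..<int r}" if "i \<in> {1..n}" for i by (rule PiE_mem[OF w that])
    fix i assume "i \<in> Fix n \<iota>"
    hence i: "i \<in> {1..n}" "\<iota> i = i" by (simp_all add: Fix_def)
    have "\<sigma> i \<in> {1..n}" using i permutes_in_image[OF \<sigma>] by blast
    thus "?w' (\<sigma> i) = (w i + 2 * y i) mod int r" by (simp add: inv i algebra_simps)
  qed
  have "(\<Prod>i\<in>Fix n \<iota>. col_sign (int r) par ((\<lambda>i\<in>{1..n}. (x (\<sigma> i) + y i) mod int r) i) (w i)) =
      (\<Prod>i\<in>Fix n \<iota>. col_sign (int r) par ((x (\<sigma> i) + y i) mod int r) (w i))"
    by (rule prod.cong[OF refl]) (simp add: Fix_def)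
  moreover have "(\<Prod>i\<in>lower_ends n \<iota>. pair_sign (\<pi> \<circ> \<sigma>) i (\<iota> i)) =
      (\<Prod>j\<in>lower_ends n ?\<iota>'. pair_sign \<pi> j (?\<iota>' j)) * (\<Prod>i\<in>lower_ends n \<iota>. pair_sign \<sigma> i (\<iota> i))"
  proof (rule pair_sign_prod[where \<sigma> = \<sigma> and \<iota> = \<iota> and \<iota>' = ?\<iota>'])
    show "inj \<pi>" "\<sigma> permutes {1..n}" by (rule permutes_inj[OF \<pi>], rule \<sigma>)
    show "?\<iota>' (\<sigma> i) = \<sigma> (\<iota> i)" for i by (rule conj)
    show "\<iota> i \<in> {1..n} \<and> \<iota> (\<iota> i) = i" if "i \<in> {1..n}" for i by (rule iota[OF that])
  qed
  ultimately show ?thesis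
    using tot_sign_split[OF gh[unfolded e wreath_mult[OF \<sigma>]] \<omega>', of par]
      tot_sign_split[OF g' actW, of par] tot_sign_split[OF h' \<omega>', of par] fixpart
    unfolding act unfolding e wreath_mult[OF \<sigma>] by (simp only: mult_ac)
qed

lemma tot_sign_one:
  assumes \<omega>: "\<omega> \<in> carrier (wreath r n)"
  shows "tot_sign r n par \<one>\<^bsub>wreath r n\<^esub> (enc n \<omega>) = 1"
  unfolding tot_sign_def
proof (rule prod.neutral, rule ballI)
  obtain w \<iota> where e: "\<omega> = (w, \<iota>)" by (cases \<omega>)
  have w: "w \<in> {1..n} \<rightarrow>\<^sub>E {0..<int r}" using \<omega> unfolding e wreath_carrier_iff[OF r_pos] by auto
  fix i assume i: "i \<in> {1..n}"
  have "w i \<in> {0..<int r}" by (rule PiE_mem[OF w i])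
  hence "(w i div 2) mod int r < int r div 2" using r_even by auto
  thus "loc_sign (int r) (snd \<one>\<^bsub>wreath r n\<^esub>) (fst \<one>\<^bsub>wreath r n\<^esub>) par i (enc n \<omega> i) = 1"
    using i unfolding e enc_apply[OF i] wreath_one by (simp add: loc_sign_def inv_sign_def col_sign_def)
qed

lemma odd_witness_iff:
  fixes R :: int
  assumes "even R" "0 < R" "w \<in> {0..<R}"
  shows "odd w \<and> (\<exists>k\<in>{0..R div 2 - 1}. 2 * k + 1 = w \<and> (c + k) mod R \<in> {R div 2..R - 1}) \<longleftrightarrow>
    w mod 2 = 1 \<and> R div 2 \<le> (c + w div 2) mod R"
proof
  assume "odd w \<and> (\<exists>k\<in>{0..R div 2 - 1}. 2 * k + 1 = w \<and> (c + k) mod R \<in> {R div 2..R - 1})"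
  then obtain k where k: "2 * k + 1 = w" "R div 2 \<le> (c + k) mod R" by auto
  have "w div 2 = k \<and> w mod 2 = 1" using k(1) by presburger
  thus "w mod 2 = 1 \<and> R div 2 \<le> (c + w div 2) mod R" using k(2) by simp
next
  assume A: "w mod 2 = 1 \<and> R div 2 \<le> (c + w div 2) mod R"
  have "w div 2 \<in> {0..R div 2 - 1}" using assms by auto
  moreover have "2 * (w div 2) + 1 = w" "odd w" using conjunct1[OF A] by presburger+
  moreover have "(c + w div 2) mod R \<in> {R div 2..R - 1}" using A assms(2) by simp
  ultimately show "odd w \<and> (\<exists>k\<in>{0..R div 2 - 1}. 2 * k + 1 = w \<and> (c + k) mod R \<in> {R div 2..R - 1})" by blast
qed

lemma even_witness_iff:
  fixes R :: int
  assumes "even R" "0 < R" "w \<in> {0..<R}"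
  shows "even w \<and> (\<exists>k\<in>{0..R div 2 - 1}. 2 * k = w \<and> (c + k) mod R \<in> {R div 2..R - 1}) \<longleftrightarrow>
    w mod 2 = 0 \<and> R div 2 \<le> (c + w div 2) mod R"
proof
  assume "even w \<and> (\<exists>k\<in>{0..R div 2 - 1}. 2 * k = w \<and> (c + k) mod R \<in> {R div 2..R - 1})"
  then obtain k where k: "2 * k = w" "R div 2 \<le> (c + k) mod R" by auto
  have "w div 2 = k \<and> w mod 2 = 0" using k(1) by presburger
  thus "w mod 2 = 0 \<and> R div 2 \<le> (c + w div 2) mod R" using k(2) by simp
next
  assume A: "w mod 2 = 0 \<and> R div 2 \<le> (c + w div 2) mod R"
  have "w div 2 \<in> {0..R div 2 - 1}" using assms by auto
  moreover have "2 * (w div 2) = w" "even w" using conjunct1[OF A] by presburger+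
  moreover have "(c + w div 2) mod R \<in> {R div 2..R - 1}" using A assms(2) by simp
  ultimately show "even w \<and> (\<exists>k\<in>{0..R div 2 - 1}. 2 * k = w \<and> (c + k) mod R \<in> {R div 2..R - 1})" by blast
qed

text \<open>An index counted in \<open>B_tilde\<close> is a fixed point and an index counted for an
  inverted pair is not. So both exponents merge into one product of local signs, the form that
  factors over cycles.\<close>

lemma sign_tilde_eq:
  assumes p: "2 * p dvd r" and g: "g \<in> carrier (wreath r n)" and \<omega>: "\<omega> \<in> carrier (wreath r n)"
    and sym: "transp r n \<omega> = \<omega>"
  shows "sign_tilde r p n g \<omega> =
    of_int (tot_sign r n (if int (2 * p) dvd col_sum n (fst \<omega>) then 1 else 0) g (enc n \<omega>))"
proof -
  obtain x \<pi> w \<iota> where e: "g = (x, \<pi>)" "\<omega> = (w, \<iota>)" by (cases g, cases \<omega>)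
  note g' = g[unfolded e] and \<omega>' = \<omega>[unfolded e]
  have \<pi>: "\<pi> permutes {1..n}" and \<iota>: "\<iota> permutes {1..n}" and w: "w \<in> {1..n} \<rightarrow>\<^sub>E {0..<int r}"
    using g' \<omega>' unfolding wreath_carrier_iff[OF r_pos] by auto
  have iota: "\<iota> (\<iota> i) = i" "\<iota> i \<in> {1..n}" if "i \<in> {1..n}" for i
    using that sym permutes_in_image[OF \<iota>, of i] unfolding e transp_fixed_iff[OF r_pos \<omega>'] by blast+
  define par :: int where "par = (if int (2 * p) dvd col_sum n w then 1 else 0)"
  let ?R = "int r"
  let ?Q1 = "\<lambda>i. w i mod 2 = par \<and> ?R div 2 \<le> (x i + w i div 2) mod ?R"
  let ?Q2 = "\<lambda>i. i < \<iota> i \<and> \<pi> (\<iota> i) < \<pi> i"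
  have R: "even ?R" "0 < ?R" using r_even r_pos by simp_all
  have wF: "w i \<in> {0..<?R}" if "i \<in> Fix n \<iota>" for i
    by (rule PiE_mem[OF w]) (use that in \<open>simp add: Fix_def\<close>)
  have B: "B_tilde r p n (x, \<pi>) (w, \<iota>) = {i \<in> Fix n \<iota>. ?Q1 i}"
  proof (cases "int (2 * p) dvd col_sum n w")
    case True
    hence par: "par = 1" by (simp add: par_def)
    have D: "Delta r n (w, \<iota>) \<in> residue_multiples (2 * p) r"
      unfolding Delta_pair residue_multiples_iff[OF r_pos p] by (rule True)
    show ?thesis
      unfolding B_tilde_def if_P[OF D] par perm_of_def color_def fst_conv snd_conv
      by (rule Collect_cong, rule conj_cong[OF refl], rule odd_witness_iff[OF R wF])
  next
    case False
    hence par: "par = 0" by (simp add: par_def)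
    have D: "\<not> Delta r n (w, \<iota>) \<in> residue_multiples (2 * p) r"
      unfolding Delta_pair residue_multiples_iff[OF r_pos p] by (rule False)
    show ?thesis
      unfolding B_tilde_def if_not_P[OF D] par perm_of_def color_def fst_conv snd_conv
      by (rule Collect_cong, rule conj_cong[OF refl], rule even_witness_iff[OF R wF])
  qed
  have I: "card (Inv n \<pi> \<inter> Pair2 n \<iota>) = card {i \<in> {1..n}. ?Q2 i}"
  proof -
    have "Inv n \<pi> \<inter> Pair2 n \<iota> = (\<lambda>i. (i, \<iota> i)) ` {i \<in> {1..n}. ?Q2 i}"
    proof (intro equalityI subsetI)
      fix q assume q: "q \<in> Inv n \<pi> \<inter> Pair2 n \<iota>"
      obtain i j where ij: "q = (i, j)" by (cases q)
      have "1 \<le> i" "i < j" "j \<le> n" "\<pi> j < \<pi> i" "\<iota> i = j" using q by (simp_all add: ij Inv_def Pair2_def)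
      thus "q \<in> (\<lambda>i. (i, \<iota> i)) ` {i \<in> {1..n}. ?Q2 i}" unfolding ij by (intro image_eqI[of _ _ i]) simp_all
    next
      fix q assume "q \<in> (\<lambda>i. (i, \<iota> i)) ` {i \<in> {1..n}. ?Q2 i}"
      then obtain i where i: "q = (i, \<iota> i)" "i \<in> {1..n}" "?Q2 i" by blast
      thus "q \<in> Inv n \<pi> \<inter> Pair2 n \<iota>" using iota[OF i(2)] by (simp add: Inv_def Pair2_def)
    qed
    thus ?thesis by (simp add: card_image inj_on_def)
  qed
  have "tot_sign r n par (x, \<pi>) (enc n (w, \<iota>)) = (\<Prod>i\<in>{1..n}. if (if \<iota> i = i then ?Q1 i else ?Q2 i) then -1 else 1)"
    unfolding tot_sign_def fst_conv snd_conv
  proof (rule prod.cong[OF refl])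
    fix i assume i: "i \<in> {1..n}"
    show "loc_sign ?R \<pi> x par i (enc n (w, \<iota>) i) = (if (if \<iota> i = i then ?Q1 i else ?Q2 i) then -1 else 1)"
      unfolding enc_apply[OF i] by (simp add: loc_sign_def col_sign_def inv_sign_def)
  qed
  also have "\<dots> = (-1) ^ card {i \<in> {1..n}. if \<iota> i = i then ?Q1 i else ?Q2 i}"
    by (rule prod_minus_one) simp
  also have "{i \<in> {1..n}. if \<iota> i = i then ?Q1 i else ?Q2 i} = {i \<in> Fix n \<iota>. ?Q1 i} \<union> {i \<in> {1..n}. ?Q2 i}"
    by (auto simp: Fix_def)
  also have "card \<dots> = card {i \<in> Fix n \<iota>. ?Q1 i} + card {i \<in> {1..n}. ?Q2 i}"
    by (rule card_Un_disjoint) (auto simp: Fix_def)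
  finally show ?thesis
    unfolding e sign_tilde_def B perm_of_def snd_conv fst_conv I par_def[symmetric] by (simp add: power_add)
qed

end

section \<open>From the wreath product to G(r,p,n)\<close>

definition shift_col :: "nat \<Rightarrow> nat \<Rightarrow> int \<Rightarrow> (nat \<Rightarrow> nat \<times> int) \<Rightarrow> nat \<Rightarrow> nat \<times> int" where
  "shift_col r n c h = (\<lambda>i\<in>{1..n}. (fst (h i), (snd (h i) + c) mod int r))"

definition total_col :: "nat \<Rightarrow> (nat \<Rightarrow> nat \<times> int) \<Rightarrow> int" where
  "total_col n h = col_sum n (\<lambda>i. snd (h i))"

lemma shift_col_apply: "i \<in> {1..n} \<Longrightarrow> shift_col r n c h i = (fst (h i), (snd (h i) + c) mod int r)"
  by (simp add: shift_col_def)

lemma shift_col_add: "shift_col r n a (shift_col r n b h) = shift_col r n (b + a) h"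
  unfolding shift_col_def[of r n a] shift_col_def[of r n "b + a"]
  by (rule restrict_ext) (simp add: shift_col_apply mod_simps add.assoc)

lemma shift_col_zero:
  assumes "h \<in> Adm (int r) P {1..n}"
  shows "shift_col r n 0 h = h"
proof
  fix i show "shift_col r n 0 h i = h i"
  proof (cases "i \<in> {1..n}")
    case True
    thus ?thesis using Adm_snd[OF assms True] by (simp add: shift_col_apply prod_eq_iff)
  next
    case False
    thus ?thesis using PiE_arb[OF Adm_PiE[OF assms] False]
      by (simp only: shift_col_def restrict_apply if_False)
  qed
qed

lemma total_col_shift:
  assumes "m dvd r"
  shows "int m dvd total_col n (shift_col r n c h) - (total_col n h + int n * c)"
proof -
  have "total_col n (shift_col r n c h) - (total_col n h + int n * c) =
      (\<Sum>i\<in>{1..n}. (snd (h i) + c) mod int r - (snd (h i) + c))"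
    unfolding total_col_def col_sum_def by (simp add: sum_subtractf sum.distrib shift_col_apply)
  moreover have "int m dvd (\<Sum>i\<in>{1..n}. (snd (h i) + c) mod int r - (snd (h i) + c))"
  proof (rule dvd_sum)
    fix i
    have "int m dvd int r" using assms by simp
    thus "int m dvd (snd (h i) + c) mod int r - (snd (h i) + c)" using mod_dvd_diff dvd_trans by blast
  qed
  ultimately show ?thesis by metis
qed

lemma total_col_shift_iff:
  assumes "m dvd r"
  shows "int m dvd total_col n (shift_col r n c h) \<longleftrightarrow> int m dvd total_col n h + int n * c"
proof -
  have "total_col n (shift_col r n c h) =
      (total_col n (shift_col r n c h) - (total_col n h + int n * c)) + (total_col n h + int n * c)" by simp
  thus ?thesis using dvd_add_right_iff[OF total_col_shift[OF assms, of n c h]] by metis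
qed

lemma shift_dvd:
  fixes R :: int
  assumes "R dvd a - b - d"
  shows "R dvd (a + c) mod R - (b + c) mod R - d"
proof -
  have "(a + c) mod R - (b + c) mod R - d =
      ((a + c) mod R - (a + c)) - ((b + c) mod R - (b + c)) + (a - b - d)" by simp
  moreover have "R dvd \<dots>" by (intro dvd_add dvd_diff mod_dvd_diff assms)
  ultimately show ?thesis by metis
qed

text \<open>The conditions involve the colours of the unknown only through differences, so adding a
  common constant preserves them.\<close>

lemma shift_invol:
  assumes h: "h \<in> Adm (int r) (invol_cond (int r) \<pi> x) {1..n}" and \<pi>: "\<pi> permutes {1..n}" and r: "0 < r"
  shows "shift_col r n c h \<in> Adm (int r) (invol_cond (int r) \<pi> x) {1..n}"
proof (rule AdmI)
  fix i assume i: "i \<in> {1..n}"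
  have fi: "fst (h i) \<in> {1..n}" and \<pi>i: "\<pi> i \<in> {1..n}" using Adm_fst[OF h i] permutes_in_image[OF \<pi>] i by blast+
  show "fst (shift_col r n c h i) \<in> {1..n}" unfolding shift_col_apply[OF i] fst_conv by (rule fi)
  show "snd (shift_col r n c h i) \<in> {0..<int r}" unfolding shift_col_apply[OF i] using r by simp
  show "invol_cond (int r) \<pi> x (shift_col r n c h) i"
    using Adm_cond[OF h i]
    unfolding invol_cond_def shift_col_apply[OF i] fst_conv snd_conv shift_col_apply[OF fi] shift_col_apply[OF \<pi>i]
    by (intro conjI shift_dvd) (simp_all only: simp_thms)
qed (simp only: shift_col_def restrict_apply if_False)

lemma shift_sqrt:
  assumes h: "h \<in> Adm (int r) (sqrt_cond (int r) \<pi> x) {1..n}" and r: "0 < r"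
  shows "shift_col r n c h \<in> Adm (int r) (sqrt_cond (int r) \<pi> x) {1..n}"
proof (rule AdmI)
  fix i assume i: "i \<in> {1..n}"
  have fi: "fst (h i) \<in> {1..n}" using Adm_fst[OF h i] .
  show "fst (shift_col r n c h i) \<in> {1..n}" unfolding shift_col_apply[OF i] fst_conv by (rule fi)
  show "snd (shift_col r n c h i) \<in> {0..<int r}" unfolding shift_col_apply[OF i] using r by simp
  show "sqrt_cond (int r) \<pi> x (shift_col r n c h) i"
    using Adm_cond[OF h i]
    unfolding sqrt_cond_def shift_col_apply[OF i] fst_conv snd_conv shift_col_apply[OF fi]
    by (intro conjI shift_dvd) (simp_all only: simp_thms)
qed (simp only: shift_col_def restrict_apply if_False)

text \<open>A colour \<open>2 * k\<close> becomes \<open>2 * k + 1\<close> with the same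
  \<open>k\<close>; it does not wrap around because \<open>R\<close> is even. So the two signs agree
  at each point.\<close>

lemma col_sign_shift_odd:
  assumes "even R" "0 < R" "w \<in> {0..<R}"
  shows "col_sign R 1 c ((w + 1) mod R) = col_sign R 0 c w"
proof (cases "even w")
  case True
  have "w + 1 \<noteq> R" using True assms(1) by auto
  hence e: "(w + 1) mod R = w + 1" using assms(3) by simp
  have "(w + 1) div 2 = w div 2" "(w + 1) mod 2 = 1" "w mod 2 = 0" using True by presburger+
  thus ?thesis unfolding e col_sign_def by simp
next
  case False
  have "2 dvd (w + 1) mod R" using False assms(1) by (simp add: dvd_mod_iff)
  hence a: "(w + 1) mod R mod 2 \<noteq> 1" by presburger
  have b: "w mod 2 \<noteq> 0" using False by presburger
  show ?thesis unfolding col_sign_parity[OF a] col_sign_parity[OF b] ..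
qed

text \<open>A colour \<open>2 * k + 1\<close> becomes \<open>2 * (k + 1)\<close>, so
  \<open>k\<close> moves by one and the signs differ point by point. The discrepancy at
  \<open>i\<close> is a quantity depending on the half at \<open>i\<close> times the same quantity
  at the image of \<open>i\<close>. As \<pi> permutes the fixed points of odd colour, these factors
  cancel in the product.\<close>

lemma fix_sign_shift_even:
  assumes R: "even R" "0 < R" and fin: "finite F" and inj: "inj \<pi>" and \<pi>F: "\<pi> ` F \<subseteq> F"
    and w: "\<And>i. i \<in> F \<Longrightarrow> w i \<in> {0..<R}"
    and step: "\<And>i. i \<in> F \<Longrightarrow> R dvd w (\<pi> i) - w i - 2 * x i"
  shows "(\<Prod>i\<in>F. col_sign R 0 (x i) ((w i + 1) mod R)) = (\<Prod>i\<in>F. col_sign R 1 (x i) (w i))"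
proof -
  let ?O = "{i \<in> F. odd (w i)}"
  let ?k = "\<lambda>i. w i div 2"
  \<comment> \<open>The change of the half sign when its argument grows by one. Invariance under
    \<open>R div 2\<close> makes it independent of the chosen half.\<close>
  define \<delta> where "\<delta> k = half_sign R k * half_sign R (k + 1)" for k
  have \<delta>2: "\<delta> k * \<delta> k = 1" for k
    using half_sign_square[of R k] half_sign_square[of R "k + 1"] by (simp add: \<delta>_def mult_ac)
  have \<delta>per: "\<delta> (k + (R div 2) * e) = \<delta> k" for k e
  proof -
    have e: "k + (R div 2) * e + 1 = (k + 1) + (R div 2) * e" by simp
    show ?thesis unfolding \<delta>_def e half_sign_multiple[OF R] by simp
  qed
  have par: "w (\<pi> i) mod 2 = w i mod 2" if "i \<in> F" for i
  proof -
    have "2 dvd w (\<pi> i) - w i - 2 * x i" using step[OF that] R(1) dvd_trans by blast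
    thus ?thesis by presburger
  qed
  have \<pi>O: "\<pi> ` ?O \<subseteq> ?O"
  proof (rule image_subsetI)
    fix i assume i: "i \<in> ?O"
    hence "w (\<pi> i) mod 2 = w i mod 2" using par by blast
    hence "odd (w (\<pi> i))" using i by (simp add: odd_iff_mod_2_eq_one)
    thus "\<pi> i \<in> ?O" using i \<pi>F by blast
  qed
  have bij: "bij_betw \<pi> ?O ?O"
    unfolding bij_betw_def using endo_inj_surj[OF _ \<pi>O] fin inj by (auto intro: inj_on_subset)
  have prods: "col_sign R 0 (x i) ((w i + 1) mod R) = \<delta> (?k i) * \<delta> (?k (\<pi> i)) * col_sign R 1 (x i) (w i)"
    if i: "i \<in> ?O" for i
  proof -
    have iF: "i \<in> F" and odd: "odd (w i)" using i by auto
    obtain k where wk: "w i = 2 * k + 1" using odd by (rule oddE)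
    have ki: "?k i = k" unfolding wk by simp
    have 1: "col_sign R 1 (x i) (w i) = half_sign R k * half_sign R (k + x i)"
      by (rule col_sign_lift[OF R w[OF iF]]) (simp_all add: wk)
    have d: "R dvd (w i + 1) mod R - 2 * (k + 1) - 0"
    proof -
      have "2 * (k + 1) + 0 = w i + 1" unfolding wk by simp
      hence "(w i + 1) mod R - 2 * (k + 1) - 0 = (w i + 1) mod R - (w i + 1)" by simp
      thus ?thesis using mod_dvd_diff by metis
    qed
    have p0: "(w i + 1) mod R mod 2 = 0"
    proof -
      have "2 dvd (w i + 1) mod R" using odd R(1) by (simp add: dvd_mod_iff)
      thus ?thesis by presburger
    qed
    have 0: "col_sign R 0 (x i) ((w i + 1) mod R) = half_sign R (k + 1) * half_sign R (k + 1 + x i)"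
      by (rule col_sign_lift[OF R _ p0 d]) (use R(2) in simp)
    have odd': "odd (w (\<pi> i))" using \<pi>O i by blast
    obtain k' where wk': "w (\<pi> i) = 2 * k' + 1" using odd' by (rule oddE)
    have ki': "?k (\<pi> i) = k'" unfolding wk' by simp
    obtain e where e: "w (\<pi> i) - w i - 2 * x i = R * e" using step[OF iF] by (auto simp: dvd_def)
    define f where "f = (R div 2) * e"
    have Re: "R * e = 2 * f"
      unfolding f_def mult.assoc[symmetric] dvd_mult_div_cancel[OF R(1)] ..
    have "k' = k + x i + f" using e unfolding wk wk' Re by linarith
    hence k': "k' = k + x i + (R div 2) * e" unfolding f_def .
    have "\<delta> k' = \<delta> (k + x i)" unfolding k' by (rule \<delta>per)
    hence "\<delta> k * \<delta> k' * col_sign R 1 (x i) (w i) =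
        (half_sign R k * half_sign R k) * (half_sign R (k + x i) * half_sign R (k + x i)) *
        (half_sign R (k + 1) * half_sign R (k + 1 + x i))"
      unfolding 1 \<delta>_def by (simp add: mult_ac add_ac)
    hence "\<delta> k * \<delta> k' * col_sign R 1 (x i) (w i) = col_sign R 0 (x i) ((w i + 1) mod R)"
      unfolding half_sign_square 0 by simp
    thus ?thesis unfolding ki ki' by simp
  qed
  have "(\<Prod>i\<in>F. col_sign R 0 (x i) ((w i + 1) mod R)) = (\<Prod>i\<in>?O. col_sign R 0 (x i) ((w i + 1) mod R))"
  proof (rule prod.mono_neutral_right[OF fin])
    show "\<forall>i\<in>F - ?O. col_sign R 0 (x i) ((w i + 1) mod R) = 1"
    proof
      fix i assume "i \<in> F - ?O"
      hence ev: "even (w i)" by blast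
      have "odd ((w i + 1) mod R)" using ev R(1) by (simp add: dvd_mod_iff)
      hence "(w i + 1) mod R mod 2 \<noteq> 0" by presburger
      thus "col_sign R 0 (x i) ((w i + 1) mod R) = 1" by (rule col_sign_parity)
    qed
  qed blast
  also have "\<dots> = (\<Prod>i\<in>?O. \<delta> (?k i) * \<delta> (?k (\<pi> i)) * col_sign R 1 (x i) (w i))"
    by (rule prod.cong[OF refl]) (rule prods)
  also have "\<dots> = (\<Prod>i\<in>?O. \<delta> (?k i)) * (\<Prod>i\<in>?O. \<delta> (?k (\<pi> i))) * (\<Prod>i\<in>?O. col_sign R 1 (x i) (w i))"
    by (simp only: prod.distrib)
  also have "(\<Prod>i\<in>?O. \<delta> (?k (\<pi> i))) = (\<Prod>i\<in>?O. \<delta> (?k i))" by (rule prod.reindex_bij_betw[OF bij])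
  also have "(\<Prod>i\<in>?O. \<delta> (?k i)) * (\<Prod>i\<in>?O. \<delta> (?k i)) = 1"
    unfolding prod.distrib[symmetric] by (simp only: \<delta>2 prod.neutral_const)
  also have "1 * (\<Prod>i\<in>?O. col_sign R 1 (x i) (w i)) = (\<Prod>i\<in>F. col_sign R 1 (x i) (w i))"
    unfolding mult_1_left
  proof (rule prod.mono_neutral_left[OF fin])
    show "\<forall>i\<in>F - ?O. col_sign R 1 (x i) (w i) = 1"
    proof
      fix i assume "i \<in> F - ?O"
      hence "even (w i)" by blast
      hence "w i mod 2 \<noteq> 1" by presburger
      thus "col_sign R 1 (x i) (w i) = 1" by (rule col_sign_parity)
    qed
  qed blast
  finally show ?thesis .
qed

text \<open>The sign of the pairs does not see colours. On fixed points the first equation holds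
  term by term, the second only for the product, and this is where commutation with \<pi>
  enters.\<close>

lemma tot_sign_shift_one:
  assumes r: "even r" "0 < r" and g: "(x, \<pi>) \<in> carrier (wreath r n)"
    and h: "h \<in> Adm (int r) (invol_cond (int r) \<pi> x) {1..n}"
  shows "tot_sign r n 1 (x, \<pi>) (shift_col r n 1 h) = tot_sign r n 0 (x, \<pi>) h"
    "tot_sign r n 0 (x, \<pi>) (shift_col r n 1 h) = tot_sign r n 1 (x, \<pi>) h"
proof -
  have \<pi>: "\<pi> permutes {1..n}" using g unfolding wreath_carrier_iff[OF r(2)] by simp
  have R: "even (int r)" "0 < int r" using r by simp_all
  let ?F = "{i \<in> {1..n}. fst (h i) = i}"
  have F: "?F \<subseteq> {1..n}" by blast
  let ?N = "\<Prod>i\<in>{1..n} - ?F. inv_sign \<pi> i (fst (h i))"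
  have split: "tot_sign r n q (x, \<pi>) h' = ?N * (\<Prod>i\<in>?F. col_sign (int r) q (x i) (snd (h' i)))"
    if "\<And>i. i \<in> {1..n} \<Longrightarrow> fst (h' i) = fst (h i)" for q h'
  proof -
    have "tot_sign r n q (x, \<pi>) h' = (\<Prod>i\<in>{1..n} - ?F. loc_sign (int r) \<pi> x q i (h' i)) *
        (\<Prod>i\<in>?F. loc_sign (int r) \<pi> x q i (h' i))"
      unfolding tot_sign_def fst_conv snd_conv by (rule prod.subset_diff[OF F]) simp
    also have "(\<Prod>i\<in>{1..n} - ?F. loc_sign (int r) \<pi> x q i (h' i)) = ?N"
      by (rule prod.cong[OF refl]) (use that in \<open>simp add: loc_sign_def\<close>)
    also have "(\<Prod>i\<in>?F. loc_sign (int r) \<pi> x q i (h' i)) = (\<Prod>i\<in>?F. col_sign (int r) q (x i) (snd (h' i)))"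
      by (rule prod.cong[OF refl]) (use that in \<open>simp add: loc_sign_def\<close>)
    finally show ?thesis .
  qed
  have sh: "(\<Prod>i\<in>?F. col_sign (int r) q (x i) (snd (shift_col r n 1 h i))) =
      (\<Prod>i\<in>?F. col_sign (int r) q (x i) ((snd (h i) + 1) mod int r))" for q
    by (rule prod.cong[OF refl]) (simp add: shift_col_apply)
  have sh_fst: "fst (shift_col r n 1 h i) = fst (h i)" if "i \<in> {1..n}" for i
    using that by (simp add: shift_col_apply)
  have split_sh: "tot_sign r n q (x, \<pi>) (shift_col r n 1 h) =
      ?N * (\<Prod>i\<in>?F. col_sign (int r) q (x i) ((snd (h i) + 1) mod int r))" for q
    unfolding sh[symmetric] by (rule split) (rule sh_fst)
  have split_h: "tot_sign r n q (x, \<pi>) h = ?N * (\<Prod>i\<in>?F. col_sign (int r) q (x i) (snd (h i)))" for q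
    by (rule split) (rule refl)
  have "(\<Prod>i\<in>?F. col_sign (int r) 1 (x i) ((snd (h i) + 1) mod int r)) =
      (\<Prod>i\<in>?F. col_sign (int r) 0 (x i) (snd (h i)))"
    by (rule prod.cong[OF refl], rule col_sign_shift_odd[OF R]) (use Adm_snd[OF h] in blast)
  thus "tot_sign r n 1 (x, \<pi>) (shift_col r n 1 h) = tot_sign r n 0 (x, \<pi>) h"
    unfolding split_sh split_h
    by (rule arg_cong[where f = "\<lambda>z. ?N * z"])
  have "(\<Prod>i\<in>?F. col_sign (int r) 0 (x i) ((snd (h i) + 1) mod int r)) =
      (\<Prod>i\<in>?F. col_sign (int r) 1 (x i) (snd (h i)))"
  proof (rule fix_sign_shift_even[where \<pi> = \<pi>, OF R])
    show "finite ?F" by simp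
    show "inj \<pi>" by (rule permutes_inj[OF \<pi>])
    show "snd (h i) \<in> {0..<int r}" if "i \<in> ?F" for i by (rule Adm_snd[OF h]) (use that in blast)
    show "\<pi> ` ?F \<subseteq> ?F"
    proof (rule image_subsetI)
      fix i assume i: "i \<in> ?F"
      hence "\<pi> i \<in> {1..n}" using permutes_in_image[OF \<pi>] by blast
      moreover have "fst (h (\<pi> i)) = \<pi> i" using invol_commute[OF h, of i] i by simp
      ultimately show "\<pi> i \<in> ?F" by blast
    qed
    show "int r dvd snd (h (\<pi> i)) - snd (h i) - 2 * x i" if i: "i \<in> ?F" for i
    proof -
      have iA: "i \<in> {1..n}" and fi: "fst (h i) = i" using i by auto
      have "invol_cond (int r) \<pi> x h i" by (rule Adm_cond[OF h iA])
      hence "int r dvd snd (h (\<pi> i)) - snd (h i) - (x i + x i)" unfolding invol_cond_def fi by blast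
      thus ?thesis by (simp only: mult_2)
    qed
  qed
  thus "tot_sign r n 0 (x, \<pi>) (shift_col r n 1 h) = tot_sign r n 1 (x, \<pi>) h"
    unfolding split_sh split_h
    by (rule arg_cong[where f = "\<lambda>z. ?N * z"])
qed

text \<open>Each unit step toggles the clause, so the shift is taken as a natural number and only
  its parity matters.\<close>

lemma tot_sign_shift:
  assumes r: "even r" "0 < r" and g: "(x, \<pi>) \<in> carrier (wreath r n)"
    and h: "h \<in> Adm (int r) (invol_cond (int r) \<pi> x) {1..n}" and q: "q = 0 \<or> q = 1"
  shows "tot_sign r n q (x, \<pi>) (shift_col r n (int c) h) = tot_sign r n ((q + int c) mod 2) (x, \<pi>) h"
  using q
proof (induction c arbitrary: q)
  case 0
  have "q mod 2 = q" using 0 by auto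
  thus ?case using shift_col_zero[OF h] by simp
next
  case (Suc c)
  have \<pi>: "\<pi> permutes {1..n}" using g unfolding wreath_carrier_iff[OF r(2)] by simp
  have e: "shift_col r n (int (Suc c)) h = shift_col r n 1 (shift_col r n (int c) h)"
    unfolding shift_col_add by (simp add: add.commute)
  note sh = tot_sign_shift_one[OF r g shift_invol[OF h \<pi> r(2), of "int c"]]
  from Suc.prems show ?case
  proof
    assume q0: "q = 0"
    have "tot_sign r n q (x, \<pi>) (shift_col r n (int (Suc c)) h) = tot_sign r n ((1 + int c) mod 2) (x, \<pi>) h"
      unfolding e q0 sh by (rule Suc.IH) simp
    thus ?thesis by (simp add: q0 add.commute)
  next
    assume q1: "q = 1"
    have "tot_sign r n q (x, \<pi>) (shift_col r n (int (Suc c)) h) = tot_sign r n ((0 + int c) mod 2) (x, \<pi>) h"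
      unfolding e q1 sh by (rule Suc.IH) simp
    moreover have "(0 + int c) mod 2 = (q + int (Suc c)) mod 2" unfolding q1 by presburger
    ultimately show ?thesis by simp
  qed
qed

section \<open>Counting by total colour\<close>

lemma sum_over_shifts:
  fixes f :: "'a \<Rightarrow> int" and s :: "'a \<Rightarrow> int"
  assumes fin: "finite \<Omega>" and p: "0 < p" and cop: "coprime p n"
  shows "(\<Sum>h\<in>\<Omega>. f h) = (\<Sum>c<p. \<Sum>h | h \<in> \<Omega> \<and> int p dvd s h + int n * int c. f h)"
proof -
  have cop': "coprime (int n) (int p)" using cop by (simp add: coprime_commute)
  \<comment> \<open>As \<open>n\<close> is invertible modulo \<open>p\<close>, exactly one shift
    below \<open>p\<close> makes the total divisible by \<open>p\<close>; the elements are sorted by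
    that shift.\<close>
  have one: "(\<Sum>c<p. if int p dvd t + int n * int c then v else 0) = v" for t and v :: int
  proof -
    obtain u where "[int n * u = 1] (mod int p)" using cong_solve_coprime_int[OF cop'] by blast
    hence u: "int p dvd int n * u - 1" by (simp add: cong_iff_dvd_diff)
    \<comment> \<open>The residue of \<open>- t\<close> times the inverse \<open>u\<close> of
      \<open>n\<close>.\<close>
    define c0 where "c0 = nat ((- t * u) mod int p)"
    have c0: "int c0 = (- t * u) mod int p" using p by (simp add: c0_def)
    have lt: "c0 < p"
    proof -
      have "int c0 < int p" unfolding c0 using p by simp
      thus ?thesis by simp
    qed
    have sol: "int p dvd t + int n * int c0"
    proof -
      have "t + int n * int c0 = int n * (int c0 - (- t * u)) + (int n * u - 1) * (- t)"
        by (simp add: algebra_simps)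
      moreover have "int p dvd int c0 - (- t * u)" unfolding c0 by (rule mod_dvd_diff)
      ultimately show ?thesis using u by (metis dvd_add dvd_mult dvd_mult2)
    qed
    have uniq: "c = c0" if "c < p" "int p dvd t + int n * int c" for c
    proof -
      have "int p dvd (t + int n * int c) - (t + int n * int c0)" by (rule dvd_diff[OF that(2) sol])
      hence "int p dvd int n * (int c - int c0)" by (simp add: algebra_simps)
      hence "int p dvd int c - int c0" using cop' by (simp add: coprime_commute coprime_dvd_mult_right_iff)
      hence "int c = int c0" by (rule eq_if_dvd_diff) (use that(1) lt in auto)
      thus ?thesis by simp
    qed
    have iff: "int p dvd t + int n * int c \<longleftrightarrow> c = c0" if "c < p" for c using uniq[OF that] sol by blast
    have "(\<Sum>c<p. if int p dvd t + int n * int c then v else 0) = (\<Sum>c<p. if c = c0 then v else 0)"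
    proof (rule sum.cong[OF refl])
      fix c assume "c \<in> {..<p}"
      hence "c < p" by (simp only: lessThan_iff)
      thus "(if int p dvd t + int n * int c then v else 0) = (if c = c0 then v else 0)" by (simp only: iff)
    qed
    also have "\<dots> = v" unfolding sum.delta[OF finite_lessThan] using lt by (simp only: lessThan_iff if_True)
    finally show ?thesis .
  qed
  have "(\<Sum>c<p. \<Sum>h | h \<in> \<Omega> \<and> int p dvd s h + int n * int c. f h) =
      (\<Sum>c<p. \<Sum>h\<in>\<Omega>. if int p dvd s h + int n * int c then f h else 0)"
    by (rule sum.cong[OF refl], rule sum.inter_filter[OF fin])
  also have "\<dots> = (\<Sum>h\<in>\<Omega>. \<Sum>c<p. if int p dvd s h + int n * int c then f h else 0)" by (rule sum.swap)
  also have "\<dots> = (\<Sum>h\<in>\<Omega>. f h)" by (rule sum.cong[OF refl]) (rule one)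
  finally show ?thesis by simp
qed

text \<open>The shift by \<open>c\<close> is a bijection from the class that needs it onto the class
  of total colour 0 modulo \<open>m\<close>. The modulus is a parameter because both
  \<open>p\<close> and \<open>2 * p\<close> occur.\<close>

lemma sum_over_shift:
  fixes f :: "(nat \<Rightarrow> nat \<times> int) \<Rightarrow> int"
  assumes closed: "\<And>h d. h \<in> \<Omega> \<Longrightarrow> shift_col r n d h \<in> \<Omega>"
    and zero: "\<And>h. h \<in> \<Omega> \<Longrightarrow> shift_col r n 0 h = h" and m: "m dvd r"
  shows "(\<Sum>h | h \<in> \<Omega> \<and> int m dvd total_col n h + int n * c. f (shift_col r n c h)) =
    (\<Sum>h | h \<in> \<Omega> \<and> int m dvd total_col n h. f h)"
proof (rule sum.reindex_bij_witness[where i = "shift_col r n (- c)" and j = "shift_col r n c"])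
  fix h assume "h \<in> {h. h \<in> \<Omega> \<and> int m dvd total_col n h + int n * c}"
  hence h: "h \<in> \<Omega>" "int m dvd total_col n h + int n * c" by blast+
  show "shift_col r n (- c) (shift_col r n c h) = h" unfolding shift_col_add using zero[OF h(1)] by simp
  show "shift_col r n c h \<in> {h. h \<in> \<Omega> \<and> int m dvd total_col n h}"
    using closed[OF h(1)] h(2) unfolding mem_Collect_eq total_col_shift_iff[OF m] by blast
next
  fix h assume "h \<in> {h. h \<in> \<Omega> \<and> int m dvd total_col n h}"
  hence h: "h \<in> \<Omega>" "int m dvd total_col n h" by blast+
  show e: "shift_col r n c (shift_col r n (- c) h) = h" unfolding shift_col_add using zero[OF h(1)] by simp
  have "int m dvd total_col n (shift_col r n (- c) h) + int n * c"
    unfolding total_col_shift_iff[OF m, symmetric] e by (rule h(2))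
  thus "shift_col r n (- c) h \<in> {h. h \<in> \<Omega> \<and> int m dvd total_col n h + int n * c}"
    using closed[OF h(1)] by blast
qed (rule refl)

lemma sum_alternating: "(\<Sum>c<2 * m. T ((1 + int c) mod 2)) = int m * (T 0 + T 1 :: int)"
proof (induction m)
  case (Suc m)
  have "(1 + int (2 * m)) mod 2 = 1" "(1 + int (Suc (2 * m))) mod 2 = 0" by presburger+
  thus ?case using Suc.IH by (simp add: algebra_simps)
qed simp

text \<open>A shift of all colours by \<open>p\<close> adds \<open>n * p\<close> to the total. With
  \<open>n\<close> odd it exchanges the residues 0 and \<open>p\<close> modulo
  \<open>2 * p\<close>.\<close>

lemma odd_multiple_iff:
  fixes t :: int
  assumes p: "0 < p" and n: "odd n"
  shows "int (2 * p) dvd t + int n * int p \<longleftrightarrow> int p dvd t \<and> \<not> int (2 * p) dvd t"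
proof (cases "int p dvd t")
  case True
  then obtain s where s: "t = int p * s" by (auto simp: dvd_def)
  have e: "t + int n * int p = int p * (s + int n)" unfolding s by (simp add: algebra_simps)
  have p2: "int (2 * p) = int p * 2" by simp
  have p0: "int p \<noteq> 0" using p by simp
  have "int (2 * p) dvd t + int n * int p \<longleftrightarrow> even (s + int n)"
    unfolding e p2 by (rule dvd_mult_cancel_left[THEN trans]) (use p0 in blast)
  moreover have "int (2 * p) dvd t \<longleftrightarrow> even s"
    unfolding s p2 by (rule dvd_mult_cancel_left[THEN trans]) (use p0 in blast)
  moreover have "even (s + int n) \<longleftrightarrow> odd s" using n by simp
  ultimately show ?thesis using True by blast
next
  case False
  have "int p dvd t" if "int (2 * p) dvd t + int n * int p"
  proof -
    have "int p dvd int (2 * p)" by simp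
    hence "int p dvd t + int n * int p" using that dvd_trans by blast
    thus ?thesis by (simp add: dvd_add_left_iff)
  qed
  thus ?thesis using False by blast
qed

text \<open>\<open>T q\<close> uses clause \<open>q\<close> on all elements of total colour
  divisible by \<open>p\<close>. Sorting the wreath product sum by shifts gives
  \<open>p div 2\<close> copies each of \<open>T 0\<close> and \<open>T 1\<close>, and the mixed sum
  with its two clauses is half of \<open>T 0 + T 1\<close>. Both sides of the wreath product
  identity thus acquire the factor \<open>p\<close>, which is cancelled.\<close>

lemma signed_fixed_points_eq_sqrt_count:
  assumes r_pos: "0 < r" and dvd: "2 * p dvd r" and p_pos: "0 < p" and p_even: "even p" and cop: "coprime p n"
    and g: "(x, \<pi>) \<in> carrier (wreath r n)"
  shows "(\<Sum>h | h \<in> Adm (int r) (invol_cond (int r) \<pi> x) {1..n} \<and> int p dvd total_col n h.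
      tot_sign r n (if int (2 * p) dvd total_col n h then 1 else 0) (x, \<pi>) h) =
    int (card {h \<in> Adm (int r) (sqrt_cond (int r) \<pi> x) {1..n}. int p dvd total_col n h})"
proof -
  let ?\<Omega> = "Adm (int r) (invol_cond (int r) \<pi> x) {1..n}"
  let ?\<Theta> = "Adm (int r) (sqrt_cond (int r) \<pi> x) {1..n}"
  let ?\<chi> = "\<Sum>h | h \<in> ?\<Omega> \<and> int p dvd total_col n h.
      tot_sign r n (if int (2 * p) dvd total_col n h then 1 else 0) (x, \<pi>) h"
  define T where "T q = (\<Sum>h | h \<in> ?\<Omega> \<and> int p dvd total_col n h. tot_sign r n q (x, \<pi>) h)" for q
  have \<pi>: "\<pi> permutes {1..n}" using g unfolding wreath_carrier_iff[OF r_pos] by simp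
  have pr: "p dvd r" using dvd by (rule dvd_mult_right)
  have r_even: "even r" using dvd by (rule dvd_mult_left)
  have n_odd: "odd n"
  proof
    assume "even n"
    hence "is_unit (2 :: nat)" using coprime_common_divisor[OF cop p_even] by blast
    thus False by simp
  qed
  have fin: "finite ?\<Omega>" "finite ?\<Theta>" by (simp_all add: finite_Adm)
  have shi: "shift_col r n d h \<in> ?\<Omega>" if "h \<in> ?\<Omega>" for h d by (rule shift_invol[OF that \<pi> r_pos])
  have shs: "shift_col r n d h \<in> ?\<Theta>" if "h \<in> ?\<Theta>" for h d by (rule shift_sqrt[OF that r_pos])
  \<comment> \<open>Shifting by \<open>c\<close> moves the elements that need \<open>c\<close> into
    the class of total colour divisible by \<open>p\<close> and turns clause 1 into clause
    \<open>(1 + c) mod 2\<close>.\<close>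
  have whole: "(\<Sum>h\<in>?\<Omega>. tot_sign r n 1 (x, \<pi>) h) = (\<Sum>c<p. T ((1 + int c) mod 2))"
    unfolding sum_over_shifts[OF fin(1) p_pos cop, of _ "total_col n"]
  proof (rule sum.cong[OF refl])
    fix c
    let ?q = "(1 + int c) mod 2"
    have q: "?q = 0 \<or> ?q = 1" by presburger
    have q2: "(?q + int c) mod 2 = 1" by presburger
    have "(\<Sum>h | h \<in> ?\<Omega> \<and> int p dvd total_col n h + int n * int c. tot_sign r n 1 (x, \<pi>) h) =
        (\<Sum>h | h \<in> ?\<Omega> \<and> int p dvd total_col n h + int n * int c. tot_sign r n ?q (x, \<pi>) (shift_col r n (int c) h))"
    proof (rule sum.cong[OF refl])
      fix h assume "h \<in> {h. h \<in> ?\<Omega> \<and> int p dvd total_col n h + int n * int c}"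
      hence h: "h \<in> ?\<Omega>" by blast
      show "tot_sign r n 1 (x, \<pi>) h = tot_sign r n ?q (x, \<pi>) (shift_col r n (int c) h)"
        unfolding tot_sign_shift[OF r_even r_pos g h q] q2 ..
    qed
    also have "\<dots> = T ?q"
      unfolding T_def by (rule sum_over_shift[OF shi shift_col_zero pr])
    finally show "(\<Sum>h | h \<in> ?\<Omega> \<and> int p dvd total_col n h + int n * int c. tot_sign r n 1 (x, \<pi>) h) = T ?q" .
  qed
  define U where "U q = (\<Sum>h | h \<in> ?\<Omega> \<and> int (2 * p) dvd total_col n h. tot_sign r n q (x, \<pi>) h)" for q
  define V where "V q = (\<Sum>h | h \<in> ?\<Omega> \<and> int p dvd total_col n h \<and> \<not> int (2 * p) dvd total_col n h.
      tot_sign r n q (x, \<pi>) h)" for q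
  \<comment> \<open>The shift by \<open>p\<close> exchanges the two classes modulo
    \<open>2 * p\<close>. Being even, it leaves the clause unchanged.\<close>
  have UV: "V q = U q" if q: "q = 0 \<or> q = 1" for q
  proof -
    have qp: "(q + int p) mod 2 = q"
    proof -
      obtain m where "p = 2 * m" using p_even by (rule evenE)
      thus ?thesis using q by auto
    qed
    have "V q = (\<Sum>h | h \<in> ?\<Omega> \<and> int (2 * p) dvd total_col n h + int n * int p.
        tot_sign r n q (x, \<pi>) (shift_col r n (int p) h))"
      unfolding V_def odd_multiple_iff[OF p_pos n_odd]
    proof (rule sum.cong[OF refl])
      fix h assume "h \<in> {h. h \<in> ?\<Omega> \<and> int p dvd total_col n h \<and> \<not> int (2 * p) dvd total_col n h}"
      hence h: "h \<in> ?\<Omega>" by blast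
      show "tot_sign r n q (x, \<pi>) h = tot_sign r n q (x, \<pi>) (shift_col r n (int p) h)"
        unfolding tot_sign_shift[OF r_even r_pos g h q] qp ..
    qed
    also have "\<dots> = U q" unfolding U_def by (rule sum_over_shift[OF shi shift_col_zero dvd])
    finally show ?thesis .
  qed
  have split: "(\<Sum>h | h \<in> ?\<Omega> \<and> int p dvd total_col n h. f h) =
      (\<Sum>h | h \<in> ?\<Omega> \<and> int (2 * p) dvd total_col n h. f h) +
      (\<Sum>h | h \<in> ?\<Omega> \<and> int p dvd total_col n h \<and> \<not> int (2 * p) dvd total_col n h. f h)" for f :: "_ \<Rightarrow> int"
  proof -
    let ?X = "{h. h \<in> ?\<Omega> \<and> int (2 * p) dvd total_col n h}"
    let ?Y = "{h. h \<in> ?\<Omega> \<and> int p dvd total_col n h \<and> \<not> int (2 * p) dvd total_col n h}"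
    have "int p dvd int (2 * p)" by simp
    hence "{h. h \<in> ?\<Omega> \<and> int p dvd total_col n h} = ?X \<union> ?Y" using dvd_trans by blast
    moreover have "finite ?X" "finite ?Y" using fin(1) by (auto intro: finite_subset[rotated])
    moreover have "?X \<inter> ?Y = {}" by blast
    ultimately show ?thesis by (metis (no_types, lifting) sum.union_disjoint)
  qed
  have TUV: "T q = U q + V q" for q unfolding T_def U_def V_def by (rule split)
  \<comment> \<open>The given sign uses the odd clause on totals 0 modulo \<open>2 * p\<close> and
    the even clause on the others. Replacing \<open>V\<close> by \<open>U\<close> in
    \<open>T 0 + T 1\<close> doubles exactly this sum.\<close>
  have "?\<chi> = U 1 + V 0"
    unfolding split U_def V_def by (rule arg_cong2[where f = "(+)"]; rule sum.cong) auto
  hence \<chi>: "T 0 + T 1 = 2 * ?\<chi>" unfolding TUV using UV[of 0] UV[of 1] by simp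
  obtain m where m: "p = 2 * m" using p_even by (rule evenE)
  have "(\<Sum>h\<in>?\<Omega>. tot_sign r n 1 (x, \<pi>) h) = int m * (T 0 + T 1)"
    unfolding whole using sum_alternating[of T m] unfolding m .
  hence lhs: "(\<Sum>h\<in>?\<Omega>. tot_sign r n 1 (x, \<pi>) h) = int p * ?\<chi>" unfolding \<chi> m by simp
  have "int (card ?\<Theta>) = (\<Sum>h\<in>?\<Theta>. 1)" by simp
  also have "\<dots> = (\<Sum>c<p. \<Sum>h | h \<in> ?\<Theta> \<and> int p dvd total_col n h + int n * int c. 1)"
    by (rule sum_over_shifts[OF fin(2) p_pos cop])
  also have "\<dots> = (\<Sum>c<p. \<Sum>h | h \<in> ?\<Theta> \<and> int p dvd total_col n h. 1)"
    by (rule sum.cong[OF refl], rule sum_over_shift[OF shs shift_col_zero pr, where f = "\<lambda>_. 1"])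
  also have "\<dots> = int p * int (card {h \<in> ?\<Theta>. int p dvd total_col n h})" by simp
  finally have rhs: "int (card ?\<Theta>) = int p * int (card {h \<in> ?\<Theta>. int p dvd total_col n h})" .
  have main: "adm_sum (int r) (invol_cond (int r) \<pi> x) (loc_sign (int r) \<pi> x 1) {1..n} =
      adm_sum (int r) (sqrt_cond (int r) \<pi> x) (\<lambda>_ _. 1) {1..n}"
  proof (rule invol_sum_eq_sqrt_sum)
    show "\<pi> ` {1..n} \<subseteq> {1..n}" using permutes_image[OF \<pi>] by simp
  qed (use r_pos r_even permutes_inj[OF \<pi>] in simp_all)
  have inv: "adm_sum (int r) (invol_cond (int r) \<pi> x) (loc_sign (int r) \<pi> x 1) {1..n} =
      (\<Sum>h\<in>?\<Omega>. tot_sign r n 1 (x, \<pi>) h)"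
    unfolding adm_sum_def tot_sign_def fst_conv snd_conv ..
  have sqrt: "adm_sum (int r) (sqrt_cond (int r) \<pi> x) (\<lambda>_ _. 1) {1..n} = int (card ?\<Theta>)"
    unfolding adm_sum_def by simp
  have eq: "int p * ?\<chi> = int p * int (card {h \<in> ?\<Theta>. int p dvd total_col n h})"
    by (rule trans[OF lhs[symmetric] trans[OF inv[symmetric] trans[OF main trans[OF sqrt rhs]]]])
  have "int p \<noteq> 0" using p_pos by simp
  from iffD1[OF mult_left_cancel[OF this] eq] show ?thesis .
qed

section \<open>The Gelfand model\<close>

text \<open>The model is rational and indexed by symmetric elements, while the character theory is
  about complex matrices of size \<open>D\<close>. Numbering the index set and embedding the
  coefficients is the extension of scalars.\<close>

lemma kernel_mat_rep:
  fixes M :: "'g \<Rightarrow> 's \<Rightarrow> 's \<Rightarrow> rat"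
  assumes fin: "finite S"
    and one: "\<And>s t. s \<in> S \<Longrightarrow> t \<in> S \<Longrightarrow> M \<one>\<^bsub>G\<^esub> s t = (if s = t then 1 else 0)"
    and mult: "\<And>g h s t. g \<in> carrier G \<Longrightarrow> h \<in> carrier G \<Longrightarrow> s \<in> S \<Longrightarrow> t \<in> S \<Longrightarrow>
      M (g \<otimes>\<^bsub>G\<^esub> h) s t = (\<Sum>u\<in>S. M g s u * M h u t)"
  obtains D and X :: "'g \<Rightarrow> complex mat" where "mat_rep G D X"
    "\<And>g. mat_trace (X g) = of_rat (\<Sum>s\<in>S. M g s s)"
proof -
  define D where "D = card S"
  obtain e where e: "bij_betw e {..<D} S"
    using ex_bij_betw_nat_finite[OF fin] unfolding D_def atLeast0LessThan by blast
  have eS: "e i \<in> S" if "i < D" for i using bij_betwE[OF e] that by blast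
  have einj: "e i = e j \<longleftrightarrow> i = j" if "i < D" "j < D" for i j
    using bij_betw_imp_inj_on[OF e] that by (auto dest: inj_onD)
  define X :: "'g \<Rightarrow> complex mat" where "X g = mat D D (\<lambda>(i, j). of_rat (M g (e i) (e j)))" for g
  have Xc: "X g \<in> carrier_mat D D" for g by (simp add: X_def)
  have "mat_rep G D X"
    unfolding mat_rep_def
  proof (intro conjI ballI)
    show "X g \<in> carrier_mat D D" for g by (rule Xc)
    show "X \<one>\<^bsub>G\<^esub> = 1\<^sub>m D" by (rule eq_matI) (simp_all add: X_def one eS einj)
    fix g h assume g: "g \<in> carrier G" and h: "h \<in> carrier G"
    show "X (g \<otimes>\<^bsub>G\<^esub> h) = X g * X h"
    proof (rule eq_matI)
      fix i j assume "i < dim_row (X g * X h)" "j < dim_col (X g * X h)"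
      hence ij: "i < D" "j < D" using Xc[of g] Xc[of h] by auto
      have "X (g \<otimes>\<^bsub>G\<^esub> h) $$ (i, j) = of_rat (\<Sum>u\<in>S. M g (e i) u * M h u (e j))"
        using ij mult[OF g h eS[OF ij(1)] eS[OF ij(2)]] by (simp add: X_def)
      also have "\<dots> = of_rat (\<Sum>k<D. M g (e i) (e k) * M h (e k) (e j))"
        by (rule arg_cong[where f = of_rat], rule sum.reindex_bij_betw[OF e, symmetric])
      also have "\<dots> = (X g * X h) $$ (i, j)"
        unfolding mult_mat_index_sum[OF Xc Xc ij] of_rat_sum
        by (rule sum.cong[OF refl]) (use ij in \<open>simp add: X_def of_rat_mult\<close>)
      finally show "X (g \<otimes>\<^bsub>G\<^esub> h) $$ (i, j) = (X g * X h) $$ (i, j)" .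
    qed (use Xc[of g] Xc[of h] Xc[of "g \<otimes>\<^bsub>G\<^esub> h"] in auto)
  qed
  moreover have "mat_trace (X g) = of_rat (\<Sum>s\<in>S. M g s s)" for g
  proof -
    have "mat_trace (X g) = of_rat (\<Sum>i<D. M g (e i) (e i))" by (simp add: mat_trace_def X_def of_rat_sum)
    also have "(\<Sum>i<D. M g (e i) (e i)) = (\<Sum>s\<in>S. M g s s)" by (rule sum.reindex_bij_betw[OF e])
    finally show ?thesis .
  qed
  ultimately show thesis by (rule that)
qed

lemma kernel_character:
  fixes M :: "'g \<Rightarrow> 's \<Rightarrow> 's \<Rightarrow> 'k::field"
  assumes fin: "finite S" and g: "g \<in> carrier G"
  shows "rep_character G S (\<lambda>g. \<lambda>v\<in>carrier (coord_space S). \<lambda>s\<in>S. \<Sum>t\<in>S. v t * M g s t) g =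
    (\<Sum>s\<in>S. M g s s)"
  unfolding rep_character_def op_trace_def restrict_apply'[OF g]
proof (rule sum.cong[OF refl])
  fix s assume s: "s \<in> S"
  have c: "(coord_vec S s :: 's \<Rightarrow> 'k) \<in> carrier (coord_space S)"
    unfolding coord_space_simps coord_vec_def by simp
  have "(\<Sum>t\<in>S. coord_vec S s t * M g s t) = (\<Sum>t\<in>S. if t = s then M g s t else 0)"
    by (rule sum.cong[OF refl]) (simp add: coord_vec_def)
  also have "\<dots> = M g s s" using fin s by simp
  finally show "(\<lambda>v\<in>carrier (coord_space S). \<lambda>s\<in>S. \<Sum>t\<in>S. v t * M g s t) (coord_vec S s) s = M g s s"
    unfolding restrict_apply'[OF c] restrict_apply'[OF s] .
qed

section \<open>The model as a signed permutation representation\<close>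

context
  fixes r p n :: nat
  assumes r_pos: "0 < r" and p2_dvd: "2 * p dvd r"
begin

lemma p_dvd: "p dvd r"
  using p2_dvd by (rule dvd_mult_right)

lemma r_even: "even r"
  using p2_dvd by (rule dvd_mult_left)

lemma symmetric_elements_iff:
  "\<omega> \<in> symmetric_elements r p n \<longleftrightarrow>
    \<omega> \<in> carrier (wreath r n) \<and> int p dvd col_sum n (fst \<omega>) \<and> transp r n \<omega> = \<omega>"
  unfolding symmetric_elements_def mem_Collect_eq Grpn_carrier_iff[OF r_pos p_dvd] by blast

lemma finite_symmetric_elements: "finite (symmetric_elements r p n)"
  by (rule finite_subset[OF _ finite_wreath[OF r_pos]]) (use symmetric_elements_iff in blast)

abbreviation act :: "colored_perm \<Rightarrow> colored_perm \<Rightarrow> colored_perm" where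
  "act g \<omega> \<equiv> g \<otimes>\<^bsub>wreath r n\<^esub> \<omega> \<otimes>\<^bsub>wreath r n\<^esub> transp r n g"

lemma act_closed:
  assumes g: "g \<in> carrier (Grpn r p n)" and \<omega>: "\<omega> \<in> symmetric_elements r p n"
  shows "act g \<omega> \<in> symmetric_elements r p n"
proof -
  interpret W: group "wreath r n" by (rule group_wreath[OF r_pos])
  interpret G: group "Grpn r p n" by (rule group_Grpn[OF r_pos p_dvd])
  have gW: "g \<in> carrier (wreath r n)" using g unfolding Grpn_carrier_iff[OF r_pos p_dvd] by blast
  have \<omega>W: "\<omega> \<in> carrier (wreath r n)" and sym: "transp r n \<omega> = \<omega>" using \<omega> unfolding symmetric_elements_iff by blast+
  have tW: "transp r n g \<in> carrier (wreath r n)" by (rule transp_closed[OF r_pos gW])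
  have "transp r n (act g \<omega>) = g \<otimes>\<^bsub>wreath r n\<^esub> (\<omega> \<otimes>\<^bsub>wreath r n\<^esub> transp r n g)"
    unfolding transp_mult[OF r_pos W.m_closed[OF gW \<omega>W] tW] transp_mult[OF r_pos gW \<omega>W]
      transp_transp[OF r_pos gW] sym ..
  also have "\<dots> = act g \<omega>" by (rule W.m_assoc[OF gW \<omega>W tW, symmetric])
  finally have "transp r n (act g \<omega>) = act g \<omega>" .
  moreover have "\<omega> \<in> carrier (Grpn r p n)" using \<omega> unfolding symmetric_elements_def by blast
  hence "act g \<omega> \<in> carrier (Grpn r p n)"
    using G.m_closed[OF G.m_closed[OF g] transp_Grpn[OF r_pos p_dvd g]] unfolding Grpn_mult by blast
  ultimately show ?thesis unfolding symmetric_elements_def by blast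
qed

lemma act_mult:
  assumes g: "g \<in> carrier (wreath r n)" and h: "h \<in> carrier (wreath r n)" and \<omega>: "\<omega> \<in> carrier (wreath r n)"
  shows "act (g \<otimes>\<^bsub>wreath r n\<^esub> h) \<omega> = act g (act h \<omega>)"
proof -
  interpret W: group "wreath r n" by (rule group_wreath[OF r_pos])
  note t = transp_closed[OF r_pos g] transp_closed[OF r_pos h]
  show ?thesis
    unfolding transp_mult[OF r_pos g h] using g h \<omega> t by (simp only: W.m_assoc W.m_closed)
qed

lemma act_one:
  assumes "\<omega> \<in> carrier (wreath r n)"
  shows "act \<one>\<^bsub>wreath r n\<^esub> \<omega> = \<omega>"
proof -
  interpret W: group "wreath r n" by (rule group_wreath[OF r_pos])
  have t: "transp r n \<one>\<^bsub>wreath r n\<^esub> \<in> carrier (wreath r n)" by (rule transp_closed[OF r_pos W.one_closed])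
  have "transp r n \<one>\<^bsub>wreath r n\<^esub> \<otimes>\<^bsub>wreath r n\<^esub> transp r n \<one>\<^bsub>wreath r n\<^esub> = transp r n \<one>\<^bsub>wreath r n\<^esub>"
    using transp_mult[OF r_pos W.one_closed W.one_closed] W.l_one[OF W.one_closed] by metis
  hence "transp r n \<one>\<^bsub>wreath r n\<^esub> = \<one>\<^bsub>wreath r n\<^esub>" using W.r_cancel_one[OF t t] by blast
  thus ?thesis using assms by (simp only: W.l_one W.r_one)
qed

text \<open>The action adds every colour of \<open>h\<close> twice, and the colour sum of
  \<open>h\<close> is a multiple of \<open>p\<close>. So the clause of the sign is constant on
  orbits, and the cocycle identity for a fixed clause carries over to
  \<open>sign_tilde\<close>.\<close>

lemma col_sum_act:
  assumes h: "h \<in> carrier (Grpn r p n)" and \<omega>: "\<omega> \<in> carrier (wreath r n)"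
  shows "int (2 * p) dvd col_sum n (fst (act h \<omega>)) \<longleftrightarrow> int (2 * p) dvd col_sum n (fst \<omega>)"
proof -
  obtain x \<pi> w \<iota> where e: "h = (x, \<pi>)" "\<omega> = (w, \<iota>)" by (cases h, cases \<omega>)
  have g': "(x, \<pi>) \<in> carrier (wreath r n)" and s: "int p dvd col_sum n x"
    using h unfolding e Grpn_carrier_iff[OF r_pos p_dvd] by auto
  note \<omega>' = \<omega>[unfolded e]
  have \<pi>: "\<pi> permutes {1..n}" and \<iota>: "\<iota> permutes {1..n}"
    using g' \<omega>' unfolding wreath_carrier_iff[OF r_pos] by auto
  let ?f = "\<lambda>i. x (\<iota> i) + w i + x i"
  have "int (2 * p) dvd col_sum n (fst (act h \<omega>)) \<longleftrightarrow> int (2 * p) dvd col_sum n (\<lambda>i. ?f (inv_into UNIV \<pi> i))"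
    unfolding e act_pair[OF r_pos g' \<omega>'] fst_conv
    by (rule col_sum_mod[where r = r]) (use p2_dvd in \<open>simp_all only: restrict_apply' mod_dvd_diff int_dvd_int_iff\<close>)
  also have "col_sum n (\<lambda>i. ?f (inv_into UNIV \<pi> i)) = col_sum n ?f" by (rule col_sum_permute[OF permutes_inv[OF \<pi>]])
  also have "\<dots> = 2 * col_sum n x + col_sum n w"
    using col_sum_permute[OF \<iota>, of x] by (simp add: col_sum_def sum.distrib)
  also have "int (2 * p) dvd 2 * col_sum n x + col_sum n w \<longleftrightarrow> int (2 * p) dvd col_sum n w"
    by (rule dvd_add_right_iff) (use s in simp)
  finally show ?thesis unfolding e fst_conv .
qed

lemma sign_tilde_cocycle:
  assumes g: "g \<in> carrier (Grpn r p n)" and h: "h \<in> carrier (Grpn r p n)" and \<omega>: "\<omega> \<in> symmetric_elements r p n"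
  shows "sign_tilde r p n (g \<otimes>\<^bsub>wreath r n\<^esub> h) \<omega> = sign_tilde r p n g (act h \<omega>) * sign_tilde r p n h \<omega>"
proof -
  interpret W: group "wreath r n" by (rule group_wreath[OF r_pos])
  have gW: "g \<in> carrier (wreath r n)" and hW: "h \<in> carrier (wreath r n)"
    using g h unfolding Grpn_carrier_iff[OF r_pos p_dvd] by blast+
  have \<omega>W: "\<omega> \<in> carrier (wreath r n)" "transp r n \<omega> = \<omega>" using \<omega> unfolding symmetric_elements_iff by blast+
  have aW: "act h \<omega> \<in> carrier (wreath r n)" "transp r n (act h \<omega>) = act h \<omega>"
    using act_closed[OF h \<omega>] unfolding symmetric_elements_iff by blast+
  note eq = sign_tilde_eq[OF r_pos r_even p2_dvd]
  show ?thesis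
    unfolding eq[OF W.m_closed[OF gW hW] \<omega>W] eq[OF gW aW] eq[OF hW \<omega>W] col_sum_act[OF h \<omega>W(1)]
      tot_sign_cocycle[OF r_pos r_even gW hW \<omega>W] of_int_mult ..
qed

definition kernel :: "colored_perm \<Rightarrow> colored_perm \<Rightarrow> colored_perm \<Rightarrow> rat" where
  "kernel g \<tau> \<omega> = sign_tilde r p n g \<omega> * coord_vec (symmetric_elements r p n) (act g \<omega>) \<tau>"

lemma rho_tilde_kernel:
  "rho_tilde r p n = (\<lambda>g. \<lambda>v\<in>carrier (coord_space (symmetric_elements r p n)).
    \<lambda>\<tau>\<in>symmetric_elements r p n. \<Sum>\<omega>\<in>symmetric_elements r p n. v \<omega> * kernel g \<tau> \<omega>)"
  unfolding rho_tilde_def Let_def Grpn_mult kernel_def ..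

lemma kernel_one:
  assumes \<tau>: "\<tau> \<in> symmetric_elements r p n" and \<omega>: "\<omega> \<in> symmetric_elements r p n"
  shows "kernel \<one>\<^bsub>Grpn r p n\<^esub> \<tau> \<omega> = (if \<tau> = \<omega> then 1 else 0)"
proof -
  interpret W: group "wreath r n" by (rule group_wreath[OF r_pos])
  have \<omega>W: "\<omega> \<in> carrier (wreath r n)" "transp r n \<omega> = \<omega>" using \<omega> unfolding symmetric_elements_iff by blast+
  have "sign_tilde r p n \<one>\<^bsub>wreath r n\<^esub> \<omega> = 1"
    unfolding sign_tilde_eq[OF r_pos r_even p2_dvd W.one_closed \<omega>W] tot_sign_one[OF r_pos r_even \<omega>W(1)] by simp
  thus ?thesis
    unfolding kernel_def Grpn_one act_one[OF \<omega>W(1)] coord_vec_def restrict_apply'[OF \<tau>] by (simp only: mult_1_left)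
qed

lemma kernel_mult:
  assumes g: "g \<in> carrier (Grpn r p n)" and h: "h \<in> carrier (Grpn r p n)"
    and \<tau>: "\<tau> \<in> symmetric_elements r p n" and \<omega>: "\<omega> \<in> symmetric_elements r p n"
  shows "kernel (g \<otimes>\<^bsub>Grpn r p n\<^esub> h) \<tau> \<omega> = (\<Sum>u\<in>symmetric_elements r p n. kernel g \<tau> u * kernel h u \<omega>)"
proof -
  let ?S = "symmetric_elements r p n"
  have W: "g \<in> carrier (wreath r n)" "h \<in> carrier (wreath r n)" "\<omega> \<in> carrier (wreath r n)"
    using g h \<omega> unfolding Grpn_carrier_iff[OF r_pos p_dvd] symmetric_elements_iff by blast+
  have "(\<Sum>u\<in>?S. kernel g \<tau> u * kernel h u \<omega>) =
      (\<Sum>u\<in>?S. if u = act h \<omega> then kernel g \<tau> u * sign_tilde r p n h \<omega> else 0)"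
    by (rule sum.cong[OF refl]) (simp add: kernel_def[of h] coord_vec_def)
  also have "\<dots> = kernel g \<tau> (act h \<omega>) * sign_tilde r p n h \<omega>"
    unfolding sum.delta[OF finite_symmetric_elements] using act_closed[OF h \<omega>] by (simp only: if_True)
  also have "\<dots> = kernel (g \<otimes>\<^bsub>Grpn r p n\<^esub> h) \<tau> \<omega>"
    unfolding kernel_def Grpn_mult act_mult[OF W] sign_tilde_cocycle[OF g h \<omega>] by (simp only: mult_ac)
  finally show ?thesis by (rule sym)
qed

end

lemma total_col_enc: "total_col n (enc n g) = col_sum n (fst g)"
  unfolding total_col_def col_sum_def by (rule sum.cong[OF refl]) (simp add: enc_def)

text \<open>In a signed permutation matrix only fixed basis vectors contribute to the trace. These
  and the solutions of the root equation are then identified with their encodings.\<close>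

lemma kernel_trace:
  assumes r_pos: "0 < r" and p_pos: "0 < p" and p2: "2 * p dvd r" and p_even: "even p" and cop: "coprime p n"
    and g: "g \<in> carrier (Grpn r p n)"
  shows "(\<Sum>\<omega>\<in>symmetric_elements r p n. kernel r p n g \<omega> \<omega>) =
    of_nat (card {h \<in> carrier (Grpn r p n). h = g \<otimes>\<^bsub>Grpn r p n\<^esub> transp r n h})"
proof -
  have pr: "p dvd r" using p2 by (rule dvd_mult_right)
  have r_even: "even r" using p2 by (rule dvd_mult_left)
  let ?S = "symmetric_elements r p n"
  let ?act = "\<lambda>\<omega>. g \<otimes>\<^bsub>wreath r n\<^esub> \<omega> \<otimes>\<^bsub>wreath r n\<^esub> transp r n g"
  obtain x \<pi> where e: "g = (x, \<pi>)" by (cases g)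
  have gW: "g \<in> carrier (wreath r n)" using g unfolding Grpn_carrier_iff[OF r_pos pr] by blast
  note g' = gW[unfolded e]
  have \<pi>: "\<pi> permutes {1..n}" using g' unfolding wreath_carrier_iff[OF r_pos] by simp
  let ?\<Omega> = "Adm (int r) (invol_cond (int r) \<pi> x) {1..n}"
  let ?\<Theta> = "Adm (int r) (sqrt_cond (int r) \<pi> x) {1..n}"
  note S_iff = symmetric_elements_iff[OF r_pos p2]
  let ?s = "\<lambda>h. tot_sign r n (if int (2 * p) dvd total_col n h then 1 else 0) g h"
  have "(\<Sum>\<omega>\<in>?S. kernel r p n g \<omega> \<omega>) = (\<Sum>\<omega>\<in>?S. if ?act \<omega> = \<omega> then of_int (?s (enc n \<omega>)) else 0)"
  proof (rule sum.cong[OF refl])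
    fix \<omega> assume \<omega>: "\<omega> \<in> ?S"
    hence W: "\<omega> \<in> carrier (wreath r n)" "transp r n \<omega> = \<omega>" unfolding S_iff by blast+
    show "kernel r p n g \<omega> \<omega> = (if ?act \<omega> = \<omega> then of_int (?s (enc n \<omega>)) else 0)"
      unfolding kernel_def[OF r_pos p2] coord_vec_def restrict_apply'[OF \<omega>]
        sign_tilde_eq[OF r_pos r_even p2 gW W] total_col_enc by simp
  qed
  also have "\<dots> = (\<Sum>\<omega> | \<omega> \<in> ?S \<and> ?act \<omega> = \<omega>. of_int (?s (enc n \<omega>)))"
    by (rule sum.inter_filter[OF finite_symmetric_elements[OF r_pos p2], symmetric])
  also have "\<dots> = (\<Sum>h | h \<in> ?\<Omega> \<and> int p dvd total_col n h. of_int (?s h))"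
  proof (rule sum.reindex_bij_witness[where i = "dec n" and j = "enc n"])
    fix \<omega> assume "\<omega> \<in> {\<omega>. \<omega> \<in> ?S \<and> ?act \<omega> = \<omega>}"
    hence W: "\<omega> \<in> carrier (wreath r n)" "transp r n \<omega> = \<omega>" "int p dvd col_sum n (fst \<omega>)" "?act \<omega> = \<omega>"
      unfolding S_iff by blast+
    show "dec n (enc n \<omega>) = \<omega>" by (rule dec_enc[OF r_pos W(1)])
    have "enc n \<omega> \<in> ?\<Omega>" unfolding enc_invol_iff[OF r_pos g' W(1)] using W(2,4) unfolding e by blast
    thus "enc n \<omega> \<in> {h. h \<in> ?\<Omega> \<and> int p dvd total_col n h}" unfolding mem_Collect_eq total_col_enc using W(3) by blast
  next
    fix h assume "h \<in> {h. h \<in> ?\<Omega> \<and> int p dvd total_col n h}"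
    hence h: "h \<in> ?\<Omega>" "int p dvd total_col n h" by blast+
    show ed: "enc n (dec n h) = h" by (rule enc_dec[OF Adm_PiE[OF h(1)]])
    have W: "dec n h \<in> carrier (wreath r n)" by (rule dec_closed_invol[OF r_pos h(1)])
    have "transp r n (dec n h) = dec n h \<and> ?act (dec n h) = dec n h"
      using h(1) enc_invol_iff[OF r_pos g' W] unfolding ed e by blast
    moreover have "int p dvd col_sum n (fst (dec n h))" unfolding total_col_enc[symmetric] ed by (rule h(2))
    ultimately show "dec n h \<in> {\<omega>. \<omega> \<in> ?S \<and> ?act \<omega> = \<omega>}" using W unfolding S_iff by blast
  qed (rule refl)
  also have "\<dots> = of_int (\<Sum>h | h \<in> ?\<Omega> \<and> int p dvd total_col n h. ?s h)" by (rule of_int_sum[symmetric])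
  also have "\<dots> = of_int (int (card {h \<in> ?\<Theta>. int p dvd total_col n h}))"
    unfolding e signed_fixed_points_eq_sqrt_count[OF r_pos p2 p_pos p_even cop g'] ..
  also have "card {h \<in> ?\<Theta>. int p dvd total_col n h} =
      card {h \<in> carrier (Grpn r p n). h = g \<otimes>\<^bsub>Grpn r p n\<^esub> transp r n h}"
  proof (rule bij_betw_same_card[OF bij_betw_byWitness[where f' = "enc n"]])
    have dW: "dec n h \<in> carrier (wreath r n)" "enc n (dec n h) = h" if "h \<in> ?\<Theta>" for h
      using dec_closed_sqrt[OF r_pos that permutes_inj[OF \<pi>]] enc_dec[OF Adm_PiE[OF that]] by blast+
    show "\<forall>h\<in>{h \<in> ?\<Theta>. int p dvd total_col n h}. enc n (dec n h) = h" using dW(2) by blast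
    show "\<forall>h\<in>{h \<in> carrier (Grpn r p n). h = g \<otimes>\<^bsub>Grpn r p n\<^esub> transp r n h}. dec n (enc n h) = h"
      unfolding Grpn_carrier_iff[OF r_pos pr] using dec_enc[OF r_pos] by blast
    show "dec n ` {h \<in> ?\<Theta>. int p dvd total_col n h} \<subseteq>
        {h \<in> carrier (Grpn r p n). h = g \<otimes>\<^bsub>Grpn r p n\<^esub> transp r n h}"
    proof (rule image_subsetI)
      fix h assume "h \<in> {h \<in> ?\<Theta>. int p dvd total_col n h}"
      hence h: "h \<in> ?\<Theta>" "int p dvd total_col n h" by blast+
      have "dec n h = g \<otimes>\<^bsub>wreath r n\<^esub> transp r n (dec n h)"
        using h(1) enc_sqrt_iff[OF r_pos g' dW(1)[OF h(1)]] unfolding dW(2)[OF h(1)] e by blast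
      moreover have "int p dvd col_sum n (fst (dec n h))"
        unfolding total_col_enc[symmetric] dW(2)[OF h(1)] by (rule h(2))
      ultimately show "dec n h \<in> {h \<in> carrier (Grpn r p n). h = g \<otimes>\<^bsub>Grpn r p n\<^esub> transp r n h}"
        unfolding Grpn_carrier_iff[OF r_pos pr] Grpn_mult using dW(1)[OF h(1)] by blast
    qed
    show "enc n ` {h \<in> carrier (Grpn r p n). h = g \<otimes>\<^bsub>Grpn r p n\<^esub> transp r n h} \<subseteq>
        {h \<in> ?\<Theta>. int p dvd total_col n h}"
    proof (rule image_subsetI)
      fix h assume "h \<in> {h \<in> carrier (Grpn r p n). h = g \<otimes>\<^bsub>Grpn r p n\<^esub> transp r n h}"
      hence h: "h \<in> carrier (wreath r n)" "int p dvd col_sum n (fst h)" "h = g \<otimes>\<^bsub>wreath r n\<^esub> transp r n h"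
        unfolding Grpn_carrier_iff[OF r_pos pr] Grpn_mult by blast+
      have "enc n h \<in> ?\<Theta>" unfolding enc_sqrt_iff[OF r_pos g' h(1)] using h(3) unfolding e .
      thus "enc n h \<in> {h \<in> ?\<Theta>. int p dvd total_col n h}" using h(2) unfolding total_col_enc[symmetric] by blast
    qed
  qed
  finally show ?thesis unfolding of_int_of_nat_eq .
qed

theorem theorem3p2:
  fixes r p n :: nat
  assumes "r > 0" and "p > 0" and "n > 0"
    and "p dvd r"
    and "gcd p n = 1"
    and "even (r div p)" and "even p"
  shows "gelfand_model (Grpn r p n) (symmetric_elements r p n) (rho_tilde r p n)"
proof -
  let ?G = "Grpn r p n" and ?S = "symmetric_elements r p n"
  have cop: "coprime p n" using assms(5) unfolding coprime_iff_gcd_eq_1 .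
  \<comment> \<open>This is how the parity of \<open>r div p\<close> enters: the class of
    \<open>Delta\<close> modulo \<open>2 * p\<close> can be read off from integer colour
    sums.\<close>
  have p2: "2 * p dvd r"
  proof -
    obtain k where k: "r div p = 2 * k" using assms(6) by (rule evenE)
    have "r = (2 * p) * k" using dvd_mult_div_cancel[OF assms(4)] unfolding k by (simp add: mult_ac)
    thus ?thesis by (rule dvdI)
  qed
  have grp: "group ?G" by (rule group_Grpn[OF assms(1,4)])
  have GW: "g \<in> carrier (wreath r n)" if "g \<in> carrier ?G" for g
    using that unfolding Grpn_carrier_iff[OF assms(1,4)] by blast
  have fin: "finite (carrier ?G)" by (rule finite_subset[OF _ finite_wreath[OF assms(1)]]) (use GW in blast)
  interpret group ?G by (rule grp)
  interpret anti_involution ?G "transp r n"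
  proof
    show "finite (carrier ?G)" by (rule fin)
    fix g assume g: "g \<in> carrier ?G"
    show "transp r n g \<in> carrier ?G" by (rule transp_Grpn[OF assms(1,4) g])
    show "transp r n (transp r n g) = g" by (rule transp_transp[OF assms(1) GW[OF g]])
    show "\<exists>k\<in>carrier ?G. k \<otimes>\<^bsub>?G\<^esub> g = transp r n g \<otimes>\<^bsub>?G\<^esub> k"
      unfolding Grpn_mult by (rule transp_conjugate[OF assms(1,4) cop GW[OF g]])
    fix h assume h: "h \<in> carrier ?G"
    show "transp r n (g \<otimes>\<^bsub>?G\<^esub> h) = transp r n h \<otimes>\<^bsub>?G\<^esub> transp r n g"
      unfolding Grpn_mult by (rule transp_mult[OF assms(1) GW[OF g] GW[OF h]])
  qed
  note K = finite_symmetric_elements[OF assms(1) p2] kernel_one[OF assms(1) p2] kernel_mult[OF assms(1) p2]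
  obtain D and X :: "colored_perm \<Rightarrow> complex mat" where X: "mat_rep ?G D X"
    and Xtr: "\<And>g. mat_trace (X g) = of_rat (\<Sum>s\<in>?S. kernel r p n g s s)"
    using kernel_mat_rep[of ?S "kernel r p n" ?G, OF K] by blast
  have tr: "mat_trace (X g) = of_nat (card {h \<in> carrier ?G. h = g \<otimes>\<^bsub>?G\<^esub> transp r n h})"
    if "g \<in> carrier ?G" for g
    unfolding Xtr kernel_trace[OF assms(1,2) p2 assms(7) cop that] by (rule of_rat_of_nat_eq)
  have char: "of_rat (rep_character ?G ?S (rho_tilde r p n) g) = mat_trace (X g)" if "g \<in> carrier ?G" for g
    unfolding Xtr rho_tilde_kernel[OF assms(1) p2] kernel_character[OF K(1) that] ..
  have rep: "representation ?G ?S (rho_tilde r p n)"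
    unfolding rho_tilde_kernel[OF assms(1) p2] by (rule matrix_representation[OF grp K])
  show ?thesis
    unfolding gelfand_model_def Irr_eq_matrix_characters[OF grp]
    using grp fin rep model_character[OF X tr] char by simp
qed

end
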